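(* Let $k\ge 1$, $g\ge 1$, and let $\rho:F_g\to\mathrm{PSL}(2k,\mathbb{R})$ be a purely hyperbolic (Anosov) Schottky representation of the free group $F_g$, with boundary map $\xi:\partial_\infty F_g\to\mathrm{Flag}^+(\mathbb{R}^{2k})$. Let $\Omega=\mathbb{RP}^{2k-1}\setminus\bigcup_{x\in\partial_\infty F_g}\mathbb{P}(\xi(x)^{(k)})$. Then the action of $F_g$ on $\Omega$ via $\rho$, which is properly discontinuous and cocompact, admits a fundamental domain bounded by finitely many polyhedral hypersurfaces.
   Context: Oriented flags ($n=2k$). $\mathbb{R}^n$ has its standard orientation. Consider complete flags $F^{(1)}\subset\dots\subset F^{(n-1)}$ in $\mathbb{R}^n$ ($\dim F^{(i)}=i$) with a choice of orientation on each $F^{(i)}$. As $n$ is even, $\mathrm{Flag}^+(\mathbb{R}^n)$ is the quotient of the set of these by simultaneously reversing the orientations of all odd-dimensional $F^{(i)}$; an oriented flag before passing to this quotient is called a lift. $\mathrm{PSL}(n,\mathbb{R})$ acts on $\mathrm{Flag}^+(\mathbb{R}^n)$. Direct sums of oriented subspaces are oriented by concatenating positive bases in order; $F^{(0)}=\{0\}$. A triple $(F_1,F_2,F_3)$ in $\mathrm{Flag}^+(\mathbb{R}^n)$ is hyperconvex if there are lifts $\widehat F_1,\widehat F_2,\widehat F_3$ such that $\widehat F_1^{(i_1)}\oplus \widehat F_2^{(i_2)}\oplus \widehat F_3^{(i_3)}=\mathbb{R}^n$ as oriented vector spaces for all integers $0\le i_1,i_2,i_3\le n-1$ with $i_1+i_2+i_3=n$.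 Intervals are $(\!(F,G)\!)=\{H: (F,H,G)\text{ hyperconvex}\}$, with opposite $-(\!(F,G)\!)=(\!(G,F)\!)$. Purely hyperbolic Schottky representations. $\mathbb{RP}^1$ carries its standard cyclic order, $(a,b)\subset\mathbb{RP}^1$ is the set of $x$ with $(a,x,b)$ positively ordered, and $-(a,b)=(b,a)$. Let $A_1,\dots,A_g\in\mathrm{PSL}(2,\mathbb{R})$ and let $I_j^\pm=(a_j^\pm,b_j^\pm)\subset\mathbb{RP}^1$ be $2g$ intervals with pairwise disjoint closures such that $A_j(-I_j^-)=I_j^+$; then $\Gamma=\langle A_1,\dots,A_g\rangle\cong F_g$ is free on the $A_j$. Let $\xi_0$ be a map from the set of endpoints of the $I_j^\pm$ to $\mathrm{Flag}^+(\mathbb{R}^n)$ sending positively cyclically ordered triples to hyperconvex triples. Put $J_j^\pm=(\!(\xi_0(a_j^\pm),\xi_0(b_j^\pm))\!)$ and let $h_1,\dots,h_g\in\mathrm{PSL}(n,\mathbb{R})$ satisfy $h_j\xi_0(b_j^-)=\xi_0(a_j^+)$, $h_j\xi_0(a_j^-)=\xi_0(b_j^+)$, so $h_j(-J_j^-)=J_j^+$. The homomorphism $\rho:F_g\cong\Gamma\to\mathrm{PSL}(n,\mathbb{R})$, $A_j\mapsto h_j$, is a purely hyperbolic Schottky representation (such representations are Anosov with respect to the Borel subgroup). Boundary map. Write $A_{-j}=A_j^{-1}$, $J_{-j}^+=J_j^-$, and for a reduced word $\gamma=A_{j_1}\cdots A_{j_m}$ put $J_\gamma=\rho(A_{j_1}\cdots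 A_{j_{m-1}})J_{j_m}^+$. A point $x\in\partial_\infty F_g$ is an infinite reduced word; with $\gamma_m$ its prefix of length $m$, $\xi(x)$ is the unique element of $\bigcap_m J_{\gamma_m}$. Fundamental domain: a closed subset $D\subset\Omega$ with $\bigcup_{\gamma}\rho(\gamma)D=\Omega$ and such that $D$ and $\rho(\gamma)D$ have disjoint interiors for all $\gamma\ne 1$. A polyhedral hypersurface in $\mathbb{RP}^{2k-1}$ is a finite union of $(2k-2)$-dimensional polyhedral pieces, each the projectivization of a closed convex polyhedral cone (defined by finitely many linear inequalities) in a linear hyperplane of $\mathbb{R}^{2k}$; "bounded by" means that the topological boundary of $D$ is a union of such hypersurfaces. *)

theory Defs
  imports
    "HOL-Analysis.Analysis"
    "HOL-Algebra.Coset"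
    "Jordan_Normal_Form.Determinant"
begin

section \<open>Oriented subspaces\<close>

text \<open>An orientation of a subspace of \<open>\<real>\<^sup>n\<close> is an equivalence class of ordered bases (lists of
  vectors), two bases being equivalent if the base change has positive determinant. An oriented
  subspace is the set of its positive bases; the subspace itself is recovered as their span.
  The size of the base change varies, hence the determinant of Jordan_Normal_Form.
  The zero subspace has the single basis \<open>[]\<close>, so \<open>{[]}\<close> is the zero subspace with the orientation
  that is neutral for direct sums.\<close>

type_synonym 'n oriented = "(real^'n) list set"

definition ordered_basis :: "(real^'n) list \<Rightarrow> bool" where
  "ordered_basis bs \<longleftrightarrow> distinct bs \<and> independent (set bs)"

definition base_change :: "(real^'n) list \<Rightarrow> (real^'n) list \<Rightarrow> real mat \<Rightarrow> bool" where
  "base_change bs cs M \<longleftrightarrow> length bs = length cs \<and> M \<in> carrier_mat (length bs) (length bs) \<and>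
     (\<forall>j<length cs. cs ! j = (\<Sum>i<length bs. (M $$ (i, j)) *\<^sub>R (bs ! i)))"

definition same_orientation :: "(real^'n) list \<Rightarrow> (real^'n) list \<Rightarrow> bool" where
  "same_orientation bs cs \<longleftrightarrow> ordered_basis bs \<and> ordered_basis cs \<and>
     (\<exists>M. base_change bs cs M \<and> Determinant.det M > 0)"

definition opposite_orientation :: "(real^'n) list \<Rightarrow> (real^'n) list \<Rightarrow> bool" where
  "opposite_orientation bs cs \<longleftrightarrow> ordered_basis bs \<and> ordered_basis cs \<and>
     (\<exists>M. base_change bs cs M \<and> Determinant.det M < 0)"

definition orientation_of :: "(real^'n) list \<Rightarrow> 'n oriented" where
  "orientation_of bs = {cs. same_orientation bs cs}"

definition oriented_subspaces :: "nat \<Rightarrow> 'n::finite oriented set" where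
  "oriented_subspaces d = {orientation_of bs | bs. ordered_basis bs \<and> length bs = d}"

definition underlying :: "'n::finite oriented \<Rightarrow> (real^'n) set" where
  "underlying V = (\<Union>bs\<in>V. span (set bs))"

definition reverse_orientation :: "'n::finite oriented \<Rightarrow> 'n oriented" where
  "reverse_orientation V = {cs. \<exists>bs\<in>V. opposite_orientation bs cs}"

text \<open>If the sum is not direct, the concatenations are not bases and the result is empty.\<close>

definition oriented_sum :: "'n::finite oriented \<Rightarrow> 'n oriented \<Rightarrow> 'n oriented" (infixl "\<oplus>\<^sub>o" 65) where
  "V \<oplus>\<^sub>o W = {cs. \<exists>bs\<in>V. \<exists>bs'\<in>W. same_orientation (bs @ bs') cs}"

text \<open>The linear order on the index type enumerates the standard basis. (In a numeral type such
  as \<open>2\<close> the index \<open>2 = 0\<close> is the least one.)\<close>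

definition standard_orientation :: "'n::{finite,linorder} oriented" where
  "standard_orientation =
     orientation_of (map (\<lambda>i. axis i 1) (sorted_list_of_set (UNIV :: 'n set)))"


section \<open>Oriented flags\<close>

text \<open>A lift \<open>F\<close> is extended by \<open>F 0 = {[]}\<close> (the zero subspace) and by the dummy
  value \<open>F i = {}\<close> for \<open>i \<ge> n\<close>. A point of \<open>Flag\<^sup>+\<close> is the set of its two lifts.\<close>

type_synonym 'n lift = "nat \<Rightarrow> 'n oriented"
type_synonym 'n flag = "'n lift set"

definition lifts :: "'n::finite lift set" where
  "lifts = {F. (\<forall>i<CARD('n). F i \<in> oriented_subspaces i) \<and>
               (\<forall>i. Suc i < CARD('n) \<longrightarrow> underlying (F i) \<subseteq> underlying (F (Suc i))) \<and>
               (\<forall>i\<ge>CARD('n). F i = {})}"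

definition reverse_odd :: "'n::finite lift \<Rightarrow> 'n lift" where
  "reverse_odd F = (\<lambda>i. if odd i then reverse_orientation (F i) else F i)"

definition oriented_flags :: "'n::finite flag set" where
  "oriented_flags = lifts // {(F, F'). F \<in> lifts \<and> (F' = F \<or> F' = reverse_odd F)}"

text \<open>Both lifts have the same underlying subspaces, so the union is over equal sets.\<close>

definition flag_subspace :: "'n::finite flag \<Rightarrow> nat \<Rightarrow> (real^'n) set" where
  "flag_subspace f i = (\<Union>F\<in>f. underlying (F i))"

definition hyperconvex ::
    "'n::{finite,linorder} flag \<Rightarrow> 'n flag \<Rightarrow> 'n flag \<Rightarrow> bool" where
  "hyperconvex f\<^sub>1 f\<^sub>2 f\<^sub>3 \<longleftrightarrow>
     f\<^sub>1 \<in> oriented_flags \<and> f\<^sub>2 \<in> oriented_flags \<and> f\<^sub>3 \<in> oriented_flags \<and>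
     (\<exists>F\<^sub>1\<in>f\<^sub>1. \<exists>F\<^sub>2\<in>f\<^sub>2. \<exists>F\<^sub>3\<in>f\<^sub>3. \<forall>i\<^sub>1 i\<^sub>2 i\<^sub>3.
        i\<^sub>1 < CARD('n) \<and> i\<^sub>2 < CARD('n) \<and> i\<^sub>3 < CARD('n) \<and> i\<^sub>1 + i\<^sub>2 + i\<^sub>3 = CARD('n) \<longrightarrow>
        F\<^sub>1 i\<^sub>1 \<oplus>\<^sub>o F\<^sub>2 i\<^sub>2 \<oplus>\<^sub>o F\<^sub>3 i\<^sub>3 = standard_orientation)"

definition flag_interval ::
    "'n::{finite,linorder} flag \<Rightarrow> 'n flag \<Rightarrow> 'n flag set" where
  "flag_interval f f' = {f''. hyperconvex f f'' f'}"


section \<open>Projective spaces\<close>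

definition quotient_topology :: "'a topology \<Rightarrow> ('a \<Rightarrow> 'b) \<Rightarrow> 'b topology" where
  "quotient_topology X q =
     topology (\<lambda>U. U \<subseteq> q ` topspace X \<and> openin X {x \<in> topspace X. q x \<in> U})"

lemma openin_quotient_topology:
  "openin (quotient_topology X q) U \<longleftrightarrow>
     U \<subseteq> q ` topspace X \<and> openin X {x \<in> topspace X. q x \<in> U}"
proof -
  let ?P = "\<lambda>U. U \<subseteq> q ` topspace X \<and> openin X {x \<in> topspace X. q x \<in> U}"
  have "?P (S \<inter> T)" if "?P S" "?P T" for S T
  proof -
    have "{x \<in> topspace X. q x \<in> S \<inter> T} =
        {x \<in> topspace X. q x \<in> S} \<inter> {x \<in> topspace X. q x \<in> T}" by auto
    then show ?thesis using that by auto
  qed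
  moreover have "?P (\<Union>\<K>)" if "\<forall>K\<in>\<K>. ?P K" for \<K>
  proof -
    have "{x \<in> topspace X. q x \<in> \<Union>\<K>} = (\<Union>K\<in>\<K>. {x \<in> topspace X. q x \<in> K})" by auto
    moreover have "openin X (\<Union>K\<in>\<K>. {x \<in> topspace X. q x \<in> K})"
      using that by (intro openin_Union) auto
    ultimately show ?thesis using that by auto
  qed
  ultimately have "istopology ?P"
    unfolding istopology_def by blast
  then show ?thesis
    by (simp add: quotient_topology_def)
qed

lemma topspace_quotient_topology [simp]:
  "topspace (quotient_topology X q) = q ` topspace X"
proof -
  have "openin (quotient_topology X q) (q ` topspace X)"
    by (auto simp: openin_quotient_topology cong: conj_cong)
  then show ?thesis
    by (metis openin_quotient_topology openin_subset openin_topspace subset_antisym)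
qed

lemma quotient_map_quotient_topology:
  "quotient_map X (quotient_topology X q) q"
  by (auto simp: quotient_map_def openin_quotient_topology)

text \<open>Points of projective space are the lines through the origin, as sets of vectors.\<close>

type_synonym 'n line = "(real^'n) set"

definition projective_space :: "'n::finite line topology" where
  "projective_space = quotient_topology (top_of_set (- {0})) (\<lambda>v. span {v})"

definition projectivization :: "(real^'n::finite) set \<Rightarrow> 'n line set" where
  "projectivization C = {span {v} | v. v \<in> C \<and> v \<noteq> 0}"

text \<open>The cyclic order on \<open>\<real>P\<^sup>1\<close> given by increasing angle (counterclockwise).\<close>

definition positively_ordered :: "2 line \<Rightarrow> 2 line \<Rightarrow> 2 line \<Rightarrow> bool" where
  "positively_ordered p q r \<longleftrightarrow> (\<exists>\<alpha> \<beta> \<gamma>. \<alpha> < \<beta> \<and> \<beta> < \<gamma> \<and> \<gamma> < \<alpha> + pi \<and>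
     p = span {vector [cos \<alpha>, sin \<alpha>]} \<and>
     q = span {vector [cos \<beta>, sin \<beta>]} \<and>
     r = span {vector [cos \<gamma>, sin \<gamma>]})"

definition cyclic_interval :: "2 line \<Rightarrow> 2 line \<Rightarrow> 2 line set" where
  "cyclic_interval p r = {q. positively_ordered p q r}"


section \<open>Projective special linear groups\<close>

text \<open>Only used in even dimension, where \<open>-1\<close> has determinant 1. Elements of
  \<open>PSL\<close> are the cosets \<open>{M, -M}\<close>.\<close>

type_synonym 'n psl = "(real^'n^'n) set"

definition SL :: "(real^'n^'n::finite) monoid" where
  "SL = \<lparr>carrier = {M. Determinants.det M = 1}, monoid.mult = (**), one = Finite_Cartesian_Product.mat 1\<rparr>"

definition PSL :: "'n::finite psl monoid" where
  "PSL = SL Mod {Finite_Cartesian_Product.mat 1, - Finite_Cartesian_Product.mat 1}"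

text \<open>The images of a line under the two representatives coincide.\<close>

definition act_line :: "'n::finite psl \<Rightarrow> 'n line \<Rightarrow> 'n line" where
  "act_line p L = (\<Union>M\<in>p. (*v) M ` L)"

definition act_flag :: "'n::finite psl \<Rightarrow> 'n flag \<Rightarrow> 'n flag" where
  "act_flag p f = {(\<lambda>i. map ((*v) M) ` F i) | M F. M \<in> p \<and> F \<in> f}"


section \<open>Free groups\<close>

text \<open>The letter \<open>j > 0\<close> stands for the \<open>j\<close>-th free generator and \<open>-j\<close> for its inverse. Elements of
  the free group are reduced words, multiplied by concatenation and free reduction.\<close>

definition letters :: "nat \<Rightarrow> int set" where
  "letters g = {j. j \<noteq> 0 \<and> \<bar>j\<bar> \<le> int g}"

definition reduced_words :: "nat \<Rightarrow> int list set" where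
  "reduced_words g = {w. set w \<subseteq> letters g \<and> (\<forall>i. Suc i < length w \<longrightarrow> w ! Suc i \<noteq> - (w ! i))}"

fun prepend_letter :: "int \<Rightarrow> int list \<Rightarrow> int list" where
  "prepend_letter j [] = [j]"
| "prepend_letter j (i # w) = (if i = - j then w else j # i # w)"

definition free_group :: "nat \<Rightarrow> int list monoid" where
  "free_group g = \<lparr>carrier = reduced_words g, monoid.mult = foldr prepend_letter, one = []\<rparr>"

definition free_group_boundary :: "nat \<Rightarrow> (nat \<Rightarrow> int) set" where
  "free_group_boundary g = {x. (\<forall>i. x i \<in> letters g) \<and> (\<forall>i. x (Suc i) \<noteq> - x i)}"


section \<open>Schottky representations\<close>

text \<open>For \<open>j \<in> {1..g}\<close> the endpoints of \<open>I\<^sub>j\<^sup>+\<close> are \<open>a j, b j\<close> and those of \<open>I\<^sub>j\<^sup>-\<close>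
  are \<open>a (-j), b (-j)\<close>. So \<open>I\<^sub>j\<^sup>-\<close> is the interval of the letter \<open>-j\<close>, in accordance with the
  convention \<open>J\<^bsub>-j\<^esub>\<^sup>+ = J\<^sub>j\<^sup>-\<close>.\<close>

definition schottky_generators ::
    "nat \<Rightarrow> (int \<Rightarrow> 2 psl) \<Rightarrow> (int \<Rightarrow> 2 line) \<Rightarrow> (int \<Rightarrow> 2 line) \<Rightarrow> bool" where
  "schottky_generators g A a b \<longleftrightarrow>
     (\<forall>j\<in>letters g. a j \<in> topspace projective_space \<and> b j \<in> topspace projective_space \<and> a j \<noteq> b j) \<and>
     (\<forall>i\<in>letters g. \<forall>j\<in>letters g. i \<noteq> j \<longrightarrow>
        (projective_space closure_of cyclic_interval (a i) (b i)) \<inter>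
        (projective_space closure_of cyclic_interval (a j) (b j)) = {}) \<and>
     (\<forall>j\<in>{1..int g}. A j \<in> carrier PSL \<and>
        act_line (A j) ` cyclic_interval (b (- j)) (a (- j)) = cyclic_interval (a j) (b j))"

definition purely_hyperbolic_schottky ::
    "nat \<Rightarrow> (int \<Rightarrow> 2 psl) \<Rightarrow> (int \<Rightarrow> 2 line) \<Rightarrow> (int \<Rightarrow> 2 line) \<Rightarrow>
     (2 line \<Rightarrow> 'n::{finite,linorder} flag) \<Rightarrow> (int \<Rightarrow> 'n psl) \<Rightarrow>
     (int list \<Rightarrow> 'n psl) \<Rightarrow> bool" where
  "purely_hyperbolic_schottky g A a b \<xi>\<^sub>0 h \<rho> \<longleftrightarrow>
     schottky_generators g A a b \<and>
     (\<forall>p \<in> a ` letters g \<union> b ` letters g. \<xi>\<^sub>0 p \<in> oriented_flags) \<and>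
     (\<forall>p \<in> a ` letters g \<union> b ` letters g. \<forall>q \<in> a ` letters g \<union> b ` letters g.
      \<forall>r \<in> a ` letters g \<union> b ` letters g.
        positively_ordered p q r \<longrightarrow> hyperconvex (\<xi>\<^sub>0 p) (\<xi>\<^sub>0 q) (\<xi>\<^sub>0 r)) \<and>
     (\<forall>j\<in>{1..int g}. h j \<in> carrier PSL \<and>
        act_flag (h j) (\<xi>\<^sub>0 (b (- j))) = \<xi>\<^sub>0 (a j) \<and>
        act_flag (h j) (\<xi>\<^sub>0 (a (- j))) = \<xi>\<^sub>0 (b j)) \<and>
     \<rho> \<in> hom (free_group g) PSL \<and>
     (\<forall>j\<in>{1..int g}. \<rho> [j] = h j)"

definition word_interval ::
    "(int \<Rightarrow> 2 line) \<Rightarrow> (int \<Rightarrow> 2 line) \<Rightarrow>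
     (2 line \<Rightarrow> 'n::{finite,linorder} flag) \<Rightarrow> (int list \<Rightarrow> 'n psl) \<Rightarrow>
     int list \<Rightarrow> 'n flag set" where
  "word_interval a b \<xi>\<^sub>0 \<rho> w =
     act_flag (\<rho> (butlast w)) ` flag_interval (\<xi>\<^sub>0 (a (last w))) (\<xi>\<^sub>0 (b (last w)))"

definition boundary_map ::
    "(int \<Rightarrow> 2 line) \<Rightarrow> (int \<Rightarrow> 2 line) \<Rightarrow>
     (2 line \<Rightarrow> 'n::{finite,linorder} flag) \<Rightarrow> (int list \<Rightarrow> 'n psl) \<Rightarrow>
     (nat \<Rightarrow> int) \<Rightarrow> 'n flag" where
  "boundary_map a b \<xi>\<^sub>0 \<rho> x =
     (THE f. f \<in> (\<Inter>m\<in>{1..}. word_interval a b \<xi>\<^sub>0 \<rho> (map x [0..<m])))"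


section \<open>Group actions and fundamental domains\<close>

definition properly_discontinuous :: "'g set \<Rightarrow> ('g \<Rightarrow> 'a \<Rightarrow> 'a) \<Rightarrow> 'a topology \<Rightarrow> bool" where
  "properly_discontinuous G act X \<longleftrightarrow>
     (\<forall>K. compactin X K \<longrightarrow> finite {\<gamma> \<in> G. act \<gamma> ` K \<inter> K \<noteq> {}})"

definition cocompact :: "'g set \<Rightarrow> ('g \<Rightarrow> 'a \<Rightarrow> 'a) \<Rightarrow> 'a topology \<Rightarrow> bool" where
  "cocompact G act X \<longleftrightarrow> compact_space (quotient_topology X (\<lambda>x. (\<lambda>\<gamma>. act \<gamma> x) ` G))"

definition fundamental_domain ::
    "('g, 'm) monoid_scheme \<Rightarrow> ('g \<Rightarrow> 'a \<Rightarrow> 'a) \<Rightarrow> 'a topology \<Rightarrow> 'a set \<Rightarrow> bool" where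
  "fundamental_domain G act X D \<longleftrightarrow>
     closedin X D \<and>
     (\<Union>\<gamma>\<in>carrier G. act \<gamma> ` D) = topspace X \<and>
     (\<forall>\<gamma>\<in>carrier G. \<gamma> \<noteq> \<one>\<^bsub>G\<^esub> \<longrightarrow> (X interior_of D) \<inter> (X interior_of (act \<gamma> ` D)) = {})"

text \<open>The projectivization of a cone has one dimension less than the cone, so a piece of
  dimension \<open>n - 2\<close> comes from a cone spanning its hyperplane.\<close>

definition polyhedral_piece :: "'n::finite line set \<Rightarrow> bool" where
  "polyhedral_piece P \<longleftrightarrow> (\<exists>u W C. u \<noteq> 0 \<and> finite W \<and>
     C = {v. u \<bullet> v = 0 \<and> (\<forall>w\<in>W. w \<bullet> v \<ge> 0)} \<and>
     dim C = CARD('n) - 1 \<and> P = projectivization C)"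

definition polyhedral_hypersurface :: "'n::finite line set \<Rightarrow> bool" where
  "polyhedral_hypersurface H \<longleftrightarrow>
     (\<exists>\<P>. finite \<P> \<and> \<P> \<noteq> {} \<and> (\<forall>P\<in>\<P>. polyhedral_piece P) \<and> H = \<Union>\<P>)"

end

theory Submission imports Defs begin

text \<open>The proof is a ping-pong argument in projective space, in which total positivity supplies the
  nested domains. Fix for each letter \<open>j\<close> a basis \<open>B j\<close> adapted to the pair of flags
  \<open>\<xi>\<^sub>0 (a j)\<close>, \<open>\<xi>\<^sub>0 (b j)\<close>: initial segments span the first flag, final segments the second one.
  A flag lies in the interval between the two exactly if its Pluecker coordinates in this basis are
  positive, and an interval that is nested in another one gives a change of basis all of whose minors
  are positive (\<open>nested_adapted_totally_positive\<close>; Fekete's criterion reduces the minors to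
  those that the hyperconvexity condition controls).

  Let \<open>H j\<close> consist of the lines spanned by vectors whose coordinates in \<open>B j\<close> have fewer than \<open>k\<close>
  sign changes for some choice of the signs of zero coordinates, and \<open>G j\<close> of those for which this
  holds for every choice. Totally positive matrices do not increase the number of sign
  changes, in the strong sense that compares an arbitrary choice of signs for the image with an
  arbitrary one for the vector (\<open>variation_diminishing\<close>); hence \<open>\<rho> [i]\<close> maps \<open>H j\<close> into \<open>G i\<close> if
  \<open>j \<noteq> - i\<close>. On the other hand \<open>\<rho> [j]\<close> carries \<open>B (- j)\<close> to \<open>B j\<close> in reverse order with factors of
  alternating sign, which turns \<open>m\<close> sign changes into \<open>2 k - 1 - m\<close>. This is where the dimension
  \<open>2 k\<close> enters: fewer than \<open>k\<close> changes become at least \<open>k\<close> changes, so that \<open>\<rho> [j]\<close>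
  maps the complement of \<open>G (- j)\<close> onto \<open>H j\<close> (\<open>many_to_few\<close>). These two properties are what the
  locale \<open>ping_pong\<close> requires; there the complement \<open>D\<close> of the sets \<open>G j\<close> is a fundamental domain
  for the complement of the limit set, which consists of the intersections of the translates of the \<open>H j\<close>
  along infinite reduced words, and its frontier is the union of the sets \<open>H j - G j\<close>.

  It remains to identify the limit set. Along an infinite word one has an infinite product of
  totally positive matrices from a finite set. Their compound matrices have positive
  entries within fixed bounds, so they contract Pluecker coordinates projectively at a uniform rate
  (\<open>birkhoff_chain\<close>). Consequently the nested intervals of flags meet in a single flag, which
  is \<open>\<xi> x\<close>, and the nested cones of vectors with fewer than \<open>k\<close> sign changes meet exactly in
  the \<open>k\<close>-dimensional subspace of this flag (\<open>limit_basis\<close>).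

  Finally a line in \<open>H j - G j\<close> admits choices of signs with fewer and with at least \<open>k\<close> changes.
  Passing from one to the other, the number of changes crosses \<open>k\<close> at the flip of one zero
  coordinate; so the line lies in one of finitely many simplicial cones in coordinate hyperplanes
  (\<open>few_many_faces\<close>).\<close>

(* The dollar sign is kept for the components of vectors in Euclidean spaces. *)
no_notation vec_index (infixl "$" 100)


section \<open>Determinants of arrays\<close>

text \<open>Matrices of varying size are functions on pairs of natural numbers here, so that submatrices are
  obtained by composition with index functions.\<close>

definition detf :: "nat \<Rightarrow> (nat \<Rightarrow> nat \<Rightarrow> real) \<Rightarrow> real" where
  "detf q F = Determinant.det (Matrix.mat q q (\<lambda>(a, b). F a b))"

lemma detf_cong:
  "(\<And>a b. a < q \<Longrightarrow> b < q \<Longrightarrow> F a b = G a b) \<Longrightarrow> detf q F = detf q G"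
  unfolding detf_def by (rule arg_cong[where f = Determinant.det]) auto

lemma detf_0 [simp]: "detf 0 F = 1"
  by (simp add: detf_def)

lemma detf_leibniz:
  "detf q F = (\<Sum>p | p permutes {..<q}. of_int (sign p) * (\<Prod>i<q. F i (p i)))"
proof -
  have *: "p i < q" if "p permutes {..<q}" "i < q" for p i
    using permutes_in_image[OF that(1), of i] that(2) by auto
  show ?thesis
    unfolding detf_def
    by (subst det_def'[of _ q]) (auto simp: atLeast0LessThan * intro!: sum.cong prod.cong)
qed

lemma detf_1 [simp]: "detf (Suc 0) F = F 0 0"
proof -
  have "{..<Suc 0} = {0}" by auto
  then show ?thesis by (simp add: detf_leibniz)
qed

lemma detf_transpose: "detf q (\<lambda>a b. F b a) = detf q F"
proof -
  have "Matrix.mat q q (\<lambda>(a, b). F b a) = transpose_mat (Matrix.mat q q (\<lambda>(a, b). F a b))"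
    by auto
  then show ?thesis unfolding detf_def using Determinant.det_transpose
    by (metis mat_carrier)
qed

lemma detf_mult: "detf q (\<lambda>a b. \<Sum>k<q. F a k * G k b) = detf q F * detf q G"
proof -
  have "Matrix.mat q q (\<lambda>(a, b). \<Sum>k<q. F a k * G k b) =
      Matrix.mat q q (\<lambda>(a, b). F a b) * Matrix.mat q q (\<lambda>(a, b). G a b)"
    by (rule eq_matI) (auto simp: scalar_prod_def atLeast0LessThan)
  then show ?thesis unfolding detf_def by (simp add: Determinant.det_mult[of _ q])
qed

lemma detf_lower:
  assumes "\<And>a b. a < b \<Longrightarrow> b < q \<Longrightarrow> F a b = 0"
  shows "detf q F = (\<Prod>a<q. F a a)"
proof -
  have "detf q F = prod_list (diag_mat (Matrix.mat q q (\<lambda>(a, b). F a b)))"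
    unfolding detf_def by (rule det_lower_triangular[where n = q]) (use assms in auto)
  also have "\<dots> = (\<Prod>a<q. F a a)"
    by (simp add: prod_list_diag_prod atLeast0LessThan)
  finally show ?thesis .
qed

lemma detf_upper:
  assumes "\<And>a b. b < a \<Longrightarrow> a < q \<Longrightarrow> F a b = 0"
  shows "detf q F = (\<Prod>a<q. F a a)"
  using detf_lower[of q "\<lambda>a b. F b a"] assms detf_transpose[of q F] by simp

lemma detf_scale: "detf q (\<lambda>a b. r a * F a b) = (\<Prod>a<q. r a) * detf q F"
  unfolding detf_leibniz by (simp add: prod.distrib sum_distrib_left mult_ac)

lemma detf_scale_columns: "detf q (\<lambda>a b. s b * F a b) = (\<Prod>b<q. s b) * detf q F"
  using detf_scale[of q s "\<lambda>a b. F b a"]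
  by (simp only: detf_transpose[of q "\<lambda>a b. s a * F b a"] detf_transpose[of q F])

lemma detf_zero_row: "i < q \<Longrightarrow> (\<And>b. b < q \<Longrightarrow> F i b = 0) \<Longrightarrow> detf q F = 0"
proof -
  assume i: "i < q" and 0: "\<And>b. b < q \<Longrightarrow> F i b = 0"
  have "(\<Prod>j<q. F j (p j)) = 0" if "p permutes {..<q}" for p
    using i 0 permutes_in_image[OF that, of i] by (intro prod_zero) auto
  then show ?thesis unfolding detf_leibniz by (intro sum.neutral) auto
qed

lemma detf_equal_rows:
  assumes "i < q" "j < q" "i \<noteq> j" "\<And>b. b < q \<Longrightarrow> F i b = F j b"
  shows "detf q F = 0"
  unfolding detf_def
  by (rule det_identical_rows[where i = i and j = j and n = q]) (use assms in \<open>auto simp: Matrix.row_def\<close>)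

lemma detf_expand_rows:
  assumes "\<And>a. a < q \<Longrightarrow> finite (S a)"
    and "\<And>a b. a < q \<Longrightarrow> b < q \<Longrightarrow> F a b = (\<Sum>s\<in>S a. c a s * G a s b)"
  shows "detf q F =
    (\<Sum>f\<in>Pi\<^sub>E {..<q} S. (\<Prod>a<q. c a (f a)) * detf q (\<lambda>a. G a (f a)))"
proof -
  have "(\<Prod>a<q. F a (p a)) = (\<Sum>f\<in>Pi\<^sub>E {..<q} S. \<Prod>a<q. c a (f a) * G a (f a) (p a))"
    if p: "p permutes {..<q}" for p
  proof -
    have "(\<Prod>a<q. F a (p a)) = (\<Prod>a<q. \<Sum>s\<in>S a. c a s * G a s (p a))"
      using permutes_in_image[OF p] by (intro prod.cong) (auto simp: assms(2))
    then show ?thesis using assms(1) by (subst (asm) prod_sum_PiE) auto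
  qed
  then have "detf q F = (\<Sum>p | p permutes {..<q}. of_int (sign p) *
      (\<Sum>f\<in>Pi\<^sub>E {..<q} S. (\<Prod>a<q. c a (f a)) * (\<Prod>a<q. G a (f a) (p a))))"
    unfolding detf_leibniz by (intro sum.cong) (auto simp: prod.distrib)
  also have "\<dots> = (\<Sum>f\<in>Pi\<^sub>E {..<q} S. (\<Prod>a<q. c a (f a)) * detf q (\<lambda>a. G a (f a)))"
    unfolding detf_leibniz sum_distrib_left
    by (subst sum.swap) (simp add: mult_ac)
  finally show ?thesis .
qed

text \<open>A determinant is positive if its rows are nonnegative combinations of vectors all of whose choices
  have nonnegative determinant, and one choice contributes. Both criteria for total positivity below
  write differences of rows as sums of consecutive differences and conclude in this way.\<close>

lemma detf_expand_rows_pos: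
  assumes "\<And>a. a < q \<Longrightarrow> finite (S a)"
    and "\<And>a b. a < q \<Longrightarrow> b < q \<Longrightarrow> F a b = (\<Sum>s\<in>S a. c a s * G a s b)"
    and c: "\<And>a s. a < q \<Longrightarrow> s \<in> S a \<Longrightarrow> c a s \<ge> 0"
    and nonneg: "\<And>f. (\<And>a. a < q \<Longrightarrow> f a \<in> S a) \<Longrightarrow> detf q (\<lambda>a. G a (f a)) \<ge> 0"
    and f\<^sub>0: "\<And>a. a < q \<Longrightarrow> f\<^sub>0 a \<in> S a \<and> c a (f\<^sub>0 a) > 0" "detf q (\<lambda>a. G a (f\<^sub>0 a)) > 0"
  shows "detf q F > 0"
proof -
  let ?f = "restrict f\<^sub>0 {..<q}"
  have 1: "?f \<in> Pi\<^sub>E {..<q} S" using f\<^sub>0 by auto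
  have 2: "finite (Pi\<^sub>E {..<q} S)" using assms(1) by (intro finite_PiE) auto
  have "detf q (\<lambda>a. G a (?f a)) = detf q (\<lambda>a. G a (f\<^sub>0 a))" by (rule detf_cong) auto
  then have "(\<Prod>a<q. c a (?f a)) * detf q (\<lambda>a. G a (?f a)) > 0"
    using f\<^sub>0 by (intro mult_pos_pos prod_pos) auto
  then have "(\<Sum>f\<in>Pi\<^sub>E {..<q} S. (\<Prod>a<q. c a (f a)) * detf q (\<lambda>a. G a (f a))) > 0"
    using 1 2 c nonneg
    by (intro sum_pos2[of _ ?f]) (auto intro!: mult_nonneg_nonneg prod_nonneg simp: PiE_iff)
  then show ?thesis using detf_expand_rows[OF assms(1,2)] by simp
qed

lemma detf_row_differences:
  "detf q (\<lambda>a b. if a = 0 then F a b else F a b - F (a - 1) b) = detf q F"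
proof -
  define L where "L = (\<lambda>a k. if k = a then 1 else if Suc k = a then -1 else (0::real))"
  have "detf q (\<lambda>a b. \<Sum>k<q. L a k * F k b) = detf q L * detf q F"
    by (rule detf_mult)
  moreover have "detf q L = 1"
    by (subst detf_lower) (auto simp: L_def)
  moreover have "detf q (\<lambda>a b. \<Sum>k<q. L a k * F k b) =
      detf q (\<lambda>a b. if a = 0 then F a b else F a b - F (a - 1) b)"
  proof (rule detf_cong)
    fix a b assume a: "a < q"
    have "(\<Sum>k<q. L a k * F k b) = (\<Sum>k<q. (if k = a then F k b else 0) + (if Suc k = a then - F k b else 0))"
      by (rule sum.cong) (auto simp: L_def)
    also have "\<dots> = F a b + (\<Sum>k<q. if Suc k = a then - F k b else 0)"
      using a by (simp add: sum.distrib)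
    also have "(\<Sum>k<q. if Suc k = a then - F k b else 0) = (if a = 0 then 0 else - F (a - 1) b)"
    proof (cases a)
      case (Suc a')
      then have "(\<Sum>k<q. if Suc k = a then - F k b else 0) = (\<Sum>k<q. if k = a' then - F k b else 0)"
        by (intro sum.cong) auto
      then show ?thesis using Suc a by simp
    qed simp
    finally show "(\<Sum>k<q. L a k * F k b) = (if a = 0 then F a b else F a b - F (a - 1) b)"
      by simp
  qed
  ultimately show ?thesis by simp
qed

lemma detf_column_differences:
  "detf q (\<lambda>a b. if b = 0 then F a b else F a b - F a (b - 1)) = detf q F"
  using detf_row_differences[of q "\<lambda>a b. F b a"]
  by (simp only: detf_transpose[of q "\<lambda>a b. if a = 0 then F b a else F b a - F b (a - 1)"] detf_transpose[of q F])

lemma detf_first_column: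
  assumes "\<And>a. a < q \<Longrightarrow> F (Suc a) 0 = 0"
  shows "detf (Suc q) F = F 0 0 * detf q (\<lambda>a b. F (Suc a) (Suc b))"
proof -
  let ?A = "Matrix.mat 1 1 (\<lambda>(a, b). F a b)" and ?B = "Matrix.mat 1 q (\<lambda>(a, b). F a (Suc b))"
  let ?D = "Matrix.mat q q (\<lambda>(a, b). F (Suc a) (Suc b))"
  have "Matrix.mat (Suc q) (Suc q) (\<lambda>(a, b). F a b) = four_block_mat ?A ?B (0\<^sub>m q 1) ?D"
    by (rule eq_matI) (auto simp: assms gr0_conv_Suc)
  then have "detf (Suc q) F = Determinant.det ?A * Determinant.det ?D"
    unfolding detf_def by (simp only:) (rule det_four_block_mat_lower_left_zero_col, auto)
  then show ?thesis using detf_1[of F] by (simp add: detf_def)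
qed

lemma detf_ones_column:
  assumes "\<And>a. a \<le> q \<Longrightarrow> F a 0 = 1"
  shows "detf (Suc q) F = detf q (\<lambda>a b. F (Suc a) (Suc b) - F a (Suc b))"
  using detf_row_differences[of "Suc q" F, symmetric] assms
  by (simp add: detf_first_column)


section \<open>Criteria for total positivity\<close>

text \<open>Fekete's criterion: minors with consecutive rows suffice. Dividing each row by its
  first entry makes the first column constant; taking differences of rows then removes it. The
  consecutive differences satisfy the hypothesis in size one less, and the difference of two
  arbitrary rows is a sum of consecutive differences.\<close>

lemma fekete:
  assumes "\<And>q i. q \<le> p \<Longrightarrow> i + q \<le> n \<Longrightarrow> detf q (\<lambda>a. X (i + a)) > 0"
    and "q \<le> p" "\<And>a. a < q \<Longrightarrow> I a < n" "\<And>a b. a < b \<Longrightarrow> b < q \<Longrightarrow> I a < I b"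
  shows "detf q (\<lambda>a. X (I a)) > 0"
  using assms
proof (induction p arbitrary: q n X I)
  case (Suc p)
  show ?case
  proof (cases q)
    case (Suc q')
    have pos: "X i 0 > 0" if "i < n" for i
      using Suc.prems(1)[of 1 i] that by simp
    define Y where "Y = (\<lambda>i j. X i j / X i 0)"
    define Z where "Z = (\<lambda>i j. Y (Suc i) (Suc j) - Y i (Suc j))"
    have X: "detf m (\<lambda>a. X (f a)) = (\<Prod>a<m. X (f a) 0) * detf m (\<lambda>a. Y (f a))"
      if "\<And>a. a < m \<Longrightarrow> f a < n" for f m
      unfolding detf_scale[symmetric] using pos that
      by (intro detf_cong) (force simp: Y_def)
    have Y: "detf m (\<lambda>a. Y (f a)) > 0 \<longleftrightarrow> detf m (\<lambda>a. X (f a)) > 0"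
      if "\<And>a. a < m \<Longrightarrow> f a < n" for f m
    proof -
      have "(\<Prod>a<m. X (f a) 0) > 0" using pos that by (intro prod_pos) auto
      then show ?thesis using X[of m f] that by (simp add: zero_less_mult_iff)
    qed
    have one: "Y i 0 = 1" if "i < n" for i using pos[OF that] by (simp add: Y_def)
    have ZY: "detf m (\<lambda>a. Z (i + a)) > 0" if "m \<le> p" "i + m \<le> n - 1" for m i
    proof (cases "m = 0")
      case False
      have "detf (Suc m) (\<lambda>a. Y (i + a)) > 0"
        using that False Suc.prems(1)[of "Suc m" i] by (subst Y) auto
      moreover have "detf (Suc m) (\<lambda>a. Y (i + a)) = detf m (\<lambda>a. Z (i + a))"
        using that False by (subst detf_ones_column) (auto simp: one Z_def)
      ultimately show ?thesis by simp
    qed simp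
    have Zpos: "detf q' (\<lambda>a. Z (f a)) > 0" if f: "\<And>a. a < q' \<Longrightarrow> f a \<in> {I a..<I (Suc a)}" for f
    proof (rule Suc.IH[of "n - 1"])
      show "q' \<le> p" using Suc Suc.prems by simp
      show "f a < n - 1" if "a < q'" for a
        using f[OF that] Suc.prems(3)[of "Suc a"] that Suc by auto
      show "f a < f b" if "a < b" "b < q'" for a b
      proof -
        have "I (Suc a) \<le> I b"
          using that Suc Suc.prems(4)[of "Suc a" b] by (cases "Suc a = b") auto
        then show ?thesis using f[of a] f[of b] that by auto
      qed
    qed (use ZY in auto)
    have sub: "Y (I (Suc a)) (Suc b) - Y (I a) (Suc b) = (\<Sum>s = I a..<I (Suc a). 1 * Z s b)"
      if "a < q'" for a b
      using Suc.prems(4)[of a "Suc a"] that Suc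
      by (simp add: Z_def sum_Suc_diff'[of "I a" "I (Suc a)" "\<lambda>i. Y i (Suc b)"])
    have "detf q' (\<lambda>a b. Y (I (Suc a)) (Suc b) - Y (I a) (Suc b)) > 0"
    proof (rule detf_expand_rows_pos[where S = "\<lambda>a. {I a..<I (Suc a)}" and G = "\<lambda>a s. Z s" and c = "\<lambda>_ _. 1" and f\<^sub>0 = I])
      show "detf q' (\<lambda>a. Z (f a)) \<ge> 0" if "\<And>a. a < q' \<Longrightarrow> f a \<in> {I a..<I (Suc a)}" for f
        using Zpos[of f] that by fastforce
      show "detf q' (\<lambda>a. Z (I a)) > 0"
        using Suc.prems(4) Suc by (intro Zpos) auto
    qed (use sub Suc.prems(4) Suc in auto)
    moreover have "detf (Suc q') (\<lambda>a. Y (I a)) =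
        detf q' (\<lambda>a b. Y (I (Suc a)) (Suc b) - Y (I a) (Suc b))"
      using Suc.prems(3) Suc by (subst detf_ones_column) (auto simp: one)
    ultimately show ?thesis using Y[of q I] Suc.prems(3) Suc by simp
  qed simp
qed simp

text \<open>The index functions of minors of size \<open>q\<close>; values beyond the first \<open>q\<close> are arbitrary.\<close>

definition increasing :: "nat \<Rightarrow> nat \<Rightarrow> (nat \<Rightarrow> nat) \<Rightarrow> bool" where
  "increasing q n I \<longleftrightarrow> (\<forall>a<q. I a < n) \<and> (\<forall>a b. a < b \<longrightarrow> b < q \<longrightarrow> I a < I b)"

definition totally_positive :: "nat \<Rightarrow> nat \<Rightarrow> (nat \<Rightarrow> nat \<Rightarrow> real) \<Rightarrow> bool" where
  "totally_positive n m X \<longleftrightarrow>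
     (\<forall>q I J. increasing q n I \<longrightarrow> increasing q m J \<longrightarrow> detf q (\<lambda>a b. X (I a) (J b)) > 0)"

lemma increasing_gaps_sum:
  fixes Y Z :: "nat \<Rightarrow> real"
  assumes "\<And>i. i < n \<Longrightarrow> Y i = (\<Sum>s\<le>i. Z s)" and "increasing q n I" "a < q"
  shows "(if a = 0 then Y (I a) else Y (I a) - Y (I (a - 1))) =
    (\<Sum>s\<in>(if a = 0 then {..I a} else {I (a - 1)<..I a}). 1 * Z s)"
proof (cases a)
  case 0
  then show ?thesis using assms by (auto simp: increasing_def)
next
  case (Suc a')
  have lt: "I a' < I a" "I a < n" "I a' < n" using assms Suc by (auto simp: increasing_def)
  then have "{..I a} = {..I a'} \<union> {I a'<..I a}" by auto
  then have "(\<Sum>s\<le>I a. Z s) = (\<Sum>s\<le>I a'. Z s) + (\<Sum>s\<in>{I a'<..I a}. Z s)"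
    by (metis (no_types) finite_atMost finite_greaterThanAtMost ivl_disj_int_one(3) sum.union_disjoint)
  then show ?thesis using Suc lt assms(1) by simp
qed

lemma increasing_gaps_choice:
  assumes "increasing q n I"
    and "\<And>a. a < q \<Longrightarrow> f a \<in> (if a = 0 then {..I a} else {I (a - 1)<..I a})"
  shows "increasing q n f"
proof -
  have "f a < f b" if "a < b" "b < q" for a b
  proof -
    have "I a \<le> I (b - 1)"
    proof (cases "a = b - 1")
      case False
      then have "a < b - 1" "b - 1 < q" using that by auto
      then show ?thesis using assms(1) by (auto simp: increasing_def intro: less_imp_le)
    qed simp
    moreover have "f a \<le> I a" "I (b - 1) < f b"
      using assms(2)[of a] assms(2)[of b] that by (auto split: if_splits)
    ultimately show ?thesis by simp
  qed
  moreover have "f a < n" if "a < q" for a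
  proof -
    have "f a \<le> I a" using assms(2)[of a] that by (auto split: if_splits)
    then show ?thesis using assms(1) that by (fastforce simp: increasing_def)
  qed
  ultimately show ?thesis by (auto simp: increasing_def)
qed

text \<open>It suffices to test the minors of consecutive rows and initial columns, and of initial rows and
  consecutive columns. After rescaling rows and columns the first row and the first column are
  constant, and the mixed second differences \<open>Z\<close> satisfy the hypotheses in smaller size. The rescaled array is
  recovered from \<open>Z\<close>, bordered by a unit vector, by summation over rows and over columns.
  Summation is multiplication by a triangular array with nonnegative minors, so positivity is
  inherited.\<close>

lemma totally_positive_criterion:
  assumes "\<And>q i. i + q \<le> n \<Longrightarrow> q \<le> m \<Longrightarrow> detf q (\<lambda>a b. X (i + a) b) > 0"
    and "\<And>q j. q \<le> n \<Longrightarrow> j + q \<le> m \<Longrightarrow> detf q (\<lambda>a b. X a (j + b)) > 0"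
  shows "totally_positive n m X"
  using assms
proof (induction n arbitrary: m X)
  case 0
  then show ?case
    by (auto simp: totally_positive_def increasing_def) (metis detf_0 gr0I less_numeral_extra(1))
next
  case (Suc n)
  show ?case
  proof (cases m)
    case 0
    then show ?thesis
      by (auto simp: totally_positive_def increasing_def) (metis detf_0 gr0I less_numeral_extra(1))
  next
    case (Suc m')
    have r: "X i 0 > 0" if "i < Suc n" for i
      using Suc.prems(1)[of i 1] that Suc by simp
    have c: "X 0 j > 0" if "j < m" for j
      using Suc.prems(2)[of 1 j] that by simp
    define Y where "Y = (\<lambda>i j. X i j * X 0 0 / (X i 0 * X 0 j))"
    define Z where "Z = (\<lambda>i j. Y (Suc i) (Suc j) - Y i (Suc j) - Y (Suc i) j + Y i j)"
    define Z' where "Z' = (\<lambda>i j. if i = 0 \<and> j = 0 then 1 else if i = 0 \<or> j = 0 then 0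
      else Z (i - 1) (j - 1))"
    have Y: "detf q (\<lambda>a b. Y (I a) (J b)) > 0 \<longleftrightarrow> detf q (\<lambda>a b. X (I a) (J b)) > 0"
      if "\<And>a. a < q \<Longrightarrow> I a < Suc n" "\<And>a. a < q \<Longrightarrow> J a < m" for I J q
    proof -
      have "detf q (\<lambda>a b. Y (I a) (J b)) =
          detf q (\<lambda>a b. (X 0 0 / X (I a) 0) * ((1 / X 0 (J b)) * X (I a) (J b)))"
        by (rule detf_cong) (auto simp: Y_def)
      also have "\<dots> = (\<Prod>a<q. X 0 0 / X (I a) 0) * ((\<Prod>b<q. 1 / X 0 (J b)) *
          detf q (\<lambda>a b. X (I a) (J b)))"
        by (simp only: detf_scale detf_scale_columns)
      finally have *: "detf q (\<lambda>a b. Y (I a) (J b)) = (\<Prod>a<q. X 0 0 / X (I a) 0) *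
          ((\<Prod>b<q. 1 / X 0 (J b)) * detf q (\<lambda>a b. X (I a) (J b)))" .
      have "(\<Prod>a<q. X 0 0 / X (I a) 0) > 0" "(\<Prod>b<q. 1 / X 0 (J b)) > 0"
        using that r c Suc by (auto intro!: prod_pos divide_pos_pos)
      then show ?thesis unfolding * by (simp add: zero_less_mult_iff)
    qed
    have Y0: "Y i 0 = 1" if "i < Suc n" for i
      using r[OF that] r[of 0] by (auto simp: Y_def)
    have Y0': "Y 0 j = 1" if "j < m" for j
      using c[OF that] r[of 0] by (auto simp: Y_def)
    have Z1: "detf q (\<lambda>a b. Z (i + a) b) > 0" if "i + q \<le> n" "q \<le> m'" for i q
    proof -
      let ?V = "\<lambda>a b. Y (Suc (i + a)) b - Y (i + a) b"
      have "detf (Suc q) (\<lambda>a b. Y (i + a) b) > 0"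
        using Y[of "Suc q" "\<lambda>a. i + a" "\<lambda>b. b"] Suc.prems(1)[of i "Suc q"] that Suc by simp
      also have "detf (Suc q) (\<lambda>a b. Y (i + a) b) = detf q (\<lambda>a b. ?V a (Suc b))"
        using that by (subst detf_ones_column) (auto simp: Y0)
      also have "\<dots> = detf q (\<lambda>a b. if b = 0 then ?V a (Suc b) else ?V a (Suc b) - ?V a (Suc (b - 1)))"
        by (rule detf_column_differences[symmetric])
      also have "\<dots> = detf q (\<lambda>a b. Z (i + a) b)"
        using that by (intro detf_cong) (auto simp: Z_def Y0)
      finally show ?thesis .
    qed
    have Z2: "detf q (\<lambda>a b. Z a (j + b)) > 0" if "q \<le> n" "j + q \<le> m'" for j q
    proof -
      let ?V = "\<lambda>b a. Y a (Suc (j + b)) - Y a (j + b)"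
      have "detf (Suc q) (\<lambda>a b. Y a (j + b)) > 0"
        using Y[of "Suc q" "\<lambda>a. a" "\<lambda>b. j + b"] Suc.prems(2)[of "Suc q" j] that Suc by simp
      also have "detf (Suc q) (\<lambda>a b. Y a (j + b)) = detf (Suc q) (\<lambda>b a. Y a (j + b))"
        by (rule detf_transpose[symmetric])
      also have "\<dots> = detf q (\<lambda>b a. ?V b (Suc a))"
        using that Suc by (subst detf_ones_column) (auto simp: Y0')
      also have "\<dots> = detf q (\<lambda>b a. if a = 0 then ?V b (Suc a) else ?V b (Suc a) - ?V b (Suc (a - 1)))"
        by (rule detf_column_differences[symmetric])
      also have "\<dots> = detf q (\<lambda>b a. Z a (j + b))"
        using that Suc by (intro detf_cong) (auto simp: Z_def Y0')
      also have "\<dots> = detf q (\<lambda>a b. Z a (j + b))"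
        by (rule detf_transpose)
      finally show ?thesis .
    qed
    have "totally_positive n m' Z"
      by (rule Suc.IH) (use Z1 Z2 in auto)
    then have Zpos: "detf q (\<lambda>a b. Z (I a) (J b)) > 0" if "increasing q n I" "increasing q m' J" for q I J
      using that by (auto simp: totally_positive_def)
    define R where "R = (\<lambda>s j. \<Sum>t\<le>j. Z' s t)"
    have RY: "Y i j = (\<Sum>s\<le>i. R s j)" if "i < Suc n" "j < m" for i j
      using that
    proof (induction i arbitrary: j)
      case 0
      have "R 0 j = (\<Sum>t\<le>j. if t = 0 then 1 else 0)"
        unfolding R_def by (rule sum.cong) (auto simp: Z'_def)
      then show ?case using 0 by (simp add: Y0')
    next
      case (Suc i)
      have "R (Suc i) j = Y (Suc i) j - Y i j" if "j < m" for j
        using that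
      proof (induction j)
        case 0
        then show ?case using Suc.prems by (simp add: R_def Z'_def Y0)
      next
        case (Suc j)
        have "R (Suc i) (Suc j) = R (Suc i) j + Z i j" by (simp add: R_def Z'_def)
        then show ?case using Suc by (simp add: Z_def)
      qed
      then show ?case using Suc by simp
    qed
    have Z'pos: "detf q (\<lambda>a b. Z' (s a) (t b)) \<ge> 0 \<and>
        (0 < q \<longrightarrow> s 0 = 0 \<longrightarrow> t 0 = 0 \<longrightarrow> detf q (\<lambda>a b. Z' (s a) (t b)) > 0)"
      if s: "increasing q (Suc n) s" and t: "increasing q m t" for q s t
    proof (cases q)
      case (Suc q')
      have s_pos: "s a > 0" if "0 < a" "a < q" for a using s that by (force simp: increasing_def)
      have t_pos: "t a > 0" if "0 < a" "a < q" for a using t that by (force simp: increasing_def)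
      show ?thesis
      proof (cases "s 0 = 0")
        case s0: True
        show ?thesis
        proof (cases "t 0 = 0")
          case True
          have "detf q (\<lambda>a b. Z' (s a) (t b)) =
              detf q' (\<lambda>a b. Z' (s (Suc a)) (t (Suc b)))"
            unfolding Suc using s0 True s_pos Suc by (subst detf_first_column) (auto simp: Z'_def)
          also have "\<dots> = detf q' (\<lambda>a b. Z (s (Suc a) - 1) (t (Suc b) - 1))"
          proof (rule detf_cong)
            fix a b assume "a < q'" "b < q'"
            then have "s (Suc a) > 0" "t (Suc b) > 0" using s_pos t_pos Suc by auto
            then show "Z' (s (Suc a)) (t (Suc b)) = Z (s (Suc a) - 1) (t (Suc b) - 1)"
              by (simp add: Z'_def)
          qed
          also have "\<dots> > 0"
          proof (rule Zpos)
            show "increasing q' n (\<lambda>a. s (Suc a) - 1)"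
              unfolding increasing_def
            proof (intro conjI allI impI)
              show "s (Suc a) - 1 < n" if "a < q'" for a
              proof -
                have "s (Suc a) < Suc n" "s (Suc a) > 0"
                  using s s_pos[of "Suc a"] that Suc by (auto simp: increasing_def)
                then show ?thesis by simp
              qed
              show "s (Suc a) - 1 < s (Suc b) - 1" if "a < b" "b < q'" for a b
              proof -
                have "s (Suc a) < s (Suc b)" "s (Suc a) > 0"
                  using s s_pos[of "Suc a"] that Suc by (auto simp: increasing_def)
                then show ?thesis by simp
              qed
            qed
            show "increasing q' m' (\<lambda>a. t (Suc a) - 1)"
              unfolding increasing_def
            proof (intro conjI allI impI)
              show "t (Suc a) - 1 < m'" if "a < q'" for a
              proof -
                have "t (Suc a) < m" "t (Suc a) > 0"
                  using t t_pos[of "Suc a"] that Suc by (auto simp: increasing_def)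
                then show ?thesis using \<open>m = Suc m'\<close> by simp
              qed
              show "t (Suc a) - 1 < t (Suc b) - 1" if "a < b" "b < q'" for a b
              proof -
                have "t (Suc a) < t (Suc b)" "t (Suc a) > 0"
                  using t t_pos[of "Suc a"] that Suc by (auto simp: increasing_def)
                then show ?thesis by simp
              qed
            qed
          qed
          finally show ?thesis by simp
        next
          case False
          have "detf q (\<lambda>a b. Z' (s a) (t b)) = 0"
          proof (rule detf_zero_row)
            show "0 < q" using Suc by simp
            show "Z' (s 0) (t b) = 0" if "b < q" for b
              using False s0 t_pos[of b] that by (cases "b = 0") (auto simp: Z'_def)
          qed
          then show ?thesis using False by simp
        qed
      next
        case s0: False
        then have s_pos: "s a > 0" if "a < q" for a using s_pos[of a] that by (cases "a = 0") auto
        show ?thesis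
        proof (cases "t 0 = 0")
          case True
          have "detf q (\<lambda>a b. Z' (s b) (t a)) = 0"
          proof (rule detf_zero_row)
            show "0 < q" using Suc by simp
            show "Z' (s b) (t 0) = 0" if "b < q" for b
              using True s_pos[of b] that by (auto simp: Z'_def)
          qed
          then show ?thesis using s0 detf_transpose[of q "\<lambda>a b. Z' (s a) (t b)"] by simp
        next
          case False
          then have t_pos: "t a > 0" if "a < q" for a using t_pos[of a] that by (cases "a = 0") auto
          have "detf q (\<lambda>a b. Z' (s a) (t b)) = detf q (\<lambda>a b. Z (s a - 1) (t b - 1))"
          proof (rule detf_cong)
            fix a b assume "a < q" "b < q"
            then have "s a > 0" "t b > 0" using s_pos t_pos by auto
            then show "Z' (s a) (t b) = Z (s a - 1) (t b - 1)" by (simp add: Z'_def)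
          qed
          also have "\<dots> > 0"
          proof (rule Zpos)
            show "increasing q n (\<lambda>a. s a - 1)"
              unfolding increasing_def
            proof (intro conjI allI impI)
              show "s a - 1 < n" if "a < q" for a
              proof -
                have "s a < Suc n" "s a > 0"
                  using s s_pos[of a] that by (auto simp: increasing_def)
                then show ?thesis by simp
              qed
              show "s a - 1 < s b - 1" if "a < b" "b < q" for a b
              proof -
                have "s a < s b" "s a > 0"
                  using s s_pos[of a] that by (auto simp: increasing_def)
                then show ?thesis by simp
              qed
            qed
            show "increasing q m' (\<lambda>a. t a - 1)"
              unfolding increasing_def
            proof (intro conjI allI impI)
              show "t a - 1 < m'" if "a < q" for a
              proof -
                have "t a < m" "t a > 0"
                  using t t_pos[of a] that by (auto simp: increasing_def)
                then show ?thesis using \<open>m = Suc m'\<close> by simp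
              qed
              show "t a - 1 < t b - 1" if "a < b" "b < q" for a b
              proof -
                have "t a < t b" "t a > 0"
                  using t t_pos[of a] that by (auto simp: increasing_def)
                then show ?thesis by simp
              qed
            qed
          qed
          finally show ?thesis using s0 by simp
        qed
      qed
    qed simp
    have Rpos: "detf q (\<lambda>a b. R (s a) (J b)) \<ge> 0 \<and>
        (0 < q \<longrightarrow> s 0 = 0 \<longrightarrow> detf q (\<lambda>a b. R (s a) (J b)) > 0)"
      if s: "increasing q (Suc n) s" and J: "increasing q m J" for q s J
    proof -
      let ?S = "\<lambda>b. if b = 0 then {..J b} else {J (b - 1)<..J b}"
      let ?F = "\<lambda>b a. if b = 0 then R (s a) (J b) else R (s a) (J b) - R (s a) (J (b - 1))"
      have "detf q (\<lambda>a b. R (s a) (J b)) = detf q (\<lambda>b a. R (s a) (J b))"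
        by (rule detf_transpose[symmetric])
      also have "\<dots> = detf q ?F"
        by (rule detf_row_differences[symmetric])
      finally have eq: "detf q (\<lambda>a b. R (s a) (J b)) = detf q ?F" .
      have F: "?F b a = (\<Sum>t\<in>?S b. 1 * Z' (s a) t)" if "b < q" for a b
        using that by (intro increasing_gaps_sum[OF _ J]) (auto simp: R_def)
      have t: "increasing q m f" if "\<And>b. b < q \<Longrightarrow> f b \<in> ?S b" for f
        using increasing_gaps_choice[OF J, of f] that by auto
      have tr: "detf q (\<lambda>b a. Z' (s a) (f b)) = detf q (\<lambda>a b. Z' (s a) (f b))" for f
        by (rule detf_transpose)
      have "detf q ?F = (\<Sum>f\<in>Pi\<^sub>E {..<q} ?S. (\<Prod>b<q. 1) * detf q (\<lambda>b a. Z' (s a) (f b)))"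
        by (rule detf_expand_rows) (use F in auto)
      also have "\<dots> \<ge> 0"
        unfolding tr using Z'pos[OF s t] by (intro sum_nonneg) (auto simp: PiE_iff)
      finally have "detf q ?F \<ge> 0" .
      moreover have "detf q ?F > 0" if "0 < q" "s 0 = 0"
      proof (rule detf_expand_rows_pos[where S = ?S and G = "\<lambda>b t a. Z' (s a) t" and c = "\<lambda>_ _. 1"
            and f\<^sub>0 = "\<lambda>b. if b = 0 then 0 else J b"])
        have in_S: "(if b = 0 then 0 else J b) \<in> ?S b" if "b < q" for b
          using J that by (auto simp: increasing_def)
        show "\<And>b. b < q \<Longrightarrow> (if b = 0 then 0 else J b) \<in> ?S b \<and> (0::real) < 1"
          using in_S by auto
        show "0 < detf q (\<lambda>b a. Z' (s a) (if b = 0 then 0 else J b))"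
          unfolding tr using Z'pos[OF s t[of "\<lambda>b. if b = 0 then 0 else J b", OF in_S]] that by auto
        show "0 \<le> detf q (\<lambda>b a. Z' (s a) (f b))" if "\<And>b. b < q \<Longrightarrow> f b \<in> ?S b" for f
          unfolding tr using Z'pos[OF s t[of f, OF that]] by auto
      qed (use F in auto)
      ultimately show ?thesis using eq by simp
    qed
    have "detf q (\<lambda>a b. Y (I a) (J b)) > 0"
      if I: "increasing q (Suc n) I" and J: "increasing q m J" for q I J
    proof (cases "q = 0")
      case False
      let ?S = "\<lambda>b. if b = 0 then {..I b} else {I (b - 1)<..I b}"
      let ?F = "\<lambda>a b. if a = 0 then Y (I a) (J b) else Y (I a) (J b) - Y (I (a - 1)) (J b)"
      have eq: "detf q (\<lambda>a b. Y (I a) (J b)) = detf q ?F"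
        by (rule detf_row_differences[symmetric])
      have F: "?F a b = (\<Sum>s\<in>?S a. 1 * R s (J b))" if "a < q" "b < q" for a b
        using that J by (intro increasing_gaps_sum[OF _ I]) (auto simp: increasing_def intro!: RY)
      have s: "increasing q (Suc n) f" if "\<And>b. b < q \<Longrightarrow> f b \<in> ?S b" for f
        using increasing_gaps_choice[OF I, of f] that by auto
      have "detf q ?F > 0"
      proof (rule detf_expand_rows_pos[where S = ?S and G = "\<lambda>a s b. R s (J b)" and c = "\<lambda>_ _. 1"
            and f\<^sub>0 = "\<lambda>b. if b = 0 then 0 else I b"])
        have in_S: "(if b = 0 then 0 else I b) \<in> ?S b" if "b < q" for b
          using I that by (auto simp: increasing_def)
        show "\<And>b. b < q \<Longrightarrow> (if b = 0 then 0 else I b) \<in> ?S b \<and> (0::real) < 1"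
          using in_S by auto
        show "0 < detf q (\<lambda>a b. R (if a = 0 then 0 else I a) (J b))"
          using Rpos[OF s[of "\<lambda>b. if b = 0 then 0 else I b", OF in_S] J] False by auto
        show "0 \<le> detf q (\<lambda>a b. R (f a) (J b))" if "\<And>b. b < q \<Longrightarrow> f b \<in> ?S b" for f
          using Rpos[OF s[of f, OF that] J] by auto
      qed (use F in auto)
      then show ?thesis using eq by simp
    qed simp
    then show ?thesis
      unfolding totally_positive_def using Y by (auto simp: increasing_def)
  qed
qed


section \<open>Pluecker coordinates and the Cauchy--Binet formula\<close>

definition subsets :: "nat \<Rightarrow> nat \<Rightarrow> (nat \<Rightarrow> nat) set" where
  "subsets q n = {I \<in> {..<q} \<rightarrow>\<^sub>E {..<n}. increasing q n I}"

lemma finite_subsets [simp]: "finite (subsets q n)"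
  unfolding subsets_def by (rule finite_subset[of _ "{..<q} \<rightarrow>\<^sub>E {..<n}"]) (auto intro: finite_PiE)

lemma subsetsD: "I \<in> subsets q n \<Longrightarrow> increasing q n I"
  by (simp add: subsets_def)

lemma increasing_inj: "increasing q n I \<Longrightarrow> inj_on I {..<q}"
  by (rule linorder_inj_onI) (auto simp: increasing_def dest: less_imp_neq)

lemma restrict_in_subsets: "increasing q n I \<Longrightarrow> restrict I {..<q} \<in> subsets q n"
  by (auto simp: subsets_def increasing_def)

lemma increasing_id: "q \<le> n \<Longrightarrow> increasing q n (\<lambda>a. a)"
  by (auto simp: increasing_def)

lemma subsets_eq_if_image_eq:
  assumes "I \<in> subsets q n" "J \<in> subsets q n" "I ` {..<q} = J ` {..<q}"
  shows "I = J"
proof -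
  have s: "sorted_wrt (<) (map I [0..<q])" if "I \<in> subsets q n" for I
    using subsetsD[OF that] by (auto simp: sorted_wrt_iff_nth_less increasing_def)
  have "map I [0..<q] = map J [0..<q]"
    by (rule strict_sorted_equal) (use s assms in \<open>auto simp: atLeast0LessThan\<close>)
  then have "I a = J a" if "a < q" for a using that by auto
  moreover have "I a = J a" if "\<not> a < q" for a
    using that assms(1,2) by (auto simp: subsets_def PiE_iff extensional_def)
  ultimately show ?thesis by blast
qed

lemma detf_permute_rows:
  assumes "\<pi> permutes {..<q}"
  shows "detf q (\<lambda>a. F (\<pi> a)) = of_int (sign \<pi>) * detf q F"
proof -
  have \<pi>: "\<pi> i < q" if "i < q" for i using permutes_in_image[OF assms, of i] that by auto
  have "detf q (\<lambda>a. F (\<pi> a)) =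
    Determinant.det (Matrix.mat q q (\<lambda>(i, j). Matrix.mat q q (\<lambda>(a, b). F a b) $$ (\<pi> i, j)))"
    unfolding detf_def by (rule arg_cong[where f = Determinant.det]) (use \<pi> in auto)
  also have "\<dots> = of_int (sign \<pi>) * detf q F"
    unfolding detf_def using assms by (subst det_permute_rows) (auto simp: atLeast0LessThan)
  finally show ?thesis .
qed

text \<open>An injective function is an increasing one composed with a permutation; this is
  the combinatorial part of the Cauchy--Binet formula.\<close>

lemma sum_injective_functions:
  fixes g :: "(nat \<Rightarrow> nat) \<Rightarrow> real"
  shows "(\<Sum>f\<in>{f \<in> {..<p} \<rightarrow>\<^sub>E {..<n}. inj_on f {..<p}}. g f) =
    (\<Sum>J\<in>subsets p n. \<Sum>\<pi> | \<pi> permutes {..<p}. g (restrict (\<lambda>a. J (\<pi> a)) {..<p}))"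
proof -
  let ?c = "\<lambda>(J, \<pi>). restrict (\<lambda>a. J (\<pi> a)) {..<p} :: nat \<Rightarrow> nat"
  let ?A = "subsets p n \<times> {\<pi>. \<pi> permutes {..<p}}"
  have \<pi>: "\<pi> i < p" if "\<pi> permutes {..<p}" "i < p" for \<pi> i
    using permutes_in_image[OF that(1), of i] that(2) by auto
  have img: "?c (J, \<pi>) ` {..<p} = J ` {..<p}" if "\<pi> permutes {..<p}" for J \<pi>
  proof -
    have "?c (J, \<pi>) ` {..<p} = J ` (\<pi> ` {..<p})" by auto
    then show ?thesis using permutes_image[OF that] by simp
  qed
  have inj: "inj_on ?c ?A"
  proof (intro inj_onI, clarify)
    fix J \<pi> J' \<pi>'
    assume *: "J \<in> subsets p n" "J' \<in> subsets p n" "\<pi> permutes {..<p}" "\<pi>' permutes {..<p}"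
      "restrict (\<lambda>a. J (\<pi> a)) {..<p} = restrict (\<lambda>a. J' (\<pi>' a)) {..<p}"
    have J: "J = J'"
      using * img[of \<pi> J] img[of \<pi>' J'] by (intro subsets_eq_if_image_eq[of J p n J']) auto
    have "\<pi> a = \<pi>' a" for a
    proof (cases "a < p")
      case True
      then have "J (\<pi> a) = J (\<pi>' a)" using *(5) J by (metis lessThan_iff restrict_apply')
      then show ?thesis
        using increasing_inj[OF subsetsD[OF *(1)]] \<pi> * True by (auto dest: inj_onD)
    next
      case False
      then show ?thesis using *(3,4) by (simp add: permutes_not_in)
    qed
    then show "J = J' \<and> \<pi> = \<pi>'" using J by blast
  qed
  have surj: "?c ` ?A = {f \<in> {..<p} \<rightarrow>\<^sub>E {..<n}. inj_on f {..<p}}"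
  proof (intro equalityI subsetI)
    fix f assume "f \<in> ?c ` ?A"
    then obtain J \<pi> where *: "J \<in> subsets p n" "\<pi> permutes {..<p}" "f = ?c (J, \<pi>)" by auto
    have "inj_on f {..<p}"
    proof (rule inj_onI)
      fix a b assume ab: "a \<in> {..<p}" "b \<in> {..<p}" "f a = f b"
      then have "J (\<pi> a) = J (\<pi> b)" using * by auto
      then have "\<pi> a = \<pi> b"
        using increasing_inj[OF subsetsD[OF *(1)]] \<pi>[OF *(2)] ab by (auto dest: inj_onD)
      then show "a = b" using permutes_inj[OF *(2)] by (auto dest: injD)
    qed
    then show "f \<in> {f \<in> {..<p} \<rightarrow>\<^sub>E {..<n}. inj_on f {..<p}}"
      using * \<pi>[OF *(2)] subsetsD[OF *(1)] by (auto simp: increasing_def)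
  next
    fix f assume f: "f \<in> {f \<in> {..<p} \<rightarrow>\<^sub>E {..<n}. inj_on f {..<p}}"
    define S where "S = f ` {..<p}"
    define L where "L = sorted_list_of_set S"
    have finS: "finite S" "card S = p" using f by (auto simp: S_def card_image)
    have L: "length L = p" "set L = S" "sorted_wrt (<) L" "distinct L"
      using finS by (auto simp: L_def)
    define J where "J = restrict (\<lambda>a. L ! a) {..<p}"
    have LS: "L ! a \<in> S" if "a < p" for a using nth_mem[of a L] that L(1,2) by simp
    have "S \<subseteq> {..<n}" using f by (auto simp: S_def)
    then have "L ! a < n" if "a < p" for a using LS[OF that] by blast
    moreover have "L ! a < L ! b" if "a < b" "b < p" for a b
      using sorted_wrt_nth_less[OF L(3)] that L(1) by simp
    ultimately have "increasing p n (\<lambda>a. L ! a)" unfolding increasing_def by blast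
    then have J: "J \<in> subsets p n" unfolding J_def by (rule restrict_in_subsets)
    have bJ: "bij_betw J {..<p} S"
      using bij_betw_nth[OF L(4), of "{..<p}" S] L by (simp add: J_def bij_betw_def inj_on_def)
    define \<pi> where "\<pi> = (\<lambda>a. if a < p then inv_into {..<p} J (f a) else a)"
    have "bij_betw (inv_into {..<p} J \<circ> f) {..<p} {..<p}"
      by (rule bij_betw_trans[OF _ bij_betw_inv_into[OF bJ]]) (use f in \<open>simp add: S_def bij_betw_def\<close>)
    then have "bij_betw \<pi> {..<p} {..<p}"
      by (subst bij_betw_cong[of _ _ "inv_into {..<p} J \<circ> f"]) (auto simp: \<pi>_def)
    then have \<pi>p: "\<pi> permutes {..<p}" by (rule bij_imp_permutes) (auto simp: \<pi>_def)
    have "?c (J, \<pi>) a = f a" for a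
    proof (cases "a < p")
      case True
      have "f a \<in> J ` {..<p}" using bJ True by (auto simp: S_def bij_betw_def)
      then show ?thesis using True by (simp add: \<pi>_def f_inv_into_f)
    next
      case False
      then show ?thesis using f by (auto simp: PiE_iff extensional_def)
    qed
    then have "?c (J, \<pi>) = f" by blast
    then show "f \<in> ?c ` ?A" using J \<pi>p by force
  qed
  have "(\<Sum>f\<in>{f \<in> {..<p} \<rightarrow>\<^sub>E {..<n}. inj_on f {..<p}}. g f) = (\<Sum>x\<in>?A. g (?c x))"
    unfolding surj[symmetric] by (simp add: sum.reindex[OF inj])
  also have "\<dots> = (\<Sum>J\<in>subsets p n. \<Sum>\<pi> | \<pi> permutes {..<p}. g (?c (J, \<pi>)))"
    by (subst sum.cartesian_product) (simp add: case_prod_unfold)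
  finally show ?thesis by simp
qed

lemma cauchy_binet:
  "detf p (\<lambda>a b. \<Sum>k<n. A a k * B k b) =
    (\<Sum>J\<in>subsets p n. detf p (\<lambda>a b. A a (J b)) * detf p (\<lambda>a. B (J a)))"
proof -
  let ?P = "{..<p} \<rightarrow>\<^sub>E {..<n}"
  let ?g = "\<lambda>f. (\<Prod>a<p. A a (f a)) * detf p (\<lambda>a. B (f a))"
  have fin: "finite ?P" by (auto intro: finite_PiE)
  have "detf p (\<lambda>a b. \<Sum>k<n. A a k * B k b) = (\<Sum>f\<in>?P. ?g f)"
    by (rule detf_expand_rows) auto
  also have "\<dots> = (\<Sum>f\<in>{f \<in> ?P. inj_on f {..<p}}. ?g f)"
  proof (rule sum.mono_neutral_right[OF fin])
    show "\<forall>f\<in>?P - {f \<in> ?P. inj_on f {..<p}}. ?g f = 0"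
    proof
      fix f assume "f \<in> ?P - {f \<in> ?P. inj_on f {..<p}}"
      then obtain i j where "i < p" "j < p" "i \<noteq> j" "f i = f j" by (auto simp: inj_on_def)
      then have "detf p (\<lambda>a. B (f a)) = 0" by (intro detf_equal_rows[of i _ j]) auto
      then show "?g f = 0" by simp
    qed
  qed auto
  also have "\<dots> = (\<Sum>J\<in>subsets p n. \<Sum>\<pi> | \<pi> permutes {..<p}. ?g (restrict (\<lambda>a. J (\<pi> a)) {..<p}))"
    by (rule sum_injective_functions)
  also have "\<dots> = (\<Sum>J\<in>subsets p n. detf p (\<lambda>a b. A a (J b)) * detf p (\<lambda>a. B (J a)))"
  proof (rule sum.cong[OF refl])
    fix J
    have "?g (restrict (\<lambda>a. J (\<pi> a)) {..<p}) =
        of_int (sign \<pi>) * (\<Prod>a<p. A a (J (\<pi> a))) * detf p (\<lambda>a. B (J a))"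
      if "\<pi> permutes {..<p}" for \<pi>
    proof -
      have "detf p (\<lambda>a. B (restrict (\<lambda>a. J (\<pi> a)) {..<p} a)) = detf p (\<lambda>a. (\<lambda>a. B (J a)) (\<pi> a))"
        by (rule detf_cong) auto
      also have "\<dots> = of_int (sign \<pi>) * detf p (\<lambda>a. B (J a))"
        using that by (rule detf_permute_rows)
      finally show ?thesis by simp
    qed
    then show "(\<Sum>\<pi> | \<pi> permutes {..<p}. ?g (restrict (\<lambda>a. J (\<pi> a)) {..<p})) =
        detf p (\<lambda>a b. A a (J b)) * detf p (\<lambda>a. B (J a))"
      unfolding detf_leibniz[of p "\<lambda>a b. A a (J b)"] sum_distrib_right
      by (intro sum.cong) auto
  qed
  finally show ?thesis .
qed

text \<open>The Pluecker coordinates of the span of the first \<open>p\<close> columns of an array.\<close>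

definition plucker :: "nat \<Rightarrow> (nat \<Rightarrow> nat \<Rightarrow> real) \<Rightarrow> (nat \<Rightarrow> nat) \<Rightarrow> real" where
  "plucker p X I = detf p (\<lambda>a. X (I a))"

definition mmult :: "nat \<Rightarrow> (nat \<Rightarrow> nat \<Rightarrow> real) \<Rightarrow> (nat \<Rightarrow> nat \<Rightarrow> real) \<Rightarrow> nat \<Rightarrow> nat \<Rightarrow> real" where
  "mmult n A B = (\<lambda>i j. \<Sum>k<n. A i k * B k j)"

text \<open>The Cauchy--Binet formula says that an array acts on the Pluecker coordinates of degree \<open>p\<close> by
  its compound array, whose entries are the minors of size \<open>p\<close>.\<close>

lemma plucker_mmult:
  "plucker p (mmult n T X) I =
    (\<Sum>J\<in>subsets p n. detf p (\<lambda>a b. T (I a) (J b)) * plucker p X J)"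
  unfolding plucker_def mmult_def by (rule cauchy_binet)

lemma plucker_cong:
  assumes "\<And>i j. i < n \<Longrightarrow> j < p \<Longrightarrow> X i j = Y i j" "increasing p n I"
  shows "plucker p X I = plucker p Y I"
  unfolding plucker_def using assms by (intro detf_cong) (auto simp: increasing_def)

lemma plucker_restrict: "plucker p X (restrict I {..<p}) = plucker p X I"
  unfolding plucker_def by (rule detf_cong) auto


section \<open>Contraction by positive matrices\<close>

text \<open>One step of the contraction in Hilbert's projective metric. The nonnegative vectors \<open>x - l y\<close> and
  \<open>u y - x\<close> have images that dominate a definite multiple of the image of \<open>y\<close>, since the entries
  of \<open>M\<close> lie between two positive bounds; this moves both bounds inwards.\<close>

lemma birkhoff_step:
  fixes M :: "'i \<Rightarrow> 'i \<Rightarrow> real"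
  assumes fin: "finite S" and M: "\<And>i j. i \<in> S \<Longrightarrow> j \<in> S \<Longrightarrow> \<kappa> \<le> M i j \<and> M i j \<le> \<kappa>'" and \<kappa>: "0 < \<kappa>" "\<kappa> \<le> \<kappa>'"
    and y: "\<And>j. j \<in> S \<Longrightarrow> y j \<ge> 0" "sum y S > 0"
    and xy: "\<And>j. j \<in> S \<Longrightarrow> l * y j \<le> x j \<and> x j \<le> u * y j"
  obtains l' u' where "l \<le> l'" "u' \<le> u" "u' - l' = (1 - \<kappa> / \<kappa>') * (u - l)"
    "\<And>i. i \<in> S \<Longrightarrow> l' * (\<Sum>j\<in>S. M i j * y j) \<le> (\<Sum>j\<in>S. M i j * x j) \<and>
       (\<Sum>j\<in>S. M i j * x j) \<le> u' * (\<Sum>j\<in>S. M i j * y j)"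
proof -
  define s where "s = sum y S"
  define v where "v = (\<Sum>j\<in>S. x j - l * y j)"
  define w where "w = (\<Sum>j\<in>S. u * y j - x j)"
  let ?\<theta> = "\<kappa> / \<kappa>'"
  have s: "s > 0" and v: "v \<ge> 0" and w: "w \<ge> 0"
    using y xy by (auto simp: s_def v_def w_def intro!: sum_nonneg)
  have vw: "v + w = (u - l) * s"
    by (simp add: v_def w_def s_def sum.distrib[symmetric] sum_distrib_left algebra_simps)
  have key: "?\<theta> * (\<Sum>j\<in>S. z j) / s * (\<Sum>j\<in>S. M i j * y j) \<le> (\<Sum>j\<in>S. M i j * z j)"
    if i: "i \<in> S" and z: "\<And>j. j \<in> S \<Longrightarrow> z j \<ge> 0" for i z
  proof -
    have "(\<Sum>j\<in>S. M i j * y j) \<le> (\<Sum>j\<in>S. \<kappa>' * y j)"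
      using M[OF i] y by (intro sum_mono mult_right_mono) auto
    then have "(\<Sum>j\<in>S. M i j * y j) \<le> \<kappa>' * s" by (simp add: s_def sum_distrib_left)
    then have "?\<theta> * (\<Sum>j\<in>S. z j) / s * (\<Sum>j\<in>S. M i j * y j) \<le> ?\<theta> * (\<Sum>j\<in>S. z j) / s * (\<kappa>' * s)"
      using \<kappa> s z by (intro mult_left_mono) (auto intro!: mult_nonneg_nonneg divide_nonneg_nonneg sum_nonneg)
    also have "\<dots> = \<kappa> * (\<Sum>j\<in>S. z j)" using \<kappa> s by simp
    also have "\<dots> = (\<Sum>j\<in>S. \<kappa> * z j)" by (rule sum_distrib_left)
    also have "\<dots> \<le> (\<Sum>j\<in>S. M i j * z j)"
      using M[OF i] z by (intro sum_mono mult_right_mono) auto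
    finally show ?thesis .
  qed
  show ?thesis
  proof
    show "l \<le> l + ?\<theta> * v / s" "u - ?\<theta> * w / s \<le> u"
      using \<kappa> s v w by (auto intro!: divide_nonneg_nonneg mult_nonneg_nonneg)
    have "(u - ?\<theta> * w / s) - (l + ?\<theta> * v / s) = (u - l) - ?\<theta> * ((v + w) / s)"
      using s \<kappa> by (simp add: field_simps)
    also have "(v + w) / s = u - l" using vw s by simp
    finally show "(u - ?\<theta> * w / s) - (l + ?\<theta> * v / s) = (1 - ?\<theta>) * (u - l)"
      by (simp add: algebra_simps)
    fix i assume i: "i \<in> S"
    have 1: "?\<theta> * v / s * (\<Sum>j\<in>S. M i j * y j) \<le> (\<Sum>j\<in>S. M i j * (x j - l * y j))"
      unfolding v_def by (rule key[OF i]) (use xy in auto)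
    have 2: "?\<theta> * w / s * (\<Sum>j\<in>S. M i j * y j) \<le> (\<Sum>j\<in>S. M i j * (u * y j - x j))"
      unfolding w_def by (rule key[OF i]) (use xy in auto)
    have 3: "(\<Sum>j\<in>S. M i j * (x j - l * y j)) = (\<Sum>j\<in>S. M i j * x j) - l * (\<Sum>j\<in>S. M i j * y j)"
      "(\<Sum>j\<in>S. M i j * (u * y j - x j)) = u * (\<Sum>j\<in>S. M i j * y j) - (\<Sum>j\<in>S. M i j * x j)"
      by (simp_all add: sum_subtractf sum_distrib_left algebra_simps)
    show "(l + ?\<theta> * v / s) * (\<Sum>j\<in>S. M i j * y j) \<le> (\<Sum>j\<in>S. M i j * x j) \<and>
       (\<Sum>j\<in>S. M i j * x j) \<le> (u - ?\<theta> * w / s) * (\<Sum>j\<in>S. M i j * y j)"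
      using 1 2 unfolding 3 by (simp only: distrib_right left_diff_distrib) linarith
  qed
qed

text \<open>Iterating the contraction. After the step from \<open>Suc N\<close> to \<open>N\<close> all ratios of entries of \<open>x\<close> and \<open>y\<close>
  lie between \<open>\<theta> r\<close> and \<open>r / \<theta>\<close>, where \<open>r\<close> is the quotient of the sums and \<open>\<theta> = \<kappa> / \<kappa>'\<close>;
  this is why the estimate is uniform in \<open>x\<close> and \<open>y\<close>.\<close>

lemma birkhoff_chain:
  fixes M :: "nat \<Rightarrow> 'i \<Rightarrow> 'i \<Rightarrow> real"
  assumes fin: "finite S"
    and M: "\<And>t i j. i \<in> S \<Longrightarrow> j \<in> S \<Longrightarrow> \<kappa> \<le> M t i j \<and> M t i j \<le> \<kappa>'" and \<kappa>: "0 < \<kappa>" "\<kappa> \<le> \<kappa>'"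
    and x: "\<And>t i. t \<le> N \<Longrightarrow> i \<in> S \<Longrightarrow> x t i = (\<Sum>j\<in>S. M t i j * x (Suc t) j)"
    and y: "\<And>t i. t \<le> N \<Longrightarrow> i \<in> S \<Longrightarrow> y t i = (\<Sum>j\<in>S. M t i j * y (Suc t) j)"
    and x0: "\<And>i. i \<in> S \<Longrightarrow> x (Suc N) i \<ge> 0" "sum (x (Suc N)) S > 0"
    and y0: "\<And>i. i \<in> S \<Longrightarrow> y (Suc N) i \<ge> 0" "sum (y (Suc N)) S > 0"
  obtains l where "l > 0"
    "\<And>i. i \<in> S \<Longrightarrow> l * y 0 i \<le> x 0 i \<and> x 0 i \<le> l * (1 + (1 - \<kappa> / \<kappa>') ^ N / (\<kappa> / \<kappa>')\<^sup>2) * y 0 i"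
proof -
  let ?\<theta> = "\<kappa> / \<kappa>'"
  define r where "r = sum (x (Suc N)) S / sum (y (Suc N)) S"
  have \<theta>: "0 < ?\<theta>" "?\<theta> \<le> 1" using \<kappa> by auto
  have r: "r > 0" using x0 y0 by (simp add: r_def)
  have pos: "(\<forall>i\<in>S. y t i \<ge> 0) \<and> sum (y t) S > 0" if "t \<le> Suc N" for t
    using that
  proof (induction "Suc N - t" arbitrary: t)
    case 0
    then show ?case using y0 by auto
  next
    case (Suc d)
    then have t: "t \<le> N" and IH: "\<forall>i\<in>S. y (Suc t) i \<ge> 0" "sum (y (Suc t)) S > 0" by auto
    have ge: "y t i \<ge> \<kappa> * sum (y (Suc t)) S" if "i \<in> S" for i
      unfolding y[OF t that] sum_distrib_left using IH M that by (intro sum_mono mult_right_mono) auto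
    have gt: "y t i > 0" if "i \<in> S" for i
      using ge[OF that] mult_pos_pos[OF \<kappa>(1) IH(2)] by linarith
    have "S \<noteq> {}" using IH by auto
    then show ?case using gt fin by (intro conjI ballI sum_pos) (auto intro: less_imp_le)
  qed
  have "\<exists>l u. ?\<theta> * r \<le> l \<and> u \<le> r / ?\<theta> \<and> u - l \<le> (1 - ?\<theta>) ^ d * (r / ?\<theta>) \<and>
      (\<forall>i\<in>S. l * y (N - d) i \<le> x (N - d) i \<and> x (N - d) i \<le> u * y (N - d) i)" if "d \<le> N" for d
    using that
  proof (induction d)
    case 0
    have "?\<theta> * r * y N i \<le> x N i \<and> x N i \<le> r / ?\<theta> * y N i" if i: "i \<in> S" for i
    proof -
      have b: "\<kappa> * sum (z (Suc N)) S \<le> z N i \<and> z N i \<le> \<kappa>' * sum (z (Suc N)) S"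
        if "\<And>i. i \<in> S \<Longrightarrow> z N i = (\<Sum>j\<in>S. M N i j * z (Suc N) j)" "\<And>i. i \<in> S \<Longrightarrow> z (Suc N) i \<ge> 0" for z
        unfolding that(1)[OF i] sum_distrib_left using that(2) M[OF i]
        by (intro conjI sum_mono mult_right_mono) auto
      have bx: "\<kappa> * sum (x (Suc N)) S \<le> x N i" "x N i \<le> \<kappa>' * sum (x (Suc N)) S"
        using b[of x] x x0 by auto
      have by': "\<kappa> * sum (y (Suc N)) S \<le> y N i" "y N i \<le> \<kappa>' * sum (y (Suc N)) S"
        using b[of y] y y0 by auto
      have "?\<theta> * r * y N i \<le> ?\<theta> * r * (\<kappa>' * sum (y (Suc N)) S)"
        by (intro mult_left_mono by' less_imp_le[OF mult_pos_pos[OF \<theta>(1) r]])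
      also have "\<dots> = \<kappa> * sum (x (Suc N)) S" using \<kappa> y0 by (simp add: r_def)
      finally have 1: "?\<theta> * r * y N i \<le> x N i" using bx by linarith
      have "\<kappa>' * sum (x (Suc N)) S = r / ?\<theta> * (\<kappa> * sum (y (Suc N)) S)" using \<kappa> y0 by (simp add: r_def)
      also have "\<dots> \<le> r / ?\<theta> * y N i"
        by (intro mult_left_mono by' less_imp_le[OF divide_pos_pos[OF r \<theta>(1)]])
      finally show ?thesis using 1 bx by linarith
    qed
    moreover have "r / ?\<theta> - ?\<theta> * r \<le> r / ?\<theta>" using mult_pos_pos[OF \<theta>(1) r] by linarith
    ultimately show ?case by (intro exI[of _ "?\<theta> * r"] exI[of _ "r / ?\<theta>"]) simp
  next
    case (Suc d)
    then obtain l u where lu: "?\<theta> * r \<le> l" "u \<le> r / ?\<theta>" "u - l \<le> (1 - ?\<theta>) ^ d * (r / ?\<theta>)"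
      "\<And>i. i \<in> S \<Longrightarrow> l * y (N - d) i \<le> x (N - d) i \<and> x (N - d) i \<le> u * y (N - d) i" by auto
    have N: "Suc (N - Suc d) = N - d" using Suc.prems by simp
    obtain l' u' where l': "l \<le> l'" "u' \<le> u" "u' - l' = (1 - ?\<theta>) * (u - l)"
      "\<And>i. i \<in> S \<Longrightarrow> l' * (\<Sum>j\<in>S. M (N - Suc d) i j * y (N - d) j) \<le> (\<Sum>j\<in>S. M (N - Suc d) i j * x (N - d) j) \<and>
       (\<Sum>j\<in>S. M (N - Suc d) i j * x (N - d) j) \<le> u' * (\<Sum>j\<in>S. M (N - Suc d) i j * y (N - d) j)"
      by (rule birkhoff_step[where M = "M (N - Suc d)" and y = "y (N - d)" and l = l and x = "x (N - d)" and u = u,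
            OF fin M \<kappa>])
        (use pos[of "N - d"] lu(4) in auto)
    have "u' - l' \<le> (1 - ?\<theta>) * ((1 - ?\<theta>) ^ d * (r / ?\<theta>))"
      unfolding l'(3) using \<theta> lu(3) by (intro mult_left_mono) auto
    then show ?case
      using lu l' x[of "N - Suc d"] y[of "N - Suc d"] N
      by (intro exI[of _ l'] exI[of _ u']) (auto simp: mult.assoc)
  qed
  from this[of N] obtain l u where lu: "?\<theta> * r \<le> l" "u - l \<le> (1 - ?\<theta>) ^ N * (r / ?\<theta>)"
      "\<And>i. i \<in> S \<Longrightarrow> l * y 0 i \<le> x 0 i \<and> x 0 i \<le> u * y 0 i" by auto
  have l: "l > 0" using lu(1) \<theta> r mult_pos_pos[OF \<theta>(1) r] by linarith
  have "(1 - ?\<theta>) ^ N * (r / ?\<theta>) = (1 - ?\<theta>) ^ N / ?\<theta>\<^sup>2 * (?\<theta> * r)"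
    using \<theta> \<kappa> by (simp add: power2_eq_square field_simps)
  also have "\<dots> \<le> (1 - ?\<theta>) ^ N / ?\<theta>\<^sup>2 * l"
    using lu(1) \<theta> by (intro mult_left_mono) auto
  finally have u: "u \<le> l * (1 + (1 - ?\<theta>) ^ N / ?\<theta>\<^sup>2)" using lu(2) by (simp add: algebra_simps)
  show ?thesis
  proof (rule that[OF l])
    fix i assume i: "i \<in> S"
    have "u * y 0 i \<le> l * (1 + (1 - ?\<theta>) ^ N / ?\<theta>\<^sup>2) * y 0 i"
      using u pos[of 0] i by (intro mult_right_mono) auto
    then show "l * y 0 i \<le> x 0 i \<and> x 0 i \<le> l * (1 + (1 - ?\<theta>) ^ N / ?\<theta>\<^sup>2) * y 0 i"
      using lu(3)[OF i] by linarith
  qed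
qed


section \<open>Sign changes and variation diminution\<close>

definition sign_changes :: "nat \<Rightarrow> (nat \<Rightarrow> bool) \<Rightarrow> nat" where
  "sign_changes n \<sigma> = card {i. Suc i < n \<and> \<sigma> i \<noteq> \<sigma> (Suc i)}"

text \<open>A choice \<open>\<sigma>\<close> of signs is compatible with a vector if it agrees with the signs of the nonzero
  entries; a zero entry admits both signs.\<close>

definition signs_of :: "nat \<Rightarrow> (nat \<Rightarrow> bool) \<Rightarrow> (nat \<Rightarrow> real) \<Rightarrow> bool" where
  "signs_of n \<sigma> y \<longleftrightarrow> (\<forall>i<n. if \<sigma> i then y i \<ge> 0 else y i \<le> 0)"

lemma sign_changes_cong: "(\<And>i. i < n \<Longrightarrow> \<sigma> i = \<tau> i) \<Longrightarrow> sign_changes n \<sigma> = sign_changes n \<tau>"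
  unfolding sign_changes_def by (rule arg_cong[where f = card]) auto

text \<open>Multiplication by alternating signs exchanges changes and non-changes.\<close>

lemma sign_changes_alternate: "sign_changes n \<sigma> + sign_changes n (\<lambda>i. \<sigma> i \<noteq> even i) = n - 1"
proof -
  let ?A = "{i. Suc i < n \<and> \<sigma> i \<noteq> \<sigma> (Suc i)}" and ?B = "{i. Suc i < n \<and> \<sigma> i = \<sigma> (Suc i)}"
  have fin: "finite ?A" "finite ?B" by (auto intro: finite_subset[of _ "{..<n}"])
  have "card ?A + card ?B = card (?A \<union> ?B)" using fin by (intro card_Un_disjoint[symmetric]) auto
  also have "?A \<union> ?B = {..<n - 1}" by auto
  finally have "card ?A + card ?B = n - 1" by simp
  moreover have "?B = {i. Suc i < n \<and> (\<sigma> i \<noteq> even i) \<noteq> (\<sigma> (Suc i) \<noteq> even (Suc i))}" by auto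
  ultimately show ?thesis unfolding sign_changes_def by simp
qed

lemma sign_changes_reverse: "sign_changes n (\<lambda>i. \<sigma> (n - 1 - i)) = sign_changes n \<sigma>"
proof -
  have "bij_betw (\<lambda>i. n - 2 - i) {i. Suc i < n \<and> \<sigma> (n - 1 - i) \<noteq> \<sigma> (n - 1 - Suc i)}
      {i. Suc i < n \<and> \<sigma> i \<noteq> \<sigma> (Suc i)}"
    by (rule bij_betwI[of _ _ _ "\<lambda>i. n - 2 - i"])
      (auto simp: Suc_diff_Suc numeral_2_eq_2 Suc_diff_le)
  then show ?thesis unfolding sign_changes_def by (simp add: bij_betw_same_card)
qed

text \<open>The maximal intervals of constant sign, numbered from zero; \<open>block \<sigma> i\<close> is the number of the
  interval that contains \<open>i\<close>.\<close>

definition block :: "(nat \<Rightarrow> bool) \<Rightarrow> nat \<Rightarrow> nat" where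
  "block \<sigma> i = card {l. l < i \<and> \<sigma> l \<noteq> \<sigma> (Suc l)}"

lemma block_0 [simp]: "block \<sigma> 0 = 0"
  by (simp add: block_def)

lemma block_Suc: "block \<sigma> (Suc i) = block \<sigma> i + (if \<sigma> i \<noteq> \<sigma> (Suc i) then 1 else 0)"
proof -
  have "{l. l < Suc i \<and> \<sigma> l \<noteq> \<sigma> (Suc l)} =
      (if \<sigma> i \<noteq> \<sigma> (Suc i) then insert i {l. l < i \<and> \<sigma> l \<noteq> \<sigma> (Suc l)} else {l. l < i \<and> \<sigma> l \<noteq> \<sigma> (Suc l)})"
    by (auto simp: less_Suc_eq)
  then show ?thesis by (simp add: block_def)
qed

lemma block_mono: "i \<le> j \<Longrightarrow> block \<sigma> i \<le> block \<sigma> j"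
  by (induction rule: dec_induct) (auto simp: block_Suc)

lemma sign_block: "\<sigma> i \<longleftrightarrow> (\<sigma> 0 \<longleftrightarrow> even (block \<sigma> i))"
  by (induction i) (auto simp: block_Suc)

lemma block_last: "n > 0 \<Longrightarrow> block \<sigma> (n - 1) = sign_changes n \<sigma>"
  unfolding block_def sign_changes_def by (rule arg_cong[where f = card]) auto

lemma block_le: "i < n \<Longrightarrow> block \<sigma> i \<le> sign_changes n \<sigma>"
  using block_mono[of i "n - 1" \<sigma>] block_last[of n \<sigma>] by simp

lemma block_attained: "b \<le> block \<sigma> m \<Longrightarrow> \<exists>i\<le>m. block \<sigma> i = b"
proof (induction m)
  case (Suc m)
  then show ?case by (cases "b \<le> block \<sigma> m") (auto simp: block_Suc le_Suc_eq split: if_splits)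
qed simp

lemma block_attained': "n > 0 \<Longrightarrow> b \<le> sign_changes n \<sigma> \<Longrightarrow> \<exists>i<n. block \<sigma> i = b"
proof -
  assume "n > 0" "b \<le> sign_changes n \<sigma>"
  then obtain i where "i \<le> n - 1" "block \<sigma> i = b"
    using block_attained[of b \<sigma> "n - 1"] block_last[of n \<sigma>] by auto
  then show ?thesis using \<open>n > 0\<close> by (intro exI[of _ i]) auto
qed

lemma block_less_imp: "block \<sigma> i < block \<sigma> j \<Longrightarrow> i < j"
  using block_mono[of j i \<sigma>] by fastforce

lemma sign_changes_less: "n > 0 \<Longrightarrow> sign_changes n \<sigma> < n"
  using sign_changes_alternate[of n \<sigma>] by simp

text \<open>A vector with \<open>p - 1\<close> sign changes is a combination of \<open>p\<close> nonnegative vectors supported on the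
  successive blocks of constant sign. The minors of such an array are nonnegative, and a totally
  positive array makes them positive. A block on which the vector vanishes contributes the
  indicator of the block with coefficient zero, so that the number of columns stays \<open>p\<close>.\<close>

lemma block_decomposition:
  assumes y: "signs_of n \<sigma> y" "i\<^sub>0 < n" "y i\<^sub>0 \<noteq> 0" and p: "p = Suc (sign_changes n \<sigma>)"
  obtains V c where "\<And>i. i < n \<Longrightarrow> y i = (\<Sum>b<p. V i b * c b)" "\<exists>b<p. c b \<noteq> 0"
    "\<And>T I. totally_positive n n T \<Longrightarrow> increasing p n I \<Longrightarrow> plucker p (mmult n T V) I > 0"
proof -
  let ?B = "\<lambda>b. {i. i < n \<and> block \<sigma> i = b}"
  define zero where "zero b \<longleftrightarrow> (\<forall>i\<in>?B b. y i = 0)" for b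
  define V where "V = (\<lambda>i b. if block \<sigma> i = b then if zero b then 1 else \<bar>y i\<bar> else 0)"
  define c where "c = (\<lambda>b. if zero b then 0 else if \<sigma> 0 = even b then 1 else -1 :: real)"
  show ?thesis
  proof
    fix i assume i: "i < n"
    have "(\<Sum>b<p. V i b * c b) = (\<Sum>b<p. if b = block \<sigma> i then V i b * c b else 0)"
      by (rule sum.cong) (auto simp: V_def)
    also have "\<dots> = V i (block \<sigma> i) * c (block \<sigma> i)"
      using block_le[OF i, of \<sigma>] p by simp
    also have "\<dots> = y i"
    proof (cases "zero (block \<sigma> i)")
      case True
      then show ?thesis using i by (simp add: V_def c_def zero_def)
    next
      case False
      then show ?thesis
        using y(1) i sign_block[of \<sigma> i] by (auto simp: V_def c_def signs_of_def split: if_splits)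
    qed
    finally show "y i = (\<Sum>b<p. V i b * c b)" by simp
  next
    have "\<not> zero (block \<sigma> i\<^sub>0)" using y by (auto simp: zero_def)
    then have "c (block \<sigma> i\<^sub>0) \<noteq> 0" by (auto simp: c_def)
    then show "\<exists>b<p. c b \<noteq> 0" using block_le[OF y(2), of \<sigma>] p by (auto intro!: exI[of _ "block \<sigma> i\<^sub>0"])
  next
    fix T I assume T: "totally_positive n n T" and I: "increasing p n I"
    have "\<exists>i\<in>?B b. V i b > 0" if "b < p" for b
    proof (cases "zero b")
      case True
      then show ?thesis using block_attained'[of n b \<sigma>] that p y(2) by (auto simp: V_def)
    next
      case False
      then show ?thesis by (auto simp: V_def zero_def)
    qed
    then obtain f\<^sub>0 where f\<^sub>0: "\<And>b. b < p \<Longrightarrow> f\<^sub>0 b \<in> ?B b \<and> V (f\<^sub>0 b) b > 0" by metis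
    have f: "detf p (\<lambda>b a. T (I a) (f b)) > 0" if "\<And>b. b < p \<Longrightarrow> f b \<in> ?B b" for f
    proof -
      have "increasing p n f"
        using that block_less_imp[of \<sigma>] by (auto simp: increasing_def)
      then have "detf p (\<lambda>a b. T (I a) (f b)) > 0" using T I by (auto simp: totally_positive_def)
      then show ?thesis using detf_transpose[of p "\<lambda>a b. T (I a) (f b)"] by simp
    qed
    have "detf p (\<lambda>b a. mmult n T V (I a) b) > 0"
    proof (rule detf_expand_rows_pos[where S = ?B and c = "\<lambda>b k. V k b" and G = "\<lambda>b k a. T (I a) k" and f\<^sub>0 = f\<^sub>0])
      show "mmult n T V (I a) b = (\<Sum>k\<in>?B b. V k b * T (I a) k)" for a b
        unfolding mmult_def
        by (rule sum.mono_neutral_cong_right) (auto simp: V_def)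
      show "0 \<le> detf p (\<lambda>b a. T (I a) (f b))" if "\<And>b. b < p \<Longrightarrow> f b \<in> ?B b" for f
        using f[of f, OF that] by simp
      show "detf p (\<lambda>b a. T (I a) (f\<^sub>0 b)) > 0" using f\<^sub>0 by (intro f) auto
      show "\<And>a. a < p \<Longrightarrow> f\<^sub>0 a \<in> ?B a \<and> 0 < V (f\<^sub>0 a) a" by (rule f\<^sub>0)
    qed (auto simp: V_def)
    then show "plucker p (mmult n T V) I > 0"
      unfolding plucker_def using detf_transpose[of p "\<lambda>a b. mmult n T V (I a) b"] by simp
  qed
qed

lemma detf_kernel:
  assumes "detf p N \<noteq> 0" "\<And>a. a < p \<Longrightarrow> (\<Sum>b<p. N a b * c b) = 0" "b < p"
  shows "c b = 0"
proof (rule ccontr)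
  assume "c b \<noteq> 0"
  let ?A = "Matrix.mat p p (\<lambda>(a, b). N a b)" and ?v = "Matrix.vec p c"
  have "?A *\<^sub>v ?v = 0\<^sub>v p"
    by (rule eq_vecI) (use assms(2) in \<open>auto simp: scalar_prod_def atLeast0LessThan\<close>)
  moreover have "?v \<noteq> 0\<^sub>v p" using \<open>c b \<noteq> 0\<close> assms(3) by (metis index_vec index_zero_vec(1))
  ultimately have "Determinant.det ?A = 0"
    by (subst det_0_iff_vec_prod_zero_field[of _ p]) (auto intro!: exI[of _ ?v])
  then show False using assms(1) by (simp add: detf_def)
qed

lemma detf_kernel_converse:
  assumes "\<And>a. a < p \<Longrightarrow> (\<Sum>b<p. N a b * c b) = 0" "b < p" "c b \<noteq> 0"
  shows "detf p N = 0"
  using detf_kernel[of p N c b] assms by blast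

lemma detf_solve:
  assumes "detf p N \<noteq> 0"
  obtains c where "\<And>a. a < p \<Longrightarrow> (\<Sum>b<p. N a b * c b) = x a"
proof -
  let ?A = "Matrix.mat p p (\<lambda>(a, b). N a b)"
  have A: "?A \<in> carrier_mat p p" by simp
  obtain B where B: "B \<in> carrier_mat p p" "?A * B = 1\<^sub>m p"
    using det_non_zero_imp_unit[OF A, of "()"] assms unfolding detf_def Units_def by (auto simp: ring_mat_def)
  define v where "v = B *\<^sub>v Matrix.vec p x"
  have v: "v \<in> carrier_vec p" using B(1) by (simp add: v_def carrier_vecI)
  have "?A *\<^sub>v v = Matrix.vec p x"
    unfolding v_def using B A by (subst assoc_mult_mat_vec[symmetric, of _ p p _ p]) auto
  then have "row ?A a \<bullet> v = x a" if "a < p" for a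
    using that A by (metis dim_row_mat(1) index_mult_mat_vec index_vec)
  then have "(\<Sum>b<p. N a b * vec_index v b) = x a" if "a < p" for a
    using that v by (auto simp: scalar_prod_def atLeast0LessThan)
  then show ?thesis using that by blast
qed

lemma detf_laplace:
  "detf (Suc q) F = (\<Sum>a\<le>q. (-1) ^ a * F a 0 * detf q (\<lambda>i j. F (if i < a then i else Suc i) (Suc j)))"
proof -
  let ?A = "Matrix.mat (Suc q) (Suc q) (\<lambda>(a, b). F a b)"
  have "detf (Suc q) F = (\<Sum>a<Suc q. ?A $$ (a, 0) * cofactor ?A a 0)"
    unfolding detf_def by (rule laplace_expansion_column) auto
  also have "\<dots> = (\<Sum>a<Suc q. (-1) ^ a * F a 0 * detf q (\<lambda>i j. F (if i < a then i else Suc i) (Suc j)))"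
  proof (rule sum.cong[OF refl])
    fix a assume "a \<in> {..<Suc q}"
    moreover have "mat_delete ?A a 0 = Matrix.mat q q (\<lambda>(i, j). F (if i < a then i else Suc i) (Suc j))"
      by (rule eq_matI) (auto simp: mat_delete_def)
    ultimately show "?A $$ (a, 0) * cofactor ?A a 0 =
        (-1) ^ a * F a 0 * detf q (\<lambda>i j. F (if i < a then i else Suc i) (Suc j))"
      by (simp add: cofactor_def detf_def)
  qed
  finally show ?thesis by (simp add: lessThan_Suc_atMost)
qed

definition omit :: "nat \<Rightarrow> (nat \<Rightarrow> nat) \<Rightarrow> nat \<Rightarrow> nat" where
  "omit a I = (\<lambda>i. I (if i < a then i else Suc i))"

lemma increasing_omit: "increasing (Suc p) n I \<Longrightarrow> a \<le> p \<Longrightarrow> increasing p n (omit a I)"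
  by (auto simp: increasing_def omit_def)

text \<open>The coordinates of \<open>x \<and> X\<^sub>0 \<and> \<dots> \<and> X\<^bsub>p-1\<^esub>\<close>.\<close>

definition wedge :: "nat \<Rightarrow> (nat \<Rightarrow> nat \<Rightarrow> real) \<Rightarrow> (nat \<Rightarrow> real) \<Rightarrow> (nat \<Rightarrow> nat) \<Rightarrow> real" where
  "wedge p X x I = (\<Sum>a\<le>p. (-1) ^ a * x (I a) * plucker p X (omit a I))"

lemma wedge_detf: "wedge p X x I = detf (Suc p) (\<lambda>a b. if b = 0 then x (I a) else X (I a) (b - 1))"
  unfolding wedge_def plucker_def omit_def by (subst detf_laplace) simp

lemma wedge_in_span:
  assumes "\<And>a. a \<le> p \<Longrightarrow> x (I a) = (\<Sum>b<p. X (I a) b * c b)"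
  shows "wedge p X x I = 0"
  unfolding wedge_detf
proof (rule detf_kernel_converse[where c = "\<lambda>b. if b = 0 then -1 else c (b - 1)" and b = 0])
  fix a assume "a < Suc p"
  have "(\<Sum>b<Suc p. (if b = 0 then x (I a) else X (I a) (b - 1)) * (if b = 0 then - 1 else c (b - 1)))
      = - x (I a) + (\<Sum>b<p. X (I a) b * c b)"
    by (simp add: sum.lessThan_Suc_shift del: sum.lessThan_Suc)
  then show "(\<Sum>b<Suc p. (if b = 0 then x (I a) else X (I a) (b - 1)) * (if b = 0 then - 1 else c (b - 1))) = 0"
    using assms[of a] \<open>a < Suc p\<close> by simp
qed auto

text \<open>The coefficients are determined by the first \<open>p\<close> entries; the determinant of size \<open>p + 1\<close> that
  tests any further entry vanishes.\<close>

lemma in_span_if_wedge_0: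
  assumes pos: "plucker p X (\<lambda>a. a) \<noteq> 0" and 0: "\<And>I. increasing (Suc p) n I \<Longrightarrow> wedge p X x I = 0"
  obtains c where "\<And>i. i < n \<Longrightarrow> x i = (\<Sum>b<p. X i b * c b)"
proof -
  obtain c where c: "\<And>a. a < p \<Longrightarrow> (\<Sum>b<p. X a b * c b) = x a"
    using detf_solve[of p X x] pos unfolding plucker_def by blast
  define x' where "x' = (\<lambda>i. x i - (\<Sum>b<p. X i b * c b))"
  have "x' i = 0" if i: "i < n" for i
  proof (cases "i < p")
    case True
    then show ?thesis using c by (simp add: x'_def)
  next
    case False
    define I where "I = (\<lambda>a. if a < p then a else i)"
    have I: "increasing (Suc p) n I" using False i by (auto simp: increasing_def I_def)
    have "wedge p X x' I = wedge p X x I - wedge p X (\<lambda>i. \<Sum>b<p. X i b * c b) I"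
      by (simp add: wedge_def x'_def sum_subtractf algebra_simps)
    then have "wedge p X x' I = 0" using 0[OF I] wedge_in_span[of p "\<lambda>i. \<Sum>b<p. X i b * c b" I X c] by simp
    moreover have "wedge p X x' I = (\<Sum>a\<in>{p}. (-1) ^ a * x' (I a) * plucker p X (omit a I))"
      unfolding wedge_def by (rule sum.mono_neutral_right) (use c in \<open>auto simp: I_def x'_def\<close>)
    moreover have "plucker p X (omit p I) = plucker p X (\<lambda>a. a)"
      unfolding plucker_def by (rule detf_cong) (auto simp: omit_def I_def)
    ultimately show ?thesis using pos by (simp add: I_def)
  qed
  then have "x i = (\<Sum>b<p. X i b * c b)" if "i < n" for i using that by (simp add: x'_def)
  then show ?thesis using that by blast
qed

text \<open>With \<open>k\<close> changes there are \<open>k + 1\<close> entries of weakly alternating sign. The determinant formed by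
  the vector and the \<open>k\<close> columns at these indices vanishes, but in its expansion along the vector
  all terms have the same sign; so the \<open>k + 1\<close> entries vanish, and then the whole combination
  is trivial.\<close>

lemma sign_changes_in_positive_span:
  assumes N: "\<And>I. increasing k n I \<Longrightarrow> plucker k X I > 0" and k: "k \<le> n" and c: "\<exists>b<k. c b \<noteq> 0"
    and \<tau>: "signs_of n \<tau> (\<lambda>i. \<Sum>b<k. X i b * c b)"
  shows "sign_changes n \<tau> < k"
proof (rule ccontr)
  define z where "z = (\<lambda>i. \<Sum>b<k. X i b * c b)"
  assume "\<not> sign_changes n \<tau> < k"
  then have k\<tau>: "k \<le> sign_changes n \<tau>" by simp
  have "n > 0" using c k by auto
  then have "\<forall>a\<le>k. \<exists>i<n. block \<tau> i = a" using block_attained'[of n _ \<tau>] k\<tau> by auto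
  then obtain J where J: "\<And>a. a \<le> k \<Longrightarrow> J a < n \<and> block \<tau> (J a) = a" by metis
  have Jinc: "increasing (Suc k) n J"
    unfolding increasing_def using J block_less_imp[of \<tau>] by (metis less_Suc_eq_le less_imp_le_nat order_less_le_trans)
  define \<epsilon> where "\<epsilon> = (if \<tau> 0 then 1 else -1 :: real)"
  have alt: "\<epsilon> * (-1) ^ a * z (J a) \<ge> 0" if "a \<le> k" for a
    using \<tau> J[OF that] sign_block[of \<tau> "J a"]
    by (cases "even a") (auto simp: \<epsilon>_def signs_of_def z_def split: if_splits)
  have "wedge k X z J = 0" by (rule wedge_in_span[of _ _ _ _ c]) (simp add: z_def)
  then have "(\<Sum>a\<le>k. \<epsilon> * (-1) ^ a * z (J a) * plucker k X (omit a J)) = 0"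
    unfolding wedge_def by (simp add: sum_distrib_left[symmetric] mult.assoc)
  then have "\<forall>a\<in>{..k}. \<epsilon> * (-1) ^ a * z (J a) * plucker k X (omit a J) = 0"
    by (subst (asm) sum_nonneg_eq_0_iff)
      (auto intro!: mult_nonneg_nonneg alt less_imp_le[OF N] increasing_omit[OF Jinc])
  then have z0: "z (J a) = 0" if "a \<le> k" for a
    using N[OF increasing_omit[OF Jinc that]] that by (auto simp: \<epsilon>_def split: if_splits)
  have "increasing k n J" using Jinc by (auto simp: increasing_def)
  then have "plucker k X J > 0" by (rule N)
  then have "c b = 0" if "b < k" for b
    using detf_kernel[of k "\<lambda>a. X (J a)" c b] that z0 by (auto simp: plucker_def z_def)
  then show False using c by blast
qed

text \<open>The image of the vector lies in the span of the images of its block vectors, whose maximal minors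
  are positive, and such a span contains only vectors with few sign changes.\<close>

theorem variation_diminishing:
  assumes T: "totally_positive n n T" and y: "signs_of n \<sigma> y" "i\<^sub>0 < n" "y i\<^sub>0 \<noteq> 0"
    and \<tau>: "signs_of n \<tau> (\<lambda>i. \<Sum>k<n. T i k * y k)"
  shows "sign_changes n \<tau> \<le> sign_changes n \<sigma>"
proof -
  define p where "p = Suc (sign_changes n \<sigma>)"
  have p: "p \<le> n" using sign_changes_less[of n \<sigma>] y(2) by (simp add: p_def)
  obtain V c where V: "\<And>i. i < n \<Longrightarrow> y i = (\<Sum>b<p. V i b * c b)" "\<exists>b<p. c b \<noteq> 0"
    "\<And>T I. totally_positive n n T \<Longrightarrow> increasing p n I \<Longrightarrow> plucker p (mmult n T V) I > 0"
    using block_decomposition[OF y p_def] by blast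
  have z: "(\<Sum>k<n. T i k * y k) = (\<Sum>b<p. mmult n T V i b * c b)" for i
  proof -
    have "(\<Sum>k<n. T i k * y k) = (\<Sum>k<n. \<Sum>b<p. T i k * V k b * c b)"
      by (rule sum.cong) (auto simp: V(1) sum_distrib_left mult_ac)
    also have "\<dots> = (\<Sum>b<p. mmult n T V i b * c b)"
      unfolding mmult_def by (subst sum.swap) (simp add: sum_distrib_right)
    finally show ?thesis .
  qed
  have "sign_changes n \<tau> < p"
    by (rule sign_changes_in_positive_span[where X = "mmult n T V" and c = c])
      (use V T p \<tau> z in auto)
  then show ?thesis by (simp add: p_def)
qed


section \<open>Limit flags of infinite products of totally positive matrices\<close>

text \<open>Only the first \<open>p\<close> columns and the indices up to \<open>N\<close> are constrained, so that finite chains can end in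
  an array without positivity and can have fewer columns than rows.\<close>

definition chain :: "nat \<Rightarrow> nat \<Rightarrow> (nat \<Rightarrow> nat \<Rightarrow> nat \<Rightarrow> real) \<Rightarrow> nat \<Rightarrow> (nat \<Rightarrow> nat \<Rightarrow> nat \<Rightarrow> real) \<Rightarrow> bool" where
  "chain n p T N Z \<longleftrightarrow> (\<forall>t\<le>N. \<forall>i<n. \<forall>j<p. Z t i j = mmult n (T t) (Z (Suc t)) i j)"

text \<open>The flag spanned by the initial columns lies in the positive part of the flag variety.\<close>

definition positive_flag :: "nat \<Rightarrow> (nat \<Rightarrow> nat \<Rightarrow> real) \<Rightarrow> bool" where
  "positive_flag n X \<longleftrightarrow> (\<forall>p\<le>n. \<forall>I. increasing p n I \<longrightarrow> plucker p X I > 0)"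

definition uniformly_positive :: "nat \<Rightarrow> (nat \<Rightarrow> nat \<Rightarrow> nat \<Rightarrow> real) \<Rightarrow> bool" where
  "uniformly_positive n T \<longleftrightarrow> (\<forall>t. totally_positive n n (T t)) \<and> finite (range T)"

lemma uniformly_positive_bounds:
  assumes "uniformly_positive n T"
  obtains \<kappa> \<kappa>' where "0 < \<kappa>" "\<kappa> \<le> \<kappa>'"
    "\<And>t I J. I \<in> subsets p n \<Longrightarrow> J \<in> subsets p n \<Longrightarrow>
       \<kappa> \<le> detf p (\<lambda>a b. T t (I a) (J b)) \<and> detf p (\<lambda>a b. T t (I a) (J b)) \<le> \<kappa>'"
proof -
  let ?A = "(\<lambda>(M, I, J). detf p (\<lambda>a b. M (I a) (J b))) ` (range T \<times> subsets p n \<times> subsets p n)"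
  have fin: "finite (insert 1 ?A)" using assms by (auto simp: uniformly_positive_def)
  have pos: "x > 0" if "x \<in> insert 1 ?A" for x
    using that assms by (auto simp: uniformly_positive_def totally_positive_def subsets_def)
  have in_A: "detf p (\<lambda>a b. T t (I a) (J b)) \<in> insert 1 ?A"
    if "I \<in> subsets p n" "J \<in> subsets p n" for t I J
    using that by (auto intro!: image_eqI[of _ _ "(T t, I, J)"])
  show ?thesis
  proof (rule that[of "Min (insert 1 ?A)" "Max (insert 1 ?A)"])
    show "0 < Min (insert 1 ?A)" using pos fin by (subst Min_gr_iff) auto
    have "Min (insert 1 ?A) \<le> 1" "1 \<le> Max (insert 1 ?A)" using fin by (auto intro: Min_le Max_ge)
    then show "Min (insert 1 ?A) \<le> Max (insert 1 ?A)" by linarith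
    fix t I J assume "I \<in> subsets p n" "J \<in> subsets p n"
    from in_A[OF this, of t] fin
    show "Min (insert 1 ?A) \<le> detf p (\<lambda>a b. T t (I a) (J b)) \<and>
        detf p (\<lambda>a b. T t (I a) (J b)) \<le> Max (insert 1 ?A)"
      by (intro conjI Min_le Max_ge)
  qed
qed

lemma chain_plucker:
  assumes "chain n p T N Z" "t \<le> N" "I \<in> subsets p n"
  shows "plucker p (Z t) I =
    (\<Sum>J\<in>subsets p n. detf p (\<lambda>a b. T t (I a) (J b)) * plucker p (Z (Suc t)) J)"
proof -
  have "plucker p (Z t) I = plucker p (mmult n (T t) (Z (Suc t))) I"
    using assms by (intro plucker_cong[of n]) (auto simp: chain_def dest: subsetsD)
  then show ?thesis by (simp add: plucker_mmult)
qed

text \<open>The entries of the compounds of the \<open>T t\<close> lie between two positive bounds, because there are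
  finitely many \<open>T t\<close>; therefore the contraction rate depends only on \<open>N\<close>.\<close>

lemma plucker_contraction:
  assumes T: "uniformly_positive n T"
  obtains e where "e \<longlonglongrightarrow> 0" "\<And>N. e N \<ge> 0"
    "\<And>N Z Z'. chain n p T N Z \<Longrightarrow> chain n p T N Z' \<Longrightarrow>
      (\<And>I. I \<in> subsets p n \<Longrightarrow> plucker p (Z (Suc N)) I \<ge> 0) \<Longrightarrow>
      sum (plucker p (Z (Suc N))) (subsets p n) > 0 \<Longrightarrow>
      (\<And>I. I \<in> subsets p n \<Longrightarrow> plucker p (Z' (Suc N)) I \<ge> 0) \<Longrightarrow>
      sum (plucker p (Z' (Suc N))) (subsets p n) > 0 \<Longrightarrow>
      \<exists>l>0. \<forall>I\<in>subsets p n. l * plucker p (Z' 0) I \<le> plucker p (Z 0) I \<and>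
         plucker p (Z 0) I \<le> l * (1 + e N) * plucker p (Z' 0) I"
proof -
  obtain \<kappa> \<kappa>' where \<kappa>: "0 < \<kappa>" "\<kappa> \<le> \<kappa>'"
    and M: "\<And>t I J. I \<in> subsets p n \<Longrightarrow> J \<in> subsets p n \<Longrightarrow>
       \<kappa> \<le> detf p (\<lambda>a b. T t (I a) (J b)) \<and> detf p (\<lambda>a b. T t (I a) (J b)) \<le> \<kappa>'"
    using uniformly_positive_bounds[OF T, of p] by blast
  define \<theta> where "\<theta> = \<kappa> / \<kappa>'"
  have \<theta>: "0 < \<theta>" "\<theta> \<le> 1" using \<kappa> by (auto simp: \<theta>_def)
  show ?thesis
  proof (rule that[of "\<lambda>N. (1 - \<theta>) ^ N / \<theta>\<^sup>2"])
    have "(\<lambda>N. (1 - \<theta>) ^ N) \<longlonglongrightarrow> 0" using \<theta> by (intro LIMSEQ_realpow_zero) auto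
    then show "(\<lambda>N. (1 - \<theta>) ^ N / \<theta>\<^sup>2) \<longlonglongrightarrow> 0" by (rule tendsto_divide_zero)
    show "0 \<le> (1 - \<theta>) ^ N / \<theta>\<^sup>2" for N using \<theta> by auto
    fix N Z Z'
    assume *: "chain n p T N Z" "chain n p T N Z'"
      "\<And>I. I \<in> subsets p n \<Longrightarrow> plucker p (Z (Suc N)) I \<ge> 0"
      "sum (plucker p (Z (Suc N))) (subsets p n) > 0"
      "\<And>I. I \<in> subsets p n \<Longrightarrow> plucker p (Z' (Suc N)) I \<ge> 0"
      "sum (plucker p (Z' (Suc N))) (subsets p n) > 0"
    obtain l where "l > 0" "\<And>I. I \<in> subsets p n \<Longrightarrow> l * plucker p (Z' 0) I \<le> plucker p (Z 0) I \<and>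
         plucker p (Z 0) I \<le> l * (1 + (1 - \<kappa> / \<kappa>') ^ N / (\<kappa> / \<kappa>')\<^sup>2) * plucker p (Z' 0) I"
      by (rule birkhoff_chain[where S = "subsets p n" and x = "\<lambda>t. plucker p (Z t)" and y = "\<lambda>t. plucker p (Z' t)"
            and M = "\<lambda>t I J. detf p (\<lambda>a b. T t (I a) (J b))" and N = N, OF finite_subsets M \<kappa>])
        (use chain_plucker[OF *(1)] chain_plucker[OF *(2)] *(3-6) in auto)
    then show "\<exists>l>0. \<forall>I\<in>subsets p n. l * plucker p (Z' 0) I \<le> plucker p (Z 0) I \<and>
         plucker p (Z 0) I \<le> l * (1 + (1 - \<theta>) ^ N / \<theta>\<^sup>2) * plucker p (Z' 0) I"
      by (auto simp: \<theta>_def)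
  qed
qed

lemma positive_flag_sum:
  assumes "positive_flag n X" "p \<le> n"
  shows "sum (plucker p X) (subsets p n) > 0"
proof (rule sum_pos)
  show "subsets p n \<noteq> {}" using restrict_in_subsets[OF increasing_id[OF assms(2)]] by auto
qed (use assms in \<open>auto simp: positive_flag_def dest: subsetsD\<close>)

lemma chain_mono: "chain n p T N Z \<Longrightarrow> q \<le> p \<Longrightarrow> chain n q T N Z"
  by (auto simp: chain_def)

text \<open>For every \<open>N\<close> the two flags at time \<open>0\<close> have proportional Pluecker coordinates up to a factor
  \<open>1 + e N\<close>; let \<open>N\<close> tend to infinity.\<close>

lemma limit_flag_unique:
  assumes T: "uniformly_positive n T" and p: "p \<le> n"
    and Y: "\<And>N. chain n n T N Y" "\<And>t. positive_flag n (Y t)"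
    and Z: "\<And>N. chain n n T N Z" "\<And>t. positive_flag n (Z t)"
  obtains l where "l > 0" "\<And>I. increasing p n I \<Longrightarrow> plucker p (Z 0) I = l * plucker p (Y 0) I"
proof -
  obtain e where e: "e \<longlonglongrightarrow> 0" "\<And>N. e N \<ge> 0"
    and contr: "\<And>N Z Z'. chain n p T N Z \<Longrightarrow> chain n p T N Z' \<Longrightarrow>
      (\<And>I. I \<in> subsets p n \<Longrightarrow> plucker p (Z (Suc N)) I \<ge> 0) \<Longrightarrow>
      sum (plucker p (Z (Suc N))) (subsets p n) > 0 \<Longrightarrow>
      (\<And>I. I \<in> subsets p n \<Longrightarrow> plucker p (Z' (Suc N)) I \<ge> 0) \<Longrightarrow>
      sum (plucker p (Z' (Suc N))) (subsets p n) > 0 \<Longrightarrow>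
      \<exists>l>0. \<forall>I\<in>subsets p n. l * plucker p (Z' 0) I \<le> plucker p (Z 0) I \<and>
         plucker p (Z 0) I \<le> l * (1 + e N) * plucker p (Z' 0) I"
    using plucker_contraction[OF T, of p] by blast
  have Ypos: "plucker p (Y t) I > 0" and Zpos: "plucker p (Z t) I > 0" if "I \<in> subsets p n" for t I
    using Y(2) Z(2) p subsetsD[OF that] by (auto simp: positive_flag_def)
  have l: "\<exists>l>0. \<forall>I\<in>subsets p n. l * plucker p (Y 0) I \<le> plucker p (Z 0) I \<and>
         plucker p (Z 0) I \<le> l * (1 + e N) * plucker p (Y 0) I" for N
    by (rule contr[of N Z Y]) (use Y Z p positive_flag_sum Ypos Zpos in \<open>auto intro: chain_mono less_imp_le\<close>)
  define r where "r I = plucker p (Z 0) I / plucker p (Y 0) I" for I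
  have "r I \<le> r J" if IJ: "I \<in> subsets p n" "J \<in> subsets p n" for I J
  proof (rule LIMSEQ_le_const)
    have "(\<lambda>N. (1 + e N) * r J) \<longlonglongrightarrow> (1 + 0) * r J" by (intro tendsto_intros e)
    then show "(\<lambda>N. (1 + e N) * r J) \<longlonglongrightarrow> r J" by simp
    show "\<exists>N. \<forall>n\<ge>N. r I \<le> (1 + e n) * r J"
    proof (intro exI allI impI)
      fix N
      obtain l where l: "l > 0" "\<forall>I\<in>subsets p n. l * plucker p (Y 0) I \<le> plucker p (Z 0) I \<and>
         plucker p (Z 0) I \<le> l * (1 + e N) * plucker p (Y 0) I" using l by blast
      have "r I \<le> l * (1 + e N)" "l \<le> r J"
        using l Ypos[OF IJ(1), of 0] Ypos[OF IJ(2), of 0] IJ by (auto simp: r_def field_simps)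
      moreover have "l * (1 + e N) \<le> r J * (1 + e N)"
        using e(2)[of N] calculation(2) by (intro mult_right_mono) auto
      ultimately show "r I \<le> (1 + e N) * r J" by (simp add: mult.commute)
    qed
  qed
  then have eq: "r I = r J" if "I \<in> subsets p n" "J \<in> subsets p n" for I J
    using that by (simp add: antisym)
  let ?I0 = "restrict (\<lambda>a. a) {..<p}"
  have I0: "?I0 \<in> subsets p n" using restrict_in_subsets[OF increasing_id[OF p]] .
  show ?thesis
  proof (rule that[of "r ?I0"])
    show "r ?I0 > 0" using Ypos[OF I0] Zpos[OF I0] by (auto simp: r_def)
    fix I assume "increasing p n I"
    then have I: "restrict I {..<p} \<in> subsets p n" by (rule restrict_in_subsets)
    from eq[OF I I0] Ypos[OF I, of 0]
    have "plucker p (Z 0) (restrict I {..<p}) = r ?I0 * plucker p (Y 0) (restrict I {..<p})"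
      by (simp add: r_def field_simps)
    then show "plucker p (Z 0) I = r ?I0 * plucker p (Y 0) I" by (simp only: plucker_restrict)
  qed
qed

text \<open>Pluecker coordinates determine the subspace: the linear equations that they give for membership
  in the span are the same. The factor is the determinant of the base change, so its
  sign decides whether the two orientations agree.\<close>

lemma same_span_if_plucker_proportional:
  assumes X: "\<And>I. increasing p n I \<Longrightarrow> plucker p Z I = l * plucker p Y I" and l: "l \<noteq> 0"
    and p: "p \<le> n" and Y: "plucker p Y (\<lambda>a. a) \<noteq> 0"
  obtains M where "\<And>i j. i < n \<Longrightarrow> j < p \<Longrightarrow> Z i j = (\<Sum>b<p. Y i b * M b j)" "detf p M = l"
proof -
  have "\<exists>c. \<forall>i<n. Z i j = (\<Sum>b<p. Y i b * c b)" if j: "j < p" for j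
  proof -
    have "wedge p Y (\<lambda>i. Z i j) I = 0" if I: "increasing (Suc p) n I" for I
    proof -
      have "wedge p Z (\<lambda>i. Z i j) I = 0"
        using j by (intro wedge_in_span[where c = "\<lambda>b. if b = j then 1 else 0"])
          (simp add: if_distrib[of "\<lambda>x. _ * x"] cong: if_cong)
      moreover have "wedge p Z (\<lambda>i. Z i j) I = l * wedge p Y (\<lambda>i. Z i j) I"
        unfolding wedge_def sum_distrib_left
        by (rule sum.cong) (auto simp: X[OF increasing_omit[OF I]])
      ultimately show ?thesis using l by simp
    qed
    from in_span_if_wedge_0[OF Y this] show ?thesis by metis
  qed
  then obtain c where c: "\<And>j i. j < p \<Longrightarrow> i < n \<Longrightarrow> Z i j = (\<Sum>b<p. Y i b * c j b)" by metis
  show ?thesis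
  proof (rule that[of "\<lambda>b j. c j b"])
    show "Z i j = (\<Sum>b<p. Y i b * c j b)" if "i < n" "j < p" for i j using c that by simp
    have "plucker p Z (\<lambda>a. a) = detf p (\<lambda>a b. \<Sum>k<p. Y a k * c b k)"
      unfolding plucker_def using p by (intro detf_cong) (auto simp: c)
    also have "\<dots> = plucker p Y (\<lambda>a. a) * detf p (\<lambda>b j. c j b)"
      unfolding plucker_def by (rule detf_mult)
    finally show "detf p (\<lambda>b j. c j b) = l" using X[OF increasing_id[OF p]] Y by auto
  qed
qed

lemma convergent_subsequence_finite:
  fixes f :: "nat \<Rightarrow> 'k \<Rightarrow> real"
  assumes "finite K" "\<And>m k. k \<in> K \<Longrightarrow> \<bar>f m k\<bar> \<le> B"
  shows "\<exists>r. strict_mono (r :: nat \<Rightarrow> nat) \<and> (\<forall>k\<in>K. convergent (\<lambda>m. f (r m) k))"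
  using assms
proof (induction K rule: finite_induct)
  case empty
  then show ?case by (auto intro!: exI[of _ "\<lambda>m. m"] simp: strict_mono_def)
next
  case (insert k K)
  then obtain r where r: "strict_mono r" "\<forall>k\<in>K. convergent (\<lambda>m. f (r m) k)" by auto
  obtain s where s: "strict_mono s" "monoseq (\<lambda>m. f (r (s m)) k)"
    using seq_monosub[of "\<lambda>m. f (r m) k"] by auto
  have "Bseq (\<lambda>m. f (r (s m)) k)" using insert.prems[of k] by (intro BseqI'[of _ B]) auto
  then have "convergent (\<lambda>m. f (r (s m)) k)" using s(2) by (rule Bseq_monoseq_convergent)
  moreover have "convergent (\<lambda>m. f (r (s m)) j)" if "j \<in> K" for j
    using convergent_subseq_convergent[OF _ s(1), of "\<lambda>m. f (r m) j"] r(2) that by (simp add: o_def)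
  ultimately show ?case
    using r(1) s(1) by (intro exI[of _ "\<lambda>m. r (s m)"]) (auto simp: strict_mono_def)
qed

text \<open>Column operations normalize a flag in general position; the entries below the diagonal become
  quotients of Pluecker coordinates, which makes them easy to bound.\<close>

lemma lower_unipotent_representative:
  assumes X: "\<And>p. p \<le> n \<Longrightarrow> plucker p X (\<lambda>a. a) \<noteq> 0"
  obtains L U where "\<And>i j. L i j = (\<Sum>b<n. X i b * U b j)"
    "\<And>b j. j < b \<Longrightarrow> U b j = 0"
    "\<And>i j. j < n \<Longrightarrow> i < j \<Longrightarrow> L i j = 0" "\<And>j. j < n \<Longrightarrow> L j j = 1"
    "\<And>p I. p \<le> n \<Longrightarrow> plucker p L I * plucker p X (\<lambda>a. a) = plucker p X I"
proof -
  have "\<exists>c. \<forall>a<Suc j. (\<Sum>b<Suc j. X a b * c b) = (if a = j then 1 else 0)" if "j < n" for j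
    using detf_solve[of "Suc j" X "\<lambda>a. if a = j then 1 else 0"] X[of "Suc j"] that
    unfolding plucker_def by (metis Suc_leI)
  then obtain c where c: "\<And>j a. j < n \<Longrightarrow> a < Suc j \<Longrightarrow> (\<Sum>b<Suc j. X a b * c j b) = (if a = j then 1 else 0)"
    by metis
  define U where "U = (\<lambda>b j. if b \<le> j then c j b else 0)"
  define L where "L = (\<lambda>i j. \<Sum>b<n. X i b * U b j)"
  have L: "L i j = (\<Sum>b<Suc j. X i b * c j b)" if "j < n" for i j
    unfolding L_def by (rule sum.mono_neutral_cong_right) (use that in \<open>auto simp: U_def\<close>)
  have LU: "plucker p L I = plucker p X I * detf p U" if "p \<le> n" for p I
  proof -
    have "plucker p L I = detf p (\<lambda>a b. \<Sum>k<p. X (I a) k * U k b)"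
      unfolding plucker_def
    proof (rule detf_cong)
      fix a b assume "b < p"
      show "L (I a) b = (\<Sum>k<p. X (I a) k * U k b)"
        unfolding L_def by (rule sum.mono_neutral_right) (use that \<open>b < p\<close> in \<open>auto simp: U_def\<close>)
    qed
    then show ?thesis unfolding plucker_def by (simp add: detf_mult)
  qed
  have L1: "plucker p L (\<lambda>a. a) = 1" if "p \<le> n" for p
    unfolding plucker_def by (subst detf_lower) (use that in \<open>auto simp: L c simp del: sum.lessThan_Suc\<close>)
  show ?thesis
  proof (rule that[of L U])
    show "plucker p L I * plucker p X (\<lambda>a. a) = plucker p X I" if "p \<le> n" for p I
      using LU[OF that, of I] LU[OF that, of "\<lambda>a. a"] L1[OF that] by (simp add: mult_ac)
  qed (use L c in \<open>auto simp: L_def U_def\<close>)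
qed

lemma mmult_assoc: "mmult n A (mmult n B C) i j = mmult n (mmult n A B) C i j"
  unfolding mmult_def sum_distrib_left sum_distrib_right
  by (subst sum.swap) (simp add: mult_ac)

lemma inverse_array:
  assumes "detf n T \<noteq> 0"
  obtains S where "\<And>i j. i < n \<Longrightarrow> j < n \<Longrightarrow> mmult n T S i j = (if i = j then 1 else 0)"
    "\<And>i j. i < n \<Longrightarrow> j < n \<Longrightarrow> mmult n S T i j = (if i = j then 1 else 0)"
proof -
  let ?A = "Matrix.mat n n (\<lambda>(a, b). T a b)"
  have A: "?A \<in> carrier_mat n n" by simp
  obtain B where B: "B \<in> carrier_mat n n" "?A * B = 1\<^sub>m n" "B * ?A = 1\<^sub>m n"
    using det_non_zero_imp_unit[OF A, of "()"] assms unfolding detf_def Units_def by (auto simp: ring_mat_def)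
  show ?thesis
  proof (rule that[of "\<lambda>i j. B $$ (i, j)"])
    fix i j assume ij: "i < n" "j < n"
    have "mmult n T (\<lambda>i j. B $$ (i, j)) i j = (?A * B) $$ (i, j)"
      using ij B(1) by (auto simp: mmult_def scalar_prod_def atLeast0LessThan)
    then show "mmult n T (\<lambda>i j. B $$ (i, j)) i j = (if i = j then 1 else 0)" using B(2) ij by simp
    have "mmult n (\<lambda>i j. B $$ (i, j)) T i j = (B * ?A) $$ (i, j)"
      using ij B(1) by (auto simp: mmult_def scalar_prod_def atLeast0LessThan)
    then show "mmult n (\<lambda>i j. B $$ (i, j)) T i j = (if i = j then 1 else 0)" using B(3) ij by simp
  qed
qed

lemma detf_tendsto:
  assumes "\<And>a b. a < q \<Longrightarrow> b < q \<Longrightarrow> ((\<lambda>m. F m a b) \<longlongrightarrow> G a b) net"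
  shows "((\<lambda>m. detf q (F m)) \<longlongrightarrow> detf q G) net"
  unfolding detf_leibniz
proof (intro tendsto_intros)
  fix p i assume "p \<in> {p. p permutes {..<q}}" "i \<in> {..<q}"
  then show "((\<lambda>m. F m i (p i)) \<longlongrightarrow> G i (p i)) net"
    using assms permutes_in_image[of p "{..<q}" i] by auto
qed

lemma totally_positive_flag: "totally_positive n n T \<Longrightarrow> positive_flag n T"
  by (auto simp: positive_flag_def totally_positive_def plucker_def dest!: increasing_id)

lemma positive_flag_mmult:
  assumes T: "totally_positive n n T"
    and X: "\<And>p I. p \<le> n \<Longrightarrow> I \<in> subsets p n \<Longrightarrow> plucker p X I \<ge> 0"
      "\<And>p. p \<le> n \<Longrightarrow> \<exists>I\<in>subsets p n. plucker p X I \<noteq> 0"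
  shows "positive_flag n (mmult n T X)"
  unfolding positive_flag_def
proof (intro allI impI)
  fix p I assume p: "p \<le> n" and I: "increasing p n I"
  have T: "detf p (\<lambda>a b. T (I a) (J b)) > 0" if "J \<in> subsets p n" for J
    using T I subsetsD[OF that] by (auto simp: totally_positive_def)
  obtain J where J: "J \<in> subsets p n" "plucker p X J \<noteq> 0" using X(2)[OF p] by blast
  show "plucker p (mmult n T X) I > 0"
    unfolding plucker_mmult
    by (rule sum_pos2[OF finite_subsets J(1)]) (use T J X(1)[OF p] in \<open>auto simp: less_le intro!: mult_nonneg_nonneg\<close>)
qed

text \<open>Take the flags of the finite products \<open>T\<^sub>0 \<dots> T\<^sub>m\<close> and pass to a limit. Their lower unipotent
  representatives stay bounded: the entries are quotients of Pluecker coordinates, which are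
  comparable uniformly in \<open>m\<close> because the minors of the first factor \<open>T\<^sub>0\<close> are positive. The limit has
  nonnegative coordinates only, but its inverse images under the partial products have the same property,
  and one further totally positive factor makes them positive.\<close>

theorem limit_flag_exists:
  assumes T: "uniformly_positive n T"
  obtains Y where "\<And>N. chain n n T N Y" "\<And>t. positive_flag n (Y t)"
proof -
  have TP: "totally_positive n n (T t)" for t using T by (auto simp: uniformly_positive_def)
  have "detf n (T t) > 0" for t
  proof -
    have "detf n (\<lambda>a b. T t ((\<lambda>a. a) a) ((\<lambda>a. a) b)) > 0"
      using TP[of t] increasing_id[of n n] unfolding totally_positive_def by blast
    then show ?thesis by simp
  qed
  then have "\<exists>S. (\<forall>i<n. \<forall>j<n. mmult n (T t) S i j = (if i = j then 1 else 0)) \<and>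
      (\<forall>i<n. \<forall>j<n. mmult n S (T t) i j = (if i = j then 1 else 0))" for t
    using inverse_array[of n "T t"] by (metis less_irrefl)
  then obtain S where S: "\<And>t i j. i < n \<Longrightarrow> j < n \<Longrightarrow> mmult n (T t) (S t) i j = (if i = j then 1 else 0)"
      "\<And>t i j. i < n \<Longrightarrow> j < n \<Longrightarrow> mmult n (S t) (T t) i j = (if i = j then 1 else 0)" by metis
  define pos where "pos = (\<lambda>X. \<forall>p\<le>n. \<forall>I\<in>subsets p n. plucker p X I \<ge> 0)"
  \<comment> \<open>\<open>P m d = T\<^sub>m\<^sub>-\<^sub>d \<dots> T\<^sub>m\<close>\<close>
  define P where "P = (\<lambda>m. rec_nat (T m) (\<lambda>d X. mmult n (T (m - Suc d)) X))"
  have P_0: "P m 0 = T m" and P_Suc: "P m (Suc d) = mmult n (T (m - Suc d)) (P m d)" for m d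
    by (simp_all add: P_def)
  have Ppos: "positive_flag n (P m d)" for m d
  proof (induction d)
    case 0
    then show ?case using totally_positive_flag[OF TP] by (simp add: P_0)
  next
    case (Suc d)
    have "plucker p (P m d) I > 0" if "p \<le> n" "I \<in> subsets p n" for p I
      using Suc that by (auto simp: positive_flag_def dest: subsetsD)
    then show ?case
      unfolding P_Suc
    proof (intro positive_flag_mmult TP)
      show "\<exists>I\<in>subsets p n. plucker p (P m d) I \<noteq> 0" if "p \<le> n" for p
      proof (rule bexI)
        show I: "restrict (\<lambda>a. a) {..<p} \<in> subsets p n"
          by (rule restrict_in_subsets[OF increasing_id[OF that]])
        have "plucker p (P m d) (restrict (\<lambda>a. a) {..<p}) > 0"
          using Suc subsetsD[OF I] that unfolding positive_flag_def by blast
        then show "plucker p (P m d) (restrict (\<lambda>a. a) {..<p}) \<noteq> 0" by simp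
      qed
    qed (simp add: less_imp_le)
  qed
  define good where "good = (\<lambda>m L U. (\<forall>i j. L i j = (\<Sum>b<n. P m m i b * U b j)) \<and>
    (\<forall>b j. j < b \<longrightarrow> U b j = 0) \<and> (\<forall>i j. j < n \<longrightarrow> i < j \<longrightarrow> L i j = 0) \<and> (\<forall>j<n. L j j = 1) \<and>
    (\<forall>p\<le>n. \<forall>I. plucker p L I * plucker p (P m m) (\<lambda>a. a) = plucker p (P m m) I))"
  have Pid: "plucker p (P m d) (\<lambda>a. a) > 0" if "p \<le> n" for p m d
    using Ppos[of m d] increasing_id[OF that] that by (auto simp: positive_flag_def)
  have "\<exists>L U. good m L U" for m
  proof -
    have "plucker p (P m m) (\<lambda>a. a) \<noteq> 0" if "p \<le> n" for p using Pid[OF that, of m m] by simp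
    then show ?thesis
    proof (rule lower_unipotent_representative[of n "P m m"])
      fix L U
      assume "\<And>i j. L i j = (\<Sum>b<n. P m m i b * U b j)" "\<And>b j. j < b \<Longrightarrow> U b j = 0"
        "\<And>i j. j < n \<Longrightarrow> i < j \<Longrightarrow> L i j = 0" "\<And>j. j < n \<Longrightarrow> L j j = 1"
        "\<And>p I. p \<le> n \<Longrightarrow> plucker p L I * plucker p (P m m) (\<lambda>a. a) = plucker p (P m m) I"
      then have "good m L U" unfolding good_def by blast
      then show ?thesis by blast
    qed
  qed
  then obtain L U where LU: "\<And>m. good m (L m) (U m)" by metis
  obtain B where B: "\<And>m i j. i < n \<Longrightarrow> j < n \<Longrightarrow> \<bar>L m i j\<bar> \<le> B"
  proof -
    have "\<exists>B\<ge>0. \<forall>m i. i < n \<longrightarrow> \<bar>L m i j\<bar> \<le> B" if j: "j < n" for j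
    proof -
      obtain \<kappa> \<kappa>' where \<kappa>: "0 < \<kappa>" "\<kappa> \<le> \<kappa>'"
        and M: "\<And>t I J. I \<in> subsets (Suc j) n \<Longrightarrow> J \<in> subsets (Suc j) n \<Longrightarrow>
       \<kappa> \<le> detf (Suc j) (\<lambda>a b. T t (I a) (J b)) \<and> detf (Suc j) (\<lambda>a b. T t (I a) (J b)) \<le> \<kappa>'"
        using uniformly_positive_bounds[OF T, of "Suc j"] by blast
      have "\<bar>L m i j\<bar> \<le> max 1 (\<kappa>' / \<kappa>)" if i: "i < n" for m i
      proof (cases "i \<le> j")
        case True
        then have "\<bar>L m i j\<bar> \<le> 1" using LU[of m] j by (cases "i = j") (auto simp: good_def)
        then show ?thesis by simp
      next
        case False
        define I where "I = (\<lambda>a. if a < j then a else i)"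
        have I: "increasing (Suc j) n I" using False i j by (auto simp: increasing_def I_def)
        have "L m i j = plucker (Suc j) (L m) I"
          unfolding plucker_def using LU[of m] j
          by (subst detf_lower) (auto simp: good_def I_def)
        then have L: "L m i j * plucker (Suc j) (P m m) (\<lambda>a. a) = plucker (Suc j) (P m m) I"
          using LU[of m] j by (simp add: good_def)
        have pid: "plucker (Suc j) (P m m) (\<lambda>a. a) > 0" using Pid j by simp
        have pI: "plucker (Suc j) (P m m) I > 0" using Ppos[of m m] I j by (simp add: positive_flag_def)
        have "plucker (Suc j) (P m m) I \<le> \<kappa>' / \<kappa> * plucker (Suc j) (P m m) (\<lambda>a. a)"
        proof (cases m)
          case 0
          let ?K = "restrict (\<lambda>a. a) {..<Suc j}"
          have K: "?K \<in> subsets (Suc j) n" using j by (intro restrict_in_subsets increasing_id) auto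
          have 1: "plucker (Suc j) (T 0) K = detf (Suc j) (\<lambda>a b. T 0 (K a) (?K b))" for K
            unfolding plucker_def by (rule detf_cong) auto
          have "plucker (Suc j) (T 0) (restrict I {..<Suc j}) \<le> \<kappa>'"
            "\<kappa> \<le> plucker (Suc j) (T 0) ?K"
            unfolding 1 using M[OF restrict_in_subsets[OF I] K] M[OF K K] by auto
          then have "plucker (Suc j) (T 0) I \<le> \<kappa>'" "\<kappa> \<le> plucker (Suc j) (T 0) (\<lambda>a. a)"
            by (simp_all only: plucker_restrict)
          moreover have "\<kappa>' = \<kappa>' / \<kappa> * \<kappa>" using \<kappa> by simp
          moreover have "\<kappa>' / \<kappa> * \<kappa> \<le> \<kappa>' / \<kappa> * plucker (Suc j) (T 0) (\<lambda>a. a)"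
            using calculation(2) \<kappa> by (intro mult_left_mono) auto
          ultimately show ?thesis using 0 by (simp add: P_0)
        next
          case (Suc m')
          let ?X = "P m m'"
          have eq: "P m m = mmult n (T 0) ?X" using P_Suc[of m m'] Suc by simp
          have pos: "plucker (Suc j) ?X J \<ge> 0" if "J \<in> subsets (Suc j) n" for J
            using Ppos[of m m'] subsetsD[OF that] j by (auto simp: positive_flag_def intro: less_imp_le)
          have b: "\<kappa> * sum (plucker (Suc j) ?X) (subsets (Suc j) n) \<le> plucker (Suc j) (P m m) K \<and>
              plucker (Suc j) (P m m) K \<le> \<kappa>' * sum (plucker (Suc j) ?X) (subsets (Suc j) n)"
            if "increasing (Suc j) n K" for K
          proof -
            let ?K = "restrict K {..<Suc j}"
            have K: "?K \<in> subsets (Suc j) n" using that by (rule restrict_in_subsets)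
            have "plucker (Suc j) (P m m) ?K =
                (\<Sum>J\<in>subsets (Suc j) n. detf (Suc j) (\<lambda>a b. T 0 (?K a) (J b)) * plucker (Suc j) ?X J)"
              unfolding eq by (rule plucker_mmult)
            then have "plucker (Suc j) (P m m) K =
                (\<Sum>J\<in>subsets (Suc j) n. detf (Suc j) (\<lambda>a b. T 0 (?K a) (J b)) * plucker (Suc j) ?X J)"
              by (simp only: plucker_restrict)
            then show ?thesis unfolding sum_distrib_left
              using M[OF K] pos by (auto intro!: sum_mono mult_right_mono)
          qed
          let ?s = "sum (plucker (Suc j) ?X) (subsets (Suc j) n)"
          have "increasing (Suc j) n (\<lambda>a. a)" using j by (intro increasing_id) auto
          then have "\<kappa> * ?s \<le> plucker (Suc j) (P m m) (\<lambda>a. a)" using b by blast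
          then have "\<kappa>' / \<kappa> * (\<kappa> * ?s) \<le> \<kappa>' / \<kappa> * plucker (Suc j) (P m m) (\<lambda>a. a)"
            using \<kappa> by (intro mult_left_mono) auto
          moreover have "\<kappa>' / \<kappa> * (\<kappa> * ?s) = \<kappa>' * ?s" using \<kappa> by simp
          ultimately show ?thesis using b[OF I] by linarith
        qed
        then have "L m i j * plucker (Suc j) (P m m) (\<lambda>a. a) \<le> \<kappa>' / \<kappa> * plucker (Suc j) (P m m) (\<lambda>a. a)"
          using L by simp
        then have "L m i j \<le> \<kappa>' / \<kappa>" using pid by (simp only: mult_le_cancel_right_pos)
        moreover have "L m i j > 0" using L pI pid by (metis zero_less_mult_pos2)
        ultimately show ?thesis by simp
      qed
      then show ?thesis by (intro exI[of _ "max 1 (\<kappa>' / \<kappa>)"]) auto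
    qed
    then obtain b where b: "\<And>j. j < n \<Longrightarrow> b j \<ge> 0" "\<And>j m i. j < n \<Longrightarrow> i < n \<Longrightarrow> \<bar>L m i j\<bar> \<le> b j" by metis
    show ?thesis
    proof (rule that[of "\<Sum>j<n. b j"])
      fix m i j assume ij: "i < n" "j < n"
      have "b j \<le> (\<Sum>j<n. b j)" using b(1) ij by (intro member_le_sum) auto
      then show "\<bar>L m i j\<bar> \<le> (\<Sum>j<n. b j)" using b(2)[OF ij(2,1), of m] by linarith
    qed
  qed
  obtain r where r: "strict_mono r" "\<forall>k\<in>{..<n} \<times> {..<n}. convergent (\<lambda>m. case k of (i, j) \<Rightarrow> L (r m) i j)"
    using convergent_subsequence_finite[of "{..<n} \<times> {..<n}" "\<lambda>m (i, j). L m i j" B] B by auto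
  define L\<^sub>0 where "L\<^sub>0 i j = lim (\<lambda>m. L (r m) i j)" for i j
  have L\<^sub>0: "(\<lambda>m. L (r m) i j) \<longlonglongrightarrow> L\<^sub>0 i j" if "i < n" "j < n" for i j
    using r(2) that by (auto simp: L\<^sub>0_def convergent_LIMSEQ_iff)
  define Q where "Q = (\<lambda>X. rec_nat X (\<lambda>t Y. mmult n (S t) Y))"
  have Q_0: "Q X 0 = X" and Q_Suc: "Q X (Suc t) = mmult n (S t) (Q X t)" for X t
    by (simp_all add: Q_def)
  have TQ: "mmult n (T t) (Q X (Suc t)) i j = Q X t i j" if "i < n" for X t i j
  proof -
    have "mmult n (T t) (Q X (Suc t)) i j = mmult n (mmult n (T t) (S t)) (Q X t) i j"
      by (simp only: Q_Suc mmult_assoc)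
    also have "\<dots> = (\<Sum>k<n. (if i = k then 1 else 0) * Q X t k j)"
      using that by (simp add: mmult_def[of n "mmult n (T t) (S t)"] S)
    finally show ?thesis using that by (simp add: if_distrib[of "\<lambda>x. x * _"] cong: if_cong)
  qed
  define Y where "Y = Q L\<^sub>0"
  have Ylim: "(\<lambda>m. Q (L (r m)) t i j) \<longlonglongrightarrow> Y t i j" if "i < n" "j < n" for t i j
    using that
  proof (induction t arbitrary: i j)
    case 0
    then show ?case using L\<^sub>0 by (simp add: Y_def Q_0)
  next
    case (Suc t)
    then show ?case unfolding Y_def Q_Suc mmult_def by (intro tendsto_intros) auto
  qed
  have QP: "Q (L m) t i j = mmult n (P m (m - t)) (U m) i j" if "t \<le> m" "i < n" "j < n" for m t i j
    using that
  proof (induction t arbitrary: i j)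
    case 0
    then show ?case using LU[of m] by (simp add: Q_0 good_def mmult_def)
  next
    case (Suc t)
    have "m - t = Suc (m - Suc t)" "m - Suc (m - Suc t) = t" using Suc.prems by auto
    then have P: "P m (m - t) = mmult n (T t) (P m (m - Suc t))" using P_Suc[of m "m - Suc t"] by simp
    have "Q (L m) (Suc t) i j = (\<Sum>k<n. S t i k * mmult n (P m (m - t)) (U m) k j)"
      unfolding Q_Suc mmult_def[of n "S t"] using Suc by (intro sum.cong) auto
    also have "\<dots> = mmult n (S t) (mmult n (P m (m - t)) (U m)) i j" by (simp add: mmult_def[of n "S t"])
    also have "\<dots> = mmult n (mmult n (S t) (mmult n (T t) (P m (m - Suc t)))) (U m) i j"
      by (simp only: P mmult_assoc)
    also have "\<dots> = (\<Sum>k<n. mmult n (mmult n (S t) (T t)) (P m (m - Suc t)) i k * U m k j)"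
      by (simp only: mmult_def[of n _ "U m"] mmult_assoc)
    also have "\<dots> = (\<Sum>k<n. (\<Sum>l<n. (if i = l then 1 else 0) * P m (m - Suc t) l k) * U m k j)"
      using Suc.prems by (simp add: mmult_def[of n "mmult n (S t) (T t)"] S)
    also have "\<dots> = mmult n (P m (m - Suc t)) (U m) i j"
      using Suc.prems by (simp add: mmult_def if_distrib[of "\<lambda>x. x * _"] cong: if_cong)
    finally show ?case .
  qed
  have Yplu: "plucker p (Y t) I \<ge> 0" if p: "p \<le> n" and I: "increasing p n I" for p t I
  proof (rule tendsto_lowerbound)
    show "((\<lambda>m. plucker p (Q (L (r m)) t) I) \<longlongrightarrow> plucker p (Y t) I) sequentially"
      unfolding plucker_def using p I by (intro detf_tendsto Ylim) (auto simp: increasing_def)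
    have Qpos: "plucker p (Q (L m) t) I \<ge> 0" if "m \<ge> t" for m
    proof -
      have U: "mmult n X (U m) i j = (\<Sum>b<p. X i b * U m b j)" if "j < p" for X i j
        unfolding mmult_def
        by (rule sum.mono_neutral_right) (use p LU[of m] that in \<open>auto simp: good_def\<close>)
      have Q: "plucker p (mmult n X (U m)) J = plucker p X J * detf p (U m)" for X J
      proof -
        have "plucker p (mmult n X (U m)) J = detf p (\<lambda>a b. \<Sum>k<p. X (J a) k * U m k b)"
          unfolding plucker_def by (rule detf_cong) (simp add: U)
        then show ?thesis by (simp add: plucker_def detf_mult)
      qed
      have "plucker p (L m) (\<lambda>a. a) = plucker p (mmult n (P m m) (U m)) (\<lambda>a. a)"
        unfolding plucker_def by (rule detf_cong) (use LU[of m] in \<open>auto simp: good_def mmult_def\<close>)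
      also have "\<dots> = plucker p (P m m) (\<lambda>a. a) * detf p (U m)" by (rule Q)
      finally have "plucker p (L m) (\<lambda>a. a) = plucker p (P m m) (\<lambda>a. a) * detf p (U m)" .
      moreover have "plucker p (L m) (\<lambda>a. a) = 1"
        unfolding plucker_def by (subst detf_lower) (use LU[of m] p in \<open>auto simp: good_def\<close>)
      ultimately have "plucker p (P m m) (\<lambda>a. a) * detf p (U m) > 0" by simp
      then have U: "detf p (U m) > 0" using Pid[OF p, of m m] by (rule zero_less_mult_pos)
      have "plucker p (Q (L m) t) I = plucker p (mmult n (P m (m - t)) (U m)) I"
        by (rule plucker_cong[of n]) (use QP that p I in auto)
      also have "\<dots> = plucker p (P m (m - t)) I * detf p (U m)" by (rule Q)
      also have "\<dots> \<ge> 0"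
        using Ppos[of m "m - t"] U p I by (intro mult_nonneg_nonneg less_imp_le) (auto simp: positive_flag_def)
      finally show ?thesis .
    qed
    show "\<forall>\<^sub>F m in sequentially. 0 \<le> plucker p (Q (L (r m)) t) I"
    proof (rule eventually_sequentiallyI)
      fix m assume "t \<le> m"
      then have "t \<le> r m" using seq_suble[OF r(1), of m] by simp
      then show "0 \<le> plucker p (Q (L (r m)) t) I" by (rule Qpos)
    qed
  qed simp
  have ch: "chain n n T N Y" for N
    unfolding chain_def Y_def using TQ by simp
  have nz: "\<exists>I\<in>subsets p n. plucker p (Y t) I \<noteq> 0" if p: "p \<le> n" for p t
  proof (induction t)
    case 0
    have "L\<^sub>0 i j = 0" if "i < j" "j < n" for i j
    proof -
      have "L m i j = 0" for m using LU[of m] that unfolding good_def by blast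
      then show ?thesis using L\<^sub>0[of i j] that by (simp add: LIMSEQ_const_iff)
    qed
    moreover have "L\<^sub>0 j j = 1" if "j < n" for j
    proof -
      have "L m j j = 1" for m using LU[of m] that unfolding good_def by blast
      then show ?thesis using L\<^sub>0[of j j] that by (simp add: LIMSEQ_const_iff)
    qed
    ultimately have "plucker p (Y 0) (\<lambda>a. a) = 1"
      unfolding plucker_def Y_def Q_0 using p by (subst detf_lower) auto
    then have "plucker p (Y 0) (restrict (\<lambda>a. a) {..<p}) = 1" by (simp only: plucker_restrict)
    then have "plucker p (Y 0) (restrict (\<lambda>a. a) {..<p}) \<noteq> 0" by (metis one_neq_zero)
    then show ?case
      by (rule bexI[OF _ restrict_in_subsets[OF increasing_id[OF p]]])
  next
    case (Suc t)
    then obtain I where I: "I \<in> subsets p n" "plucker p (Y t) I \<noteq> 0" by blast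
    have "chain n p T t Y" using chain_mono[OF ch p] .
    from chain_plucker[OF this _ I(1), of t] I(2)
    have "(\<Sum>J\<in>subsets p n. detf p (\<lambda>a b. T t (I a) (J b)) * plucker p (Y (Suc t)) J) \<noteq> 0" by simp
    then obtain J where "J \<in> subsets p n" "detf p (\<lambda>a b. T t (I a) (J b)) * plucker p (Y (Suc t)) J \<noteq> 0"
      by (metis (no_types, lifting) sum.neutral)
    then show ?case by (intro bexI[of _ J]) auto
  qed
  have "positive_flag n (Y t)" for t
  proof -
    have "positive_flag n (mmult n (T t) (Y (Suc t)))"
      using Yplu nz by (intro positive_flag_mmult TP) (auto dest: subsetsD)
    moreover have "plucker p (mmult n (T t) (Y (Suc t))) I = plucker p (Y t) I"
      if "p \<le> n" "increasing p n I" for p I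
      by (rule plucker_cong[OF _ that(2)]) (use ch[of t] that in \<open>auto simp: chain_def\<close>)
    ultimately show ?thesis by (simp add: positive_flag_def)
  qed
  then show ?thesis using that ch by blast
qed

lemma chain_to:
  obtains Z where "chain n p T N Z" "Z (Suc N) = V"
proof
  let ?R = "rec_nat V (\<lambda>d X. mmult n (T (N - d)) X)"
  show "chain n p T N (\<lambda>t. ?R (Suc N - t))"
    unfolding chain_def by (simp add: Suc_diff_le)
qed simp

lemma chain_vector:
  assumes Z: "chain n p T N Z" and x: "\<And>t i. t \<le> N \<Longrightarrow> i < n \<Longrightarrow> x t i = (\<Sum>k<n. T t i k * x (Suc t) k)"
    and c: "\<And>i. i < n \<Longrightarrow> x (Suc N) i = (\<Sum>b<p. Z (Suc N) i b * c b)" and "i < n"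
  shows "x 0 i = (\<Sum>b<p. Z 0 i b * c b)"
proof -
  have "\<forall>i<n. x (Suc N - d) i = (\<Sum>b<p. Z (Suc N - d) i b * c b)" if "d \<le> Suc N" for d
    using that
  proof (induction d)
    case 0
    then show ?case using c by simp
  next
    case (Suc d)
    then have t: "Suc (N - d) = Suc N - d" "N - d \<le> N" by auto
    have IH: "\<forall>i<n. x (Suc (N - d)) i = (\<Sum>b<p. Z (Suc (N - d)) i b * c b)" using Suc t by simp
    have "x (N - d) i = (\<Sum>b<p. Z (N - d) i b * c b)" if i: "i < n" for i
    proof -
      have "x (N - d) i = (\<Sum>k<n. T (N - d) i k * (\<Sum>b<p. Z (Suc (N - d)) k b * c b))"
        unfolding x[OF t(2) i] by (rule sum.cong) (use IH in auto)
      also have "\<dots> = (\<Sum>b<p. mmult n (T (N - d)) (Z (Suc (N - d))) i b * c b)"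
        unfolding mmult_def sum_distrib_left sum_distrib_right by (subst sum.swap) (simp add: mult_ac)
      also have "\<dots> = (\<Sum>b<p. Z (N - d) i b * c b)"
        by (rule sum.cong) (use Z i t(2) in \<open>auto simp: chain_def\<close>)
      finally show ?thesis .
    qed
    then show ?case by simp
  qed
  from this[of "Suc N"] show ?thesis using \<open>i < n\<close> by simp
qed

text \<open>A nonzero vector that stays in the cone of few sign changes when it is pulled back arbitrarily far
  lies in the limit subspace. The number of changes has a value \<open>q\<close> for infinitely many \<open>t\<close>; for
  these, block decomposition of \<open>x t\<close> puts it into the span of \<open>q + 1\<close> vectors with positive coordinates one
  step earlier. By contraction, the images of these spans at time \<open>0\<close> converge to the limit
  subspace of dimension \<open>q + 1 \<le> k\<close>, and all of them contain \<open>x 0\<close>.\<close>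

theorem cone_limit:
  assumes T: "uniformly_positive n T" and k: "k \<le> n"
    and Y: "\<And>N. chain n n T N Y" "\<And>t. positive_flag n (Y t)"
    and x: "\<And>t i. i < n \<Longrightarrow> x t i = (\<Sum>j<n. T t i j * x (Suc t) j)"
    and nz: "\<And>t. \<exists>i<n. x t i \<noteq> 0"
    and cone: "\<And>t. \<exists>\<sigma>. signs_of n \<sigma> (x t) \<and> sign_changes n \<sigma> < k"
  obtains c where "\<And>i. i < n \<Longrightarrow> x 0 i = (\<Sum>b<k. Y 0 i b * c b)"
proof -
  obtain \<sigma> where \<sigma>: "\<And>t. signs_of n (\<sigma> t) (x t)" "\<And>t. sign_changes n (\<sigma> t) < k" using cone by metis
  have "\<exists>q<k. \<exists>\<^sub>\<infinity>t. sign_changes n (\<sigma> t) = q"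
  proof -
    have "range (\<lambda>t. sign_changes n (\<sigma> t)) \<subseteq> {..<k}" using \<sigma>(2) by auto
    then have "finite (range (\<lambda>t. sign_changes n (\<sigma> t)))" by (rule finite_subset) simp
    from inf_img_fin_dom[OF this] obtain q where
      "q \<in> range (\<lambda>t. sign_changes n (\<sigma> t))" "infinite ((\<lambda>t. sign_changes n (\<sigma> t)) -` {q} \<inter> UNIV)" by auto
    then show ?thesis using \<sigma>(2) by (auto simp: INFM_iff_infinite vimage_def)
  qed
  then obtain q where q: "q < k" "\<exists>\<^sub>\<infinity>t. sign_changes n (\<sigma> t) = q" by blast
  define p where "p = Suc q"
  have p: "p \<le> k" "p \<le> n" using q k by (auto simp: p_def)
  obtain e where e: "e \<longlonglongrightarrow> 0" "\<And>N. e N \<ge> 0"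
    and contr: "\<And>N Z Z'. chain n p T N Z \<Longrightarrow> chain n p T N Z' \<Longrightarrow>
      (\<And>I. I \<in> subsets p n \<Longrightarrow> plucker p (Z (Suc N)) I \<ge> 0) \<Longrightarrow>
      sum (plucker p (Z (Suc N))) (subsets p n) > 0 \<Longrightarrow>
      (\<And>I. I \<in> subsets p n \<Longrightarrow> plucker p (Z' (Suc N)) I \<ge> 0) \<Longrightarrow>
      sum (plucker p (Z' (Suc N))) (subsets p n) > 0 \<Longrightarrow>
      \<exists>l>0. \<forall>I\<in>subsets p n. l * plucker p (Z' 0) I \<le> plucker p (Z 0) I \<and>
         plucker p (Z 0) I \<le> l * (1 + e N) * plucker p (Z' 0) I"
    using plucker_contraction[OF T, of p] by blast
  have Ypos: "plucker p (Y t) I > 0" if "increasing p n I" for t I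
    using Y(2) p that by (auto simp: positive_flag_def)
  have main: "\<exists>X. (\<forall>I. increasing (Suc p) n I \<longrightarrow> wedge p X (x 0) I = 0) \<and>
      (\<exists>l>0. \<forall>I\<in>subsets p n. l * plucker p (Y 0) I \<le> plucker p X I \<and>
         plucker p X I \<le> l * (1 + e N) * plucker p (Y 0) I)"
    if t: "sign_changes n (\<sigma> (Suc (Suc N))) = q" for N
  proof -
    let ?t = "Suc (Suc N)"
    obtain i where i: "i < n" "x ?t i \<noteq> 0" using nz by blast
    obtain V c where V: "\<And>i. i < n \<Longrightarrow> x ?t i = (\<Sum>b<p. V i b * c b)"
      "\<And>T I. totally_positive n n T \<Longrightarrow> increasing p n I \<Longrightarrow> plucker p (mmult n T V) I > 0"
      using block_decomposition[OF \<sigma>(1) i, of p] t p_def by metis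
    obtain Z where Z: "chain n p T (Suc N) Z" "Z ?t = V" using chain_to[of n p T "Suc N" V] .
    have x0: "x 0 i = (\<Sum>b<p. Z 0 i b * c b)" if "i < n" for i
      by (rule chain_vector[OF Z(1), of x c i]) (use x V Z that in auto)
    have Zpos: "plucker p (Z (Suc N)) I > 0" if "I \<in> subsets p n" for I
    proof -
      have "plucker p (Z (Suc N)) I = plucker p (mmult n (T (Suc N)) V) I"
        by (rule plucker_cong[OF _ subsetsD[OF that]]) (use Z in \<open>auto simp: chain_def\<close>)
      then show ?thesis using V(2)[OF _ subsetsD[OF that]] T by (simp add: uniformly_positive_def)
    qed
    have ne: "subsets p n \<noteq> {}" using restrict_in_subsets[OF increasing_id[OF p(2)]] by auto
    have "\<exists>l>0. \<forall>I\<in>subsets p n. l * plucker p (Y 0) I \<le> plucker p (Z 0) I \<and>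
         plucker p (Z 0) I \<le> l * (1 + e N) * plucker p (Y 0) I"
    proof (rule contr)
      show "chain n p T N Z" using Z(1) by (auto simp: chain_def)
      show "chain n p T N Y" using Y(1) p(2) by (rule chain_mono)
      show "sum (plucker p (Z (Suc N))) (subsets p n) > 0" using Zpos ne by (intro sum_pos) auto
      show "sum (plucker p (Y (Suc N))) (subsets p n) > 0" using positive_flag_sum[OF Y(2) p(2)] .
      show "plucker p (Z (Suc N)) I \<ge> 0" if "I \<in> subsets p n" for I using Zpos[OF that] by simp
      show "plucker p (Y (Suc N)) I \<ge> 0" if "I \<in> subsets p n" for I
        using Ypos[OF subsetsD[OF that]] by (simp add: less_imp_le)
    qed
    moreover have "wedge p (Z 0) (x 0) I = 0" if "increasing (Suc p) n I" for I
      by (rule wedge_in_span[of p _ _ _ c]) (use x0 that in \<open>auto simp: increasing_def\<close>)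
    ultimately show ?thesis by blast
  qed
  have "wedge p (Y 0) (x 0) I = 0" if I: "increasing (Suc p) n I" for I
  proof -
    define B where "B = (\<Sum>a\<le>p. \<bar>x 0 (I a)\<bar> * plucker p (Y 0) (omit a I))"
    have bound: "\<bar>wedge p (Y 0) (x 0) I\<bar> \<le> e N * B" if t: "sign_changes n (\<sigma> (Suc (Suc N))) = q" for N
    proof -
      obtain X l where X: "wedge p X (x 0) I = 0" and l: "l > 0"
        "\<And>I. I \<in> subsets p n \<Longrightarrow> l * plucker p (Y 0) I \<le> plucker p X I \<and>
         plucker p X I \<le> l * (1 + e N) * plucker p (Y 0) I"
        using main[OF t] I by blast
      have l: "\<bar>plucker p X J / l - plucker p (Y 0) J\<bar> \<le> e N * plucker p (Y 0) J"
        if J: "increasing p n J" for J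
      proof -
        have "l * plucker p (Y 0) J \<le> plucker p X J" "plucker p X J \<le> l * (1 + e N) * plucker p (Y 0) J"
          using l(2)[OF restrict_in_subsets[OF J]] by (simp_all only: plucker_restrict)
        then have "plucker p (Y 0) J \<le> plucker p X J / l" "plucker p X J / l \<le> (1 + e N) * plucker p (Y 0) J"
          using l(1) by (simp_all add: field_simps)
        then show ?thesis by (simp add: algebra_simps)
      qed
      have "wedge p (Y 0) (x 0) I = - (wedge p X (x 0) I / l - wedge p (Y 0) (x 0) I)" using X by simp
      also have "\<dots> = - (\<Sum>a\<le>p. (-1) ^ a * x 0 (I a) * (plucker p X (omit a I) / l - plucker p (Y 0) (omit a I)))"
        unfolding wedge_def sum_divide_distrib sum_subtractf[symmetric] by (simp add: algebra_simps)
      finally have "\<bar>wedge p (Y 0) (x 0) I\<bar> =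
          \<bar>\<Sum>a\<le>p. (-1) ^ a * x 0 (I a) * (plucker p X (omit a I) / l - plucker p (Y 0) (omit a I))\<bar>" by simp
      also have "\<dots> \<le> (\<Sum>a\<le>p. \<bar>(-1) ^ a * x 0 (I a) * (plucker p X (omit a I) / l - plucker p (Y 0) (omit a I))\<bar>)"
        by (rule sum_abs)
      also have "\<dots> \<le> (\<Sum>a\<le>p. \<bar>x 0 (I a)\<bar> * (e N * plucker p (Y 0) (omit a I)))"
        by (rule sum_mono) (auto simp: abs_mult power_abs intro!: mult_left_mono l increasing_omit[OF I])
      also have "\<dots> = e N * B" by (simp add: B_def sum_distrib_left mult_ac)
      finally show ?thesis .
    qed
    have "(\<lambda>N. e N * B) \<longlonglongrightarrow> 0 * B" by (intro tendsto_intros e)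
    then have lim: "(\<lambda>N. e N * B) \<longlonglongrightarrow> 0" by simp
    have "\<not> \<bar>wedge p (Y 0) (x 0) I\<bar> > 0"
    proof
      assume "\<bar>wedge p (Y 0) (x 0) I\<bar> > 0"
      then have "\<forall>\<^sub>F N in sequentially. e N * B < \<bar>wedge p (Y 0) (x 0) I\<bar>"
        using order_tendstoD(2)[OF lim] by blast
      then obtain M where M: "\<And>N. N \<ge> M \<Longrightarrow> e N * B < \<bar>wedge p (Y 0) (x 0) I\<bar>"
        by (auto simp: eventually_sequentially)
      obtain t where t: "t > Suc (Suc M)" "sign_changes n (\<sigma> t) = q" using q(2) by (auto simp: INFM_nat)
      then have "t = Suc (Suc (t - 2))" "t - 2 \<ge> M" by auto
      then show False using bound[of "t - 2"] M[of "t - 2"] t(2) by fastforce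
    qed
    then show ?thesis by simp
  qed
  moreover have "plucker p (Y 0) (\<lambda>a. a) \<noteq> 0" using Ypos[OF increasing_id[OF p(2)], of 0] by simp
  ultimately obtain c where c: "\<And>i. i < n \<Longrightarrow> x 0 i = (\<Sum>b<p. Y 0 i b * c b)"
    using in_span_if_wedge_0[of p "Y 0" n "x 0"] by metis
  show ?thesis
  proof (rule that[of "\<lambda>b. if b < p then c b else 0"])
    fix i assume "i < n"
    have "(\<Sum>b<k. Y 0 i b * (if b < p then c b else 0)) = (\<Sum>b<p. Y 0 i b * c b)"
      by (rule sum.mono_neutral_cong_right) (use p in auto)
    then show "x 0 i = (\<Sum>b<k. Y 0 i b * (if b < p then c b else 0))" using c[OF \<open>i < n\<close>] by simp
  qed
qed


section \<open>Determinants of lists of vectors\<close>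

text \<open>The enumeration of the index type in the order that defines the standard orientation.\<close>

definition idx :: "nat \<Rightarrow> 'n::{finite,linorder}" where
  "idx i = sorted_list_of_set (UNIV :: 'n set) ! i"

lemma bij_idx: "bij_betw (idx :: nat \<Rightarrow> 'n::{finite,linorder}) {..<CARD('n)} UNIV"
  unfolding idx_def by (rule bij_betw_nth) auto

lemma idx_eq_iff: "i < CARD('n) \<Longrightarrow> j < CARD('n) \<Longrightarrow> (idx i :: 'n::{finite,linorder}) = idx j \<longleftrightarrow> i = j"
  using bij_idx[where 'n = 'n] by (auto simp: bij_betw_def inj_on_def)

lemma vec_eq_idx:
  fixes x y :: "real^'n::{finite,linorder}"
  assumes "\<And>i. i < CARD('n) \<Longrightarrow> x $ idx i = y $ idx i"
  shows "x = y"
  unfolding Finite_Cartesian_Product.vec_eq_iff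
proof
  fix c :: 'n
  have "c \<in> idx ` {..<CARD('n)}" using bij_idx[where 'n = 'n] by (simp add: bij_betw_def)
  then show "x $ c = y $ c" using assms by auto
qed

text \<open>A list of \<open>n\<close> vectors is a positive basis exactly if this determinant is positive, which turns
  oriented direct sums into determinants of concatenated lists.\<close>

definition Dv :: "(real^'n::{finite,linorder}) list \<Rightarrow> real" where
  "Dv vs = detf CARD('n) (\<lambda>i j. (vs ! j) $ idx i)"

lemma Dv_expand:
  fixes vs es :: "(real^'n::{finite,linorder}) list"
  assumes "\<And>j. j < CARD('n) \<Longrightarrow> vs ! j = (\<Sum>k<CARD('n). G k j *\<^sub>R es ! k)"
  shows "Dv vs = detf CARD('n) G * Dv es"
proof -
  have "Dv vs = detf CARD('n) (\<lambda>i j. \<Sum>k<CARD('n). (es ! k) $ idx i * G k j)"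
    unfolding Dv_def by (rule detf_cong) (simp add: assms mult.commute)
  then show ?thesis by (simp add: Dv_def detf_mult)
qed

lemma detf_unit_columns:
  assumes "\<And>i j. i < u + p + w \<Longrightarrow> j < u + p + w \<Longrightarrow> \<not> (u \<le> j \<and> j < u + p) \<Longrightarrow>
      G i j = (if i = j then 1 else 0)"
  shows "detf (u + p + w) G = detf p (\<lambda>a b. G (u + a) (u + b))"
  using assms
proof (induction u arbitrary: G)
  case 0
  let ?A = "Matrix.mat p p (\<lambda>(a, b). G a b)" and ?C = "Matrix.mat w p (\<lambda>(a, b). G (p + a) b)"
  have "Matrix.mat (p + w) (p + w) (\<lambda>(a, b). G a b) = four_block_mat ?A (0\<^sub>m p w) ?C (1\<^sub>m w)"
    by (rule eq_matI) (auto simp: 0)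
  then have "detf (p + w) G = Determinant.det ?A * Determinant.det (1\<^sub>m w :: real mat)"
    unfolding detf_def by (simp only:) (rule det_four_block_mat_upper_right_zero, auto)
  then show ?case by (simp add: detf_def)
next
  case (Suc u)
  have "detf (Suc (u + p + w)) G = G 0 0 * detf (u + p + w) (\<lambda>a b. G (Suc a) (Suc b))"
    by (rule detf_first_column) (use Suc.prems in auto)
  also have "detf (u + p + w) (\<lambda>a b. G (Suc a) (Suc b)) = detf p (\<lambda>a b. G (Suc (u + a)) (Suc (u + b)))"
    by (rule Suc.IH) (use Suc.prems in auto)
  finally show ?case using Suc.prems[of 0 0] by simp
qed

text \<open>If a segment of a basis is replaced, only the coordinates along that segment count: the other
  base vectors occur in the determinant already.\<close>

lemma Dv_middle:
  fixes us bs ws cs :: "(real^'n::{finite,linorder}) list"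
  assumes len: "length us + length bs + length ws = CARD('n)" "length cs = length bs"
    and c: "\<And>b. b < length bs \<Longrightarrow> cs ! b = (\<Sum>r<CARD('n). X r b *\<^sub>R (us @ bs @ ws) ! r)"
  shows "Dv (us @ cs @ ws) = detf (length bs) (\<lambda>a b. X (length us + a) b) * Dv (us @ bs @ ws)"
proof -
  let ?n = "CARD('n)" and ?u = "length us" and ?p = "length bs"
  define G where "G = (\<lambda>r j. if ?u \<le> j \<and> j < ?u + ?p then X r (j - ?u) else if r = j then 1 else 0 :: real)"
  have "Dv (us @ cs @ ws) = detf ?n G * Dv (us @ bs @ ws)"
  proof (rule Dv_expand)
    fix j assume j: "j < ?n"
    show "(us @ cs @ ws) ! j = (\<Sum>k<?n. G k j *\<^sub>R (us @ bs @ ws) ! k)"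
    proof (cases "?u \<le> j \<and> j < ?u + ?p")
      case True
      then have b: "j - ?u < length bs" "j - ?u < length cs" using len by auto
      show ?thesis using c[OF b(1)] b True by (simp add: G_def nth_append)
    next
      case False
      have "(\<Sum>k<?n. G k j *\<^sub>R (us @ bs @ ws) ! k) = (\<Sum>k<?n. if k = j then (us @ bs @ ws) ! k else 0)"
        using False by (intro sum.cong) (auto simp: G_def)
      then show ?thesis using False j len by (auto simp: nth_append)
    qed
  qed
  also have "detf ?n G = detf (?u + ?p + length ws) G" using len by simp
  also have "\<dots> = detf ?p (\<lambda>a b. G (?u + a) (?u + b))"
    by (rule detf_unit_columns) (auto simp: G_def)
  also have "\<dots> = detf ?p (\<lambda>a b. X (?u + a) b)"
    by (rule detf_cong) (auto simp: G_def)
  finally show ?thesis .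
qed

lemma Dv_swap_one:
  fixes us ws :: "(real^'n::{finite,linorder}) list"
  assumes "length us + Suc (Suc (length ws)) = CARD('n)"
  shows "Dv (us @ x # y # ws) = - Dv (us @ y # x # ws)"
proof -
  let ?n = "CARD('n)" and ?u = "length us"
  let ?\<pi> = "Transposition.transpose ?u (Suc ?u)"
  have \<pi>: "?\<pi> permutes {..<?n}" using assms by (intro permutes_swap_id) auto
  have "Dv (us @ x # y # ws) = detf ?n (\<lambda>j i. ((us @ x # y # ws) ! j) $ idx i)"
    unfolding Dv_def by (rule detf_transpose[symmetric])
  also have "\<dots> = detf ?n (\<lambda>j i. ((us @ y # x # ws) ! (?\<pi> j)) $ idx i)"
    by (rule detf_cong) (auto simp: nth_append Transposition.transpose_def nth_Cons split: nat.splits)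
  also have "\<dots> = of_int (sign ?\<pi>) * detf ?n (\<lambda>j i. ((us @ y # x # ws) ! j) $ idx i)"
    by (rule detf_permute_rows[OF \<pi>, of "\<lambda>j i. ((us @ y # x # ws) ! j) $ idx i"])
  also have "detf ?n (\<lambda>j i. ((us @ y # x # ws) ! j) $ idx i) = Dv (us @ y # x # ws)"
    unfolding Dv_def by (rule detf_transpose)
  finally show ?thesis by (simp add: sign_swap_id)
qed

lemma Dv_swap_list:
  fixes us ys ws :: "(real^'n::{finite,linorder}) list"
  assumes "length us + length ys + Suc (length ws) = CARD('n)"
  shows "Dv (us @ x # ys @ ws) = (-1) ^ length ys * Dv (us @ ys @ x # ws)"
  using assms
proof (induction ys arbitrary: us)
  case (Cons y ys)
  have "Dv (us @ x # (y # ys) @ ws) = - Dv (us @ y # x # ys @ ws)"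
    using Dv_swap_one[of us "ys @ ws" x y] Cons.prems by simp
  also have "Dv (us @ y # x # ys @ ws) = (-1) ^ length ys * Dv (us @ (y # ys) @ x # ws)"
    using Cons.IH[of "us @ [y]"] Cons.prems by simp
  finally show ?case by simp
qed simp

text \<open>Exchanging two adjacent segments costs the product of their lengths in transpositions.\<close>

lemma Dv_swap:
  fixes us xs ys ws :: "(real^'n::{finite,linorder}) list"
  assumes "length us + length xs + length ys + length ws = CARD('n)"
  shows "Dv (us @ xs @ ys @ ws) = (-1) ^ (length xs * length ys) * Dv (us @ ys @ xs @ ws)"
  using assms
proof (induction xs arbitrary: us)
  case (Cons x xs)
  have "Dv (us @ (x # xs) @ ys @ ws) = (-1) ^ (length xs * length ys) * Dv (us @ x # ys @ (xs @ ws))"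
    using Cons.IH[of "us @ [x]"] Cons.prems by simp
  also have "Dv (us @ x # ys @ (xs @ ws)) = (-1) ^ length ys * Dv (us @ ys @ x # (xs @ ws))"
    using Dv_swap_list[of us ys "xs @ ws" x] Cons.prems by simp
  finally show ?case by (simp add: power_add)
qed simp

lemma Dv_det: "Dv (vs :: (real^'n::{finite,linorder}) list) =
  Determinants.det (\<chi> r c. (vs ! inv_into {..<CARD('n)} idx c) $ r)"
proof -
  let ?n = "CARD('n)" and ?idx = "idx :: nat \<Rightarrow> 'n"
  have bij: "bij_betw ?idx {..<?n} UNIV" by (rule bij_idx)
  have inj: "inj_on ?idx {..<?n}" and img: "?idx ` {..<?n} = UNIV" using bij by (auto simp: bij_betw_def)
  have mp: "(\<lambda>x. if x \<in> (UNIV :: 'n set) then ?idx (\<pi> (inv_into {..<?n} ?idx x)) else x) =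
      map_permutation {..<?n} ?idx \<pi>" for \<pi>
    by (auto simp: map_permutation_def restrict_id_def img)
  have bp: "bij_betw (map_permutation {..<?n} ?idx) {\<pi>. \<pi> permutes {..<?n}} {\<pi>. \<pi> permutes UNIV}"
    using bij_betw_permutations[OF bij] unfolding mp .
  have "Determinants.det (\<chi> r c. (vs ! inv_into {..<?n} ?idx c) $ r) =
    (\<Sum>\<pi> | \<pi> permutes {..<?n}. of_int (sign (map_permutation {..<?n} ?idx \<pi>)) *
      (\<Prod>i\<in>UNIV. (vs ! inv_into {..<?n} ?idx (map_permutation {..<?n} ?idx \<pi> i)) $ i))"
    unfolding Determinants.det_def sum.reindex_bij_betw[OF bp, symmetric] by simp
  also have "\<dots> = (\<Sum>\<pi> | \<pi> permutes {..<?n}. of_int (sign \<pi>) * (\<Prod>i<?n. (vs ! \<pi> i) $ ?idx i))"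
  proof (intro sum.cong refl arg_cong2[where f = "(*)"])
    fix \<pi> assume "\<pi> \<in> {\<pi>. \<pi> permutes {..<?n}}"
    then have \<pi>: "\<pi> permutes {..<?n}" by simp
    show "of_int (sign (map_permutation {..<?n} ?idx \<pi>)) = (of_int (sign \<pi>) :: real)"
      using sign_map_permutation[OF inj \<pi>] by simp
    have "(\<Prod>i\<in>UNIV. (vs ! inv_into {..<?n} ?idx (map_permutation {..<?n} ?idx \<pi> i)) $ i) =
      (\<Prod>i<?n. (vs ! inv_into {..<?n} ?idx (map_permutation {..<?n} ?idx \<pi> (?idx i))) $ ?idx i)"
      by (rule prod.reindex_bij_betw[OF bij, symmetric])
    also have "\<dots> = (\<Prod>i<?n. (vs ! \<pi> i) $ ?idx i)"
    proof (rule prod.cong[OF refl])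
      fix i assume i: "i \<in> {..<?n}"
      have "inv_into {..<?n} ?idx (?idx (\<pi> i)) = \<pi> i"
        using permutes_in_image[OF \<pi>, of i] i by (intro inv_into_f_f[OF inj]) auto
      then show "(vs ! inv_into {..<?n} ?idx (map_permutation {..<?n} ?idx \<pi> (?idx i))) $ ?idx i =
          (vs ! \<pi> i) $ ?idx i"
        by (simp only: map_permutation_apply[OF inj i])
    qed
    finally show "(\<Prod>i\<in>UNIV. (vs ! inv_into {..<?n} ?idx (map_permutation {..<?n} ?idx \<pi> i)) $ i) =
      (\<Prod>i<?n. (vs ! \<pi> i) $ ?idx i)" .
  qed
  also have "\<dots> = Dv vs" unfolding Dv_def detf_leibniz ..
  finally show ?thesis by simp
qed

type_synonym 'n sqmat = "real^'n^'n"

lemma Dv_linear_image: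
  fixes M :: "'n::{finite,linorder} sqmat"
  assumes "length vs = CARD('n)"
  shows "Dv (map ((*v) M) vs) = Determinants.det M * Dv vs"
proof -
  have "inv_into {..<CARD('n)} idx c < length vs" for c :: 'n
    using bij_idx[where 'n = 'n] inv_into_into[of c idx "{..<CARD('n)}"] assms by (auto simp: bij_betw_def)
  then have "map ((*v) M) vs ! inv_into {..<CARD('n)} idx c = M *v (vs ! inv_into {..<CARD('n)} idx c)" for c :: 'n
    by simp
  then have "(\<chi> r (c :: 'n). (map ((*v) M) vs ! inv_into {..<CARD('n)} idx c) $ r) =
      M ** (\<chi> r c. (vs ! inv_into {..<CARD('n)} idx c) $ r)"
    by (simp add: Finite_Cartesian_Product.vec_eq_iff matrix_matrix_mult_def matrix_vector_mult_def)
  then show ?thesis by (simp add: Dv_det det_mul)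
qed


section \<open>Ordered bases and orientations\<close>

lemma ordered_basis_iff:
  fixes bs :: "(real^'n::finite) list"
  shows "ordered_basis bs \<longleftrightarrow>
    (\<forall>c. (\<Sum>j<length bs. c j *\<^sub>R bs ! j) = 0 \<longrightarrow> (\<forall>j<length bs. c j = 0))"
proof (intro iffI allI impI)
  fix c j assume b: "ordered_basis bs" and 0: "(\<Sum>j<length bs. c j *\<^sub>R bs ! j) = 0" and j: "j < length bs"
  have bij: "bij_betw ((!) bs) {..<length bs} (set bs)"
    using b by (intro bij_betw_nth) (auto simp: ordered_basis_def)
  define u where "u v = c (inv_into {..<length bs} ((!) bs) v)" for v
  have u: "u (bs ! i) = c i" if "i < length bs" for i
    using bij_betw_inv_into_left[OF bij] that by (simp add: u_def)
  have "(\<Sum>v\<in>set bs. u v *\<^sub>R v) = (\<Sum>j<length bs. u (bs ! j) *\<^sub>R bs ! j)"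
    by (rule sum.reindex_bij_betw[OF bij, symmetric])
  also have "\<dots> = 0" using 0 u by simp
  finally have "u (bs ! j) = 0"
    using independentD[of "set bs" "set bs" u "bs ! j"] b j by (auto simp: ordered_basis_def)
  then show "c j = 0" using u j by simp
next
  assume *: "\<forall>c. (\<Sum>j<length bs. c j *\<^sub>R bs ! j) = 0 \<longrightarrow> (\<forall>j<length bs. c j = 0)"
  have d: "distinct bs"
    unfolding distinct_conv_nth
  proof (intro allI impI notI)
    fix i j assume ij: "i < length bs" "j < length bs" "i \<noteq> j" "bs ! i = bs ! j"
    let ?c = "\<lambda>k. if k = i then 1 else if k = j then -1 else 0 :: real"
    have "(\<Sum>k<length bs. ?c k *\<^sub>R bs ! k) =
        (\<Sum>k<length bs. (if k = i then bs ! k else 0) - (if k = j then bs ! k else 0))"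
      by (rule sum.cong) (use ij in auto)
    also have "\<dots> = 0" using ij by (simp add: sum_subtractf)
    finally have "(\<Sum>k<length bs. ?c k *\<^sub>R bs ! k) = 0" .
    from *[rule_format, OF this ij(1)] show False by simp
  qed
  have bij: "bij_betw ((!) bs) {..<length bs} (set bs)" by (rule bij_betw_nth[OF d]) auto
  have "independent (set bs)"
    unfolding dependent_finite[OF finite_set]
  proof clarify
    fix u v assume u: "v \<in> set bs" "u v \<noteq> 0" "(\<Sum>v\<in>set bs. u v *\<^sub>R v) = 0"
    then obtain j where j: "j < length bs" "bs ! j = v" by (auto simp: in_set_conv_nth)
    have "(\<Sum>v\<in>set bs. u v *\<^sub>R v) = (\<Sum>j<length bs. u (bs ! j) *\<^sub>R bs ! j)"
      by (rule sum.reindex_bij_betw[OF bij, symmetric])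
    then have "u (bs ! j) = 0" using *[rule_format, of "\<lambda>j. u (bs ! j)" j] u j by simp
    then show False using u j by simp
  qed
  then show "ordered_basis bs" using d by (simp add: ordered_basis_def)
qed

lemma ordered_basis_iff_Dv:
  fixes vs :: "(real^'n::{finite,linorder}) list"
  assumes len: "length vs = CARD('n)"
  shows "ordered_basis vs \<longleftrightarrow> Dv vs \<noteq> 0"
proof
  assume nz: "Dv vs \<noteq> 0"
  show "ordered_basis vs"
    unfolding ordered_basis_iff
  proof (intro allI impI)
    fix c j assume 0: "(\<Sum>j<length vs. c j *\<^sub>R vs ! j) = 0" "j < length vs"
    have "(\<Sum>j<CARD('n). (vs ! j) $ idx i * c j) = 0" for i
      using arg_cong[OF 0(1), of "\<lambda>x. x $ idx i"] len by (simp add: mult.commute)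
    then show "c j = 0"
      using detf_kernel[of "CARD('n)" "\<lambda>i j. (vs ! j) $ idx i" c j] nz 0 len by (simp add: Dv_def)
  qed
next
  assume b: "ordered_basis vs"
  show "Dv vs \<noteq> 0"
  proof
    assume "Dv vs = 0"
    then have "Determinants.det (\<chi> r c. (vs ! inv_into {..<CARD('n)} idx c) $ r) = 0" (is "Determinants.det ?A = 0")
      by (simp add: Dv_det)
    then have "\<not> inj ((*v) ?A)" using det_nz_iff_inj[of "(*v) ?A"] by simp
    then obtain x where x: "?A *v x = 0" "x \<noteq> 0"
      using linear_injective_0[OF matrix_vector_mul_linear[of ?A]] by blast
    have bij: "bij_betw (idx :: nat \<Rightarrow> 'n) {..<CARD('n)} UNIV" by (rule bij_idx)
    have "(\<Sum>j<CARD('n). (x $ idx j) *\<^sub>R vs ! j) = 0"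
    proof (rule vec_eq_idx)
      fix i assume "i < CARD('n)"
      have "(?A *v x) $ idx i = (\<Sum>c\<in>UNIV. (vs ! inv_into {..<CARD('n)} idx c) $ idx i * x $ c)"
        by (simp add: matrix_vector_mult_def)
      also have "\<dots> = (\<Sum>j<CARD('n). (vs ! inv_into {..<CARD('n)} idx (idx j :: 'n)) $ idx i * x $ idx j)"
        by (rule sum.reindex_bij_betw[OF bij, symmetric])
      also have "\<dots> = (\<Sum>j<CARD('n). (vs ! j) $ idx i * x $ idx j)"
        by (rule sum.cong) (use bij_betw_inv_into_left[OF bij] in auto)
      finally show "(\<Sum>j<CARD('n). (x $ idx j) *\<^sub>R vs ! j) $ idx i = 0 $ idx i"
        using x by (simp add: mult.commute)
    qed
    then have "x $ idx j = 0" if "j < CARD('n)" for j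
      using b[unfolded ordered_basis_iff, rule_format, of "\<lambda>j. x $ idx j"] len that by simp
    then have "x = 0" by (intro vec_eq_idx) auto
    then show False using x by simp
  qed
qed

lemma ordered_basis_append: "ordered_basis (bs @ cs) \<Longrightarrow> ordered_basis bs"
  "ordered_basis (bs @ cs) \<Longrightarrow> ordered_basis cs"
  using independent_mono[of "set bs \<union> set cs"] by (auto simp: ordered_basis_def)

lemma ordered_basis_snoc:
  assumes "ordered_basis bs" "v \<notin> span (set bs)"
  shows "ordered_basis (bs @ [v])"
  using assms by (auto simp: ordered_basis_def independent_insert intro: span_base)

lemma ordered_basis_card: "ordered_basis bs \<Longrightarrow> card (set bs) = length bs \<and> dim (span (set bs)) = length bs"
  by (simp add: ordered_basis_def distinct_card dim_span dim_eq_card_independent)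

lemma ordered_basis_extend:
  fixes bs :: "(real^'n::finite) list"
  assumes "ordered_basis bs"
  obtains ws where "ordered_basis (bs @ ws)" "length bs + length ws = CARD('n)"
proof -
  have "\<exists>ws. ordered_basis (bs @ ws) \<and> length ws = d" if "length bs + d \<le> CARD('n)" for d
    using that
  proof (induction d)
    case 0
    then show ?case using assms by (intro exI[of _ "[]"]) simp
  next
    case (Suc d)
    then obtain ws where ws: "ordered_basis (bs @ ws)" "length ws = d" by auto
    have "dim (span (set (bs @ ws))) = length bs + d" using ordered_basis_card[OF ws(1)] ws(2) by simp
    then have "span (set (bs @ ws)) \<noteq> UNIV" using Suc.prems by (metis DIM_cart DIM_real dim_UNIV mult.right_neutral Suc_n_not_le_n add_Suc_right)
    then obtain v where "v \<notin> span (set (bs @ ws))" by auto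
    then have "ordered_basis ((bs @ ws) @ [v])" using ws(1) by (rule ordered_basis_snoc[rotated])
    then show ?case using ws by (intro exI[of _ "ws @ [v]"]) simp
  qed
  moreover have "length bs \<le> CARD('n)"
    using ordered_basis_card[OF assms] dim_subset_UNIV[of "span (set bs)"] by simp
  ultimately show ?thesis using that[of _] by (metis le_add_diff_inverse order_refl)
qed

text \<open>The relation \<open>base_change\<close> with the coefficients in an array in place of a matrix of fixed size.\<close>

definition changes :: "(real^'n) list \<Rightarrow> (real^'n) list \<Rightarrow> (nat \<Rightarrow> nat \<Rightarrow> real) \<Rightarrow> bool" where
  "changes bs cs F \<longleftrightarrow> length bs = length cs \<and>
     (\<forall>j<length cs. cs ! j = (\<Sum>i<length bs. F i j *\<^sub>R bs ! i))"

lemma base_change_iff: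
  "(\<exists>M. base_change bs cs M \<and> P (Determinant.det M)) \<longleftrightarrow> (\<exists>F. changes bs cs F \<and> P (detf (length bs) F))"
proof
  assume "\<exists>M. base_change bs cs M \<and> P (Determinant.det M)"
  then obtain M where M: "base_change bs cs M" "P (Determinant.det M)" by blast
  then have "Matrix.mat (length bs) (length bs) (\<lambda>(i, j). M $$ (i, j)) = M"
    by (intro eq_matI) (auto simp: base_change_def)
  then have "detf (length bs) (\<lambda>i j. M $$ (i, j)) = Determinant.det M" by (simp add: detf_def)
  moreover have "changes bs cs (\<lambda>i j. M $$ (i, j))" using M by (simp add: base_change_def changes_def)
  ultimately show "\<exists>F. changes bs cs F \<and> P (detf (length bs) F)" using M(2) by metis
next
  assume "\<exists>F. changes bs cs F \<and> P (detf (length bs) F)"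
  then obtain F where F: "changes bs cs F" "P (detf (length bs) F)" by blast
  let ?M = "Matrix.mat (length bs) (length bs) (\<lambda>(i, j). F i j)"
  have "base_change bs cs ?M" using F(1) by (auto simp: base_change_def changes_def)
  then show "\<exists>M. base_change bs cs M \<and> P (Determinant.det M)"
    using F(2) by (intro exI[of _ ?M]) (simp add: detf_def)
qed

lemma same_orientation_iff: "same_orientation bs cs \<longleftrightarrow>
    ordered_basis bs \<and> ordered_basis cs \<and> (\<exists>F. changes bs cs F \<and> detf (length bs) F > 0)"
  unfolding same_orientation_def base_change_iff[where P = "\<lambda>d. d > 0"] ..

lemma opposite_orientation_iff: "opposite_orientation bs cs \<longleftrightarrow>
    ordered_basis bs \<and> ordered_basis cs \<and> (\<exists>F. changes bs cs F \<and> detf (length bs) F < 0)"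
  unfolding opposite_orientation_def base_change_iff[where P = "\<lambda>d. d < 0"] ..

lemma changes_trans:
  assumes "changes bs cs F" "changes cs ds G"
  shows "changes bs ds (mmult (length bs) F G)"
  unfolding changes_def
proof (intro conjI allI impI)
  show "length bs = length ds" using assms by (simp add: changes_def)
  fix j assume j: "j < length ds"
  have "ds ! j = (\<Sum>k<length bs. G k j *\<^sub>R (\<Sum>i<length bs. F i k *\<^sub>R bs ! i))"
    using assms j by (auto simp: changes_def)
  also have "\<dots> = (\<Sum>i<length bs. mmult (length bs) F G i j *\<^sub>R bs ! i)"
    unfolding mmult_def scaleR_sum_left scaleR_sum_right by (subst sum.swap) (simp add: mult.commute)
  finally show "ds ! j = (\<Sum>i<length bs. mmult (length bs) F G i j *\<^sub>R bs ! i)" .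
qed

lemma sum_delta_scaleR:
  fixes f :: "nat \<Rightarrow> 'a::real_vector"
  shows "j < n \<Longrightarrow> (\<Sum>i<n. (if i = j then r else 0) *\<^sub>R f i) = r *\<^sub>R f j"
proof -
  assume j: "j < n"
  have "(\<Sum>i<n. (if i = j then r else 0) *\<^sub>R f i) = (\<Sum>i<n. if i = j then r *\<^sub>R f i else 0)"
    by (rule sum.cong) auto
  then show ?thesis using j by simp
qed

lemma changes_scale: "changes bs (map ((*\<^sub>R) r) bs) (\<lambda>i j. if i = j then r else 0)"
  by (simp add: changes_def sum_delta_scaleR)

lemma detf_scalar: "detf p (\<lambda>i j. if i = j then r else 0) = r ^ p"
  by (subst detf_lower) auto

lemma changes_refl: "changes bs bs (\<lambda>i j. if i = j then 1 else 0)"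
  using changes_scale[of bs 1] by (simp add: map_idI)

lemma changes_sym:
  assumes F: "changes bs cs F" "detf (length bs) F \<noteq> 0"
  obtains G where "changes cs bs G" "detf (length bs) G * detf (length bs) F = 1"
proof -
  let ?p = "length bs"
  obtain S where S: "\<And>i j. i < ?p \<Longrightarrow> j < ?p \<Longrightarrow> mmult ?p F S i j = (if i = j then 1 else 0)"
    using inverse_array[OF F(2)] by metis
  have "changes cs bs S"
    unfolding changes_def
  proof (intro conjI allI impI)
    show "length cs = length bs" using F by (simp add: changes_def)
    fix j assume j: "j < length bs"
    have "(\<Sum>i<length cs. S i j *\<^sub>R cs ! i) = (\<Sum>i<?p. S i j *\<^sub>R (\<Sum>k<?p. F k i *\<^sub>R bs ! k))"
      using F by (auto simp: changes_def)
    also have "\<dots> = (\<Sum>k<?p. mmult ?p F S k j *\<^sub>R bs ! k)"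
      unfolding mmult_def scaleR_sum_left scaleR_sum_right by (subst sum.swap) (simp add: mult.commute)
    also have "\<dots> = (\<Sum>k<?p. (if k = j then 1 else 0) *\<^sub>R bs ! k)"
      using S j by (intro sum.cong) auto
    finally show "bs ! j = (\<Sum>i<length cs. S i j *\<^sub>R cs ! i)" using j by (simp add: sum_delta_scaleR)
  qed
  moreover have "detf ?p S * detf ?p F = 1"
  proof -
    have "detf ?p F * detf ?p S = detf ?p (\<lambda>i j. if i = j then 1 else 0)"
      unfolding detf_mult[symmetric] by (rule detf_cong) (use S in \<open>simp add: mmult_def\<close>)
    then show ?thesis by (simp add: detf_scalar mult.commute)
  qed
  ultimately show ?thesis using that by blast
qed

lemma changes_exists:
  assumes "ordered_basis bs" "set cs \<subseteq> span (set bs)" "length cs = length bs"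
  obtains F where "changes bs cs F"
proof -
  have "\<exists>f. v = (\<Sum>i<length bs. f i *\<^sub>R bs ! i)" if v: "v \<in> span (set bs)" for v
  proof -
    have bij: "bij_betw ((!) bs) {..<length bs} (set bs)"
      using assms(1) by (intro bij_betw_nth) (auto simp: ordered_basis_def)
    obtain u where "v = (\<Sum>w\<in>set bs. u w *\<^sub>R w)" using v by (auto simp: span_finite)
    also have "\<dots> = (\<Sum>i<length bs. u (bs ! i) *\<^sub>R bs ! i)"
      by (rule sum.reindex_bij_betw[OF bij, symmetric])
    finally show ?thesis by (intro exI)
  qed
  then have "\<forall>j<length cs. \<exists>f. cs ! j = (\<Sum>i<length bs. f i *\<^sub>R bs ! i)" using assms(2) nth_mem by blast
  then obtain f where "\<forall>j<length cs. cs ! j = (\<Sum>i<length bs. f j i *\<^sub>R bs ! i)" by metis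
  then have "changes bs cs (\<lambda>i j. f j i)" using assms(3) by (simp add: changes_def)
  then show ?thesis using that by blast
qed

lemma changes_span:
  assumes "changes bs cs F"
  shows "set cs \<subseteq> span (set bs)"
proof
  fix v assume "v \<in> set cs"
  then obtain j where "j < length cs" "v = cs ! j" by (auto simp: in_set_conv_nth)
  then have "v = (\<Sum>i<length bs. F i j *\<^sub>R bs ! i)" using assms by (simp add: changes_def)
  also have "\<dots> \<in> span (set bs)" by (intro span_sum span_scale span_base) simp
  finally show "v \<in> span (set bs)" .
qed

lemma Dv_changes:
  fixes us bs ws cs :: "(real^'n::{finite,linorder}) list"
  assumes F: "changes bs cs F" and len: "length us + length bs + length ws = CARD('n)"
  shows "Dv (us @ cs @ ws) = detf (length bs) F * Dv (us @ bs @ ws)"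
proof -
  let ?u = "length us" and ?p = "length bs"
  let ?X = "\<lambda>r b. if ?u \<le> r \<and> r < ?u + ?p then F (r - ?u) b else 0"
  have "Dv (us @ cs @ ws) = detf ?p (\<lambda>a b. ?X (?u + a) b) * Dv (us @ bs @ ws)"
  proof (rule Dv_middle[OF len])
    show "length cs = length bs" using F by (simp add: changes_def)
    fix b assume b: "b < length bs"
    have "(\<Sum>r<CARD('n). ?X r b *\<^sub>R (us @ bs @ ws) ! r) =
        (\<Sum>r\<in>{?u..<?u + ?p}. ?X r b *\<^sub>R (us @ bs @ ws) ! r)"
      by (rule sum.mono_neutral_right) (use len in auto)
    also have "\<dots> = (\<Sum>i<?p. F i b *\<^sub>R bs ! i)"
      by (rule sum.reindex_bij_witness[of _ "\<lambda>i. ?u + i" "\<lambda>r. r - ?u"]) (auto simp: nth_append)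
    also have "\<dots> = cs ! b" using F b by (simp add: changes_def)
    finally show "cs ! b = (\<Sum>r<CARD('n). ?X r b *\<^sub>R (us @ bs @ ws) ! r)" by simp
  qed
  also have "detf ?p (\<lambda>a b. ?X (?u + a) b) = detf ?p F" by (rule detf_cong) auto
  finally show ?thesis .
qed

lemma changes_basis:
  fixes bs cs :: "(real^'n::{finite,linorder}) list"
  assumes "changes bs cs F" "ordered_basis bs"
  shows "ordered_basis cs \<longleftrightarrow> detf (length bs) F \<noteq> 0"
proof -
  obtain ws where ws: "ordered_basis (bs @ ws)" "length bs + length ws = CARD('n)"
    using ordered_basis_extend[OF assms(2)] by metis
  have len: "length cs = length bs" using assms by (simp add: changes_def)
  have eq: "Dv (cs @ ws) = detf (length bs) F * Dv (bs @ ws)"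
    using Dv_changes[OF assms(1), of "[]" ws] ws(2) by simp
  have nz: "Dv (bs @ ws) \<noteq> 0" using ws ordered_basis_iff_Dv[of "bs @ ws"] by simp
  show ?thesis
  proof
    assume cs: "ordered_basis cs"
    show "detf (length bs) F \<noteq> 0"
    proof
      assume "detf (length bs) F = 0"
      have "set bs \<subseteq> span (set cs)"
      proof -
        have "span (set cs) \<subseteq> span (set bs)"
          using span_mono[OF changes_span[OF assms(1)]] by (simp add: span_span)
        then have "span (set cs) = span (set bs)"
          using ordered_basis_card[OF cs] ordered_basis_card[OF assms(2)] len
          by (intro subspace_dim_equal) auto
        then show ?thesis using span_superset by blast
      qed
      then obtain G where "changes cs bs G" using changes_exists[OF cs] len by metis
      then have "Dv (bs @ ws) = detf (length cs) G * Dv (cs @ ws)"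
        using Dv_changes[of cs bs G "[]" ws] ws(2) len by simp
      then show False using eq \<open>detf (length bs) F = 0\<close> nz by simp
    qed
  next
    assume "detf (length bs) F \<noteq> 0"
    then have "Dv (cs @ ws) \<noteq> 0" using eq nz by simp
    then show "ordered_basis cs"
      using ordered_basis_iff_Dv[of "cs @ ws"] ws(2) len by (metis length_append ordered_basis_append(1))
  qed
qed

lemma same_orientation_refl: "ordered_basis bs \<Longrightarrow> same_orientation bs bs"
  unfolding same_orientation_iff using changes_refl[of bs] by (auto simp: detf_scalar)

lemma same_orientation_sym:
  assumes "same_orientation bs cs"
  shows "same_orientation cs bs"
proof -
  obtain F where F: "changes bs cs F" "detf (length bs) F > 0" "ordered_basis bs" "ordered_basis cs"
    using assms by (auto simp: same_orientation_iff)
  then obtain G where G: "changes cs bs G" "detf (length bs) G * detf (length bs) F = 1"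
    using changes_sym[of bs cs F] by auto
  then have "detf (length bs) G * detf (length bs) F > 0" by simp
  then have "detf (length bs) G > 0" using F(2) by (rule zero_less_mult_pos2)
  then show ?thesis unfolding same_orientation_iff using F G by (auto simp: changes_def)
qed

lemma same_orientation_trans:
  assumes "same_orientation bs cs" "same_orientation cs ds"
  shows "same_orientation bs ds"
proof -
  obtain F where F: "changes bs cs F" "detf (length bs) F > 0" "ordered_basis bs"
    using assms(1) by (auto simp: same_orientation_iff)
  obtain G where G: "changes cs ds G" "detf (length cs) G > 0" "ordered_basis ds"
    using assms(2) by (auto simp: same_orientation_iff)
  have "length cs = length bs" using F by (simp add: changes_def)
  then have "detf (length bs) (mmult (length bs) F G) > 0"
    using F G by (simp add: mmult_def detf_mult)
  then show ?thesis unfolding same_orientation_iff using changes_trans[OF F(1) G(1)] F G by blast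
qed

lemma orientation_of_eq_iff:
  assumes "ordered_basis bs"
  shows "orientation_of bs = orientation_of cs \<longleftrightarrow> same_orientation bs cs"
  using same_orientation_refl[OF assms] same_orientation_sym same_orientation_trans
  unfolding orientation_of_def by blast

lemma same_orientation_Dv:
  fixes us bs ws cs :: "(real^'n::{finite,linorder}) list"
  assumes "same_orientation bs cs" "length us + length bs + length ws = CARD('n)"
  shows "Dv (us @ cs @ ws) > 0 \<longleftrightarrow> Dv (us @ bs @ ws) > 0"
proof -
  obtain F where F: "changes bs cs F" "detf (length bs) F > 0"
    using assms(1) by (auto simp: same_orientation_iff)
  show ?thesis using Dv_changes[OF F(1) assms(2)] F(2) by (simp add: zero_less_mult_iff)
qed

lemma same_orientation_length: "same_orientation bs cs \<Longrightarrow> length bs = length cs"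
  by (auto simp: same_orientation_iff changes_def)

text \<open>Two bases of one subspace have the same orientation if this can be seen after completing both by
  the same vectors to bases of the whole space.\<close>

lemma same_orientation_if_Dv:
  fixes us bs ws cs :: "(real^'n::{finite,linorder}) list"
  assumes b: "ordered_basis bs" "ordered_basis cs" "set cs \<subseteq> span (set bs)" "length cs = length bs"
    and len: "length us + length bs + length ws = CARD('n)"
    and D: "Dv (us @ bs @ ws) * Dv (us @ cs @ ws) > 0"
  shows "same_orientation bs cs"
proof -
  obtain F where F: "changes bs cs F" using changes_exists[OF b(1,3,4)] .
  have "Dv (us @ bs @ ws) * (detf (length bs) F * Dv (us @ bs @ ws)) > 0"
    using D Dv_changes[OF F len] by simp
  then have "detf (length bs) F > 0" by (auto simp: zero_less_mult_iff mult_less_0_iff)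
  then show ?thesis unfolding same_orientation_iff using F b by blast
qed

lemma same_orientation_full:
  fixes bs cs :: "(real^'n::{finite,linorder}) list"
  assumes "length bs = CARD('n)" "length cs = CARD('n)" "Dv bs > 0" "Dv cs > 0"
  shows "same_orientation bs cs"
proof (rule same_orientation_if_Dv[of _ _ "[]" "[]"])
  show b: "ordered_basis bs" "ordered_basis cs" using assms by (simp_all add: ordered_basis_iff_Dv)
  have "dim (span (set bs)) = CARD('n)" using ordered_basis_card[OF b(1)] assms by simp
  then have "span (set bs) = UNIV" using dim_eq_full[of "set bs"] by simp
  then show "set cs \<subseteq> span (set bs)" by simp
qed (use assms in auto)

lemma same_orientation_span: "same_orientation bs cs \<Longrightarrow> span (set bs) = span (set cs)"
proof -
  assume "same_orientation bs cs"
  then have "set cs \<subseteq> span (set bs)" "set bs \<subseteq> span (set cs)"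
    using same_orientation_sym[of bs cs] unfolding same_orientation_iff by (auto dest: changes_span)
  then show ?thesis by (simp add: span_eq)
qed

lemma underlying_orientation_of:
  assumes "ordered_basis bs"
  shows "underlying (orientation_of bs) = span (set bs)"
proof -
  have "span (set cs) = span (set bs)" if "cs \<in> orientation_of bs" for cs
    using same_orientation_span[of bs cs] that by (simp add: orientation_of_def)
  moreover have "bs \<in> orientation_of bs" using same_orientation_refl[OF assms] by (simp add: orientation_of_def)
  ultimately show ?thesis unfolding underlying_def by blast
qed

definition std_basis :: "(real^'n::{finite,linorder}) list" where
  "std_basis = map (\<lambda>i. axis i 1) (sorted_list_of_set UNIV)"

lemma length_std_basis [simp]: "length (std_basis :: (real^'n::{finite,linorder}) list) = CARD('n)"
  by (simp add: std_basis_def)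

lemma Dv_std_basis: "Dv (std_basis :: (real^'n::{finite,linorder}) list) = 1"
  unfolding Dv_def std_basis_def
  by (subst detf_cong[where G = "\<lambda>i j. if i = j then 1 else 0"])
    (auto simp: axis_def idx_eq_iff[where 'n = 'n, unfolded idx_def] idx_def detf_scalar)

lemma standard_orientation_eq:
  "standard_orientation = {bs :: (real^'n::{finite,linorder}) list. length bs = CARD('n) \<and> Dv bs > 0}"
proof -
  have "same_orientation std_basis bs \<longleftrightarrow> length bs = CARD('n) \<and> Dv bs > 0"
    for bs :: "(real^'n::{finite,linorder}) list"
    using same_orientation_full[of std_basis bs] same_orientation_length[of std_basis bs]
      same_orientation_Dv[of std_basis bs "[]" "[]"] Dv_std_basis[where 'n = 'n] by auto
  then show ?thesis unfolding standard_orientation_def orientation_of_def std_basis_def by auto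
qed

lemma oriented_sum_standard:
  fixes as bs cs :: "(real^'n::{finite,linorder}) list"
  assumes len: "length as + length bs + length cs = CARD('n)"
    and b: "ordered_basis as" "ordered_basis bs" "ordered_basis cs"
  shows "orientation_of as \<oplus>\<^sub>o orientation_of bs \<oplus>\<^sub>o orientation_of cs = standard_orientation
    \<longleftrightarrow> Dv (as @ bs @ cs) > 0"
proof -
  have D: "Dv ds > 0 \<longleftrightarrow> Dv (as @ bs @ cs) > 0"
    if "same_orientation as as'" "same_orientation bs bs'" "same_orientation cs cs'"
      "same_orientation (as' @ bs') xs" "same_orientation (xs @ cs') ds" for as' bs' cs' xs ds
  proof -
    note l = that[THEN same_orientation_length]
    have "Dv ds > 0 \<longleftrightarrow> Dv (xs @ cs') > 0"
      using same_orientation_Dv[OF that(5), of "[]" "[]"] l len by simp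
    also have "\<dots> \<longleftrightarrow> Dv (as' @ bs' @ cs') > 0"
      using same_orientation_Dv[OF that(4), of "[]" cs'] l len by simp
    also have "\<dots> \<longleftrightarrow> Dv (as' @ bs' @ cs) > 0"
      using same_orientation_Dv[OF that(3), of "as' @ bs'" "[]"] l len by simp
    also have "\<dots> \<longleftrightarrow> Dv (as' @ bs @ cs) > 0"
      using same_orientation_Dv[OF that(2), of as' cs] l len by simp
    also have "\<dots> \<longleftrightarrow> Dv (as @ bs @ cs) > 0"
      using same_orientation_Dv[OF that(1), of "[]" "bs @ cs"] l len by simp
    finally show ?thesis .
  qed
  let ?V = "orientation_of as \<oplus>\<^sub>o orientation_of bs \<oplus>\<^sub>o orientation_of cs"
  have mem: "ds \<in> ?V \<longleftrightarrow> (\<exists>as' bs' cs' xs. same_orientation as as' \<and> same_orientation bs bs' \<and>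
      same_orientation cs cs' \<and> same_orientation (as' @ bs') xs \<and> same_orientation (xs @ cs') ds)" for ds
    unfolding oriented_sum_def orientation_of_def by blast
  show ?thesis
  proof
    assume eq: "?V = standard_orientation"
    have "std_basis \<in> ?V" unfolding eq standard_orientation_eq by (simp add: Dv_std_basis)
    then obtain as' bs' cs' xs where *: "same_orientation as as'" "same_orientation bs bs'"
        "same_orientation cs cs'" "same_orientation (as' @ bs') xs" "same_orientation (xs @ cs') std_basis"
      unfolding mem by blast
    show "Dv (as @ bs @ cs) > 0" using D[OF *] by (simp add: Dv_std_basis)
  next
    assume pos: "Dv (as @ bs @ cs) > 0"
    then have ob: "ordered_basis (as @ bs @ cs)" using ordered_basis_iff_Dv[of "as @ bs @ cs"] len by simp
    then have ab: "ordered_basis (as @ bs)" using ordered_basis_append(1)[of "as @ bs" cs] by simp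
    show "?V = standard_orientation"
    proof (intro equalityI subsetI)
      fix ds assume "ds \<in> ?V"
      then obtain as' bs' cs' xs where *: "same_orientation as as'" "same_orientation bs bs'"
        "same_orientation cs cs'" "same_orientation (as' @ bs') xs" "same_orientation (xs @ cs') ds"
        unfolding mem by blast
      have "length ds = CARD('n)" using *[THEN same_orientation_length] len by simp
      then show "ds \<in> standard_orientation" using D[OF *] pos by (simp add: standard_orientation_eq)
    next
      fix ds assume "ds \<in> (standard_orientation :: 'n oriented)"
      then have ds: "length ds = CARD('n)" "Dv ds > 0" by (auto simp: standard_orientation_eq)
      have "same_orientation ((as @ bs) @ cs) ds" using same_orientation_full[of "as @ bs @ cs" ds] ds pos len by simp
      then show "ds \<in> ?V" unfolding mem using b ab same_orientation_refl by blast
    qed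
  qed
qed


section \<open>Flags given by bases\<close>

definition pos_basis :: "(real^'n::{finite,linorder}) list \<Rightarrow> bool" where
  "pos_basis vs \<longleftrightarrow> length vs = CARD('n) \<and> Dv vs > 0"

definition scale :: "real \<Rightarrow> (real^'n) list \<Rightarrow> (real^'n) list" where
  "scale s vs = map ((*\<^sub>R) s) vs"

lemma scale_simps [simp]:
  "length (scale s vs) = length vs" "take i (scale s vs) = scale s (take i vs)"
  "drop i (scale s vs) = scale s (drop i vs)" "scale s (scale t vs) = scale (s * t) vs"
  "scale 1 vs = vs" "scale s [v] = [s *\<^sub>R v]" "scale s (vs @ ws) = scale s vs @ scale s ws"
  "i < length vs \<Longrightarrow> scale s vs ! i = s *\<^sub>R vs ! i" "set (scale s vs) = ((*\<^sub>R) s) ` set vs"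
  by (simp_all add: scale_def take_map drop_map map_idI)

lemmas changes_scale' = changes_scale[folded scale_def]

definition lift_of :: "(real^'n::{finite,linorder}) list \<Rightarrow> 'n lift" where
  "lift_of vs = (\<lambda>i. if i < CARD('n) then orientation_of (take i vs) else {})"

text \<open>The two lifts of the oriented flag of the initial segments. In even dimension a sign change of all
  vectors preserves the orientation of the whole space and reverses exactly the odd-dimensional
  subspaces.\<close>

definition flag_of :: "(real^'n::{finite,linorder}) list \<Rightarrow> 'n flag" where
  "flag_of vs = (\<lambda>s. lift_of (scale s vs)) ` {1, -1}"

lemma pos_basis_ordered: "pos_basis vs \<Longrightarrow> ordered_basis vs"
  using ordered_basis_iff_Dv[of vs] by (simp add: pos_basis_def)

lemma pos_basis_take: "pos_basis vs \<Longrightarrow> ordered_basis (take i vs)"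
  using pos_basis_ordered[of vs] ordered_basis_append(1)[of "take i vs" "drop i vs"] by simp

lemma pos_basis_drop: "pos_basis vs \<Longrightarrow> ordered_basis (drop i vs)"
  using pos_basis_ordered[of vs] ordered_basis_append(2)[of "take i vs" "drop i vs"] by simp

lemma Dv_scale_middle:
  fixes us bs ws :: "(real^'n::{finite,linorder}) list"
  assumes "length us + length bs + length ws = CARD('n)"
  shows "Dv (us @ scale s bs @ ws) = s ^ length bs * Dv (us @ bs @ ws)"
  using Dv_changes[OF changes_scale'[of bs s] assms] by (simp add: detf_scalar)

lemma sign_sq: "s \<in> {1, -1} \<Longrightarrow> s * s = (1 :: real)"
  by auto

lemma pos_basis_scale:
  fixes vs :: "(real^'n::{finite,linorder}) list"
  assumes "even CARD('n)" "s \<in> {1, -1}" "pos_basis vs"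
  shows "pos_basis (scale s vs)"
  using Dv_scale_middle[of "[]" vs "[]" s] assms by (auto simp: pos_basis_def)

lemma ordered_basis_scale: "r \<noteq> 0 \<Longrightarrow> ordered_basis (bs :: (real^'n::{finite,linorder}) list) \<Longrightarrow> ordered_basis (scale r bs)"
  using changes_basis[OF changes_scale'[of bs r]] by (simp add: detf_scalar)

lemma changes_both_scale: "changes bs cs F \<Longrightarrow> changes (scale r bs) (scale r cs) F"
  by (auto simp: changes_def scaleR_sum_right mult.commute)

lemma same_orientation_scale:
  fixes bs cs :: "(real^'n::{finite,linorder}) list"
  assumes "same_orientation bs cs" "r \<noteq> 0"
  shows "same_orientation (scale r bs) (scale r cs)"
  using assms unfolding same_orientation_iff
  by (auto intro: ordered_basis_scale changes_both_scale)

lemma same_orientation_neg_even: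
  fixes bs :: "(real^'n::{finite,linorder}) list"
  assumes "ordered_basis bs" "even (length bs)"
  shows "same_orientation bs (scale (-1) bs)"
  unfolding same_orientation_iff using assms changes_scale'[of bs "-1"] ordered_basis_scale[of "-1" bs]
  by (auto simp: detf_scalar intro!: exI[of _ "\<lambda>i j. if i = j then -1 else 0"])

lemma detf_neg: "detf p (\<lambda>i j. - F i j) = (-1) ^ p * detf p F"
  using detf_scale[of p "\<lambda>_. -1" F] by simp

lemma opposite_orientation_odd:
  fixes bs cs :: "(real^'n::{finite,linorder}) list"
  assumes "odd (length bs)"
  shows "opposite_orientation bs cs \<longleftrightarrow> same_orientation (scale (-1) bs) cs"
proof -
  have 1: "changes (scale (-1) bs) cs (\<lambda>i j. - F i j)" if "changes bs cs F" for F
    using that by (simp add: changes_def)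
  have 2: "changes bs cs (\<lambda>i j. - F i j)" if "changes (scale (-1) bs) cs F" for F
    using that by (simp add: changes_def)
  have 3: "detf (length bs) (\<lambda>i j. - F i j) = - detf (length bs) F" for F
    using assms by (simp add: detf_neg)
  have 4: "ordered_basis (scale (-1) bs) \<longleftrightarrow> ordered_basis bs"
    using ordered_basis_scale[of "-1" bs] ordered_basis_scale[of "-1" "scale (-1) bs"] by auto
  have "(\<exists>F. changes bs cs F \<and> detf (length bs) F < 0) \<longleftrightarrow>
      (\<exists>F. changes (scale (-1) bs) cs F \<and> detf (length bs) F > 0)"
  proof
    assume "\<exists>F. changes bs cs F \<and> detf (length bs) F < 0"
    then obtain F where "changes bs cs F" "detf (length bs) F < 0" by blast
    then show "\<exists>F. changes (scale (-1) bs) cs F \<and> detf (length bs) F > 0"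
      using 1 3[of F] by (intro exI[of _ "\<lambda>i j. - F i j"]) simp
  next
    assume "\<exists>F. changes (scale (-1) bs) cs F \<and> detf (length bs) F > 0"
    then obtain F where "changes (scale (-1) bs) cs F" "detf (length bs) F > 0" by blast
    then show "\<exists>F. changes bs cs F \<and> detf (length bs) F < 0"
      using 2 3[of F] by (intro exI[of _ "\<lambda>i j. - F i j"]) simp
  qed
  then show ?thesis unfolding same_orientation_iff opposite_orientation_iff 4 by simp
qed

lemma reverse_orientation_odd:
  fixes bs :: "(real^'n::{finite,linorder}) list"
  assumes b: "ordered_basis bs" "odd (length bs)"
  shows "reverse_orientation (orientation_of bs) = orientation_of (scale (-1) bs)"
proof (intro equalityI subsetI)
  fix cs assume "cs \<in> reverse_orientation (orientation_of bs)"
  then obtain bs' where *: "same_orientation bs bs'" "opposite_orientation bs' cs"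
    by (auto simp: reverse_orientation_def orientation_of_def)
  then have "same_orientation (scale (-1) bs') cs"
    using opposite_orientation_odd[of bs' cs] same_orientation_length[of bs bs'] b by simp
  then show "cs \<in> orientation_of (scale (-1) bs)"
    using same_orientation_trans[OF same_orientation_scale[OF *(1), of "-1"]] by (simp add: orientation_of_def)
next
  fix cs assume "cs \<in> orientation_of (scale (-1) bs)"
  then have "opposite_orientation bs cs" using opposite_orientation_odd[OF b(2)] by (simp add: orientation_of_def)
  then show "cs \<in> reverse_orientation (orientation_of bs)"
    using same_orientation_refl[OF b(1)] by (auto simp: reverse_orientation_def orientation_of_def)
qed

lemma reverse_odd_lift_of:
  fixes vs :: "(real^'n::{finite,linorder}) list"
  assumes "pos_basis vs"
  shows "reverse_odd (lift_of vs) = lift_of (scale (-1) vs)"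
proof
  fix i
  have len: "length (take i vs) = i" if "i < CARD('n)" using assms that by (simp add: pos_basis_def)
  show "reverse_odd (lift_of vs) i = lift_of (scale (-1) vs) i"
  proof (cases "i < CARD('n)")
    case True
    note b = pos_basis_take[OF assms, of i]
    show ?thesis
    proof (cases "odd i")
      case True
      then show ?thesis
        using reverse_orientation_odd[OF b] len \<open>i < _\<close> by (simp add: reverse_odd_def lift_of_def take_map)
    next
      case False
      then have "orientation_of (take i vs) = orientation_of (scale (-1) (take i vs))"
        using same_orientation_neg_even[OF b] len \<open>i < _\<close> orientation_of_eq_iff[OF b] by simp
      then show ?thesis using False by (simp add: reverse_odd_def lift_of_def take_map)
    qed
  next
    case False
    then show ?thesis by (auto simp: reverse_odd_def lift_of_def reverse_orientation_def)
  qed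
qed

lemma lift_of_in_lifts:
  assumes "pos_basis (vs :: (real^'n::{finite,linorder}) list)"
  shows "lift_of vs \<in> lifts"
  unfolding lifts_def
proof (intro CollectI conjI allI impI)
  note b = pos_basis_take[OF assms]
  have len: "length vs = CARD('n)" using assms by (simp add: pos_basis_def)
  show "lift_of vs i \<in> oriented_subspaces i" if "i < CARD('n)" for i
    using b[of i] that len by (auto simp: oriented_subspaces_def lift_of_def intro!: exI[of _ "take i vs"])
  show "underlying (lift_of vs i) \<subseteq> underlying (lift_of vs (Suc i))" if "Suc i < CARD('n)" for i
    using that b by (auto simp: lift_of_def underlying_orientation_of intro!: span_mono set_take_subset_set_take elim!: subsetD[OF span_mono, rotated])
  show "lift_of vs i = {}" if "i \<ge> CARD('n)" for i using that by (simp add: lift_of_def)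
qed

text \<open>A basis is built from dimension to dimension; the sign of the last vector is chosen so that
  the oriented subspace is met. The vector completing the flag to the whole space is
  normalized by the standard orientation.\<close>

lemma lift_has_basis:
  fixes F :: "'n::{finite,linorder} lift"
  assumes "F \<in> lifts"
  obtains vs where "pos_basis vs" "F = lift_of vs"
proof -
  let ?n = "CARD('n)"
  have sub: "F i \<in> oriented_subspaces i" if "i < ?n" for i using assms that by (simp add: lifts_def)
  have mono: "underlying (F i) \<subseteq> underlying (F (Suc i))" if "Suc i < ?n" for i
    using assms that by (simp add: lifts_def)
  have "\<exists>vs. length vs = d \<and> ordered_basis vs \<and> (\<forall>i\<le>d. F i = orientation_of (take i vs))" if "d < ?n" for d
    using that
  proof (induction d)
    case 0
    then show ?case using sub[of 0] by (auto simp: oriented_subspaces_def intro!: exI[of _ "[]"])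
  next
    case (Suc d)
    then obtain vs where vs: "length vs = d" "ordered_basis vs" "\<forall>i\<le>d. F i = orientation_of (take i vs)" by auto
    obtain bs where bs: "F (Suc d) = orientation_of bs" "ordered_basis bs" "length bs = Suc d"
      using sub[OF Suc.prems] by (auto simp: oriented_subspaces_def)
    have span: "span (set vs) \<subseteq> span (set bs)"
      using mono[OF Suc.prems] vs bs by (simp add: underlying_orientation_of)
    have "\<not> span (set bs) \<subseteq> span (set vs)"
      using dim_subset[of "span (set bs)" "span (set vs)"] ordered_basis_card[OF bs(2)] ordered_basis_card[OF vs(2)] vs bs by auto
    then obtain v where v: "v \<in> span (set bs)" "v \<notin> span (set vs)" by blast
    have b: "ordered_basis (vs @ [v])" using ordered_basis_snoc[OF vs(2) v(2)] .
    obtain ws where ws: "ordered_basis ((vs @ [v]) @ ws)" "length (vs @ [v]) + length ws = ?n"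
      using ordered_basis_extend[OF b] by blast
    have setv: "set (vs @ [v]) \<subseteq> span (set bs)" using span v(1) span_superset[of "set vs"] by auto
    obtain F' where F': "changes bs (vs @ [v]) F'" using changes_exists[OF bs(2) setv] vs bs by auto
    have nz: "Dv (vs @ [v] @ ws) \<noteq> 0" using ws ordered_basis_iff_Dv[of "(vs @ [v]) @ ws"] by simp
    have "Dv (vs @ [v] @ ws) = detf (Suc d) F' * Dv (bs @ ws)"
      using Dv_changes[OF F', of "[]" ws] ws vs bs by simp
    then have nz': "Dv (bs @ ws) \<noteq> 0" using nz by auto
    define s where "s = (if Dv (bs @ ws) * Dv (vs @ [v] @ ws) > 0 then 1 else -1 :: real)"
    have D: "Dv (vs @ scale s [v] @ ws) = s * Dv (vs @ [v] @ ws)"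
      using Dv_scale_middle[of vs "[v]" ws s] ws(2) by simp
    then have "Dv (vs @ scale s [v] @ ws) \<noteq> 0" using nz by (simp add: s_def)
    then have b': "ordered_basis ((vs @ [s *\<^sub>R v]) @ ws)"
      using ws(2) ordered_basis_iff_Dv[of "(vs @ [s *\<^sub>R v]) @ ws"] by simp
    have "same_orientation bs (vs @ [s *\<^sub>R v])"
    proof (rule same_orientation_if_Dv[of _ _ "[]" ws])
      show "set (vs @ [s *\<^sub>R v]) \<subseteq> span (set bs)" using setv by (auto intro: span_scale)
      have "Dv (bs @ ws) * (s * Dv (vs @ [v] @ ws)) > 0" using nz nz' by (auto simp: s_def zero_less_mult_iff)
      then show "Dv ([] @ bs @ ws) * Dv ([] @ (vs @ [s *\<^sub>R v]) @ ws) > 0" using D by simp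
      show "ordered_basis (vs @ [s *\<^sub>R v])" using b' ordered_basis_append(1) by blast
    qed (use bs vs ws in auto)
    then have "F (Suc d) = orientation_of (vs @ [s *\<^sub>R v])" using bs orientation_of_eq_iff by metis
    then show ?case
      using vs b' ordered_basis_append(1)[OF b'] by (intro exI[of _ "vs @ [s *\<^sub>R v]"]) (auto simp: le_Suc_eq)
  qed
  from this[of "?n - 1"] obtain vs where vs: "length vs = ?n - 1" "ordered_basis vs"
    "\<forall>i\<le>?n - 1. F i = orientation_of (take i vs)" by auto
  obtain ws where ws: "ordered_basis (vs @ ws)" "length vs + length ws = ?n" using ordered_basis_extend[OF vs(2)] by blast
  then have "length ws = 1" using vs(1) ws(2) zero_less_card_finite[where 'a = 'n] by linarith
  then obtain v where v: "ws = [v]" by (cases ws) auto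
  define s where "s = (if Dv (vs @ [v]) > 0 then 1 else -1 :: real)"
  have nz: "Dv (vs @ [v]) \<noteq> 0" using ws v ordered_basis_iff_Dv[of "vs @ ws"] by simp
  have "Dv (vs @ scale s [v]) = s * Dv (vs @ [v])"
    using Dv_scale_middle[of vs "[v]" "[]" s] ws v by simp
  then have "pos_basis (vs @ scale s [v])" using nz ws v by (auto simp: pos_basis_def s_def)
  moreover have "F = lift_of (vs @ scale s [v])"
  proof
    fix i show "F i = lift_of (vs @ scale s [v]) i"
      using vs assms by (cases "i < ?n") (auto simp: lift_of_def lifts_def)
  qed
  ultimately show ?thesis using that by blast
qed

lemma flag_of_eq_quotient:
  assumes "pos_basis (vs :: (real^'n::{finite,linorder}) list)"
  shows "flag_of vs = {(F, F'). F \<in> lifts \<and> (F' = F \<or> F' = reverse_odd F)} `` {lift_of vs}"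
  using lift_of_in_lifts[OF assms] reverse_odd_lift_of[OF assms] by (auto simp: flag_of_def)

lemma flag_has_basis:
  assumes "f \<in> (oriented_flags :: 'n::{finite,linorder} flag set)"
  obtains vs where "pos_basis vs" "f = flag_of vs"
proof -
  obtain F where F: "F \<in> lifts" "f = {(F, F'). F \<in> lifts \<and> (F' = F \<or> F' = reverse_odd F)} `` {F}"
    using assms unfolding oriented_flags_def by (auto elim: quotientE)
  obtain vs where "pos_basis vs" "F = lift_of vs" using lift_has_basis[OF F(1)] .
  then show ?thesis using that F flag_of_eq_quotient by blast
qed

lemma flag_of_in_flags:
  assumes "pos_basis (vs :: (real^'n::{finite,linorder}) list)"
  shows "flag_of vs \<in> oriented_flags"
  unfolding oriented_flags_def flag_of_eq_quotient[OF assms]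
  using lift_of_in_lifts[OF assms] by (rule quotientI)

lemma lift_of_eq_iff:
  fixes vs ws :: "(real^'n::{finite,linorder}) list"
  assumes "pos_basis vs"
  shows "lift_of vs = lift_of ws \<longleftrightarrow> (\<forall>i<CARD('n). same_orientation (take i vs) (take i ws))"
proof -
  have "lift_of vs = lift_of ws \<longleftrightarrow> (\<forall>i<CARD('n). orientation_of (take i vs) = orientation_of (take i ws))"
    unfolding lift_of_def fun_eq_iff by auto
  then show ?thesis using orientation_of_eq_iff[OF pos_basis_take[OF assms]] by simp
qed

lemma flag_of_scale: "s \<in> {1, -1} \<Longrightarrow> flag_of (scale s vs) = flag_of vs"
  by (auto simp: flag_of_def)

lemma flag_of_eq_iff:
  fixes vs ws :: "(real^'n::{finite,linorder}) list"
  assumes "pos_basis vs"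
  shows "flag_of vs = flag_of ws \<longleftrightarrow>
    (\<exists>s\<in>{1, -1}. \<forall>i<CARD('n). same_orientation (take i vs) (take i (scale s ws)))"
proof
  assume "flag_of vs = flag_of ws"
  then have "lift_of (scale 1 vs) \<in> flag_of ws" unfolding flag_of_def by blast
  then obtain s where "s \<in> {1, -1}" "lift_of (scale 1 vs) = lift_of (scale s ws)" unfolding flag_of_def by blast
  then have "s \<in> {1, -1}" "lift_of vs = lift_of (scale s ws)" by simp_all
  then show "\<exists>s\<in>{1, -1}. \<forall>i<CARD('n). same_orientation (take i vs) (take i (scale s ws))"
    using lift_of_eq_iff[OF assms] by metis
next
  assume "\<exists>s\<in>{1, -1}. \<forall>i<CARD('n). same_orientation (take i vs) (take i (scale s ws))"
  then obtain s where s: "s \<in> {1, -1}" "\<And>i. i < CARD('n) \<Longrightarrow> same_orientation (take i vs) (take i (scale s ws))" by blast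
  have "lift_of (scale t vs) = lift_of (scale t (scale s ws))" if t: "t \<in> {1, -1}" for t
  proof
    fix i show "lift_of (scale t vs) i = lift_of (scale t (scale s ws)) i"
    proof (cases "i < CARD('n)")
      case True
      have t0: "t \<noteq> 0" using t by auto
      have "ordered_basis (scale t (take i vs))" using ordered_basis_scale[OF t0 pos_basis_take[OF assms]] .
      then have "orientation_of (scale t (take i vs)) = orientation_of (scale t (take i (scale s ws)))"
        using same_orientation_scale[OF s(2)[OF True] t0] orientation_of_eq_iff by blast
      then show ?thesis using True by (simp add: lift_of_def take_map)
    qed (simp add: lift_of_def)
  qed
  then have "flag_of vs = flag_of (scale s ws)" unfolding flag_of_def by (rule image_cong[OF refl])
  then show "flag_of vs = flag_of ws" using flag_of_scale[OF s(1)] by simp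
qed

lemma flag_subspace_flag_of:
  assumes "pos_basis (vs :: (real^'n::{finite,linorder}) list)" "i < CARD('n)"
  shows "flag_subspace (flag_of vs) i = span (set (take i vs))"
proof -
  have "underlying (lift_of (scale s vs) i) = span (set (take i vs))" if s: "s \<in> {1, -1}" for s
  proof -
    have s0: "s \<noteq> 0" using s by auto
    have b: "ordered_basis (scale s (take i vs))" using ordered_basis_scale[OF s0 pos_basis_take[OF assms(1)]] .
    have "span (set (scale s (take i vs))) = span (set (take i vs))"
      using s by (subst scale_simps(9), intro span_image_scale) auto
    then show ?thesis using b assms(2) by (simp add: lift_of_def take_map underlying_orientation_of)
  qed
  then have "(\<Union>s\<in>{1, -1}. underlying (lift_of (scale s vs) i)) = span (set (take i vs))" by blast
  then show ?thesis unfolding flag_subspace_def flag_of_def by (simp only: image_image)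
qed

text \<open>The three signs account for the choice of lifts.\<close>

lemma hyperconvex_flag_of:
  fixes us vs ws :: "(real^'n::{finite,linorder}) list"
  assumes b: "pos_basis us" "pos_basis vs" "pos_basis ws"
  shows "hyperconvex (flag_of us) (flag_of vs) (flag_of ws) \<longleftrightarrow>
    (\<exists>r\<in>{1, -1}. \<exists>s\<in>{1, -1}. \<exists>t\<in>{1, -1}. \<forall>i j l. i < CARD('n) \<and> j < CARD('n) \<and> l < CARD('n) \<and> i + j + l = CARD('n) \<longrightarrow>
      r ^ i * s ^ j * t ^ l * Dv (take i us @ take j vs @ take l ws) > 0)"
proof -
  have len: "length us = CARD('n)" "length vs = CARD('n)" "length ws = CARD('n)" using b by (auto simp: pos_basis_def)
  have *: "(lift_of (scale r us) i \<oplus>\<^sub>o lift_of (scale s vs) j \<oplus>\<^sub>o lift_of (scale t ws) l = standard_orientation) \<longleftrightarrow>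
      r ^ i * s ^ j * t ^ l * Dv (take i us @ take j vs @ take l ws) > 0"
    if rst: "r \<in> {1, -1}" "s \<in> {1, -1}" "t \<in> {1, -1}"
      and ijl: "i < CARD('n)" "j < CARD('n)" "l < CARD('n)" "i + j + l = CARD('n)" for r s t i j l
  proof -
    have "(lift_of (scale r us) i \<oplus>\<^sub>o lift_of (scale s vs) j \<oplus>\<^sub>o lift_of (scale t ws) l = standard_orientation) \<longleftrightarrow>
        Dv (scale r (take i us) @ scale s (take j vs) @ scale t (take l ws)) > 0"
    proof -
      have "r \<noteq> 0" "s \<noteq> 0" "t \<noteq> 0" using rst by auto
      then have "ordered_basis (scale r (take i us))" "ordered_basis (scale s (take j vs))"
        "ordered_basis (scale t (take l ws))"
        using b by (auto intro!: ordered_basis_scale pos_basis_take)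
      from oriented_sum_standard[OF _ this] show ?thesis using ijl len by (simp add: lift_of_def)
    qed
    also have "Dv (scale r (take i us) @ scale s (take j vs) @ scale t (take l ws)) =
        r ^ i * (s ^ j * (t ^ l * Dv (take i us @ take j vs @ take l ws)))"
      using Dv_scale_middle[of "[]" "take i us" "scale s (take j vs) @ scale t (take l ws)" r]
        Dv_scale_middle[of "take i us" "take j vs" "scale t (take l ws)" s]
        Dv_scale_middle[of "take i us @ take j vs" "take l ws" "[]" t] len ijl by simp
    finally show ?thesis by (simp add: mult.assoc)
  qed
  have "hyperconvex (flag_of us) (flag_of vs) (flag_of ws) \<longleftrightarrow>
    (\<exists>r\<in>{1, -1}. \<exists>s\<in>{1, -1}. \<exists>t\<in>{1, -1}. \<forall>i j l. i < CARD('n) \<and> j < CARD('n) \<and> l < CARD('n) \<and> i + j + l = CARD('n) \<longrightarrow>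
      lift_of (scale r us) i \<oplus>\<^sub>o lift_of (scale s vs) j \<oplus>\<^sub>o lift_of (scale t ws) l = standard_orientation)"
    unfolding hyperconvex_def using b[THEN flag_of_in_flags] unfolding flag_of_def bex_simps(7) by (simp only: simp_thms)
  also have "\<dots> \<longleftrightarrow> (\<exists>r\<in>{1, -1}. \<exists>s\<in>{1, -1}. \<exists>t\<in>{1, -1}. \<forall>i j l. i < CARD('n) \<and> j < CARD('n) \<and> l < CARD('n) \<and> i + j + l = CARD('n) \<longrightarrow>
      r ^ i * s ^ j * t ^ l * Dv (take i us @ take j vs @ take l ws) > 0)"
    by (intro bex_cong refl iff_allI imp_cong *) auto
  finally show ?thesis .
qed

lemma hyperconvex_flags: "hyperconvex f g h \<Longrightarrow> f \<in> oriented_flags \<and> g \<in> oriented_flags \<and> h \<in> oriented_flags"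
  by (simp add: hyperconvex_def)


section \<open>The action of the special linear group on flags\<close>

lemma changes_linear_image:
  fixes M :: "'n::finite sqmat"
  shows "changes bs cs F \<Longrightarrow> changes (map ((*v) M) bs) (map ((*v) M) cs) F"
  by (simp add: changes_def linear_sum[OF matrix_vector_mul_linear] matrix_vector_mult_scaleR)

lemma inj_matrix: "Determinants.det (M :: 'n::{finite,linorder} sqmat) \<noteq> 0 \<Longrightarrow> M *v x = 0 \<Longrightarrow> x = 0"
  using det_nz_iff_inj[of "(*v) M"] linear_injective_0[OF matrix_vector_mul_linear[of M]] by auto

lemma ordered_basis_linear_image:
  fixes M :: "'n::{finite,linorder} sqmat"
  assumes "Determinants.det M \<noteq> 0" "ordered_basis bs"
  shows "ordered_basis (map ((*v) M) bs)"
  unfolding ordered_basis_iff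
proof (intro allI impI)
  fix c j assume 0: "(\<Sum>j<length (map ((*v) M) bs). c j *\<^sub>R map ((*v) M) bs ! j) = 0" "j < length (map ((*v) M) bs)"
  have "M *v (\<Sum>j<length bs. c j *\<^sub>R bs ! j) = (\<Sum>j<length bs. c j *\<^sub>R (M *v (bs ! j)))"
    by (simp add: linear_sum[OF matrix_vector_mul_linear] matrix_vector_mult_scaleR)
  then have "M *v (\<Sum>j<length bs. c j *\<^sub>R bs ! j) = 0" using 0 by simp
  then have "(\<Sum>j<length bs. c j *\<^sub>R bs ! j) = 0" by (rule inj_matrix[OF assms(1)])
  then show "c j = 0" using assms(2) 0(2) unfolding ordered_basis_iff by auto
qed

lemma same_orientation_linear_image:
  fixes M :: "'n::{finite,linorder} sqmat"
  assumes "Determinants.det M \<noteq> 0" "same_orientation bs cs"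
  shows "same_orientation (map ((*v) M) bs) (map ((*v) M) cs)"
proof -
  obtain F where F: "ordered_basis bs" "ordered_basis cs" "changes bs cs F" "detf (length bs) F > 0"
    using assms(2) unfolding same_orientation_iff by blast
  have "detf (length (map ((*v) M) bs)) F > 0" using F(4) by simp
  then show ?thesis
    unfolding same_orientation_iff
    using ordered_basis_linear_image[OF assms(1)] F changes_linear_image[OF F(3)] by blast
qed

lemma orientation_of_linear_image:
  fixes M :: "'n::{finite,linorder} sqmat"
  assumes "Determinants.det M = 1"
  shows "map ((*v) M) ` orientation_of bs = orientation_of (map ((*v) M) bs)"
proof (intro equalityI subsetI)
  fix cs assume "cs \<in> map ((*v) M) ` orientation_of bs"
  then show "cs \<in> orientation_of (map ((*v) M) bs)"
    using same_orientation_linear_image[of M bs] assms by (auto simp: orientation_of_def)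
next
  fix cs assume cs: "cs \<in> orientation_of (map ((*v) M) bs)"
  obtain M' where M': "M ** M' = Finite_Cartesian_Product.mat 1" "M' ** M = Finite_Cartesian_Product.mat 1"
    using invertible_det_nz[of M] assms unfolding invertible_def by auto
  have "Determinants.det M' * Determinants.det M = 1" using M'(2) det_mul[of M' M] by simp
  then have d: "Determinants.det M' \<noteq> 0" by auto
  have id: "map ((*v) M') (map ((*v) M) xs) = xs" "map ((*v) M) (map ((*v) M') xs) = xs" for xs
    using M' by (simp_all add: map_idI matrix_vector_mul_assoc)
  have "same_orientation bs (map ((*v) M') cs)"
    using same_orientation_linear_image[OF d, of "map ((*v) M) bs" cs] cs id by (simp add: orientation_of_def)
  then show "cs \<in> map ((*v) M) ` orientation_of bs"
    using id(2)[of cs] by (intro image_eqI[of _ _ "map ((*v) M') cs"]) (auto simp: orientation_of_def)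
qed

lemma scale_linear_image: "map ((*v) M) (scale s vs) = scale s (map ((*v) M) vs)"
  by (simp add: scale_def matrix_vector_mult_scaleR)

lemma act_flag_of:
  fixes M :: "'n::{finite,linorder} sqmat"
  assumes "Determinants.det M = 1" "even CARD('n)"
  shows "act_flag {M, - M} (flag_of vs) = flag_of (map ((*v) M) vs)"
proof -
  have neg: "map ((*v) (- M)) ws = scale (-1) (map ((*v) M) ws)" for ws
    by (simp add: scale_def matrix_vector_mult_def Finite_Cartesian_Product.vec_eq_iff sum_negf)
  have d: "Determinants.det (- M) = 1"
    using Dv_linear_image[of std_basis "- M"] Dv_linear_image[of std_basis M] assms
      Dv_scale_middle[of "[]" "map ((*v) M) std_basis" "[]" "-1"] by (simp add: neg Dv_std_basis)
  have act: "(\<lambda>i. map ((*v) M') ` lift_of ws i) = lift_of (map ((*v) M') ws)" if "Determinants.det M' = 1"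
    for M' :: "'n sqmat" and ws
    by (rule ext) (simp add: lift_of_def orientation_of_linear_image[OF that] take_map)
  have "act_flag {M, - M} (flag_of vs) =
      (\<Union>M'\<in>{M, - M}. (\<lambda>s i. map ((*v) M') ` lift_of (scale s vs) i) ` {1, -1})"
    unfolding act_flag_def flag_of_def by blast
  also have "\<dots> = (\<Union>M'\<in>{M, - M}. (\<lambda>s. lift_of (scale s (map ((*v) M') vs))) ` {1, -1})"
    using act[OF assms(1)] act[OF d] by (simp add: scale_linear_image)
  also have "\<dots> = flag_of (map ((*v) M) vs)"
    unfolding flag_of_def by (auto simp: neg)
  finally show ?thesis .
qed


section \<open>Adapted bases and total positivity\<close>

type_synonym 'n vecs = "(real^'n) list"

lemma ordered_basis_span:
  fixes vs :: "'n::{finite,linorder} vecs"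
  assumes "ordered_basis vs" "length vs = CARD('n)"
  shows "span (set vs) = UNIV"
proof -
  have "dim (set vs) = CARD('n)" using ordered_basis_card[OF assms(1)] assms(2) by simp
  then show ?thesis using dim_eq_full[of "set vs"] by simp
qed

text \<open>The second flag is opposite to the first one, with compatible orientations.\<close>

definition transverse :: "'n::{finite,linorder} vecs \<Rightarrow> 'n vecs \<Rightarrow> bool" where
  "transverse us ws \<longleftrightarrow> (\<forall>i\<le>CARD('n). Dv (take i us @ take (CARD('n) - i) ws) > 0)"

text \<open>The line in which the \<open>(i+1)\<close>-dimensional subspace of the first flag meets the
  \<open>(n-i)\<close>-dimensional subspace of the second one is spanned by a vector with leading coefficient
  \<open>1\<close> at \<open>us ! i\<close>.\<close>

lemma adapted_basis_exists:
  fixes us ws :: "'n::{finite,linorder} vecs"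
  assumes us: "pos_basis us" and ws: "pos_basis ws" and tr: "transverse us ws"
  obtains e where "pos_basis e" "\<And>i. i \<le> CARD('n) \<Longrightarrow> same_orientation (take i us) (take i e)"
    "\<And>l. l \<le> CARD('n) \<Longrightarrow> same_orientation (take l ws) (drop (CARD('n) - l) e)"
proof -
  let ?n = "CARD('n)"
  have len: "length us = ?n" "length ws = ?n" using us ws by (auto simp: pos_basis_def)
  have "\<exists>v f. v = us ! i + (\<Sum>a<i. f a *\<^sub>R us ! a) \<and> v \<in> span (set (take (?n - i) ws))" if i: "i < ?n" for i
  proof -
    let ?bs = "take i us @ take (?n - i) ws"
    have lb: "length ?bs = ?n" using len i by simp
    have "Dv ?bs > 0" using tr i by (simp add: transverse_def)
    then have "ordered_basis ?bs" using ordered_basis_iff_Dv[OF lb] by simp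
    moreover have "span (set ?bs) = UNIV"
      using ordered_basis_span[OF calculation lb] .
    ultimately obtain F where F: "changes ?bs us F" using changes_exists[of ?bs us] lb len by auto
    then have "us ! i = (\<Sum>a<?n. F a i *\<^sub>R ?bs ! a)" using i len lb by (simp add: changes_def)
    also have "\<dots> = (\<Sum>a<i. F a i *\<^sub>R ?bs ! a) + (\<Sum>a\<in>{i..<?n}. F a i *\<^sub>R ?bs ! a)"
      using i by (subst sum.union_disjoint[symmetric]) (auto intro: sum.cong)
    also have "(\<Sum>a<i. F a i *\<^sub>R ?bs ! a) = (\<Sum>a<i. F a i *\<^sub>R us ! a)"
      using i len by (intro sum.cong) (auto simp: nth_append)
    finally have eq: "us ! i = (\<Sum>a<i. F a i *\<^sub>R us ! a) + (\<Sum>a\<in>{i..<?n}. F a i *\<^sub>R ?bs ! a)" .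
    have "?bs ! a \<in> set (take (?n - i) ws)" if "a \<in> {i..<?n}" for a
    proof -
      have "a - i < length (take (?n - i) ws)" "?bs ! a = take (?n - i) ws ! (a - i)"
        using that i len by (auto simp: nth_append)
      then show ?thesis using nth_mem by metis
    qed
    then have "(\<Sum>a\<in>{i..<?n}. F a i *\<^sub>R ?bs ! a) \<in> span (set (take (?n - i) ws))"
      by (intro span_sum span_scale span_base) auto
    moreover have "(\<Sum>a\<in>{i..<?n}. F a i *\<^sub>R ?bs ! a) = us ! i + (\<Sum>a<i. (- F a i) *\<^sub>R us ! a)"
      using eq by (simp add: sum_negf)
    ultimately show ?thesis
      by (intro exI[of _ "us ! i + (\<Sum>a<i. (- F a i) *\<^sub>R us ! a)"] exI[of _ "\<lambda>a. - F a i"]) simp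
  qed
  then obtain v f where v: "\<And>i. i < ?n \<Longrightarrow> v i = us ! i + (\<Sum>a<i. f i a *\<^sub>R us ! a)"
    "\<And>i. i < ?n \<Longrightarrow> v i \<in> span (set (take (?n - i) ws))" by metis
  define e where "e = map v [0..<?n]"
  have le: "length e = ?n" by (simp add: e_def)
  define U where "U = (\<lambda>a i. if a < i then f i a else if a = i then 1 else 0 :: real)"
  have U: "changes (take i us) (take i e) U" if i: "i \<le> ?n" for i
    unfolding changes_def
  proof (intro conjI allI impI)
    show "length (take i us) = length (take i e)" using len le by simp
    fix j assume "j < length (take i e)"
    then have j: "j < i" "j < ?n" using le i by auto
    have "(\<Sum>a<i. U a j *\<^sub>R us ! a) = (\<Sum>a<Suc j. U a j *\<^sub>R us ! a)"
      by (rule sum.mono_neutral_right) (use j in \<open>auto simp: U_def\<close>)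
    also have "\<dots> = v j" using v(1)[OF j(2)] by (simp add: U_def add.commute)
    finally show "take i e ! j = (\<Sum>a<length (take i us). U a j *\<^sub>R take i us ! a)"
      using j i len by (simp add: e_def)
  qed
  have det: "detf i U = 1" for i by (subst detf_upper) (auto simp: U_def)
  have same1: "same_orientation (take i us) (take i e)" if "i \<le> ?n" for i
    unfolding same_orientation_iff
    using U[OF that] det len that pos_basis_take[OF us, of i] changes_basis[OF U[OF that]]
    by (auto intro!: exI[of _ U])
  have D1: "Dv (take i e @ xs) > 0 \<longleftrightarrow> Dv (take i us @ xs) > 0" if "i + length xs = ?n" for i xs
    using same_orientation_Dv[OF same1[of i], of "[]" xs] that len by simp
  have e: "pos_basis e" using D1[of ?n "[]"] us le by (simp add: pos_basis_def)
  have same2: "same_orientation (take l ws) (drop (?n - l) e)" if l: "l \<le> ?n" for l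
  proof (rule same_orientation_if_Dv[of _ _ "take (?n - l) e" "[]"])
    show "ordered_basis (take l ws)" "ordered_basis (drop (?n - l) e)"
      using pos_basis_take[OF ws] pos_basis_drop[OF e] by auto
    show "set (drop (?n - l) e) \<subseteq> span (set (take l ws))"
    proof
      fix x assume "x \<in> set (drop (?n - l) e)"
      then obtain a where a: "a < length (drop (?n - l) e)" "x = drop (?n - l) e ! a" by (auto simp: in_set_conv_nth)
      then have i: "?n - l + a < ?n" "x = v (?n - l + a)" using le by (auto simp: e_def)
      have "x \<in> span (set (take (?n - (?n - l + a)) ws))" using v(2)[OF i(1)] i(2) by simp
      moreover have "set (take (?n - (?n - l + a)) ws) \<subseteq> set (take l ws)"
        using l by (intro set_take_subset_set_take) auto
      ultimately show "x \<in> span (set (take l ws))" using span_mono by blast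
    qed
    have "Dv (take (?n - l) e @ take l ws) > 0"
      using D1[of "?n - l" "take l ws"] tr l len by (auto simp: transverse_def dest: spec[of _ "?n - l"])
    moreover have "Dv (take (?n - l) e @ drop (?n - l) e) > 0" using e by (simp add: pos_basis_def)
    ultimately show "Dv (take (?n - l) e @ take l ws @ []) * Dv (take (?n - l) e @ drop (?n - l) e @ []) > 0"
      by simp
  qed (use l len le in auto)
  show ?thesis using that[OF e same1 same2] .
qed

lemma sign_prod: "(\<Prod>a<m. (-1) ^ (i + a)) * (\<Prod>b<m. (-1) ^ Suc b) = ((-1 :: real) ^ Suc i) ^ m"
proof -
  have "(-1) ^ (i + a) * (-1) ^ Suc a = ((-1 :: real) ^ Suc i)" for a
    by (simp add: power_add mult.assoc)
  then show ?thesis by (simp add: prod.distrib[symmetric])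
qed

text \<open>The criterion requires the minors of \<open>M\<close> with initial columns and with initial rows. The former are the
  determinants in \<open>A\<close>, up to \<open>Dv e\<close>. The latter concern consecutive vectors of \<open>c\<close> and final segments
  of \<open>e\<close>, that is initial segments of \<open>f\<close>; so they are minors of the array \<open>E\<close> of \<open>f\<close> in the
  basis \<open>c\<close> in which a block of rows is left out. Assumption \<open>B\<close> gives the minors of \<open>E\<close> with consecutive rows, up to
  signs that the passage to \<open>E'\<close> removes, and Fekete's criterion yields the remaining ones.\<close>

theorem nested_totally_positive:
  fixes e c f :: "'n::{finite,linorder} vecs"
  assumes even: "even CARD('n)" and pb: "pos_basis e" "pos_basis c" and lf: "length f = CARD('n)"
    and A: "\<And>i q. 0 < q \<Longrightarrow> q < CARD('n) \<Longrightarrow> i + q \<le> CARD('n) \<Longrightarrow>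
      Dv (take i e @ take q c @ drop (i + q) e) > 0"
    and B: "\<And>i j l. i < CARD('n) \<Longrightarrow> j < CARD('n) \<Longrightarrow> l < CARD('n) \<Longrightarrow> i + j + l = CARD('n) \<Longrightarrow>
      Dv (take i c @ drop (CARD('n) - j) c @ take l f) > 0"
    and C: "\<And>l. l < CARD('n) \<Longrightarrow> same_orientation (take l f) (drop (CARD('n) - l) e)"
    and M: "changes e c M"
  shows "totally_positive CARD('n) CARD('n) M"
proof -
  let ?n = "CARD('n)"
  have len: "length e = ?n" "length c = ?n" using pb by (auto simp: pos_basis_def)
  have De: "Dv e > 0" and Dc: "Dv c > 0" using pb by (auto simp: pos_basis_def)
  have Mc: "c ! j = (\<Sum>r<?n. M r j *\<^sub>R e ! r)" if "j < ?n" for j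
    using M that len by (simp add: changes_def)
  have minor: "Dv (take i e @ cs @ drop (i + q) e) = detf q (\<lambda>a b. X (i + a) b) * Dv e"
    if "length e = ?n" "i + q \<le> ?n" "length cs = q" "\<And>b. b < q \<Longrightarrow> cs ! b = (\<Sum>r<?n. X r b *\<^sub>R e ! r)"
    for i q cs X and e :: "'n vecs"
  proof -
    have eq: "take i e @ take q (drop i e) @ drop (i + q) e = e"
      by (metis append_assoc append_take_drop_id drop_drop take_add add.commute)
    have "length (take i e) = i" "length (take q (drop i e)) = q" "length (drop (i + q) e) = ?n - (i + q)"
      using that by auto
    then show ?thesis
      using Dv_middle[of "take i e" "take q (drop i e)" "drop (i + q) e" cs X] that unfolding eq by simp
  qed
  have full: "detf ?n M > 0"
    using minor[of e 0 ?n c M] len Mc De Dc by (simp add: zero_less_mult_iff)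
  \<comment> \<open>minors with initial columns\<close>
  have 1: "detf q (\<lambda>a b. M (i + a) b) > 0" if iq: "i + q \<le> ?n" for i q
  proof -
    consider "q = 0" | "q = ?n" "i = 0" | "0 < q" "q < ?n" using iq by linarith
    then show ?thesis
    proof cases
      case 3
      have "Dv (take i e @ take q c @ drop (i + q) e) = detf q (\<lambda>a b. M (i + a) b) * Dv e"
        using iq len Mc 3 by (intro minor) auto
      then show ?thesis using A[OF 3 iq] De by (simp add: zero_less_mult_iff)
    qed (use full in auto)
  qed
  \<comment> \<open>minors with initial rows\<close>
  have span_c: "span (set c) = UNIV"
    using ordered_basis_span[OF pos_basis_ordered[OF pb(2)] len(2)] .
  obtain E where E: "changes c f E"
    using changes_exists[OF pos_basis_ordered[OF pb(2)], of f] span_c lf len by auto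
  then have Ef: "f ! t = (\<Sum>r<?n. E r t *\<^sub>R c ! r)" if "t < ?n" for t
    using that len lf by (simp add: changes_def)
  define E' where "E' = (\<lambda>r t. (-1) ^ r * ((-1) ^ Suc t * E r t))"
  have E': "detf m (\<lambda>a. E' (I a)) = (\<Prod>a<m. (-1) ^ I a) * (\<Prod>b<m. (-1) ^ Suc b) * detf m (\<lambda>a. E (I a))" for m I
    unfolding E'_def by (simp only: detf_scale detf_scale_columns mult.assoc)
  have consec: "detf m (\<lambda>a. E' (i + a)) > 0" if m: "m \<le> ?n - 1" "i + m \<le> ?n" for m i
  proof (cases "m = 0")
    case False
    define j where "j = ?n - i - m"
    have j: "i < ?n" "j < ?n" "m < ?n" "i + j + m = ?n" using m False by (auto simp: j_def)
    have "Dv (take i c @ drop (?n - j) c @ take m f) > 0" using B[OF j] .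
    also have "Dv (take i c @ drop (?n - j) c @ take m f) = (-1) ^ (j * m) * Dv (take i c @ take m f @ drop (?n - j) c)"
      using Dv_swap[of "take i c" "drop (?n - j) c" "take m f" "[]"] len lf j by simp
    also have "?n - j = i + m" using j by simp
    also have "Dv (take i c @ take m f @ drop (i + m) c) = detf m (\<lambda>a b. E (i + a) b) * Dv c"
      using len lf m j Ef by (intro minor) auto
    finally have "(-1) ^ (j * m) * detf m (\<lambda>a b. E (i + a) b) > 0"
      using Dc by (simp add: zero_less_mult_iff mult.assoc[symmetric])
    moreover have "(-1) ^ (j * m) = ((-1 :: real) ^ Suc i) ^ m"
    proof -
      have "even (i + j + m)" using even j(4) by simp
      then have "even (j * m) \<longleftrightarrow> even (Suc i * m)" by auto
      then show ?thesis by (simp add: power_mult[symmetric] minus_one_power_iff del: power_Suc)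
    qed
    ultimately show ?thesis unfolding E'[of m "\<lambda>a. i + a"] sign_prod by simp
  qed simp
  have 2: "detf q (\<lambda>a b. M a (j + b)) > 0" if q: "j + q \<le> ?n" for q j
  proof -
    consider "q = 0" | "q = ?n" "j = 0" | "0 < q" "q < ?n" using q by linarith
    then show ?thesis
    proof cases
      case 3
      define m where "m = ?n - q"
      define I where "I = (\<lambda>a. if a < j then a else a + q)"
      have m: "m \<le> ?n - 1" "q + m = ?n" "j \<le> m" using 3 q by (auto simp: m_def)
      have "detf m (\<lambda>a. E' (I a)) > 0"
        by (rule fekete[of "?n - 1" ?n]) (use consec m q in \<open>auto simp: I_def\<close>)
      moreover have "(\<Prod>a<m. (-1) ^ I a) * (\<Prod>b<m. (-1) ^ Suc b) = (-1 :: real) ^ (q * j)"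
      proof -
        have "(\<Prod>a<m. (-1) ^ I a) * (\<Prod>b<m. (-1) ^ Suc b) = (\<Prod>a<m. if a < j then -1 else (-1 :: real) ^ Suc q)"
          unfolding prod.distrib[symmetric] I_def by (rule prod.cong) (auto simp: power_add)
        also have "\<dots> = (\<Prod>a\<in>{..<j} \<union> {j..<m}. if a < j then -1 else (-1 :: real) ^ Suc q)"
          using m by (intro prod.cong) auto
        also have "\<dots> = (-1) ^ j * ((-1) ^ Suc q) ^ (m - j)"
          by (subst prod.union_disjoint) auto
        also have "\<dots> = (-1) ^ (q * j)"
        proof -
          obtain d where d: "m = j + d" using m(3) le_Suc_ex by blast
          have "even (q + (j + d))" using even m(2) d by simp
          then have "even (j + Suc q * d) \<longleftrightarrow> even (q * j)" by auto
          then have "(-1 :: real) ^ (j + Suc q * d) = (-1) ^ (q * j)" by (simp only: minus_one_power_iff)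
          moreover have "(-1 :: real) ^ j * ((-1) ^ Suc q) ^ (m - j) = (-1) ^ (j + Suc q * d)"
            using d by (simp only: diff_add_inverse power_mult power_add)
          ultimately show ?thesis by simp
        qed
        finally show ?thesis .
      qed
      ultimately have pos: "(-1) ^ (q * j) * detf m (\<lambda>a. E (I a)) > 0" unfolding E' by simp
      \<comment> \<open>the basis \<open>c\<close> with the block \<open>c\<^sub>j, \<dots>, c\<^sub>j\<^sub>+\<^sub>q\<^sub>-\<^sub>1\<close> moved to the front\<close>
      let ?x = "take q (drop j c)" and ?r = "take j c @ drop (j + q) c"
      have c_eq: "take j c @ ?x @ drop (j + q) c = c"
        by (metis append_assoc append_take_drop_id drop_drop take_add add.commute)
      have D': "Dv (?x @ ?r) = (-1) ^ (q * j) * Dv c"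
        using Dv_swap[of "[]" ?x "take j c" "drop (j + q) c"] len q c_eq by simp
      have lr: "length ?x = q" "length ?r = m" using len q m by auto
      define X where "X = (\<lambda>r b. if r < q then E (j + r) b else E (I (r - q)) b)"
      have "Dv (?x @ take m f) = detf m (\<lambda>a b. X (q + a) b) * Dv (?x @ ?r)"
      proof -
        have sum: "take m f ! b = (\<Sum>r<?n. X r b *\<^sub>R (?x @ ?r) ! r)" if b: "b < m" for b
        proof -
          have nth: "(?x @ ?r) ! r = (if r < q then c ! (j + r) else c ! I (r - q))" if "r < ?n" for r
            using that len q m lr by (auto simp: nth_append I_def intro!: arg_cong[where f = "nth c"])
          define \<phi> where "\<phi> = (\<lambda>r. if r < q then j + r else if r < q + j then r - q else r)"
          have \<phi>: "\<phi> r = (if r < q then j + r else I (r - q))" for r by (auto simp: \<phi>_def I_def)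
          have "bij_betw \<phi> {..<?n} {..<?n}"
            by (rule bij_betwI[where g = "\<lambda>s. if s < j then q + s else if s < j + q then s - j else s"])
              (use q in \<open>auto simp: \<phi>_def\<close>)
          note bij = sum.reindex_bij_betw[OF this, of "\<lambda>s. E s b *\<^sub>R c ! s"]
          have "(\<Sum>r<?n. X r b *\<^sub>R (?x @ ?r) ! r) = (\<Sum>r<?n. E (\<phi> r) b *\<^sub>R c ! \<phi> r)"
          proof (rule sum.cong[OF refl])
            fix r assume "r \<in> {..<?n}"
            then show "X r b *\<^sub>R (?x @ ?r) ! r = E (\<phi> r) b *\<^sub>R c ! \<phi> r"
              using nth[of r] \<phi>[of r] by (cases "r < q") (simp_all only: X_def if_True if_False lessThan_iff)
          qed
          also have "\<dots> = (\<Sum>s<?n. E s b *\<^sub>R c ! s)" by (rule bij)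
          also have "\<dots> = f ! b"
          proof -
            have "b < ?n" using b m(2) by linarith
            then show ?thesis by (rule Ef[symmetric])
          qed
          also have "f ! b = take m f ! b" using b by (rule nth_take[symmetric])
          finally show ?thesis by (rule sym)
        qed
        have "Dv (?x @ take m f @ []) = detf (length ?r) (\<lambda>a b. X (length ?x + a) b) * Dv (?x @ ?r @ [])"
        proof (rule Dv_middle)
          show "length ?x + length ?r + length ([] :: 'n vecs) = ?n" unfolding lr using m(2) by simp
          show "length (take m f) = length ?r" unfolding lr using lf m(2) by simp
          show "take m f ! b = (\<Sum>r<?n. X r b *\<^sub>R (?x @ ?r @ []) ! r)" if "b < length ?r" for b
            using sum[of b] that unfolding lr append_Nil2 .
        qed
        then show ?thesis unfolding lr append_Nil2 .
      qed
      also have "detf m (\<lambda>a b. X (q + a) b) = detf m (\<lambda>a. E (I a))"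
        by (simp add: X_def)
      finally have "Dv (?x @ take m f) = ((-1) ^ (q * j) * detf m (\<lambda>a. E (I a))) * Dv c"
        unfolding D' by (simp add: mult_ac)
      then have "Dv (?x @ take m f) > 0" using pos Dc by (simp only: mult_pos_pos)
      then have "Dv (?x @ drop q e) > 0"
        using same_orientation_Dv[OF C[of m], of ?x "[]"] lr lf m 3 by (simp add: m_def)
      moreover have "Dv (take 0 e @ ?x @ drop (0 + q) e) = detf q (\<lambda>a b. M (0 + a) (j + b)) * Dv e"
        by (rule minor[where X = "\<lambda>r b. M r (j + b)"]) (use len q Mc in auto)
      ultimately show ?thesis using De by (simp add: zero_less_mult_iff)
    qed (use full in auto)
  qed
  show ?thesis
    by (rule totally_positive_criterion) (use 1 2 in auto)
qed

text \<open>An adapted basis of a pair of flags: the first flag is spanned by its initial segments, the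
  second one by its final segments.\<close>

definition adapted :: "'n::{finite,linorder} vecs \<Rightarrow> 'n flag \<Rightarrow> 'n flag \<Rightarrow> bool" where
  "adapted e P S \<longleftrightarrow> pos_basis e \<and> P = flag_of e \<and>
     (\<exists>ws. pos_basis ws \<and> S = flag_of ws \<and>
        (\<forall>l<CARD('n). same_orientation (take l ws) (drop (CARD('n) - l) e)))"

text \<open>Multiplication of all three lifts by the same sign preserves the condition in even dimension, so one of
  the signs can be normalized.\<close>

lemma hyperconvex_signs:
  fixes us vs ws :: "'n::{finite,linorder} vecs"
  assumes even: "even CARD('n)"
    and b: "pos_basis us" "pos_basis vs" "pos_basis ws" and h: "hyperconvex (flag_of us) (flag_of vs) (flag_of ws)"
  obtains s t where "s \<in> {1, -1}" "t \<in> {1, -1}"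
    "\<And>i j l. i < CARD('n) \<Longrightarrow> j < CARD('n) \<Longrightarrow> l < CARD('n) \<Longrightarrow> i + j + l = CARD('n) \<Longrightarrow>
      Dv (take i us @ take j (scale s vs) @ take l (scale t ws)) > 0"
proof -
  let ?n = "CARD('n)"
  have len: "length us = ?n" "length vs = ?n" "length ws = ?n" using b by (auto simp: pos_basis_def)
  obtain r s t where rst: "r \<in> {1, -1}" "s \<in> {1, -1}" "t \<in> {1, -1 :: real}"
    and D': "\<forall>i j l. i < ?n \<and> j < ?n \<and> l < ?n \<and> i + j + l = ?n \<longrightarrow>
      r ^ i * s ^ j * t ^ l * Dv (take i us @ take j vs @ take l ws) > 0"
    using iffD1[OF hyperconvex_flag_of[OF b] h] by (elim bexE)
  have D: "r ^ i * s ^ j * t ^ l * Dv (take i us @ take j vs @ take l ws) > 0"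
    if "i < ?n" "j < ?n" "l < ?n" "i + j + l = ?n" for i j l using D' that by blast
  show ?thesis
  proof (rule that[of "r * s" "r * t"])
    show "r * s \<in> {1, -1}" "r * t \<in> {1, -1}" using rst by auto
    fix i j l assume ijl: "i < ?n" "j < ?n" "l < ?n" "i + j + l = ?n"
    have "Dv (take i us @ take j (scale (r * s) vs) @ take l (scale (r * t) ws)) =
        (r * s) ^ j * (r * t) ^ l * Dv (take i us @ take j vs @ take l ws)"
      using Dv_scale_middle[of "take i us" "take j vs" "scale (r * t) (take l ws)" "r * s"]
        Dv_scale_middle[of "take i us @ take j vs" "take l ws" "[]" "r * t"] len ijl by simp
    also have "(r * s) ^ j * (r * t) ^ l = r ^ (i + j + l) * (r ^ i * s ^ j * t ^ l)"
    proof -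
      have "r ^ i * r ^ i = 1" using rst(1) by (auto simp: power_mult_distrib[symmetric])
      then have eq: "r ^ (i + j + l) * r ^ i = r ^ j * r ^ l" by (simp add: power_add algebra_simps)
      have "(r * s) ^ j * (r * t) ^ l = (r ^ j * r ^ l) * (s ^ j * t ^ l)" by (simp add: power_mult_distrib mult_ac)
      also have "\<dots> = (r ^ (i + j + l) * r ^ i) * (s ^ j * t ^ l)" by (simp only: eq)
      finally show ?thesis by (simp only: mult.assoc)
    qed
    also have "r ^ (i + j + l) = 1" using rst(1) even ijl(4) by auto
    finally show "Dv (take i us @ take j (scale (r * s) vs) @ take l (scale (r * t) ws)) > 0"
      using D[OF ijl] by simp
  qed
qed

lemma adapted_exists:
  fixes P H S :: "'n::{finite,linorder} flag"
  assumes even: "even CARD('n)" and h: "hyperconvex P H S"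
  obtains e where "adapted e P S"
proof -
  let ?n = "CARD('n)"
  obtain us vs ws where b: "pos_basis us" "pos_basis vs" "pos_basis ws"
    and F: "P = flag_of us" "H = flag_of vs" "S = flag_of ws"
    using hyperconvex_flags[OF h] flag_has_basis by metis
  obtain s t where st: "s \<in> {1, -1}" "t \<in> {1, -1}"
    and D: "\<And>i j l. i < ?n \<Longrightarrow> j < ?n \<Longrightarrow> l < ?n \<Longrightarrow> i + j + l = ?n \<Longrightarrow>
      Dv (take i us @ take j (scale s vs) @ take l (scale t ws)) > 0"
    using hyperconvex_signs[OF even b] h F by metis
  have ws: "pos_basis (scale t ws)" using pos_basis_scale[OF even st(2) b(3)] .
  have "transverse us (scale t ws)"
    unfolding transverse_def
  proof (intro allI impI)
    fix i assume "i \<le> ?n"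
    then consider "i = 0" | "i = ?n" | "i < ?n" "?n - i < ?n" by linarith
    then show "Dv (take i us @ take (?n - i) (scale t ws)) > 0"
    proof cases
      case 3
      then show ?thesis using D[of i 0 "?n - i"] by simp
    qed (use b(1) ws in \<open>auto simp: pos_basis_def\<close>)
  qed
  from adapted_basis_exists[OF b(1) ws this] obtain e where e: "pos_basis e"
    "\<And>i. i \<le> ?n \<Longrightarrow> same_orientation (take i us) (take i e)"
    "\<And>l. l \<le> ?n \<Longrightarrow> same_orientation (take l (scale t ws)) (drop (?n - l) e)" by blast
  have "flag_of us = flag_of e"
    unfolding flag_of_eq_iff[OF b(1)] using e(2) by (intro bexI[of _ 1]) auto
  then have "adapted e P S"
    unfolding adapted_def using e ws F flag_of_scale[OF st(2), of ws]
    by (intro conjI exI[of _ "scale t ws"]) auto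
  then show ?thesis by (rule that)
qed

text \<open>The four flags are in the order \<open>P\<close>, \<open>Q\<close>, \<open>R\<close>, \<open>S\<close>. The signs that remain after normalization are fixed by
  comparison with determinants that are positive since \<open>e\<close> and \<open>c\<close> are adapted; evenness of
  the dimension enters through odd powers of a sign.\<close>

theorem nested_adapted_totally_positive:
  fixes P Q R S :: "'n::{finite,linorder} flag"
  assumes even: "even CARD('n)" and h: "hyperconvex P Q S" "hyperconvex Q R S"
    and e: "adapted e P S" and c: "adapted c Q R"
  obtains s M where "s \<in> {1, -1}" "changes e (scale s c) M" "totally_positive CARD('n) CARD('n) M"
proof -
  let ?n = "CARD('n)"
  have "?n \<noteq> 1" using even by auto
  then have n: "?n \<ge> 2" using zero_less_card_finite[where 'a = 'n] by linarith
  obtain f where f: "pos_basis f" "S = flag_of f" "\<And>l. l < ?n \<Longrightarrow> same_orientation (take l f) (drop (?n - l) e)"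
    and pe: "pos_basis e" "P = flag_of e" using e unfolding adapted_def by blast
  obtain d where d: "pos_basis d" "R = flag_of d" "\<And>l. l < ?n \<Longrightarrow> same_orientation (take l d) (drop (?n - l) c)"
    and pc: "pos_basis c" "Q = flag_of c" using c unfolding adapted_def by blast
  have len: "length e = ?n" "length c = ?n" "length d = ?n" "length f = ?n"
    using pe pc d f by (auto simp: pos_basis_def)
  obtain s t where st: "s \<in> {1, -1}" "t \<in> {1, -1}"
    and D1: "\<And>i j l. i < ?n \<Longrightarrow> j < ?n \<Longrightarrow> l < ?n \<Longrightarrow> i + j + l = ?n \<Longrightarrow>
      Dv (take i e @ take j (scale s c) @ take l (scale t f)) > 0"
    using hyperconvex_signs[OF even pe(1) pc(1) f(1)] h(1) pe pc f by metis
  have Dt: "Dv (xs @ scale r (take l ys)) = r ^ l * Dv (xs @ take l ys)"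
    if "length xs + l = ?n" "length ys = ?n" for xs ys :: "'n vecs" and r l
    using Dv_scale_middle[of xs "take l ys" "[]" r] that by simp
  have Cf: "Dv (xs @ take l f) > 0 \<longleftrightarrow> Dv (xs @ drop (?n - l) e) > 0" if "length xs + l = ?n" "l < ?n" for xs l
    using same_orientation_Dv[OF f(3)[OF that(2)], of xs "[]"] that len by simp
  have "Dv (take (?n - 1) e @ take 1 f) > 0"
    using Cf[of "take (?n - 1) e" 1] len n pe by (simp add: pos_basis_def)
  moreover have "Dv (take (?n - 1) e @ scale t (take 1 f)) > 0" using D1[of "?n - 1" 0 1] n by simp
  ultimately have t: "t = 1" using Dt[of "take (?n - 1) e" 1 f t] len n st(2) by (auto simp: zero_less_mult_iff)
  let ?c = "scale s c"
  have pc': "pos_basis ?c" using pos_basis_scale[OF even st(1) pc(1)] .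
  obtain s' t' where st': "s' \<in> {1, -1}" "t' \<in> {1, -1}"
    and D2: "\<And>i j l. i < ?n \<Longrightarrow> j < ?n \<Longrightarrow> l < ?n \<Longrightarrow> i + j + l = ?n \<Longrightarrow>
      Dv (take i ?c @ take j (scale s' d) @ take l (scale t' f)) > 0"
    using hyperconvex_signs[OF even pc' d(1) f(1)] h(2) pc d f flag_of_scale[OF st(1), of c] by metis
  have "Dv (take 1 ?c @ take (?n - 1) f) > 0" using D1[of 0 1 "?n - 1"] n t by simp
  moreover have "Dv (take 1 ?c @ scale t' (take (?n - 1) f)) > 0" using D2[of 1 0 "?n - 1"] n by simp
  moreover have "t' ^ (?n - 1) = t'" using st'(2) even n by auto
  ultimately have t': "t' = 1" using Dt[of "take 1 ?c" "?n - 1" f t'] len n st'(2) by (auto simp: zero_less_mult_iff)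
  have sd: "same_orientation (take l (scale s' d)) (drop (?n - l) ?c)" if l: "l < ?n" for l
  proof -
    have s's: "s' = s"
    proof -
      have "Dv (take (?n - 1) ?c @ scale s' (take 1 d)) > 0" using D2[of "?n - 1" 1 0] n by simp
      then have 1: "s' * Dv (take (?n - 1) ?c @ take 1 d) > 0" using Dt[of "take (?n - 1) ?c" 1 d s'] len n by simp
      have "Dv (take (?n - 1) ?c @ drop (?n - 1) ?c) > 0" using pc' by (simp only: append_take_drop_id pos_basis_def)
      then have "Dv (take (?n - 1) ?c @ scale s (drop (?n - 1) c)) > 0" by simp
      then have "s * Dv (take (?n - 1) ?c @ drop (?n - 1) c) > 0"
        using Dv_scale_middle[of "take (?n - 1) ?c" "drop (?n - 1) c" "[]" s] len n by simp
      moreover have "Dv (take (?n - 1) ?c @ drop (?n - 1) c) > 0 \<longleftrightarrow> Dv (take (?n - 1) ?c @ take 1 d) > 0"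
        using same_orientation_Dv[OF d(3)[of 1], of "take (?n - 1) ?c" "[]"] len n by simp
      ultimately show ?thesis using 1 st(1) st'(1) by (auto simp: zero_less_mult_iff mult_less_0_iff)
    qed
    have "s \<noteq> 0" using st by auto
    then show ?thesis using same_orientation_scale[OF d(3)[OF l], of s] s's by simp
  qed
  have span_e: "span (set e) = UNIV"
    using ordered_basis_span[OF pos_basis_ordered[OF pe(1)] len(1)] .
  obtain M where M: "changes e ?c M"
    using changes_exists[OF pos_basis_ordered[OF pe(1)], of ?c] span_e len by auto
  have "totally_positive ?n ?n M"
  proof (rule nested_totally_positive[OF even pe(1) pc' len(4) _ _ f(3) M])
    fix i q assume q: "0 < q" "q < ?n" "i + q \<le> ?n"
    have "Dv ((take i e @ take q ?c) @ take (?n - (i + q)) f) > 0"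
      using D1[of i q "?n - (i + q)"] q t by simp
    then show "Dv (take i e @ take q ?c @ drop (i + q) e) > 0"
      using Cf[of "take i e @ take q ?c" "?n - (i + q)"] q len by simp
  next
    fix i j l assume ijl: "i < ?n" "j < ?n" "l < ?n" "i + j + l = ?n"
    have "Dv (take i ?c @ take j (scale s' d) @ take l f) > 0" using D2[OF ijl] t' by simp
    then show "Dv (take i ?c @ drop (?n - j) ?c @ take l f) > 0"
      using same_orientation_Dv[OF sd[OF ijl(2)], of "take i ?c" "take l f"] len ijl by simp
  qed
  then show ?thesis using that[OF st(1) M] by blast
qed


section \<open>Disjoint intervals on the projective line\<close>

text \<open>The universal covering of the projective line by the angle, of period \<open>pi\<close>.\<close>

definition ang :: "real \<Rightarrow> 2 line" where
  "ang t = span {vector [cos t, sin t]}"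

lemma vector_2_eq_iff: "(x :: real^2) = y \<longleftrightarrow> x $ 1 = y $ 1 \<and> x $ 2 = y $ 2"
  by (simp add: Finite_Cartesian_Product.vec_eq_iff forall_2)

lemma span_singleton_scale: "r \<noteq> 0 \<Longrightarrow> span {r *\<^sub>R v} = span {v :: 'a::real_vector}"
  using span_image_scale[of "{v}" "\<lambda>_. r"] by simp

lemma ang_shift: "ang (t + of_int k * pi) = ang t"
proof -
  have "sin (of_int k * pi) = 0" by (simp add: sin_int_times_real mult.commute)
  moreover from this have "cos (of_int k * pi) \<noteq> 0"
    using sin_cos_squared_add[of "of_int k * pi"] by auto
  moreover have "vector [cos (t + of_int k * pi), sin (t + of_int k * pi)] =
      cos (of_int k * pi) *\<^sub>R (vector [cos t, sin t] :: real^2)"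
    using calculation(1) by (simp add: vector_2_eq_iff cos_add sin_add)
  ultimately show ?thesis unfolding ang_def using span_singleton_scale by metis
qed

lemma ang_surj:
  assumes "p \<in> topspace (projective_space :: 2 line topology)"
  obtains t where "\<alpha> \<le> t" "t < \<alpha> + pi" "p = ang t"
proof -
  obtain v :: "real^2" where v: "v \<noteq> 0" "p = span {v}" using assms by (auto simp: projective_space_def)
  define r where "r = norm v"
  have r: "r > 0" using v by (simp add: r_def)
  have "r\<^sup>2 = (v $ 1)\<^sup>2 + (v $ 2)\<^sup>2"
    unfolding r_def by (simp add: norm_vec_def L2_set_def sum_2)
  then have "(v $ 1 / r)\<^sup>2 + (v $ 2 / r)\<^sup>2 = r\<^sup>2 / r\<^sup>2" by (simp only: power_divide add_divide_distrib)
  then have "(v $ 1 / r)\<^sup>2 + (v $ 2 / r)\<^sup>2 = 1" using r by simp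
  then obtain s where s: "v $ 1 / r = cos s" "v $ 2 / r = sin s" using sincos_total_2pi by metis
  then have "v = r *\<^sub>R vector [cos s, sin s]" using r by (simp add: vector_2_eq_iff field_simps)
  then have p: "p = ang s" unfolding ang_def v(2) using span_singleton_scale[of r] r by simp
  define k where "k = \<lfloor>(s - \<alpha>) / pi\<rfloor>"
  have "of_int k \<le> (s - \<alpha>) / pi" "(s - \<alpha>) / pi < of_int k + 1" unfolding k_def by linarith+
  then have "of_int k * pi \<le> s - \<alpha>" "s - \<alpha> < of_int k * pi + pi" by (simp_all add: field_simps)
  then show ?thesis
    using that[of "s + of_int (- k) * pi"] p ang_shift[of s "- k"] by (simp add: algebra_simps)
qed

lemma quotient_map_projective:
  "quotient_map (top_of_set (- {0 :: real^'n::finite})) projective_space (\<lambda>v. span {v})"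
  unfolding projective_space_def by (rule quotient_map_quotient_topology)

lemma continuous_map_ang: "continuous_map euclideanreal projective_space ang"
proof -
  have "continuous_map euclideanreal (top_of_set (- {0 :: real^2})) (\<lambda>t. vector [cos t, sin t])"
  proof -
    have "continuous_on UNIV (\<lambda>t. vector [cos t, sin t] :: real^2)"
    proof -
      have "vector [cos t, sin t] = cos t *\<^sub>R axis 1 1 + sin t *\<^sub>R (axis 2 1 :: real^2)" for t :: real
        by (simp add: vector_2_eq_iff axis_def)
      then show ?thesis by (simp only:) (intro continuous_intros)
    qed
    moreover have "(vector [cos t, sin t] :: real^2) \<noteq> 0" for t
      using sin_zero_norm_cos_one[of t] by (auto simp: vector_2_eq_iff)
    ultimately show ?thesis by (simp add: continuous_map_in_subtopology image_subset_iff)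
  qed
  from continuous_map_compose[OF this quotient_imp_continuous_map[OF quotient_map_projective]]
  show ?thesis by (simp add: o_def ang_def[abs_def])
qed

text \<open>The closure of an interval contains its endpoints. This is the lower bound for the closure that
  makes disjointness of closures a statement about angles.\<close>

lemma ang_in_closure:
  assumes "\<alpha> < \<beta>" "\<beta> < \<alpha> + pi" "\<alpha> \<le> t" "t \<le> \<beta>"
  shows "ang t \<in> projective_space closure_of cyclic_interval (ang \<alpha>) (ang \<beta>)"
proof -
  have sub: "ang ` {\<alpha><..<\<beta>} \<subseteq> cyclic_interval (ang \<alpha>) (ang \<beta>)"
  proof
    fix p assume "p \<in> ang ` {\<alpha><..<\<beta>}"
    then obtain s where "\<alpha> < s" "s < \<beta>" "p = ang s" by auto
    then show "p \<in> cyclic_interval (ang \<alpha>) (ang \<beta>)"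
      using assms unfolding cyclic_interval_def positively_ordered_def ang_def by blast
  qed
  have "t \<in> euclideanreal closure_of {\<alpha><..<\<beta>}"
    using assms by simp
  then have "ang t \<in> projective_space closure_of (ang ` {\<alpha><..<\<beta>})"
    using continuous_map_image_closure_subset[OF continuous_map_ang, of "{\<alpha><..<\<beta>}"] by blast
  then show ?thesis using closure_of_mono[OF sub] by blast
qed

text \<open>Choose angles for \<open>b\<close>, \<open>c\<close>, \<open>d\<close> in the half-open period that begins at the angle of \<open>a\<close>. If
  \<open>d\<close> came before \<open>c\<close>, the interval from \<open>c\<close> to \<open>d\<close> would contain \<open>a\<close> in its closure; if \<open>c\<close>
  did not come after \<open>b\<close>, it would lie in the closure of the first interval.\<close>

theorem disjoint_intervals_ordered:
  assumes top: "{a, b, c, d} \<subseteq> topspace (projective_space :: 2 line topology)" and ne: "a \<noteq> b" "c \<noteq> d"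
    and disj: "(projective_space closure_of cyclic_interval a b) \<inter>
      (projective_space closure_of cyclic_interval c d) = {}"
  shows "positively_ordered b c a" "positively_ordered c d a"
proof -
  obtain \<alpha> where \<alpha>: "a = ang \<alpha>" using ang_surj[of a 0] top by auto
  obtain \<beta> where \<beta>: "\<alpha> \<le> \<beta>" "\<beta> < \<alpha> + pi" "b = ang \<beta>" using ang_surj[of b \<alpha>] top by auto
  obtain \<gamma> where \<gamma>: "\<alpha> \<le> \<gamma>" "\<gamma> < \<alpha> + pi" "c = ang \<gamma>" using ang_surj[of c \<alpha>] top by auto
  obtain \<delta> where \<delta>: "\<alpha> \<le> \<delta>" "\<delta> < \<alpha> + pi" "d = ang \<delta>" using ang_surj[of d \<alpha>] top by auto
  have \<alpha>\<beta>: "\<alpha> < \<beta>" using \<alpha> \<beta> ne by (cases "\<alpha> = \<beta>") auto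
  have ab: "ang t \<in> projective_space closure_of cyclic_interval a b" if "\<alpha> \<le> t" "t \<le> \<beta>" for t
    unfolding \<alpha> \<beta>(3) using ang_in_closure[OF \<alpha>\<beta> \<beta>(2) that] .
  have a': "ang (\<alpha> + pi) = a" "ang (\<delta> + pi) = d" using ang_shift[of \<alpha> 1] ang_shift[of \<delta> 1] \<alpha> \<delta> by simp_all
  have order: "\<gamma> < \<delta>"
  proof (rule ccontr)
    assume "\<not> \<gamma> < \<delta>"
    then have "\<delta> < \<gamma>" using ne \<gamma> \<delta> by (cases "\<gamma> = \<delta>") auto
    then have "ang (\<alpha> + pi) \<in> projective_space closure_of cyclic_interval (ang \<gamma>) (ang (\<delta> + pi))"
      using \<gamma> \<delta> by (intro ang_in_closure) auto
    then have "a \<in> projective_space closure_of cyclic_interval c d" using a' \<gamma> by simp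
    moreover have "a \<in> projective_space closure_of cyclic_interval a b" using ab[of \<alpha>] \<alpha> \<alpha>\<beta> by simp
    ultimately show False using disj by blast
  qed
  have cd: "ang t \<in> projective_space closure_of cyclic_interval c d" if "\<gamma> \<le> t" "t \<le> \<delta>" for t
    unfolding \<gamma>(3) \<delta>(3) using \<gamma> \<delta> order that by (intro ang_in_closure) auto
  have \<beta>\<gamma>: "\<beta> < \<gamma>"
  proof (rule ccontr)
    assume "\<not> \<beta> < \<gamma>"
    then have "c \<in> projective_space closure_of cyclic_interval a b" using ab[of \<gamma>] \<gamma> by simp
    moreover have "c \<in> projective_space closure_of cyclic_interval c d" using cd[of \<gamma>] \<gamma> order by simp
    ultimately show False using disj by blast
  qed
  show "positively_ordered b c a"
    unfolding positively_ordered_def using \<beta>\<gamma> \<gamma> \<beta> \<alpha>\<beta> a'(1)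
    by (intro exI[of _ \<beta>] exI[of _ \<gamma>] exI[of _ "\<alpha> + pi"]) (auto simp: ang_def)
  show "positively_ordered c d a"
    unfolding positively_ordered_def using order \<gamma> \<delta> \<beta>\<gamma> \<alpha>\<beta> a'(1)
    by (intro exI[of _ \<gamma>] exI[of _ \<delta>] exI[of _ "\<alpha> + pi"]) (auto simp: ang_def)
qed


section \<open>Ping-pong for free groups\<close>

lemma reduced_words_iff:
  "w \<in> reduced_words g \<longleftrightarrow> set w \<subseteq> letters g \<and> successively (\<lambda>i j. j \<noteq> - i) w"
  by (auto simp: reduced_words_def successively_conv_nth)

lemma reduced_words_Nil [simp]: "[] \<in> reduced_words g"
  by (simp add: reduced_words_iff)

lemma reduced_words_singleton: "[j] \<in> reduced_words g \<longleftrightarrow> j \<in> letters g"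
  by (simp add: reduced_words_iff)

lemma reduced_words_Cons:
  "j # w \<in> reduced_words g \<longleftrightarrow> j \<in> letters g \<and> w \<in> reduced_words g \<and> (w = [] \<or> hd w \<noteq> - j)"
  by (auto simp: reduced_words_iff successively_Cons)

lemma reduced_words_append:
  "u @ v \<in> reduced_words g \<longleftrightarrow> u \<in> reduced_words g \<and> v \<in> reduced_words g \<and>
    (u = [] \<or> v = [] \<or> hd v \<noteq> - last u)"
  by (auto simp: reduced_words_iff successively_append_iff)

lemma uminus_letters [simp]: "- j \<in> letters g \<longleftrightarrow> j \<in> letters g"
  by (auto simp: letters_def)

lemma letters_nonzero: "j \<in> letters g \<Longrightarrow> j \<noteq> - j"
  by (auto simp: letters_def)

lemma finite_letters [simp]: "finite (letters g)"
  by (rule finite_subset[of _ "{- int g..int g}"]) (auto simp: letters_def)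

lemma finite_reduced_words_length: "finite {w \<in> reduced_words g. length w \<le> m}"
  by (rule finite_subset[OF _ finite_lists_length_le[OF finite_letters[of g], of m]])
    (auto simp: reduced_words_iff)

lemma reduced_words_inverse: "w \<in> reduced_words g \<Longrightarrow> rev (map uminus w) \<in> reduced_words g"
  by (auto simp: reduced_words_iff successively_map elim!: successively_mono)

lemma foldr_prepend_reduced: "u @ v \<in> reduced_words g \<Longrightarrow> foldr prepend_letter u v = u @ v"
proof (induction u)
  case (Cons j u)
  then have *: "foldr prepend_letter u v = u @ v" "u @ v = [] \<or> hd (u @ v) \<noteq> - j"
    using reduced_words_Cons[of j "u @ v" g] by auto
  then show ?case by (cases "u @ v") auto
qed simp

lemma carrier_free_group [simp]: "carrier (free_group g) = reduced_words g"
  by (simp add: free_group_def)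

lemma mult_free_group: "u \<otimes>\<^bsub>free_group g\<^esub> v = foldr prepend_letter u v"
  by (simp add: free_group_def)

lemma boundary_prefix_reduced:
  assumes "x \<in> free_group_boundary g"
  shows "map x [0..<m] \<in> reduced_words g"
  using assms by (auto simp: free_group_boundary_def reduced_words_def)

lemma foldr_prepend_in: "u \<in> lists (letters g) \<Longrightarrow> v \<in> reduced_words g \<Longrightarrow> foldr prepend_letter u v \<in> reduced_words g"
proof (induction u)
  case (Cons j u)
  then have "foldr prepend_letter u v \<in> reduced_words g" "j \<in> letters g" by auto
  then show ?case
    by (cases "foldr prepend_letter u v") (auto simp: reduced_words_Cons)
qed simp

lemma free_group_closed: "u \<in> reduced_words g \<Longrightarrow> v \<in> reduced_words g \<Longrightarrow> u \<otimes>\<^bsub>free_group g\<^esub> v \<in> reduced_words g"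
  unfolding mult_free_group by (rule foldr_prepend_in) (auto simp: reduced_words_iff)

text \<open>Closed sets \<open>H j\<close> and open sets \<open>G j\<close>, one inside the other with the same closure. The letter \<open>j\<close>
  maps the complement of \<open>G (- j)\<close> onto \<open>H j\<close>. That all closed sets other than \<open>H (- j)\<close>
  are mapped into the open set \<open>G j\<close> makes the sets \<open>H j\<close> disjoint.\<close>

locale ping_pong =
  fixes g :: nat and Y :: "'a topology" and act :: "int list \<Rightarrow> 'a \<Rightarrow> 'a" and H G :: "int \<Rightarrow> 'a set"
  assumes compact: "compact_space Y"
    and act_continuous: "j \<in> letters g \<Longrightarrow> continuous_map Y Y (act [j])"
    and act_Nil: "x \<in> topspace Y \<Longrightarrow> act [] x = x"
    and act_mult: "u \<in> reduced_words g \<Longrightarrow> v \<in> reduced_words g \<Longrightarrow> x \<in> topspace Y \<Longrightarrow>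
      act (u \<otimes>\<^bsub>free_group g\<^esub> v) x = act u (act v x)"
    and closed_H: "j \<in> letters g \<Longrightarrow> closedin Y (H j)"
    and open_G: "j \<in> letters g \<Longrightarrow> openin Y (G j)"
    and G_subset_H: "j \<in> letters g \<Longrightarrow> G j \<subseteq> H j"
    and H_subset_closure: "j \<in> letters g \<Longrightarrow> H j \<subseteq> Y closure_of G j"
    and act_compl: "j \<in> letters g \<Longrightarrow> act [j] ` (topspace Y - G (- j)) = H j"
    and act_nested: "i \<in> letters g \<Longrightarrow> j \<in> letters g \<Longrightarrow> j \<noteq> - i \<Longrightarrow> act [i] ` H j \<subseteq> G i"
begin

abbreviation "S \<equiv> topspace Y"

lemma H_subset: "j \<in> letters g \<Longrightarrow> H j \<subseteq> S"
  using closed_H closedin_subset by blast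

lemma act_append: "u @ v \<in> reduced_words g \<Longrightarrow> x \<in> S \<Longrightarrow> act (u @ v) x = act u (act v x)"
  using act_mult[of u v x] foldr_prepend_reduced[of u v g]
  by (simp add: mult_free_group reduced_words_append)

lemma act_Cons: "j # w \<in> reduced_words g \<Longrightarrow> x \<in> S \<Longrightarrow> act (j # w) x = act [j] (act w x)"
  using act_append[of "[j]" w x] by simp

lemma act_inverse: "j \<in> letters g \<Longrightarrow> x \<in> S \<Longrightarrow> act [- j] (act [j] x) = x"
  using act_mult[of "[- j]" "[j]" x] act_Nil by (simp add: mult_free_group reduced_words_singleton)

lemma act_inverse': "j \<in> letters g \<Longrightarrow> x \<in> S \<Longrightarrow> act [j] (act [- j] x) = x"
  using act_inverse[of "- j" x] by simp

lemma act_letter_in: "j \<in> letters g \<Longrightarrow> x \<in> S \<Longrightarrow> act [j] x \<in> S"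
  using act_continuous[of j] by (auto simp: continuous_map_def)

lemma act_in: "w \<in> reduced_words g \<Longrightarrow> x \<in> S \<Longrightarrow> act w x \<in> S"
proof (induction w)
  case (Cons j w)
  then have "j \<in> letters g" "act w x \<in> S" by (auto simp: reduced_words_Cons)
  then show ?case using act_Cons[OF Cons.prems] act_letter_in by simp
qed (simp add: act_Nil)

lemma act_image_eq:
  assumes "j \<in> letters g" "C \<subseteq> S"
  shows "act [j] ` C = {x \<in> S. act [- j] x \<in> C}"
proof (intro equalityI subsetI)
  fix y assume "y \<in> act [j] ` C"
  then obtain x where "x \<in> C" "x \<in> S" "y = act [j] x" using assms(2) by blast
  then show "y \<in> {x \<in> S. act [- j] x \<in> C}" using act_inverse act_letter_in assms(1) by simp
next
  fix y assume "y \<in> {x \<in> S. act [- j] x \<in> C}"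
  then have "act [- j] y \<in> C" "y = act [j] (act [- j] y)" using act_inverse' assms(1) by auto
  then show "y \<in> act [j] ` C" by blast
qed

lemma closedin_act: "j \<in> letters g \<Longrightarrow> closedin Y C \<Longrightarrow> closedin Y (act [j] ` C)"
  using act_image_eq[OF _ closedin_subset] closedin_continuous_map_preimage[OF act_continuous[of "- j"]]
  by simp

lemma act_inj: "j \<in> letters g \<Longrightarrow> x \<in> S \<Longrightarrow> y \<in> S \<Longrightarrow> act [j] x = act [j] y \<Longrightarrow> x = y"
  using act_inverse by metis

lemma act_H_inverse:
  assumes "j \<in> letters g"
  shows "act [j] ` H (- j) = S - G j"
proof -
  have "H (- j) = act [- j] ` (S - G j)" using act_compl[of "- j"] assms by simp
  then have "act [j] ` H (- j) = (\<lambda>x. act [j] (act [- j] x)) ` (S - G j)" by (simp add: image_image)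
  also have "\<dots> = (\<lambda>x. x) ` (S - G j)" using act_inverse'[OF assms] by (intro image_cong) auto
  finally show ?thesis by simp
qed

lemma act_H_compl: "j \<in> letters g \<Longrightarrow> act [j] ` (S - H (- j)) = G j"
proof -
  assume j: "j \<in> letters g"
  have "act [j] ` (S - H (- j)) = S - act [j] ` H (- j)"
    using act_image_eq[OF j, of "S - H (- j)"] act_image_eq[OF j H_subset[of "- j"]] j act_letter_in[of "- j"]
    by auto
  then show ?thesis using act_H_inverse[OF j] openin_subset[OF open_G[OF j]] by auto
qed

lemma H_disjoint:
  assumes "i \<in> letters g" "j \<in> letters g" "i \<noteq> j"
  shows "H i \<inter> H j = {}"
proof -
  have "act [- i] x \<in> G (- i)" if "x \<in> H j" for x
    using act_nested[of "- i" j] assms that by auto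
  moreover have "act [- i] x \<notin> G (- i)" if "x \<in> H i" for x
    using act_H_inverse[of "- i"] assms that by auto
  ultimately show ?thesis by blast
qed

definition Hw :: "int list \<Rightarrow> 'a set" where
  "Hw w = act (butlast w) ` H (last w)"

definition Gw :: "int list \<Rightarrow> 'a set" where
  "Gw w = act (butlast w) ` G (last w)"

lemma reduced_last: "w \<in> reduced_words g \<Longrightarrow> w \<noteq> [] \<Longrightarrow> last w \<in> letters g"
  by (auto simp: reduced_words_iff)

lemma Hw_singleton [simp]: "j \<in> letters g \<Longrightarrow> Hw [j] = H j"
  using H_subset act_Nil by (force simp: Hw_def)

lemma reduced_butlast: "w \<in> reduced_words g \<Longrightarrow> butlast w \<in> reduced_words g"
  by (cases w rule: rev_cases) (auto simp: reduced_words_append)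

lemma Hw_Cons: "j # w \<in> reduced_words g \<Longrightarrow> w \<noteq> [] \<Longrightarrow> Hw (j # w) = act [j] ` Hw w"
proof -
  assume w: "j # w \<in> reduced_words g" "w \<noteq> []"
  have "j # butlast w \<in> reduced_words g" using reduced_butlast[OF w(1)] w(2) by simp
  from act_Cons[OF this] have *: "act (j # butlast w) x = act [j] (act (butlast w) x)" if "x \<in> S" for x
    using that by simp
  have l: "last w \<in> letters g" using reduced_last[OF w(1)] w(2) by simp
  show "Hw (j # w) = act [j] ` Hw w"
    unfolding Hw_def image_image using w(2) * H_subset[OF l] by (intro image_cong) auto
qed

lemma Hw_subset: "w \<in> reduced_words g \<Longrightarrow> w \<noteq> [] \<Longrightarrow> Hw w \<subseteq> S"
  using act_in[OF reduced_butlast] H_subset[OF reduced_last] by (auto simp: Hw_def)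

lemma Gw_subset_Hw: "w \<in> reduced_words g \<Longrightarrow> w \<noteq> [] \<Longrightarrow> Gw w \<subseteq> Hw w"
  unfolding Gw_def Hw_def by (intro image_mono G_subset_H reduced_last)

lemma Hw_subset_H: "w \<in> reduced_words g \<Longrightarrow> w \<noteq> [] \<Longrightarrow> Hw w \<subseteq> H (hd w)"
  and Hw_subset_G: "w \<in> reduced_words g \<Longrightarrow> Suc 0 < length w \<Longrightarrow> Hw w \<subseteq> G (hd w)"
proof -
  have "w \<in> reduced_words g \<Longrightarrow> w \<noteq> [] \<Longrightarrow> Hw w \<subseteq> H (hd w) \<and> (Suc 0 < length w \<longrightarrow> Hw w \<subseteq> G (hd w))" for w
  proof (induction w)
    case (Cons j w)
    have j: "j \<in> letters g" using Cons.prems by (simp add: reduced_words_Cons)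
    show ?case
    proof (cases "w = []")
      case True
      then show ?thesis using j by simp
    next
      case False
      then have w: "w \<in> reduced_words g" "hd w \<noteq> - j" using Cons.prems by (auto simp: reduced_words_Cons)
      moreover have "hd w \<in> letters g" using w(1) False by (auto simp: reduced_words_iff)
      ultimately have "act [j] ` H (hd w) \<subseteq> G j" using act_nested j by blast
      then have "Hw (j # w) \<subseteq> G j"
        using Cons.IH[OF w(1) False] Hw_Cons[OF Cons.prems(1) False] by blast
      then show ?thesis using G_subset_H[OF j] by auto
    qed
  qed simp
  then show "w \<in> reduced_words g \<Longrightarrow> w \<noteq> [] \<Longrightarrow> Hw w \<subseteq> H (hd w)"
    "w \<in> reduced_words g \<Longrightarrow> Suc 0 < length w \<Longrightarrow> Hw w \<subseteq> G (hd w)" by (blast, fastforce)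
qed

lemma Hw_disjoint:
  assumes "w \<in> reduced_words g" "w' \<in> reduced_words g" "length w = length w'" "w \<noteq> w'"
  shows "Hw w \<inter> Hw w' = {}"
  using assms
proof (induction w arbitrary: w')
  case (Cons j w)
  then obtain i v where w': "w' = i # v" "length v = length w" by (cases w') auto
  show ?case
  proof (cases "i = j")
    case True
    then have "w \<noteq> v" using Cons.prems w' by auto
    then have ne: "w \<noteq> []" "v \<noteq> []" using w' by auto
    have r: "w \<in> reduced_words g" "v \<in> reduced_words g" "j \<in> letters g"
      using Cons.prems w' by (auto simp: reduced_words_Cons)
    have "Hw w \<inter> Hw v = {}" using Cons.IH[OF r(1,2)] w' \<open>w \<noteq> v\<close> by simp
    then have "act [j] ` Hw w \<inter> act [j] ` Hw v = {}"
      using act_inj[OF r(3)] Hw_subset[OF r(1) ne(1)] Hw_subset[OF r(2) ne(2)] by blast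
    then show ?thesis using Hw_Cons[of j w] Hw_Cons[of j v] Cons.prems w' True ne by simp
  next
    case False
    have "H j \<inter> H i = {}" using Cons.prems w' False by (intro H_disjoint) (auto simp: reduced_words_Cons)
    then show ?thesis using Hw_subset_H[of "j # w"] Hw_subset_H[of w'] Cons.prems w' by auto
  qed
qed simp

lemma Hw_snoc: "w @ [j] \<in> reduced_words g \<Longrightarrow> w \<noteq> [] \<Longrightarrow> Hw (w @ [j]) \<subseteq> Hw w"
proof (induction w)
  case (Cons i w)
  show ?case
  proof (cases "w = []")
    case True
    then show ?thesis using Hw_subset_H[of "[i, j]"] Cons.prems by (simp add: reduced_words_Cons)
  next
    case False
    then have r: "w @ [j] \<in> reduced_words g" "i # w \<in> reduced_words g"
      using Cons.prems reduced_words_append[of "i # w" "[j]"] by (auto simp: reduced_words_Cons)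
    then show ?thesis
      using Cons.IH[OF r(1) False] Hw_Cons[of i w] Hw_Cons[of i "w @ [j]"] Cons.prems(1) False by auto
  qed
qed simp

text \<open>The nested neighbourhoods of the limit set.\<close>

definition E :: "nat \<Rightarrow> 'a set" where
  "E m = (\<Union>w\<in>{w \<in> reduced_words g. length w = m}. Hw w)"

definition limit_set :: "'a set" where
  "limit_set = (\<Inter>m\<in>{1..}. E m)"

definition Omega :: "'a set" where
  "Omega = S - limit_set"

definition D :: "'a set" where
  "D = S - (\<Union>j\<in>letters g. G j)"

lemma E_Suc: "m \<ge> 1 \<Longrightarrow> E (Suc m) \<subseteq> E m"
proof
  fix x assume m: "m \<ge> 1" "x \<in> E (Suc m)"
  then obtain w where w: "w \<in> reduced_words g" "length w = Suc m" "x \<in> Hw w" by (auto simp: E_def)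
  then obtain v j where v: "w = v @ [j]" by (cases w rule: rev_cases) auto
  have "v \<noteq> []" using v w(2) m by auto
  then have "x \<in> Hw v" using Hw_snoc[of v j] w v by auto
  then show "x \<in> E m" using v w by (auto simp: E_def reduced_words_append)
qed

lemma E_mono: "1 \<le> m \<Longrightarrow> m \<le> n \<Longrightarrow> E n \<subseteq> E m"
proof -
  assume 1: "1 \<le> m" and "m \<le> n"
  from this(2) show "E n \<subseteq> E m"
  proof (induction n rule: dec_induct)
    case (step n)
    then show ?case using E_Suc[of n] 1 by auto
  qed simp
qed

lemma closedin_Hw: "w \<in> reduced_words g \<Longrightarrow> w \<noteq> [] \<Longrightarrow> closedin Y (Hw w)"
proof (induction w)
  case (Cons j w)
  then have "j \<in> letters g" "w \<in> reduced_words g" by (auto simp: reduced_words_Cons)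
  then show ?case
    using Cons Hw_Cons[of j w] by (cases "w = []") (auto intro: closed_H closedin_act)
qed simp

lemma closedin_E: "m \<ge> 1 \<Longrightarrow> closedin Y (E m)"
  unfolding E_def
proof (intro closedin_Union finite_imageI)
  assume "m \<ge> 1"
  show "finite {w \<in> reduced_words g. length w = m}"
    by (rule finite_subset[OF _ finite_reduced_words_length[of g m]]) auto
  show "closedin Y T" if "T \<in> Hw ` {w \<in> reduced_words g. length w = m}" for T
    using that \<open>m \<ge> 1\<close> by (auto intro!: closedin_Hw)
qed

lemma limit_set_letter:
  assumes "j \<in> letters g" "x \<in> limit_set"
  shows "act [j] x \<in> limit_set"
proof -
  have "act [j] x \<in> E m" if m: "m \<ge> 1" for m
  proof -
    have "x \<in> E (Suc m)" using assms(2) by (auto simp: limit_set_def)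
    then obtain w where w: "w \<in> reduced_words g" "length w = Suc m" "x \<in> Hw w" by (auto simp: E_def)
    then obtain i v where v: "w = i # v" "length v = m" by (cases w) auto
    have "w \<noteq> []" using w(2) by auto
    then have xS: "x \<in> S" using Hw_subset[OF w(1)] w(3) by blast
    show ?thesis
    proof (cases "i = - j")
      case True
      have "v \<noteq> []" using v(2) m by auto
      then obtain y where y: "y \<in> Hw v" "x = act [- j] y" using w Hw_Cons[of i v] v True by auto
      have rv: "v \<in> reduced_words g" using w v by (simp add: reduced_words_Cons)
      then have "act [j] x = y" using y act_inverse'[OF assms(1)] Hw_subset[OF rv \<open>v \<noteq> []\<close>] by auto
      then show ?thesis using y rv v by (auto simp: E_def)
    next
      case False
      then have r: "j # w \<in> reduced_words g" using w v assms(1) by (auto simp: reduced_words_Cons)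
      then have "act [j] x \<in> Hw (j # w)" using Hw_Cons[OF r] w v by auto
      then have "act [j] x \<in> E (Suc (Suc m))" using r w by (auto simp: E_def)
      then show ?thesis using E_mono[of m "Suc (Suc m)"] m by auto
    qed
  qed
  then show ?thesis by (auto simp: limit_set_def)
qed

lemma Omega_letter: "j \<in> letters g \<Longrightarrow> act [j] ` Omega = Omega"
proof -
  assume j: "j \<in> letters g"
  have sub: "act [i] ` Omega \<subseteq> Omega" if i: "i \<in> letters g" for i
  proof
    fix y assume "y \<in> act [i] ` Omega"
    then obtain x where x: "x \<in> S" "x \<notin> limit_set" "y = act [i] x" by (auto simp: Omega_def)
    then have "y \<notin> limit_set" using limit_set_letter[of "- i" y] act_inverse[OF i] i by auto
    then show "y \<in> Omega" using x act_letter_in[OF i] by (simp add: Omega_def)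
  qed
  show ?thesis
  proof (intro equalityI sub j subsetI)
    fix x assume x: "x \<in> Omega"
    then have "act [- j] x \<in> Omega" using sub[of "- j"] j by auto
    moreover have "x = act [j] (act [- j] x)" using act_inverse'[OF j] x by (simp add: Omega_def)
    ultimately show "x \<in> act [j] ` Omega" by blast
  qed
qed

lemma Omega_subset: "Omega \<subseteq> S"
  by (auto simp: Omega_def)

theorem Omega_invariant: "w \<in> reduced_words g \<Longrightarrow> act w ` Omega = Omega"
proof (induction w)
  case Nil
  then show ?case using act_Nil Omega_subset by force
next
  case (Cons j w)
  have "act (j # w) ` Omega = act [j] ` act w ` Omega"
    unfolding image_image using act_Cons[OF Cons.prems] Omega_subset by (intro image_cong) auto
  then show ?case using Cons Omega_letter by (simp add: reduced_words_Cons)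
qed

text \<open>A point outside \<open>D\<close> lies in some \<open>G j\<close>; moved back by the letter \<open>j\<close> it lies in \<open>D\<close> or
  in some \<open>G i\<close> with \<open>i \<noteq> - j\<close>, and so on.\<close>

lemma D_or_Gw:
  assumes "x \<in> S" "m \<ge> 1"
  shows "(\<exists>w\<in>reduced_words g. length w < m \<and> x \<in> act w ` D) \<or>
    (\<exists>w\<in>reduced_words g. length w = m \<and> x \<in> Gw w)"
  using assms(2)
proof (induction m rule: dec_induct)
  case base
  show ?case
  proof (cases "x \<in> D")
    case True
    then have "x \<in> act [] ` D" using act_Nil[OF assms(1)] by force
    then show ?thesis by (intro disjI1 bexI[of _ "[]"]) auto
  next
    case False
    then obtain j where "j \<in> letters g" "x \<in> G j" using assms(1) by (auto simp: D_def)
    then show ?thesis using act_Nil[OF assms(1)]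
      by (intro disjI2 bexI[of _ "[j]"]) (force simp: Gw_def reduced_words_singleton)+
  qed
next
  case (step m)
  show ?case
  proof (cases "\<exists>w\<in>reduced_words g. length w < m \<and> x \<in> act w ` D")
    case True
    then show ?thesis using less_SucI by blast
  next
    case False
    then obtain w where w: "w \<in> reduced_words g" "length w = m" "x \<in> Gw w" using step.IH by blast
    then have ne: "w \<noteq> []" using step.hyps by auto
    define l where "l = last w"
    have l: "l \<in> letters g" using reduced_last[OF w(1) ne] by (simp add: l_def)
    obtain z where z: "z \<in> G l" "x = act (butlast w) z" using w(3) by (auto simp: Gw_def l_def)
    then obtain y where y: "y \<in> S" "y \<notin> H (- l)" "z = act [l] y" using act_H_compl[OF l] by blast
    have w_eq: "butlast w @ [l] = w" using ne by (simp add: l_def)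
    have x: "x = act w y" using act_append[of "butlast w" "[l]" y] w(1) y z w_eq by simp
    show ?thesis
    proof (cases "y \<in> D")
      case True
      then show ?thesis using w x by blast
    next
      case False
      then obtain j where j: "j \<in> letters g" "y \<in> G j" using y(1) by (auto simp: D_def)
      then have "j \<noteq> - l" using y(2) G_subset_H by blast
      then have "w @ [j] \<in> reduced_words g" using w(1) j ne by (simp add: reduced_words_append reduced_words_singleton l_def)
      moreover have "x \<in> Gw (w @ [j])" using x j by (simp add: Gw_def)
      ultimately show ?thesis using w(2) by (intro disjI2 bexI[of _ "w @ [j]"]) auto
    qed
  qed
qed

lemma D_translates: "x \<in> S \<Longrightarrow> m \<ge> 1 \<Longrightarrow> x \<notin> E m \<Longrightarrow> \<exists>w\<in>reduced_words g. x \<in> act w ` D"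
proof -
  assume x: "x \<in> S" "m \<ge> 1" "x \<notin> E m"
  have "x \<notin> Gw w" if "w \<in> reduced_words g" "length w = m" for w
  proof -
    have "w \<noteq> []" using that x(2) by auto
    then show ?thesis using x(3) that Gw_subset_Hw[of w] by (auto simp: E_def)
  qed
  then show ?thesis using D_or_Gw[OF x(1,2)] by blast
qed

lemma D_subset: "D \<subseteq> S"
  by (auto simp: D_def)

lemma D_subset_Omega: "D \<subseteq> Omega"
proof
  fix x assume x: "x \<in> D"
  have "x \<notin> E 2"
  proof
    assume "x \<in> E 2"
    then obtain w where w: "w \<in> reduced_words g" "length w = 2" "x \<in> Hw w" by (auto simp: E_def)
    moreover have "hd w \<in> letters g" using w(1,2) by (cases w) (auto simp: reduced_words_Cons)
    ultimately show False using Hw_subset_G[of w] x by (auto simp: D_def)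
  qed
  then show "x \<in> Omega" using x by (auto simp: Omega_def limit_set_def D_def)
qed

text \<open>A point that is not covered by translates of \<open>D\<close> by words of length less than \<open>m\<close> lies in \<open>E m\<close>.\<close>

theorem Omega_eq_translates: "(\<Union>w\<in>reduced_words g. act w ` D) = Omega"
proof (intro equalityI subsetI)
  fix x assume "x \<in> (\<Union>w\<in>reduced_words g. act w ` D)"
  then show "x \<in> Omega" using Omega_invariant D_subset_Omega by blast
next
  fix x assume "x \<in> Omega"
  then obtain m where "x \<in> S" "m \<ge> 1" "x \<notin> E m" by (auto simp: Omega_def limit_set_def)
  then show "x \<in> (\<Union>w\<in>reduced_words g. act w ` D)" using D_translates by blast
qed

lemma act_D_subset: "w \<in> reduced_words g \<Longrightarrow> w \<noteq> [] \<Longrightarrow> act w ` D \<subseteq> Hw w"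
proof (induction w)
  case (Cons j w)
  then have j: "j \<in> letters g" and w: "w \<in> reduced_words g" by (auto simp: reduced_words_Cons)
  show ?case
  proof (cases "w = []")
    case True
    have "D \<subseteq> S - G (- j)" using j by (auto simp: D_def)
    then show ?thesis using True act_compl[OF j] j by auto
  next
    case False
    have "act (j # w) ` D = act [j] ` act w ` D"
      unfolding image_image using act_Cons[OF Cons.prems(1)] D_subset by (intro image_cong) auto
    then show ?thesis using Cons.IH[OF w False] Hw_Cons[OF Cons.prems(1) False] by auto
  qed
qed simp

text \<open>If the image of a point under a word misses the attracting set of the word, the point lies in the
  repelling set.\<close>

lemma act_not_in_H: "w \<in> reduced_words g \<Longrightarrow> w \<noteq> [] \<Longrightarrow> x \<in> S \<Longrightarrow> act w x \<notin> H (hd w) \<Longrightarrow>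
    x \<in> Hw (rev (map uminus w))"
proof (induction w arbitrary: x rule: rev_induct)
  case (snoc l w)
  then have l: "l \<in> letters g" and w: "w \<in> reduced_words g" by (auto simp: reduced_words_append reduced_words_singleton)
  show ?case
  proof (cases "w = []")
    case True
    then have "act [l] x \<in> S - G l" using snoc.prems act_letter_in[OF l] G_subset_H[OF l] by auto
    moreover have "act [- l] ` (S - G l) = H (- l)" using act_compl[of "- l"] l by simp
    ultimately have "act [- l] (act [l] x) \<in> H (- l)" by blast
    then show ?thesis using True act_inverse[OF l snoc.prems(3)] l by simp
  next
    case False
    have "act w (act [l] x) \<notin> H (hd w)"
      using act_append[OF snoc.prems(1,3)] snoc.prems(4) False by simp
    then have IH: "act [l] x \<in> Hw (rev (map uminus w))"
      using snoc.IH[OF w False] act_letter_in[OF l snoc.prems(3)] by blast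
    have r: "- l # rev (map uminus w) \<in> reduced_words g"
      using reduced_words_inverse[OF snoc.prems(1)] by simp
    have "act [- l] (act [l] x) \<in> Hw (- l # rev (map uminus w))"
      using Hw_Cons[OF r] IH False by simp
    then show ?thesis using act_inverse[OF l snoc.prems(3)] by simp
  qed
qed simp

lemma openin_Omega: "openin Y Omega"
proof -
  have "Omega = (\<Union>m\<in>{1..}. S - E m)" by (auto simp: Omega_def limit_set_def)
  moreover have "openin Y (\<Union>m\<in>{1..}. S - E m)"
    using closedin_E by (intro openin_Union) (auto intro: openin_diff)
  ultimately show ?thesis by simp
qed

abbreviation "X \<equiv> subtopology Y Omega"

lemma topspace_X: "topspace X = Omega"
  using Omega_subset by (simp add: inf_absorb2)

text \<open>A compact set in the domain avoids some \<open>E m\<close>. Split a word of length more than \<open>2 m\<close> in two halves: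
  a point outside \<open>E m\<close> is not in the repelling set of the second half, so this half maps it into
  its attracting set and the whole word maps it into \<open>E (Suc m)\<close>, away from the compact set.\<close>

theorem properly_discontinuous_Omega: "properly_discontinuous (reduced_words g) act X"
  unfolding properly_discontinuous_def
proof (intro allI impI)
  fix K assume "compactin X K"
  then have K: "compactin Y K" "K \<subseteq> Omega" by (auto simp: compactin_subtopology)
  have "\<exists>m\<ge>1. K \<subseteq> S - E m"
  proof -
    have "\<exists>\<F>. finite \<F> \<and> \<F> \<subseteq> (\<lambda>m. S - E m) ` {1..} \<and> K \<subseteq> \<Union>\<F>"
    proof (rule compactinD[OF K(1)])
      show "openin Y U" if "U \<in> (\<lambda>m. S - E m) ` {1..}" for U
        using that closedin_E by (auto intro: openin_diff)
      show "K \<subseteq> \<Union> ((\<lambda>m. S - E m) ` {1..})" using K(2) by (auto simp: Omega_def limit_set_def)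
    qed
    then obtain \<F> where "finite \<F>" "\<F> \<subseteq> (\<lambda>m. S - E m) ` {1..}" and KF: "K \<subseteq> \<Union>\<F>" by blast
    then obtain A where A: "A \<subseteq> {1..}" "finite A" "\<F> = (\<lambda>m. S - E m) ` A" by (meson finite_subset_image)
    let ?m = "Max (insert 1 A)"
    have "E ?m \<subseteq> E m" if "m \<in> A" for m
      using that A by (intro E_mono) auto
    then have "K \<subseteq> S - E ?m" using KF unfolding A(3) by blast
    moreover have "?m \<ge> 1" using A(2) by (intro Max_ge) auto
    ultimately show ?thesis by blast
  qed
  then obtain m where m: "m \<ge> 1" "K \<subseteq> S - E m" by blast
  have "length w \<le> 2 * m" if w: "w \<in> reduced_words g" "act w ` K \<inter> K \<noteq> {}" for w
  proof (rule ccontr)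
    assume long: "\<not> length w \<le> 2 * m"
    obtain x where x: "x \<in> K" "act w x \<in> K" using w(2) by blast
    define u v where "u = take m w" and "v = drop m w"
    have uv: "w = u @ v" "length u = m" "length v \<ge> m" "v \<noteq> []" "u \<noteq> []"
      using long m(1) by (auto simp: u_def v_def)
    have r: "u \<in> reduced_words g" "v \<in> reduced_words g" "hd v \<noteq> - last u"
      using w(1) uv by (auto simp: reduced_words_append)
    have hv: "hd v \<in> letters g" using r(2) uv(4) by (auto simp: reduced_words_iff)
    have xS: "x \<in> S" using x m by auto
    have "act v x \<in> H (hd v)"
    proof (rule ccontr)
      assume "act v x \<notin> H (hd v)"
      then have "x \<in> Hw (rev (map uminus v))" using act_not_in_H[OF r(2) uv(4) xS] by blast
      then have "x \<in> E (length v)" using reduced_words_inverse[OF r(2)] by (force simp: E_def)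
      then show False using E_mono[OF m(1) uv(3)] x m by auto
    qed
    then have "act u (act v x) \<in> Hw (u @ [hd v])" by (simp add: Hw_def)
    moreover have "u @ [hd v] \<in> reduced_words g" using r hv by (simp add: reduced_words_append reduced_words_singleton)
    ultimately have "act w x \<in> E (Suc m)" using act_append[of u v x] w(1) uv xS by (force simp: E_def)
    then show False using E_Suc[OF m(1)] x m by auto
  qed
  then show "finite {w \<in> reduced_words g. act w ` K \<inter> K \<noteq> {}}"
    by (intro finite_subset[OF _ finite_reduced_words_length[of g "2 * m"]]) blast
qed

lemma closedin_D: "closedin Y D"
proof -
  have "openin Y (\<Union>j\<in>letters g. G j)" using open_G by (intro openin_Union) auto
  then show ?thesis unfolding D_def by (rule closedin_diff[OF closedin_topspace])
qed

lemma compactin_D: "compactin X D"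
  using closedin_compact_space[OF compact closedin_D] D_subset_Omega by (simp add: compactin_subtopology)

text \<open>The compact set \<open>D\<close> meets every orbit.\<close>

theorem cocompact_Omega: "cocompact (reduced_words g) act X"
proof -
  let ?orb = "\<lambda>x. (\<lambda>w. act w x) ` reduced_words g"
  have q: "quotient_map X (quotient_topology X ?orb) ?orb" by (rule quotient_map_quotient_topology)
  have "?orb ` D = topspace (quotient_topology X ?orb)"
  proof (intro equalityI)
    show "?orb ` D \<subseteq> topspace (quotient_topology X ?orb)" using D_subset_Omega topspace_X by auto
    show "topspace (quotient_topology X ?orb) \<subseteq> ?orb ` D"
    proof
      fix c assume "c \<in> topspace (quotient_topology X ?orb)"
      then obtain x where x: "x \<in> Omega" "c = ?orb x" using topspace_X by auto
      then obtain w d where w: "w \<in> reduced_words g" "d \<in> D" "x = act w d" using Omega_eq_translates by blast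
      have dS: "d \<in> S" using w D_subset by auto
      have orb_sub: "?orb (act v y) \<subseteq> ?orb y" if "v \<in> reduced_words g" "y \<in> S" for v y
      proof
        fix z assume "z \<in> ?orb (act v y)"
        then obtain u where u: "u \<in> reduced_words g" "z = act u (act v y)" by blast
        have "u \<otimes>\<^bsub>free_group g\<^esub> v \<in> reduced_words g" by (rule free_group_closed[OF u(1) that(1)])
        then show "z \<in> ?orb y" using act_mult[OF u(1) that] u(2) by (metis imageI)
      qed
      have "?orb d \<subseteq> ?orb x"
      proof -
        have "d = act (rev (map uminus w)) x"
          using w(1) dS unfolding w(3)
        proof (induction w arbitrary: d)
          case Nil
          then show ?case by (simp add: act_Nil)
        next
          case (Cons j w)
          then have r: "rev (map uminus w) @ [- j] \<in> reduced_words g" "j \<in> letters g" "w \<in> reduced_words g"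
            using reduced_words_inverse[OF Cons.prems(1)] by (auto simp: reduced_words_Cons)
          have "act (rev (map uminus (j # w))) (act (j # w) d) =
              act (rev (map uminus w)) (act [- j] (act [j] (act w d)))"
            using act_append[OF r(1)] act_Cons[OF Cons.prems(1,2)] act_letter_in[OF r(2)] act_in[OF r(3)] Cons.prems by simp
          then show ?case using Cons.IH[OF r(3) Cons.prems(2)] act_inverse[OF r(2) act_in[OF r(3) Cons.prems(2)]] by simp
        qed
        then show ?thesis using orb_sub[OF reduced_words_inverse[OF w(1)], of x] x Omega_subset by auto
      qed
      then have "c = ?orb d" using orb_sub[OF w(1) dS] w(3) x(2) by auto
      then show "c \<in> ?orb ` D" using w(2) by blast
    qed
  qed
  moreover have "compactin (quotient_topology X ?orb) (?orb ` D)"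
    by (rule image_compactin[OF compactin_D quotient_imp_continuous_map[OF q]])
  ultimately show ?thesis unfolding cocompact_def compact_space_def by simp
qed

text \<open>Every point of \<open>H j\<close> is a limit of points of \<open>G j\<close>, which are outside \<open>D\<close>.\<close>

lemma H_not_interior:
  assumes "j \<in> letters g"
  shows "H j \<inter> (X interior_of D) = {}"
proof -
  let ?U = "X interior_of D"
  have "openin Y ?U"
    using openin_interior_of[of X D] openin_Omega by (meson openin_trans_full)
  moreover have "?U \<inter> G j = {}" using interior_of_subset[of X D] assms by (auto simp: D_def)
  ultimately have "?U \<inter> Y closure_of G j = {}" using openin_Int_closure_of_eq_empty by metis
  then show ?thesis using H_subset_closure[OF assms] by blast
qed

text \<open>A nontrivial translate of \<open>D\<close> lies in some \<open>H j\<close>, which does not meet the interior of \<open>D\<close>.\<close>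

theorem fundamental_domain_D: "fundamental_domain (free_group g) act X D"
  unfolding fundamental_domain_def
proof (intro conjI ballI impI)
  show "closedin X D" using closedin_D D_subset_Omega by (auto simp: closedin_subtopology)
  show "(\<Union>w\<in>carrier (free_group g). act w ` D) = topspace X"
    using Omega_eq_translates topspace_X by simp
  fix w assume "w \<in> carrier (free_group g)" "w \<noteq> \<one>\<^bsub>free_group g\<^esub>"
  then have w: "w \<in> reduced_words g" "w \<noteq> []" by (auto simp: free_group_def)
  then have "hd w \<in> letters g" by (cases w) (auto simp: reduced_words_Cons)
  moreover have "X interior_of (act w ` D) \<subseteq> H (hd w)"
    using interior_of_subset[of X "act w ` D"] act_D_subset[OF w] Hw_subset_H[OF w] by blast
  ultimately show "X interior_of D \<inter> X interior_of (act w ` D) = {}" using H_not_interior by blast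
qed

theorem frontier_D: "X frontier_of D = (\<Union>j\<in>letters g. H j - G j)"
proof -
  have cl: "closedin X D" using closedin_D D_subset_Omega by (auto simp: closedin_subtopology)
  then have "X frontier_of D = D - X interior_of D" by (simp add: frontier_of_def closure_of_closedin)
  also have "\<dots> = (\<Union>j\<in>letters g. H j - G j)"
  proof (intro equalityI subsetI)
    fix z assume z: "z \<in> D - X interior_of D"
    have "\<exists>j\<in>letters g. z \<in> H j"
    proof (rule ccontr)
      let ?W = "S - (\<Union>j\<in>letters g. H j)"
      assume "\<not> (\<exists>j\<in>letters g. z \<in> H j)"
      then have "z \<in> ?W" using z D_subset by auto
      moreover have "?W \<subseteq> D" using G_subset_H by (auto simp: D_def)
      moreover have "openin Y ?W" using closed_H by (intro openin_diff closedin_Union) auto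
      then have "openin X ?W" using \<open>?W \<subseteq> D\<close> D_subset_Omega by (auto simp: openin_subtopology intro!: exI[of _ ?W])
      ultimately show False using z interior_of_maximal[of ?W D X] by blast
    qed
    then show "z \<in> (\<Union>j\<in>letters g. H j - G j)" using z by (auto simp: D_def)
  next
    fix z assume "z \<in> (\<Union>j\<in>letters g. H j - G j)"
    then obtain j where j: "j \<in> letters g" "z \<in> H j" "z \<notin> G j" by blast
    then have "z \<notin> G i" if "i \<in> letters g" for i
      using H_disjoint[of i j] G_subset_H[of i] that by (cases "i = j") auto
    then have "z \<in> D" using j H_subset by (auto simp: D_def)
    then show "z \<in> D - X interior_of D" using j H_not_interior[OF j(1)] by blast
  qed
  finally show ?thesis .
qed

text \<open>The sets \<open>Hw w\<close> for words of equal length are disjoint, so the words whose sets contain a given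
  limit point are prefixes of one infinite word.\<close>

theorem limit_set_eq:
  "limit_set = (\<Union>x\<in>free_group_boundary g. \<Inter>m\<in>{1..}. Hw (map x [0..<m]))"
proof (intro equalityI subsetI)
  fix z assume "z \<in> (\<Union>x\<in>free_group_boundary g. \<Inter>m\<in>{1..}. Hw (map x [0..<m]))"
  then show "z \<in> limit_set"
    unfolding limit_set_def E_def using boundary_prefix_reduced by fastforce
next
  fix z assume z: "z \<in> limit_set"
  then have "\<forall>m. \<exists>w. w \<in> reduced_words g \<and> length w = Suc m \<and> z \<in> Hw w"
    by (auto simp: limit_set_def E_def)
  then obtain w where w: "\<And>m. w m \<in> reduced_words g" "\<And>m. length (w m) = Suc m" "\<And>m. z \<in> Hw (w m)" by metis
  have step: "w (Suc m) = w m @ [last (w (Suc m))]" for m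
  proof -
    have ne: "w (Suc m) \<noteq> []" using w(2)[of "Suc m"] by auto
    then have eq: "butlast (w (Suc m)) @ [last (w (Suc m))] = w (Suc m)" by simp
    have "butlast (w (Suc m)) \<noteq> []" using w(2)[of "Suc m"] by (metis length_butlast diff_Suc_1 list.size(3) nat.simps(3))
    then have "z \<in> Hw (butlast (w (Suc m)))"
      using Hw_snoc[of "butlast (w (Suc m))" "last (w (Suc m))"] eq w(1,3)[of "Suc m"] by auto
    then have "butlast (w (Suc m)) = w m"
      using Hw_disjoint[OF reduced_butlast[OF w(1)[of "Suc m"]] w(1)[of m]] w(2,3) by auto
    then show ?thesis using eq by simp
  qed
  define x where "x i = last (w i)" for i
  have map_x: "map x [0..<Suc m] = w m" for m
  proof (induction m)
    case 0
    have "w 0 = [last (w 0)]" using w(2)[of 0] by (cases "w 0") auto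
    then show ?case by (simp add: x_def)
  next
    case (Suc m)
    have "[0..<Suc (Suc m)] = [0..<Suc m] @ [Suc m]" by simp
    then show ?case using step[of m] unfolding \<open>[0..<Suc (Suc m)] = _\<close> map_append Suc by (simp add: x_def)
  qed
  have "x \<in> free_group_boundary g"
    unfolding free_group_boundary_def
  proof (intro CollectI conjI allI)
    fix i
    have "w i \<noteq> []" using w(2)[of i] by auto
    then show "x i \<in> letters g" using reduced_last[OF w(1)[of i]] by (simp add: x_def)
    show "x (Suc i) \<noteq> - x i"
      using w(1)[of "Suc i"] \<open>w i \<noteq> []\<close> step[of i] reduced_words_append[of "w i" "[last (w (Suc i))]" g] by (simp add: x_def)
  qed
  moreover have "z \<in> Hw (map x [0..<m])" if "m \<in> {1..}" for m
    using that map_x[of "m - 1"] w(3)[of "m - 1"] by simp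
  ultimately show "z \<in> (\<Union>x\<in>free_group_boundary g. \<Inter>m\<in>{1..}. Hw (map x [0..<m]))" by blast
qed

end


section \<open>Cones of vectors with few sign changes\<close>

lemma dual_exists:
  fixes e :: "'n::{finite,linorder} vecs"
  assumes "pos_basis e"
  shows "\<exists>w. \<forall>x. x = (\<Sum>r<CARD('n). (w r \<bullet> x) *\<^sub>R e ! r)"
proof -
  let ?n = "CARD('n)"
  have len: "length e = ?n" using assms by (simp add: pos_basis_def)
  obtain F where F: "changes e (std_basis :: 'n vecs) F"
    using changes_exists[OF pos_basis_ordered[OF assms], of std_basis]
      ordered_basis_span[OF pos_basis_ordered[OF assms] len] len by auto
  have std: "(std_basis :: 'n vecs) ! i = axis (idx i) 1" if "i < ?n" for i
    using that by (simp add: std_basis_def idx_def)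
  define w where "w r = (\<Sum>i<?n. F r i *\<^sub>R (axis (idx i) 1 :: (real, 'n) Finite_Cartesian_Product.vec))" for r
  have wx: "w r \<bullet> x = (\<Sum>i<?n. F r i * x $ idx i)" for r x
    unfolding w_def inner_sum_left by (simp add: inner_axis')
  have "x = (\<Sum>r<?n. (w r \<bullet> x) *\<^sub>R e ! r)" for x :: "(real, 'n) Finite_Cartesian_Product.vec"
  proof -
    have "x = (\<Sum>i<?n. x $ idx i *\<^sub>R axis (idx i) 1)"
    proof (rule vec_eq_idx)
      fix j assume j: "j < ?n"
      have "(\<Sum>i<?n. x $ idx i *\<^sub>R axis (idx i :: 'n) 1) $ idx j = (\<Sum>i<?n. if i = j then x $ idx i else 0)"
        unfolding sum_component
      proof (rule sum.cong[OF refl])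
        fix i assume "i \<in> {..<?n}"
        then have "(idx j :: 'n) = idx i \<longleftrightarrow> j = i" using j by (intro idx_eq_iff) auto
        then show "(x $ idx i *\<^sub>R axis (idx i :: 'n) 1) $ idx j = (if i = j then x $ idx i else 0)"
          by (auto simp: axis_def)
      qed
      then show "x $ idx j = (\<Sum>i<?n. x $ idx i *\<^sub>R axis (idx i :: 'n) 1) $ idx j" using j by simp
    qed
    also have "\<dots> = (\<Sum>i<?n. x $ idx i *\<^sub>R (\<Sum>r<?n. F r i *\<^sub>R e ! r))"
      using F len std by (intro sum.cong) (auto simp: changes_def)
    also have "\<dots> = (\<Sum>r<?n. (w r \<bullet> x) *\<^sub>R e ! r)"
      unfolding wx scaleR_sum_left scaleR_sum_right by (subst sum.swap) (simp add: mult.commute)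
    finally show ?thesis .
  qed
  then show ?thesis by blast
qed

text \<open>Inner products with the dual basis are the coordinates with respect to \<open>e\<close>, so that conditions on
  the signs of coordinates are linear inequalities.\<close>

definition dual :: "'n::{finite,linorder} vecs \<Rightarrow> nat \<Rightarrow> (real, 'n) Finite_Cartesian_Product.vec" where
  "dual e = (SOME w. \<forall>x. x = (\<Sum>r<CARD('n). (w r \<bullet> x) *\<^sub>R e ! r))"

lemma dual_expand:
  fixes e :: "'n::{finite,linorder} vecs"
  assumes "pos_basis e"
  shows "x = (\<Sum>r<CARD('n). (dual e r \<bullet> x) *\<^sub>R e ! r)"
  using someI_ex[OF dual_exists[OF assms]] unfolding dual_def by blast

lemma dual_unique:
  fixes e :: "'n::{finite,linorder} vecs"
  assumes e: "pos_basis e" and x: "x = (\<Sum>r<CARD('n). a r *\<^sub>R e ! r)" and r: "r < CARD('n)"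
  shows "dual e r \<bullet> x = a r"
proof -
  have "(\<Sum>r<length e. (dual e r \<bullet> x - a r) *\<^sub>R e ! r) = 0"
    using dual_expand[OF e, of x] x e by (simp add: pos_basis_def scaleR_diff_left sum_subtractf)
  then have "dual e r \<bullet> x - a r = 0"
    using iffD1[OF ordered_basis_iff pos_basis_ordered[OF e], rule_format, of "\<lambda>r. dual e r \<bullet> x - a r" r]
      r e by (simp add: pos_basis_def)
  then show ?thesis by simp
qed

lemma dual_basis:
  fixes e :: "'n::{finite,linorder} vecs"
  assumes e: "pos_basis e" and rs: "r < CARD('n)" "s < CARD('n)"
  shows "dual e r \<bullet> e ! s = (if r = s then 1 else 0)"
  by (rule dual_unique[OF e _ rs(1)]) (use rs in \<open>simp add: sum_delta_scaleR\<close>)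

lemma dual_nonzero:
  fixes e :: "'n::{finite,linorder} vecs"
  assumes "pos_basis e" "r < CARD('n)"
  shows "dual e r \<noteq> 0"
  using dual_basis[OF assms(1,2,2)] by auto

lemma coordinate_nonzero:
  fixes e :: "'n::{finite,linorder} vecs"
  assumes "pos_basis e" "x \<noteq> 0"
  shows "\<exists>r<CARD('n). dual e r \<bullet> x \<noteq> 0"
proof (rule ccontr)
  assume "\<not> (\<exists>r<CARD('n). dual e r \<bullet> x \<noteq> 0)"
  then have "(\<Sum>r<CARD('n). (dual e r \<bullet> x) *\<^sub>R e ! r) = 0" by (intro sum.neutral) auto
  then show False using dual_expand[OF assms(1), of x] assms(2) by simp
qed

lemma dual_linear_image:
  fixes e :: "'n::{finite,linorder} vecs" and M :: "'n sqmat"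
  assumes e: "pos_basis e" "pos_basis (map ((*v) M) e)" and r: "r < CARD('n)"
  shows "dual (map ((*v) M) e) r \<bullet> (M *v x) = dual e r \<bullet> x"
proof (rule dual_unique[OF e(2) _ r])
  have len: "length e = CARD('n)" using e by (simp add: pos_basis_def)
  have "M *v x = M *v (\<Sum>r<CARD('n). (dual e r \<bullet> x) *\<^sub>R e ! r)" using dual_expand[OF e(1), of x] by simp
  also have "\<dots> = (\<Sum>r<CARD('n). (dual e r \<bullet> x) *\<^sub>R map ((*v) M) e ! r)"
    using len by (simp add: linear_sum[OF matrix_vector_mul_linear] matrix_vector_mult_scaleR)
  finally show "M *v x = (\<Sum>r<CARD('n). (dual e r \<bullet> x) *\<^sub>R map ((*v) M) e ! r)" .
qed

lemma dual_changes:
  fixes e c :: "'n::{finite,linorder} vecs"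
  assumes e: "pos_basis e" "pos_basis c" and M: "changes e c M" and r: "r < CARD('n)"
  shows "dual e r \<bullet> x = (\<Sum>j<CARD('n). M r j * (dual c j \<bullet> x))"
proof (rule dual_unique[OF e(1) _ r])
  have len: "length e = CARD('n)" "length c = CARD('n)" using e by (auto simp: pos_basis_def)
  have "x = (\<Sum>j<CARD('n). (dual c j \<bullet> x) *\<^sub>R (\<Sum>r<CARD('n). M r j *\<^sub>R e ! r))"
    using dual_expand[OF e(2), of x] M len by (simp add: changes_def)
  also have "\<dots> = (\<Sum>r<CARD('n). (\<Sum>j<CARD('n). M r j * (dual c j \<bullet> x)) *\<^sub>R e ! r)"
    unfolding scaleR_sum_left scaleR_sum_right by (subst sum.swap) (simp add: mult.commute)
  finally show "x = (\<Sum>r<CARD('n). (\<Sum>j<CARD('n). M r j * (dual c j \<bullet> x)) *\<^sub>R e ! r)" .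
qed

lemma dual_scale:
  fixes e :: "'n::{finite,linorder} vecs"
  assumes e: "pos_basis e" "pos_basis (scale s e)" and s: "s \<in> {1, -1}" and r: "r < CARD('n)"
  shows "dual (scale s e) r \<bullet> x = s * (dual e r \<bullet> x)"
proof (rule dual_unique[OF e(2) _ r])
  have "(\<Sum>r<CARD('n). (s * (dual e r \<bullet> x)) *\<^sub>R scale s e ! r) = (\<Sum>r<CARD('n). (dual e r \<bullet> x) *\<^sub>R e ! r)"
    using e s by (intro sum.cong) (auto simp: pos_basis_def)
  then show "x = (\<Sum>r<CARD('n). (s * (dual e r \<bullet> x)) *\<^sub>R scale s e ! r)"
    using dual_expand[OF e(1), of x] by simp
qed

abbreviation coordinates :: "'n::{finite,linorder} vecs \<Rightarrow> (real, 'n) Finite_Cartesian_Product.vec \<Rightarrow> nat \<Rightarrow> real" where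
  "coordinates e x \<equiv> (\<lambda>r. dual e r \<bullet> x)"

text \<open>A zero coordinate may be given either sign. The cone \<open>few\<close> asks for one choice with fewer than
  \<open>k\<close> changes, \<open>many\<close> for one choice with at least \<open>k\<close> changes; both are closed apart from the
  origin, and \<open>strictly_few\<close> is open.\<close>

definition few :: "nat \<Rightarrow> 'n::{finite,linorder} vecs \<Rightarrow> (real, 'n) Finite_Cartesian_Product.vec set" where
  "few k e = {x. x \<noteq> 0 \<and> (\<exists>\<sigma>. signs_of CARD('n) \<sigma> (coordinates e x) \<and> sign_changes CARD('n) \<sigma> < k)}"

definition many :: "nat \<Rightarrow> 'n::{finite,linorder} vecs \<Rightarrow> (real, 'n) Finite_Cartesian_Product.vec set" where
  "many k e = {x. x \<noteq> 0 \<and> (\<exists>\<sigma>. signs_of CARD('n) \<sigma> (coordinates e x) \<and> sign_changes CARD('n) \<sigma> \<ge> k)}"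

definition strictly_few :: "nat \<Rightarrow> 'n::{finite,linorder} vecs \<Rightarrow> (real, 'n) Finite_Cartesian_Product.vec set" where
  "strictly_few k e = - {0} - many k e"

lemma signs_exist: "\<exists>\<sigma>. signs_of n \<sigma> y"
  by (rule exI[of _ "\<lambda>i. y i \<ge> 0"]) (auto simp: signs_of_def)

lemma strictly_few_subset: "strictly_few k e \<subseteq> few k e"
  using signs_exist by (fastforce simp: strictly_few_def many_def few_def)

lemma signs_of_scale:
  assumes "s \<noteq> 0"
  shows "signs_of n \<sigma> (\<lambda>r. s * y r) \<longleftrightarrow> signs_of n (\<lambda>i. \<sigma> i = (s > 0)) y"
proof (cases "s > 0")
  case True
  then show ?thesis by (simp add: signs_of_def zero_le_mult_iff mult_le_0_iff)
next
  case False
  then have "s < 0" using assms by simp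
  then show ?thesis by (auto simp: signs_of_def zero_le_mult_iff mult_le_0_iff not_less split: if_splits)
qed

lemma sign_changes_neg: "sign_changes n (\<lambda>i. \<sigma> i = b) = sign_changes n \<sigma>"
  unfolding sign_changes_def by (rule arg_cong[where f = card]) auto

lemma ex_signs_scale:
  assumes "s \<noteq> 0"
  shows "(\<exists>\<sigma>. signs_of n \<sigma> (\<lambda>r. s * y r) \<and> P (sign_changes n \<sigma>)) \<longleftrightarrow> (\<exists>\<sigma>. signs_of n \<sigma> y \<and> P (sign_changes n \<sigma>))"
proof
  assume "\<exists>\<sigma>. signs_of n \<sigma> (\<lambda>r. s * y r) \<and> P (sign_changes n \<sigma>)"
  then obtain \<sigma> where "signs_of n \<sigma> (\<lambda>r. s * y r)" "P (sign_changes n \<sigma>)" by blast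
  then show "\<exists>\<sigma>. signs_of n \<sigma> y \<and> P (sign_changes n \<sigma>)"
    using signs_of_scale[OF assms] sign_changes_neg[of n \<sigma> "s > 0"]
    by (intro exI[of _ "\<lambda>i. \<sigma> i = (s > 0)"]) simp
next
  assume "\<exists>\<sigma>. signs_of n \<sigma> y \<and> P (sign_changes n \<sigma>)"
  then obtain \<sigma> where \<sigma>: "signs_of n \<sigma> y" "P (sign_changes n \<sigma>)" by blast
  have "(\<lambda>i. (\<sigma> i = (s > 0)) = (s > 0)) = \<sigma>" by auto
  then have "signs_of n (\<lambda>i. \<sigma> i = (s > 0)) (\<lambda>r. s * y r)" using signs_of_scale[OF assms, of n "\<lambda>i. \<sigma> i = (s > 0)" y] \<sigma> by simp
  then show "\<exists>\<sigma>. signs_of n \<sigma> (\<lambda>r. s * y r) \<and> P (sign_changes n \<sigma>)"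
    using \<sigma>(2) sign_changes_neg[of n \<sigma> "s > 0"] by (intro exI[of _ "\<lambda>i. \<sigma> i = (s > 0)"]) simp
qed

lemma few_scaleR: "r \<noteq> 0 \<Longrightarrow> r *\<^sub>R x \<in> few k e \<longleftrightarrow> x \<in> few k e"
  using ex_signs_scale[of r _ "coordinates e x" "\<lambda>s. s < k"] by (simp add: few_def)

lemma many_scaleR: "r \<noteq> 0 \<Longrightarrow> r *\<^sub>R x \<in> many k e \<longleftrightarrow> x \<in> many k e"
  using ex_signs_scale[of r _ "coordinates e x" "\<lambda>s. s \<ge> k"] by (simp add: many_def)

lemma strictly_few_scaleR: "r \<noteq> 0 \<Longrightarrow> r *\<^sub>R x \<in> strictly_few k e \<longleftrightarrow> x \<in> strictly_few k e"
  by (simp add: strictly_few_def many_scaleR)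

lemma signs_of_cong: "(\<And>i. i < n \<Longrightarrow> x i = y i) \<Longrightarrow> signs_of n \<sigma> x \<longleftrightarrow> signs_of n \<sigma> y"
  by (simp add: signs_of_def)

lemma few_linear_image:
  fixes e :: "'n::{finite,linorder} vecs" and M :: "'n sqmat"
  assumes "pos_basis e" "pos_basis (map ((*v) M) e)" "Determinants.det M \<noteq> 0"
  shows "M *v x \<in> few k (map ((*v) M) e) \<longleftrightarrow> x \<in> few k e"
proof -
  have "M *v x \<noteq> 0 \<longleftrightarrow> x \<noteq> 0" using inj_matrix[OF assms(3), of x] by auto
  moreover have "signs_of CARD('n) \<sigma> (coordinates (map ((*v) M) e) (M *v x)) \<longleftrightarrow> signs_of CARD('n) \<sigma> (coordinates e x)" for \<sigma>
    by (rule signs_of_cong) (rule dual_linear_image[OF assms(1,2)])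
  ultimately show ?thesis by (simp add: few_def)
qed

lemma few_scale:
  fixes e :: "'n::{finite,linorder} vecs"
  assumes "pos_basis e" "pos_basis (scale s e)" "s \<in> {1, -1}"
  shows "few k (scale s e) = few k e"
proof -
  have s: "s \<noteq> 0" using assms by auto
  have "signs_of CARD('n) \<sigma> (coordinates (scale s e) x) \<longleftrightarrow> signs_of CARD('n) \<sigma> (\<lambda>r. s * coordinates e x r)" for \<sigma> x
    by (rule signs_of_cong) (rule dual_scale[OF assms])
  then show ?thesis using ex_signs_scale[OF s, of "CARD('n)" _ "\<lambda>m. m < k"] by (simp add: few_def)
qed

text \<open>Variation diminution, applied to all compatible signs of the image.\<close>

lemma few_totally_positive:
  fixes e c :: "'n::{finite,linorder} vecs"
  assumes e: "pos_basis e" "pos_basis c" and M: "changes e c M" "totally_positive CARD('n) CARD('n) M"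
  shows "few k c \<subseteq> strictly_few k e"
proof
  fix x assume "x \<in> few k c"
  then obtain \<sigma> where \<sigma>: "x \<noteq> 0" "signs_of CARD('n) \<sigma> (coordinates c x)" "sign_changes CARD('n) \<sigma> < k"
    by (auto simp: few_def)
  obtain i where i: "i < CARD('n)" "coordinates c x i \<noteq> 0" using coordinate_nonzero[OF e(2) \<sigma>(1)] by blast
  have "sign_changes CARD('n) \<tau> < k" if "signs_of CARD('n) \<tau> (coordinates e x)" for \<tau>
  proof -
    have "signs_of CARD('n) \<tau> (\<lambda>r. \<Sum>j<CARD('n). M r j * coordinates c x j)"
    proof -
      have "signs_of CARD('n) \<tau> (coordinates e x) \<longleftrightarrow>
          signs_of CARD('n) \<tau> (\<lambda>r. \<Sum>j<CARD('n). M r j * coordinates c x j)"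
        by (rule signs_of_cong) (rule dual_changes[OF e M(1)])
      then show ?thesis using that by simp
    qed
    then show ?thesis using variation_diminishing[OF M(2) \<sigma>(2) i] \<sigma>(3) by fastforce
  qed
  then show "x \<in> strictly_few k e" using \<sigma>(1) by (force simp: strictly_few_def many_def)
qed

lemma sign_if_same_sign:
  fixes a d f :: real
  assumes "d > 0 \<longleftrightarrow> a * f > 0" "d \<noteq> 0" "f > 0" "a \<in> {1, -1}"
  shows "a * d > 0"
  using assms by auto

text \<open>The image of \<open>e\<close> and the basis \<open>e'\<close> span the same pair of flags, in opposite order. So \<open>e' ! p\<close> lies
  in the span of the last \<open>p + 1\<close> and in the span of the first \<open>n - p\<close> images, which
  have a single base vector in common. The
  signs of the factors are found by comparing orientations of the initial segments of length \<open>p\<close> and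
  \<open>p + 1\<close>, each completed by the complementary initial segment of the image of \<open>e\<close>.\<close>

lemma antidiagonal:
  fixes e e' :: "'n::{finite,linorder} vecs" and M :: "'n sqmat"
  assumes even: "even CARD('n)" and pb: "pos_basis e" "pos_basis e'" and M: "Determinants.det M = 1"
    and s: "s \<in> {1, -1}"
    and initial: "\<And>i. i < CARD('n) \<Longrightarrow> same_orientation (take i e') (scale s (map ((*v) M) (drop (CARD('n) - i) e)))"
    and final: "\<And>l. l < CARD('n) \<Longrightarrow> span (set (drop (CARD('n) - l) e')) = span (set (map ((*v) M) (take l e)))"
  obtains \<mu> where "\<And>p. p < CARD('n) \<Longrightarrow> e' ! p = \<mu> p *\<^sub>R (M *v (e ! (CARD('n) - 1 - p)))"
    "\<And>p. p < CARD('n) \<Longrightarrow> s * (-1) ^ p * \<mu> p > 0"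
proof -
  let ?n = "CARD('n)"
  define f where "f = map ((*v) M) e"
  have len: "length e = ?n" "length e' = ?n" "length f = ?n" using pb by (auto simp: pos_basis_def f_def)
  have f: "pos_basis f" using Dv_linear_image[OF len(1), of M] M pb len by (simp add: pos_basis_def f_def)
  have init: "same_orientation (take i e') (scale s (drop (?n - i) f))" if "i < ?n" for i
    using initial[OF that] by (simp add: f_def drop_map)
  have fin: "span (set (drop (?n - l) e')) = span (set (take l f))" if "l < ?n" for l
    using final[OF that] by (simp add: f_def take_map)
  have "\<exists>m. e' ! p = m *\<^sub>R f ! (?n - 1 - p)" if p: "p < ?n" for p
  proof -
    define a where "a r = dual f r \<bullet> (e' ! p)" for r
    have eq: "e' ! p = (\<Sum>r<?n. a r *\<^sub>R f ! r)" unfolding a_def by (rule dual_expand[OF f])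
    have coord: "dual f r \<bullet> x = 0" if "x \<in> span A" "\<And>y. y \<in> A \<Longrightarrow> dual f r \<bullet> y = 0" for r x A
      using span_induct[OF that(1), of "\<lambda>y. dual f r \<bullet> y = 0"] that(2)
      by (auto simp: subspace_def inner_add_right)
    have 1: "a r = 0" if r: "r < ?n - 1 - p" for r
    proof -
      have i: "Suc p < ?n" using r by simp
      have "e' ! p \<in> span (set (take (Suc p) e'))"
        using p len by (intro span_base) (auto simp: in_set_conv_nth intro!: exI[of _ p])
      also have "\<dots> = span (set (scale s (drop (?n - Suc p) f)))" by (rule same_orientation_span[OF init[OF i]])
      finally show ?thesis
        unfolding a_def
      proof (rule coord)
        fix y assume "y \<in> set (scale s (drop (?n - Suc p) f))"
        then obtain q where "q < Suc p" "y = s *\<^sub>R f ! (?n - Suc p + q)" using len i by (auto simp: in_set_conv_nth)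
        then show "dual f r \<bullet> y = 0" using dual_basis[OF f, of r "?n - Suc p + q"] r i by auto
      qed
    qed
    have 2: "a r = 0" if r: "?n - 1 - p < r" "r < ?n" for r
    proof -
      have l: "?n - p < ?n" "?n - (?n - p) = p" using r p by auto
      have "e' ! p \<in> span (set (drop p e'))"
        using p len by (intro span_base) (auto simp: in_set_conv_nth intro!: exI[of _ 0])
      also have "\<dots> = span (set (take (?n - p) f))" using fin[OF l(1)] l(2) by simp
      finally show ?thesis
        unfolding a_def
      proof (rule coord)
        fix y assume "y \<in> set (take (?n - p) f)"
        then obtain q where "q < ?n - p" "y = f ! q" using len by (auto simp: in_set_conv_nth)
        then show "dual f r \<bullet> y = 0" using dual_basis[OF f, of r q] r by auto
      qed
    qed
    have "(\<Sum>r<?n. a r *\<^sub>R f ! r) = (\<Sum>r\<in>{?n - 1 - p}. a r *\<^sub>R f ! r)"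
      by (rule sum.mono_neutral_right) (use 1 2 p in \<open>auto, metis nat_neq_iff scale_zero_left\<close>)
    then show ?thesis using eq by auto
  qed
  then obtain \<mu> where \<mu>: "\<And>p. p < ?n \<Longrightarrow> e' ! p = \<mu> p *\<^sub>R f ! (?n - 1 - p)" by metis
  have spow: "s ^ i * s ^ i = 1" for i using s by (auto simp: power_mult_distrib[symmetric])
  have sign: "s ^ i * (-1) ^ (i * (?n - i)) * Dv (take i e' @ take (?n - i) f) > 0" if i: "i \<le> ?n" for i
  proof (cases "i = ?n")
    case True
    then show ?thesis using pb(2) s even len by (auto simp: pos_basis_def)
  next
    case False
    then have i: "i < ?n" using i by simp
    have "Dv (take i e' @ take (?n - i) f) > 0 \<longleftrightarrow> Dv (scale s (drop (?n - i) f) @ take (?n - i) f) > 0"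
      using same_orientation_Dv[OF init[OF i], of "[]" "take (?n - i) f"] len i by simp
    moreover have "Dv (take i e' @ take (?n - i) f) \<noteq> 0"
    proof -
      obtain F where F: "changes (scale s (drop (?n - i) f)) (take i e') F" "detf i F > 0"
        using same_orientation_sym[OF init[OF i]] len i by (auto simp: same_orientation_iff)
      have "Dv (take i e' @ take (?n - i) f) = detf i F * Dv (scale s (drop (?n - i) f) @ take (?n - i) f)"
        using Dv_changes[OF F(1), of "[]" "take (?n - i) f"] len i by simp
      moreover have "Dv (scale s (drop (?n - i) f) @ take (?n - i) f) \<noteq> 0"
        using Dv_scale_middle[of "[]" "drop (?n - i) f" "take (?n - i) f" s]
          Dv_swap[of "[]" "drop (?n - i) f" "take (?n - i) f" "[]"] f len i s by (auto simp: pos_basis_def)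
      ultimately show ?thesis using F(2) by simp
    qed
    moreover have "Dv (scale s (drop (?n - i) f) @ take (?n - i) f) = s ^ i * (-1) ^ (i * (?n - i)) * Dv f"
      using Dv_scale_middle[of "[]" "drop (?n - i) f" "take (?n - i) f" s]
        Dv_swap[of "[]" "drop (?n - i) f" "take (?n - i) f" "[]"] len i by simp
    moreover have "Dv f > 0" using f by (simp add: pos_basis_def)
    moreover have "s ^ i * (-1) ^ (i * (?n - i)) \<in> {1, -1}"
    proof -
      have "s ^ i \<in> {1, -1}" using s by (auto simp: minus_one_power_iff split: if_splits)
      moreover have "(-1 :: real) ^ (i * (?n - i)) \<in> {1, -1}" by (simp only: minus_one_power_iff split: if_split) simp
      ultimately show ?thesis by auto
    qed
    ultimately show ?thesis by (intro sign_if_same_sign[of _ _ "Dv f"]) simp_all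
  qed
  show ?thesis
  proof (rule that[of \<mu>])
    fix p assume p: "p < ?n"
    show "e' ! p = \<mu> p *\<^sub>R (M *v (e ! (?n - 1 - p)))" using \<mu>[OF p] p len by (simp add: f_def)
    let ?t = "take (?n - 1 - p) f" and ?x = "f ! (?n - 1 - p)"
    have tk: "take (?n - p) f = ?t @ [?x]"
      using take_Suc_conv_app_nth[of "?n - 1 - p" f] p len by (simp add: Suc_diff_Suc)
    have "take (Suc p) e' = take p e' @ [\<mu> p *\<^sub>R ?x]"
      using take_Suc_conv_app_nth[of p e'] p len \<mu>[OF p] by simp
    then have "Dv (take (Suc p) e' @ take (?n - Suc p) f) = Dv (take p e' @ scale (\<mu> p) [?x] @ ?t)" by simp
    also have "\<dots> = \<mu> p * Dv (take p e' @ [?x] @ ?t)"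
      using Dv_scale_middle[of "take p e'" "[?x]" ?t "\<mu> p"] p len by simp
    also have "Dv (take p e' @ [?x] @ ?t) = (-1) ^ (?n - 1 - p) * Dv (take p e' @ take (?n - p) f)"
      using Dv_swap[of "take p e'" "[?x]" ?t "[]"] p len tk by simp
    finally have rec: "Dv (take (Suc p) e' @ take (?n - Suc p) f) =
        \<mu> p * ((-1) ^ (?n - 1 - p) * Dv (take p e' @ take (?n - p) f))" .
    let ?d = "Dv (take p e' @ take (?n - p) f)"
    have s1: "s ^ p * (-1) ^ (p * (?n - p)) * ?d > 0" using p by (intro sign) simp
    have "Suc p \<le> ?n" using p by simp
    from mult_pos_pos[OF s1 sign[OF this, unfolded rec]]
    have "(s ^ p * (-1) ^ (p * (?n - p)) * ?d) *
        (s ^ Suc p * (-1) ^ (Suc p * (?n - Suc p)) * (\<mu> p * ((-1) ^ (?n - 1 - p) * ?d))) > 0" .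
    also have "(s ^ p * (-1) ^ (p * (?n - p)) * ?d) *
        (s ^ Suc p * (-1) ^ (Suc p * (?n - Suc p)) * (\<mu> p * ((-1) ^ (?n - 1 - p) * ?d))) =
        (s ^ p * s ^ p) * s * ((-1) ^ (p * (?n - p)) * (-1) ^ (Suc p * (?n - Suc p)) * (-1) ^ (?n - 1 - p)) * \<mu> p * (?d * ?d)"
      by (simp only: power_Suc mult_ac)
    also have "(-1) ^ (p * (?n - p)) * (-1) ^ (Suc p * (?n - Suc p)) * (-1) ^ (?n - 1 - p) = (-1 :: real) ^ p"
    proof -
      obtain d where d: "?n = Suc p + d" using p le_Suc_ex[of "Suc p" ?n] by auto
      then have "even (Suc p + d)" using even by simp
      then have "even (p * (?n - p) + Suc p * (?n - Suc p) + (?n - 1 - p)) \<longleftrightarrow> even p"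
        unfolding d by (auto simp: Suc_diff_le)
      then have "(-1 :: real) ^ (p * (?n - p) + Suc p * (?n - Suc p) + (?n - 1 - p)) = (-1) ^ p"
        by (simp only: minus_one_power_iff)
      then show ?thesis by (simp only: power_add)
    qed
    finally have "s * (-1) ^ p * \<mu> p * (?d * ?d) > 0" by (simp only: spow mult_1)
    then show "s * (-1) ^ p * \<mu> p > 0" by (auto simp: zero_less_mult_iff)
  qed
qed

text \<open>Reversal preserves the number of sign changes and the alternating factors turn it into
  \<open>2 k - 1\<close> minus this number.\<close>

lemma many_antidiagonal:
  fixes e e' :: "'n::{finite,linorder} vecs" and M :: "'n sqmat"
  assumes k: "CARD('n) = 2 * k" and pb: "pos_basis e" "pos_basis e'" and M: "Determinants.det M = 1" and s: "s \<in> {1, -1}"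
    and \<mu>: "\<And>p. p < CARD('n) \<Longrightarrow> e' ! p = \<mu> p *\<^sub>R (M *v (e ! (CARD('n) - 1 - p)))"
      "\<And>p. p < CARD('n) \<Longrightarrow> s * (-1) ^ p * \<mu> p > 0"
  shows "M *v x \<in> few k e' \<longleftrightarrow> x \<in> many k e"
proof -
  let ?n = "CARD('n)"
  have n: "?n > 0" by simp
  have len: "length e = ?n" "length e' = ?n" using pb by (auto simp: pos_basis_def)
  have \<mu>0: "\<mu> p \<noteq> 0" if "p < ?n" for p using \<mu>(2)[OF that] by auto
  have c: "coordinates e' (M *v x) p = coordinates e x (?n - 1 - p) / \<mu> p" if p: "p < ?n" for p
  proof (rule dual_unique[OF pb(2) _ p])
    have "M *v x = M *v (\<Sum>r<?n. coordinates e x r *\<^sub>R e ! r)" using dual_expand[OF pb(1), of x] by simp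
    also have "\<dots> = (\<Sum>r<?n. coordinates e x r *\<^sub>R (M *v (e ! r)))"
      by (simp add: linear_sum[OF matrix_vector_mul_linear] matrix_vector_mult_scaleR)
    also have "\<dots> = (\<Sum>p<?n. coordinates e x (?n - 1 - p) *\<^sub>R (M *v (e ! (?n - 1 - p))))"
      by (rule sum.reindex_bij_witness[of _ "\<lambda>p. ?n - 1 - p" "\<lambda>p. ?n - 1 - p"]) auto
    also have "\<dots> = (\<Sum>p<?n. (coordinates e x (?n - 1 - p) / \<mu> p) *\<^sub>R e' ! p)"
      by (rule sum.cong) (use \<mu>(1) \<mu>0 in auto)
    finally show "M *v x = (\<Sum>p<?n. (coordinates e x (?n - 1 - p) / \<mu> p) *\<^sub>R e' ! p)" .
  qed
  define fl where "fl = (\<lambda>\<sigma> p. (\<sigma> (?n - 1 - p) = (s > 0)) = even p)"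
  have \<mu>pos: "\<mu> p > 0 \<longleftrightarrow> ((s > 0) = even p)" if "p < ?n" for p
    using \<mu>(2)[OF that] s by (cases "even p") (auto simp: zero_less_mult_iff)
  have signs: "signs_of ?n (fl \<sigma>) (coordinates e' (M *v x)) \<longleftrightarrow> signs_of ?n \<sigma> (coordinates e x)" for \<sigma>
  proof -
    have "signs_of ?n (fl \<sigma>) (coordinates e' (M *v x)) \<longleftrightarrow>
        (\<forall>p<?n. if \<sigma> (?n - 1 - p) then coordinates e x (?n - 1 - p) \<ge> 0 else coordinates e x (?n - 1 - p) \<le> 0)"
      unfolding signs_of_def
    proof (intro all_cong1 imp_cong refl)
      fix p assume p: "p < ?n"
      show "(if fl \<sigma> p then coordinates e' (M *v x) p \<ge> 0 else coordinates e' (M *v x) p \<le> 0) \<longleftrightarrow>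
          (if \<sigma> (?n - 1 - p) then coordinates e x (?n - 1 - p) \<ge> 0 else coordinates e x (?n - 1 - p) \<le> 0)"
        unfolding c[OF p] fl_def using \<mu>pos[OF p] \<mu>0[OF p]
        by (cases "\<mu> p > 0") (auto simp: zero_le_divide_iff divide_le_0_iff)
    qed
    also have "\<dots> \<longleftrightarrow> signs_of ?n \<sigma> (coordinates e x)"
      unfolding signs_of_def
    proof (intro iffI allI impI)
      fix q assume *: "\<forall>p<?n. if \<sigma> (?n - 1 - p) then coordinates e x (?n - 1 - p) \<ge> 0 else coordinates e x (?n - 1 - p) \<le> 0" "q < ?n"
      have "?n - 1 - q < ?n" "?n - 1 - (?n - 1 - q) = q" using *(2) by auto
      then show "if \<sigma> q then coordinates e x q \<ge> 0 else coordinates e x q \<le> 0" using *(1) by metis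
    next
      fix p assume *: "\<forall>i<?n. if \<sigma> i then coordinates e x i \<ge> 0 else coordinates e x i \<le> 0" "p < ?n"
      then show "if \<sigma> (?n - 1 - p) then coordinates e x (?n - 1 - p) \<ge> 0 else coordinates e x (?n - 1 - p) \<le> 0" by simp
    qed
    finally show ?thesis .
  qed
  have changes: "sign_changes ?n (fl \<sigma>) < k \<longleftrightarrow> sign_changes ?n \<sigma> \<ge> k" for \<sigma>
  proof -
    have "sign_changes ?n (fl \<sigma>) = sign_changes ?n (\<lambda>p. (\<sigma> (?n - 1 - p) \<noteq> even p) = (\<not> s > 0))"
      by (rule arg_cong[where f = "sign_changes ?n"]) (auto simp: fl_def)
    also have "\<dots> = sign_changes ?n (\<lambda>p. \<sigma> (?n - 1 - p) \<noteq> even p)" by (rule sign_changes_neg)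
    finally have "sign_changes ?n (fl \<sigma>) + sign_changes ?n \<sigma> = ?n - 1"
      using sign_changes_alternate[of ?n "\<lambda>p. \<sigma> (?n - 1 - p)"] sign_changes_reverse[of ?n \<sigma>] by simp
    then show ?thesis using k n by linarith
  qed
  have surj: "\<exists>\<sigma>. \<forall>p<?n. fl \<sigma> p = \<tau> p" for \<tau>
    by (rule exI[of _ "\<lambda>q. (\<tau> (?n - 1 - q) = even (?n - 1 - q)) = (s > 0)"]) (auto simp: fl_def)
  have "M *v x \<noteq> 0 \<longleftrightarrow> x \<noteq> 0" using inj_matrix[of M x] M by auto
  moreover have "(\<exists>\<tau>. signs_of ?n \<tau> (coordinates e' (M *v x)) \<and> sign_changes ?n \<tau> < k) \<longleftrightarrow>
      (\<exists>\<sigma>. signs_of ?n \<sigma> (coordinates e x) \<and> sign_changes ?n \<sigma> \<ge> k)"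
  proof
    assume "\<exists>\<tau>. signs_of ?n \<tau> (coordinates e' (M *v x)) \<and> sign_changes ?n \<tau> < k"
    then obtain \<tau> where \<tau>: "signs_of ?n \<tau> (coordinates e' (M *v x))" "sign_changes ?n \<tau> < k" by blast
    obtain \<sigma> where \<sigma>: "\<forall>p<?n. fl \<sigma> p = \<tau> p" using surj by blast
    have "signs_of ?n (fl \<sigma>) (coordinates e' (M *v x))" using \<tau>(1) \<sigma> by (simp add: signs_of_def)
    moreover have "sign_changes ?n (fl \<sigma>) < k" using \<tau>(2) sign_changes_cong[of ?n "fl \<sigma>" \<tau>] \<sigma> by simp
    ultimately show "\<exists>\<sigma>. signs_of ?n \<sigma> (coordinates e x) \<and> sign_changes ?n \<sigma> \<ge> k" using signs changes by blast
  next
    assume "\<exists>\<sigma>. signs_of ?n \<sigma> (coordinates e x) \<and> sign_changes ?n \<sigma> \<ge> k"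
    then show "\<exists>\<tau>. signs_of ?n \<tau> (coordinates e' (M *v x)) \<and> sign_changes ?n \<tau> < k" using signs changes by blast
  qed
  ultimately show ?thesis by (simp add: few_def many_def)
qed


section \<open>Cones in projective space\<close>

abbreviation proj_line :: "(real, 'n::finite) Finite_Cartesian_Product.vec \<Rightarrow> 'n line" where
  "proj_line v \<equiv> span {v}"

lemma topspace_projective: "topspace (projective_space :: 'n::finite line topology) = proj_line ` (- {0})"
  by (simp add: projective_space_def)

text \<open>The sets of nonzero vectors that are unions of punctured lines, which correspond to sets of points of
  projective space.\<close>

definition homogeneous :: "(real, 'n::finite) Finite_Cartesian_Product.vec set \<Rightarrow> bool" where
  "homogeneous C \<longleftrightarrow> 0 \<notin> C \<and> (\<forall>r x. r \<noteq> 0 \<longrightarrow> x \<in> C \<longrightarrow> r *\<^sub>R x \<in> C)"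

lemma proj_line_eq_imp: "proj_line v = proj_line w \<Longrightarrow> v \<noteq> 0 \<Longrightarrow> \<exists>r. r \<noteq> 0 \<and> w = r *\<^sub>R v"
proof -
  assume eq: "proj_line v = proj_line w" and v: "v \<noteq> 0"
  have "w \<in> proj_line v" unfolding eq by (rule span_base) simp
  then obtain r where r: "w = r *\<^sub>R v" by (auto simp: span_singleton)
  have "v \<in> proj_line w" unfolding eq[symmetric] by (rule span_base) simp
  then have "r \<noteq> 0" using r v by auto
  then show ?thesis using r by blast
qed

lemma proj_line_in_iff:
  assumes "homogeneous C" "v \<noteq> 0"
  shows "proj_line v \<in> proj_line ` C \<longleftrightarrow> v \<in> C"
proof
  assume "proj_line v \<in> proj_line ` C"
  then obtain w where w: "w \<in> C" "proj_line w = proj_line v" by auto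
  then have "w \<noteq> 0" using assms(1) by (auto simp: homogeneous_def)
  then obtain r where "r \<noteq> 0" "v = r *\<^sub>R w" using proj_line_eq_imp[OF w(2)] by blast
  then show "v \<in> C" using w assms(1) by (auto simp: homogeneous_def)
qed auto

lemma homogeneous_nonzero: "homogeneous C \<Longrightarrow> C \<subseteq> - {0}"
  by (auto simp: homogeneous_def)

lemma preimage_proj: "homogeneous C \<Longrightarrow> {x \<in> topspace (top_of_set (- {0})). proj_line x \<in> proj_line ` C} = C"
  using proj_line_in_iff homogeneous_nonzero by fastforce

lemma openin_projective:
  assumes "homogeneous C" "open C"
  shows "openin projective_space (proj_line ` C)"
proof -
  have "openin (top_of_set (- {0})) C" using assms homogeneous_nonzero by (auto intro: open_subset)
  then show ?thesis
    unfolding projective_space_def openin_quotient_topology preimage_proj[OF assms(1)]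
    using homogeneous_nonzero[OF assms(1)] by auto
qed

lemma homogeneous_compl: "homogeneous C \<Longrightarrow> homogeneous (- {0} - C)"
  unfolding homogeneous_def
proof (intro conjI allI impI)
  fix r :: real and x
  assume C: "0 \<notin> C \<and> (\<forall>r x. r \<noteq> 0 \<longrightarrow> x \<in> C \<longrightarrow> r *\<^sub>R x \<in> C)" and r: "r \<noteq> 0" "x \<in> - {0} - C"
  have "r *\<^sub>R x \<notin> C"
  proof
    assume "r *\<^sub>R x \<in> C"
    then have "inverse r *\<^sub>R (r *\<^sub>R x) \<in> C" using C r(1) by (meson inverse_nonzero_iff_nonzero)
    then show False using r by simp
  qed
  then show "r *\<^sub>R x \<in> - {0} - C" using r by simp
qed simp

lemma proj_compl:
  assumes "homogeneous C"
  shows "topspace projective_space - proj_line ` C = proj_line ` (- {0} - C)"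
  using proj_line_in_iff[OF assms] unfolding topspace_projective by blast

lemma closedin_projective:
  assumes "homogeneous C" "closed (insert 0 C)"
  shows "closedin projective_space (proj_line ` C)"
proof -
  have "- {0} - C = - insert 0 C" by auto
  then have "openin projective_space (proj_line ` (- {0} - C))"
    using assms homogeneous_compl[OF assms(1)] by (intro openin_projective) auto
  then show ?thesis
    unfolding closedin_def proj_compl[OF assms(1)]
    using homogeneous_nonzero[OF assms(1)] topspace_projective by blast
qed

lemma compact_projective: "compact_space (projective_space :: 'n::finite line topology)"
proof -
  let ?S = "sphere (0 :: (real, 'n) Finite_Cartesian_Product.vec) 1"
  have "compactin (top_of_set (- {0})) ?S" by (simp add: compactin_subtopology)
  then have "compactin (projective_space :: 'n line topology) (proj_line ` ?S)"
    using image_compactin quotient_imp_continuous_map[OF quotient_map_projective] by blast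
  moreover have "proj_line ` ?S = topspace (projective_space :: 'n line topology)"
  proof (intro equalityI subsetI)
    fix L assume "L \<in> topspace (projective_space :: 'n line topology)"
    then obtain v :: "(real, 'n) Finite_Cartesian_Product.vec" where v: "v \<noteq> 0" "L = proj_line v"
      by (auto simp: topspace_projective)
    have "proj_line ((1 / norm v) *\<^sub>R v) = proj_line v" using v(1) by (intro span_singleton_scale) simp
    then have "L = proj_line ((1 / norm v) *\<^sub>R v)" using v(2) by (simp only:)
    moreover have "(1 / norm v) *\<^sub>R v \<in> ?S" using v(1) by simp
    ultimately show "L \<in> proj_line ` ?S" by (rule image_eqI)
  next
    fix L assume "L \<in> proj_line ` ?S"
    then obtain v where "v \<in> ?S" "L = proj_line v" by blast
    moreover from this(1) have "v \<in> - {0}" by (metis ComplI dist_self insertE mem_sphere singletonD zero_neq_one empty_iff)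
    ultimately show "L \<in> topspace (projective_space :: 'n line topology)" unfolding topspace_projective by blast
  qed
  ultimately show ?thesis by (simp add: compact_space_def)
qed

lemma act_line_proj:
  fixes M :: "'n::finite sqmat"
  shows "act_line {M, - M} (proj_line v) = proj_line (M *v v)"
proof -
  have "(*v) M ` proj_line v = proj_line (M *v v)"
    using linear_span_image[OF matrix_vector_mul_linear[of M], of "{v}"] by simp
  moreover have "(*v) (- M) ` proj_line v = proj_line (- (M *v v))"
  proof -
    have "- M *v v = - (M *v v)"
      by (simp add: matrix_vector_mult_def Finite_Cartesian_Product.vec_eq_iff sum_negf)
    then show ?thesis using linear_span_image[OF matrix_vector_mul_linear[of "- M"], of "{v}"] by simp
  qed
  moreover have "proj_line (- (M *v v)) = proj_line (M *v v)"
    using span_singleton_scale[of "-1" "M *v v"] by simp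
  ultimately show ?thesis by (simp add: act_line_def)
qed

lemma continuous_act_line:
  fixes M :: "'n::{finite,linorder} sqmat"
  assumes "Determinants.det M \<noteq> 0"
  shows "continuous_map projective_space projective_space (act_line {M, - M})"
proof (rule continuous_compose_quotient_map[OF quotient_map_projective])
  have "continuous_map (top_of_set (- {0})) (top_of_set (- {0})) ((*v) M)"
    using inj_matrix[OF assms] linear_continuous_on[OF matrix_vector_mul_linear[of M, unfolded linear_conv_bounded_linear]]
    by (auto simp: continuous_map_in_subtopology)
  from continuous_map_compose[OF this quotient_imp_continuous_map[OF quotient_map_projective]]
  show "continuous_map (top_of_set (- {0})) projective_space (act_line {M, - M} \<circ> proj_line)"
    by (rule continuous_map_eq) (simp add: act_line_proj)
qed

lemma homogeneous_few: "homogeneous (few k e)"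
  and homogeneous_strictly_few: "homogeneous (strictly_few k e)"
  by (auto simp: homogeneous_def few_scaleR strictly_few_scaleR) (auto simp: few_def strictly_few_def)

lemma closed_signs_of:
  fixes e :: "'n::{finite,linorder} vecs"
  shows "closed {x. signs_of CARD('n) \<sigma> (coordinates e x)}"
proof -
  have "{x. signs_of CARD('n) \<sigma> (coordinates e x)} =
      (\<Inter>i\<in>{..<CARD('n)}. {x. (if \<sigma> i then 1 else -1) * (dual e i \<bullet> x) \<ge> 0})"
    by (auto simp: signs_of_def split: if_splits)
  also have "closed \<dots>" by (intro closed_INT ballI closed_Collect_le continuous_intros)
  finally show ?thesis .
qed

text \<open>Normalized outside the range of indices to make the set finite.\<close>

definition sign_patterns :: "nat \<Rightarrow> (nat \<Rightarrow> bool) set" where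
  "sign_patterns n = {\<sigma>. \<forall>i\<ge>n. \<sigma> i}"

lemma finite_sign_patterns: "finite (sign_patterns n)"
proof -
  have "sign_patterns n \<subseteq> (\<lambda>A i. i \<in> A \<or> i \<ge> n) ` Pow {..<n}"
  proof
    fix \<sigma> assume "\<sigma> \<in> sign_patterns n"
    then have "\<sigma> = (\<lambda>i. i \<in> {i. i < n \<and> \<sigma> i} \<or> i \<ge> n)" by (auto simp: sign_patterns_def)
    then show "\<sigma> \<in> (\<lambda>A i. i \<in> A \<or> i \<ge> n) ` Pow {..<n}" by (rule image_eqI) auto
  qed
  then show ?thesis by (rule finite_subset) auto
qed

lemma sign_pattern_restrict:
  "(\<lambda>i. \<sigma> i \<or> i \<ge> n) \<in> sign_patterns n" "signs_of n (\<lambda>i. \<sigma> i \<or> i \<ge> n) y \<longleftrightarrow> signs_of n \<sigma> y"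
  "sign_changes n (\<lambda>i. \<sigma> i \<or> i \<ge> n) = sign_changes n \<sigma>"
  by (auto simp: sign_patterns_def signs_of_def intro: sign_changes_cong)

lemma closed_ex_signs:
  fixes e :: "'n::{finite,linorder} vecs"
  shows "closed {x. \<exists>\<sigma>. signs_of CARD('n) \<sigma> (coordinates e x) \<and> P (sign_changes CARD('n) \<sigma>)}"
proof -
  let ?n = "CARD('n)"
  have "{x. \<exists>\<sigma>. signs_of ?n \<sigma> (coordinates e x) \<and> P (sign_changes ?n \<sigma>)} =
      (\<Union>\<sigma>\<in>{\<sigma> \<in> sign_patterns ?n. P (sign_changes ?n \<sigma>)}. {x. signs_of ?n \<sigma> (coordinates e x)})"
  proof (intro equalityI subsetI)
    fix x assume "x \<in> {x. \<exists>\<sigma>. signs_of ?n \<sigma> (coordinates e x) \<and> P (sign_changes ?n \<sigma>)}"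
    then obtain \<sigma> where "signs_of ?n \<sigma> (coordinates e x)" "P (sign_changes ?n \<sigma>)" by blast
    then show "x \<in> (\<Union>\<sigma>\<in>{\<sigma> \<in> sign_patterns ?n. P (sign_changes ?n \<sigma>)}. {x. signs_of ?n \<sigma> (coordinates e x)})"
      by (intro UN_I[of "\<lambda>i. \<sigma> i \<or> i \<ge> ?n"]) (simp_all add: sign_pattern_restrict)
  qed blast
  also have "closed \<dots>"
    by (intro closed_UN closed_signs_of ballI finite_subset[OF _ finite_sign_patterns]) auto
  finally show ?thesis .
qed

lemma sign_changes_constant: "sign_changes n (\<lambda>_. b) = 0"
  by (simp add: sign_changes_def)

lemma closed_few: "k \<ge> 1 \<Longrightarrow> closed (insert 0 (few k e))" for e :: "'n::{finite,linorder} vecs"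
proof -
  assume k: "k \<ge> 1"
  have "\<exists>\<sigma>. signs_of CARD('n) \<sigma> (coordinates e 0) \<and> sign_changes CARD('n) \<sigma> < k"
    using k by (intro exI[of _ "\<lambda>_. True"]) (simp add: signs_of_def sign_changes_constant)
  then have "insert 0 (few k e) = {x. \<exists>\<sigma>. signs_of CARD('n) \<sigma> (coordinates e x) \<and> sign_changes CARD('n) \<sigma> < k}"
    by (auto simp: few_def)
  then show ?thesis using closed_ex_signs[of e "\<lambda>m. m < k"] by simp
qed

lemma open_strictly_few:
  fixes e :: "'n::{finite,linorder} vecs"
  assumes "k < CARD('n)"
  shows "open (strictly_few k e)"
proof -
  have "sign_changes CARD('n) (\<lambda>i. even i) = CARD('n) - 1"
    using sign_changes_alternate[of "CARD('n)" "\<lambda>_. False"] by (simp add: sign_changes_constant)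
  then have "\<exists>\<sigma>. signs_of CARD('n) \<sigma> (coordinates e 0) \<and> sign_changes CARD('n) \<sigma> \<ge> k"
    using assms by (intro exI[of _ even]) (simp add: signs_of_def)
  then have "- strictly_few k e = {x. \<exists>\<sigma>. signs_of CARD('n) \<sigma> (coordinates e x) \<and> sign_changes CARD('n) \<sigma> \<ge> k}"
    by (auto simp: strictly_few_def many_def)
  then show ?thesis using closed_ex_signs[of e "\<lambda>m. m \<ge> k"]
    by (metis closed_def double_complement)
qed

text \<open>Adding a small multiple of a vector with the chosen signs makes all coordinates nonzero with these
  signs, so no other choice is left.\<close>

lemma few_approximable:
  fixes e :: "'n::{finite,linorder} vecs"
  assumes e: "pos_basis e" and x: "x \<in> few k e"
  shows "x \<in> closure (strictly_few k e)"
proof -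
  let ?n = "CARD('n)"
  obtain \<sigma> where \<sigma>: "x \<noteq> 0" "signs_of ?n \<sigma> (coordinates e x)" "sign_changes ?n \<sigma> < k"
    using x by (auto simp: few_def)
  define a where "a i = (if \<sigma> i then 1 else -1 :: real)" for i
  define v where "v = (\<Sum>r<?n. a r *\<^sub>R e ! r)"
  have v: "dual e r \<bullet> v = a r" if "r < ?n" for r by (rule dual_unique[OF e v_def that])
  have in_few: "x + t *\<^sub>R v \<in> strictly_few k e" if t: "t > 0" for t
  proof -
    have c: "if \<sigma> r then dual e r \<bullet> (x + t *\<^sub>R v) > 0 else dual e r \<bullet> (x + t *\<^sub>R v) < 0" if "r < ?n" for r
      using \<sigma>(2) that t v[OF that] by (auto simp: signs_of_def inner_add_right a_def add_nonneg_pos add_nonpos_neg)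
    have "\<tau> r = \<sigma> r" if "signs_of ?n \<tau> (coordinates e (x + t *\<^sub>R v))" "r < ?n" for \<tau> r
    proof -
      have "if \<tau> r then dual e r \<bullet> (x + t *\<^sub>R v) \<ge> 0 else dual e r \<bullet> (x + t *\<^sub>R v) \<le> 0"
        using that by (simp add: signs_of_def)
      then show ?thesis using c[OF that(2)] by (auto split: if_splits)
    qed
    then have "sign_changes ?n \<tau> < k" if "signs_of ?n \<tau> (coordinates e (x + t *\<^sub>R v))" for \<tau>
      using \<sigma>(3) sign_changes_cong[of ?n \<tau> \<sigma>] that by simp
    moreover have "x + t *\<^sub>R v \<noteq> 0"
    proof
      assume "x + t *\<^sub>R v = 0"
      then show False using c[of 0] by (auto split: if_splits)
    qed
    ultimately show ?thesis by (force simp: strictly_few_def many_def)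
  qed
  have "(\<lambda>m. x + (1 / real (Suc m)) *\<^sub>R v) \<longlonglongrightarrow> x + 0 *\<^sub>R v"
    by (intro tendsto_intros LIMSEQ_Suc[OF lim_1_over_n])
  then have "(\<lambda>m. x + (1 / real (Suc m)) *\<^sub>R v) \<longlonglongrightarrow> x" by simp
  then show ?thesis
    unfolding closure_sequential using in_few by (intro exI[of _ "\<lambda>m. x + (1 / real (Suc m)) *\<^sub>R v"]) auto
qed

lemma few_subset_closure:
  fixes e :: "'n::{finite,linorder} vecs"
  assumes "pos_basis e"
  shows "proj_line ` few k e \<subseteq> projective_space closure_of (proj_line ` strictly_few k e)"
proof -
  have nz: "few k e \<subseteq> - {0}" "strictly_few k e \<subseteq> - {0}" using homogeneous_nonzero homogeneous_few homogeneous_strictly_few by blast+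
  have "few k e \<subseteq> top_of_set (- {0}) closure_of strictly_few k e"
    using few_approximable[OF assms] nz
    by (auto simp: closure_of_subtopology inf_absorb2)
  then have "proj_line ` few k e \<subseteq> proj_line ` (top_of_set (- {0}) closure_of strictly_few k e)" by (rule image_mono)
  also have "\<dots> \<subseteq> projective_space closure_of (proj_line ` strictly_few k e)"
    by (rule continuous_map_image_closure_subset[OF quotient_imp_continuous_map[OF quotient_map_projective]])
  finally show ?thesis .
qed


section \<open>The boundary hypersurfaces are polyhedral\<close>

definition face :: "'n::{finite,linorder} vecs \<Rightarrow> nat \<Rightarrow> (nat \<Rightarrow> bool) \<Rightarrow> (real, 'n) Finite_Cartesian_Product.vec set" where
  "face e t \<sigma> = {x. dual e t \<bullet> x = 0 \<and> signs_of CARD('n) \<sigma> (coordinates e x)}"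

text \<open>A face is a simplicial cone; its \<open>n - 1\<close> edges are spanned by the vectors of the basis other than
  the one with number \<open>t\<close>, with signs.\<close>

lemma polyhedral_face:
  fixes e :: "'n::{finite,linorder} vecs"
  assumes e: "pos_basis e" and t: "t < CARD('n)"
  shows "polyhedral_piece (projectivization (face e t \<sigma>))"
proof -
  let ?n = "CARD('n)"
  define a where "a i = (if \<sigma> i then 1 else -1 :: real)" for i
  have len: "length e = ?n" using e by (simp add: pos_basis_def)
  have face: "face e t \<sigma> = {v. dual e t \<bullet> v = 0 \<and> (\<forall>w\<in>(\<lambda>i. a i *\<^sub>R dual e i) ` {..<?n}. w \<bullet> v \<ge> 0)}"
    by (auto simp: face_def signs_of_def a_def split: if_splits)
  have dim: "dim (face e t \<sigma>) = ?n - 1"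
  proof (rule antisym)
    have "dim (face e t \<sigma>) \<le> dim {x. dual e t \<bullet> x = 0}" by (rule dim_subset) (auto simp: face_def)
    also have "\<dots> = ?n - 1" using dim_hyperplane[OF dual_nonzero[OF e t]] by simp
    finally show "dim (face e t \<sigma>) \<le> ?n - 1" .
    let ?B = "(\<lambda>r. a r *\<^sub>R e ! r) ` ({..<?n} - {t})"
    have sub: "?B \<subseteq> face e t \<sigma>"
    proof
      fix x assume "x \<in> ?B"
      then obtain r where r: "r < ?n" "r \<noteq> t" "x = a r *\<^sub>R e ! r" by auto
      then show "x \<in> face e t \<sigma>" using dual_basis[OF e _ r(1)] t by (auto simp: face_def signs_of_def a_def)
    qed
    have "card ((!) e ` ({..<?n} - {t})) = ?n - 1"
    proof -
      have "inj_on ((!) e) ({..<?n} - {t})"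
        using pos_basis_ordered[OF e] len by (auto simp: inj_on_def ordered_basis_def nth_eq_iff_index_eq)
      then show ?thesis using t by (simp add: card_image)
    qed
    moreover have "independent ((!) e ` ({..<?n} - {t}))"
    proof (rule independent_mono)
      show "independent (set e)" using pos_basis_ordered[OF e] by (simp add: ordered_basis_def)
      show "(!) e ` ({..<?n} - {t}) \<subseteq> set e" using len by auto
    qed
    moreover have "(!) e ` ({..<?n} - {t}) \<subseteq> span (face e t \<sigma>)"
    proof
      fix x assume "x \<in> (!) e ` ({..<?n} - {t})"
      then obtain r where r: "r < ?n" "r \<noteq> t" "x = e ! r" by auto
      then have "a r *\<^sub>R e ! r \<in> span (face e t \<sigma>)" using sub by (intro span_base) auto
      then have "a r *\<^sub>R (a r *\<^sub>R e ! r) \<in> span (face e t \<sigma>)" by (rule span_scale)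
      then show "x \<in> span (face e t \<sigma>)" using r by (simp add: a_def split: if_splits)
    qed
    ultimately show "?n - 1 \<le> dim (face e t \<sigma>)" using independent_card_le_dim by (metis dim_span)
  qed
  show ?thesis
    unfolding polyhedral_piece_def
    using dual_nonzero[OF e t] face dim
    by (intro exI[of _ "dual e t"] exI[of _ "(\<lambda>i. a i *\<^sub>R dual e i) ` {..<?n}"] exI[of _ "face e t \<sigma>"]) auto
qed

text \<open>Flipping the sign at \<open>t\<close> moves the number of changes across \<open>k\<close>; the faces with this property
  make up the frontier of the cones.\<close>

definition crossing :: "nat \<Rightarrow> nat \<Rightarrow> nat \<Rightarrow> (nat \<Rightarrow> bool) \<Rightarrow> bool" where
  "crossing n k t \<sigma> \<longleftrightarrow> (sign_changes n (\<sigma>(t := True)) < k) \<noteq> (sign_changes n (\<sigma>(t := False)) < k)"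

lemma signs_of_flip: "signs_of n \<sigma> y \<Longrightarrow> y t = 0 \<Longrightarrow> signs_of n (\<sigma>(t := b)) y"
  by (auto simp: signs_of_def)

text \<open>On the left are the vectors that have compatible signs with fewer than \<open>k\<close> changes and others with at
  least \<open>k\<close>. The two choices differ at zero coordinates only.\<close>

theorem few_many_faces:
  fixes e :: "'n::{finite,linorder} vecs"
  shows "proj_line ` few k e - proj_line ` strictly_few k e =
    (\<Union>(t, \<sigma>)\<in>{(t, \<sigma>). t < CARD('n) \<and> \<sigma> \<in> sign_patterns CARD('n) \<and> crossing CARD('n) k t \<sigma>}.
       projectivization (face e t \<sigma>))"
proof -
  let ?n = "CARD('n)"
  have diff: "proj_line ` few k e - proj_line ` strictly_few k e = proj_line ` (few k e \<inter> many k e)"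
  proof -
    have "proj_line ` few k e - proj_line ` strictly_few k e = proj_line ` (few k e - strictly_few k e)"
      using proj_line_in_iff[OF homogeneous_strictly_few] homogeneous_nonzero[OF homogeneous_few] by blast
    also have "few k e - strictly_few k e = few k e \<inter> many k e" by (auto simp: strictly_few_def few_def)
    finally show ?thesis .
  qed
  have "x \<in> few k e \<inter> many k e \<longleftrightarrow>
      x \<noteq> 0 \<and> (\<exists>t \<sigma>. t < ?n \<and> \<sigma> \<in> sign_patterns ?n \<and> crossing ?n k t \<sigma> \<and> x \<in> face e t \<sigma>)" for x
  proof
    assume "x \<in> few k e \<inter> many k e"
    then obtain \<sigma> \<tau> where x: "x \<noteq> 0" and \<sigma>: "signs_of ?n \<sigma> (coordinates e x)" "sign_changes ?n \<sigma> < k"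
      and \<tau>: "signs_of ?n \<tau> (coordinates e x)" "\<not> sign_changes ?n \<tau> < k"
      by (auto simp: few_def many_def not_less)
    \<comment> \<open>change \<open>\<sigma>\<close> into \<open>\<tau>\<close> one position at a time\<close>
    define s where "s m = (\<lambda>i. if i < m then \<tau> i else \<sigma> i)" for m
    have "\<not> sign_changes ?n (s ?n) < k" using \<tau>(2) sign_changes_cong[of ?n "s ?n" \<tau>] by (simp add: s_def)
    moreover have "sign_changes ?n (s 0) < k" using \<sigma>(2) sign_changes_cong[of ?n "s 0" \<sigma>] by (simp add: s_def)
    ultimately obtain m where m: "m < ?n" "sign_changes ?n (s m) < k" "\<not> sign_changes ?n (s (Suc m)) < k"
      using inc_induct[of 0 ?n "\<lambda>m. \<not> sign_changes ?n (s m) < k"] by blast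
    have ne: "\<sigma> m \<noteq> \<tau> m"
    proof
      assume "\<sigma> m = \<tau> m"
      then have "s (Suc m) = s m" by (auto simp: s_def less_Suc_eq)
      then show False using m by simp
    qed
    have s: "(s m)(m := \<sigma> m) = s m" "(s m)(m := \<tau> m) = s (Suc m)"
      by (auto simp: s_def less_Suc_eq fun_eq_iff)
    have 0: "dual e m \<bullet> x = 0" using \<sigma>(1) \<tau>(1) ne m(1) unfolding signs_of_def by (metis order_antisym)
    let ?\<rho> = "\<lambda>i. s m i \<or> i \<ge> ?n"
    have r: "sign_changes ?n (?\<rho>(m := b)) = sign_changes ?n ((s m)(m := b))" for b
      by (rule sign_changes_cong) simp
    have "crossing ?n k m ?\<rho>"
      unfolding crossing_def r using s m ne by (cases "\<sigma> m") auto
    moreover have "signs_of ?n (s m) (coordinates e x)" using \<sigma>(1) \<tau>(1) by (simp add: signs_of_def s_def)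
    then have "x \<in> face e m ?\<rho>" using 0 sign_pattern_restrict(2)[of ?n "s m"] by (simp add: face_def)
    ultimately show "x \<noteq> 0 \<and> (\<exists>t \<sigma>. t < ?n \<and> \<sigma> \<in> sign_patterns ?n \<and> crossing ?n k t \<sigma> \<and> x \<in> face e t \<sigma>)"
      using x m(1) sign_pattern_restrict(1)[of "s m" ?n] by blast
  next
    assume "x \<noteq> 0 \<and> (\<exists>t \<sigma>. t < ?n \<and> \<sigma> \<in> sign_patterns ?n \<and> crossing ?n k t \<sigma> \<and> x \<in> face e t \<sigma>)"
    then obtain t \<sigma> where x: "x \<noteq> 0" "crossing ?n k t \<sigma>" "x \<in> face e t \<sigma>" by blast
    then have "signs_of ?n (\<sigma>(t := b)) (coordinates e x)" for b by (auto simp: face_def intro!: signs_of_flip)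
    moreover obtain b where "sign_changes ?n (\<sigma>(t := b)) < k" "k \<le> sign_changes ?n (\<sigma>(t := (\<not> b)))"
    proof (cases "sign_changes ?n (\<sigma>(t := True)) < k")
      case True
      then show ?thesis using x(2) that[of True] by (auto simp: crossing_def)
    next
      case False
      then show ?thesis using x(2) that[of False] by (auto simp: crossing_def)
    qed
    ultimately show "x \<in> few k e \<inter> many k e"
      using x(1) unfolding few_def many_def by blast
  qed
  note crossing_face = this
  show ?thesis
    unfolding diff
  proof (intro equalityI subsetI)
    fix L assume "L \<in> proj_line ` (few k e \<inter> many k e)"
    then obtain x where x: "L = proj_line x" "x \<in> few k e \<inter> many k e" by (rule imageE)
    from iffD1[OF crossing_face x(2)] obtain t \<sigma> where *: "x \<noteq> 0" "t < ?n" "\<sigma> \<in> sign_patterns ?n"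
      "crossing ?n k t \<sigma>" "x \<in> face e t \<sigma>" by (elim conjE exE)
    have "(t, \<sigma>) \<in> {(t, \<sigma>). t < ?n \<and> \<sigma> \<in> sign_patterns ?n \<and> crossing ?n k t \<sigma>}" using * by simp
    moreover have "L \<in> projectivization (face e t \<sigma>)" using * x(1) unfolding projectivization_def by blast
    ultimately show "L \<in> (\<Union>(t, \<sigma>)\<in>{(t, \<sigma>). t < ?n \<and> \<sigma> \<in> sign_patterns ?n \<and> crossing ?n k t \<sigma>}. projectivization (face e t \<sigma>))"
      by (intro UN_I[of "(t, \<sigma>)"]) simp_all
  next
    fix L assume "L \<in> (\<Union>(t, \<sigma>)\<in>{(t, \<sigma>). t < ?n \<and> \<sigma> \<in> sign_patterns ?n \<and> crossing ?n k t \<sigma>}. projectivization (face e t \<sigma>))"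
    then obtain t \<sigma> where *: "t < ?n" "\<sigma> \<in> sign_patterns ?n" "crossing ?n k t \<sigma>"
      "L \<in> projectivization (face e t \<sigma>)" by blast
    from *(4) obtain x where x: "L = proj_line x" "x \<in> face e t \<sigma>" "x \<noteq> 0" unfolding projectivization_def by blast
    have "x \<in> few k e \<inter> many k e" by (rule iffD2[OF crossing_face]) (use * x in blast)
    then show "L \<in> proj_line ` (few k e \<inter> many k e)" using x(1) by (rule rev_image_eqI)
  qed
qed

lemma finite_faces: "finite {(t, \<sigma>). t < n \<and> \<sigma> \<in> sign_patterns n \<and> crossing n k t \<sigma>}"
  by (rule finite_subset[of _ "{..<n} \<times> sign_patterns n"]) (auto simp: finite_sign_patterns)

lemma polyhedral_hypersurface_piece: "polyhedral_piece P \<Longrightarrow> polyhedral_hypersurface P"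
  unfolding polyhedral_hypersurface_def by (rule exI[of _ "{P}"]) auto


section \<open>The limit of a nested sequence of frames\<close>

lemma adapted_pos_basis: "adapted e P S \<Longrightarrow> pos_basis e"
  by (simp add: adapted_def)

text \<open>The determinants in the definition of hyperconvexity are the Pluecker coordinates at consecutive
  indices.\<close>

lemma Dv_between:
  fixes e v :: "'n::{finite,linorder} vecs"
  assumes len: "length e = CARD('n)" and Z: "changes e v Z" and ij: "i + j \<le> CARD('n)"
  shows "Dv (take i e @ take j v @ drop (i + j) e) = detf j (\<lambda>a b. Z (i + a) b) * Dv e"
proof -
  let ?n = "CARD('n)"
  have lv: "length v = ?n" using Z len by (simp add: changes_def)
  have e: "take i e @ take j (drop i e) @ drop (i + j) e = e"
    by (metis append_take_drop_id drop_drop add.commute)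
  have "Dv (take i e @ take j v @ drop (i + j) e) =
      detf (length (take j (drop i e))) (\<lambda>a b. Z (length (take i e) + a) b) *
      Dv (take i e @ take j (drop i e) @ drop (i + j) e)"
  proof (rule Dv_middle)
    fix b assume "b < length (take j (drop i e))"
    then show "take j v ! b = (\<Sum>r<?n. Z r b *\<^sub>R (take i e @ take j (drop i e) @ drop (i + j) e) ! r)"
      unfolding e using Z ij len lv by (simp add: changes_def)
  qed (use ij len lv in auto)
  then show ?thesis using ij len by (simp add: e)
qed

text \<open>The flags between the two flags to which a basis \<open>e\<close> is adapted are those whose Pluecker
  coordinates with respect to \<open>e\<close> are all positive.\<close>

lemma hyperconvex_if_positive_flag:
  fixes e v :: "'n::{finite,linorder} vecs"
  assumes e: "adapted e P S" and v: "pos_basis v" "changes e v Z" and Z: "positive_flag CARD('n) Z"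
  shows "hyperconvex P (flag_of v) S"
proof -
  let ?n = "CARD('n)"
  obtain ws where ws: "pos_basis ws" "S = flag_of ws"
      "\<And>l. l < ?n \<Longrightarrow> same_orientation (take l ws) (drop (?n - l) e)"
    and pe: "pos_basis e" "P = flag_of e" using e unfolding adapted_def by blast
  have len: "length e = ?n" "length v = ?n" "length ws = ?n" using pe ws v by (auto simp: pos_basis_def)
  have D: "Dv (take i e @ take j v @ take l ws) > 0" if "i < ?n" "j < ?n" "l < ?n" "i + j + l = ?n" for i j l
  proof -
    have "increasing j ?n (\<lambda>a. i + a)" using that by (auto simp: increasing_def)
    then have "detf j (\<lambda>a b. Z (i + a) b) > 0"
      using Z that by (simp add: positive_flag_def plucker_def)
    then have "Dv (take i e @ take j v @ drop (i + j) e) > 0"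
      using Dv_between[OF len(1) v(2), of i j] that pe(1) by (simp add: pos_basis_def)
    moreover have "?n - l = i + j" using that by simp
    ultimately show ?thesis
      using same_orientation_Dv[OF ws(3)[OF that(3)], of "take i e @ take j v" "[]"] that len by simp
  qed
  show ?thesis
    unfolding pe(2) ws(2) hyperconvex_flag_of[OF pe(1) v(1) ws(1)]
    using D by (intro bexI[of _ 1]) auto
qed

text \<open>Hyperconvexity gives the sign of the Pluecker coordinates at consecutive indices only; Fekete's
  criterion gives all others.\<close>

lemma positive_flag_if_hyperconvex:
  fixes e v :: "'n::{finite,linorder} vecs"
  assumes even: "even CARD('n)" and e: "adapted e P S" and v: "pos_basis v" "changes e v Z"
    and h: "hyperconvex P (flag_of v) S"
  obtains s where "s \<in> {1, -1}" "positive_flag CARD('n) (\<lambda>i j. s * Z i j)"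
proof -
  let ?n = "CARD('n)"
  have "?n \<noteq> 1" using even by auto
  then have n: "?n \<ge> 2" using zero_less_card_finite[where 'a = 'n] by linarith
  obtain ws where ws: "pos_basis ws" "S = flag_of ws"
      "\<And>l. l < ?n \<Longrightarrow> same_orientation (take l ws) (drop (?n - l) e)"
    and pe: "pos_basis e" "P = flag_of e" using e unfolding adapted_def by blast
  have len: "length e = ?n" "length v = ?n" "length ws = ?n" using pe ws v by (auto simp: pos_basis_def)
  obtain s t where st: "s \<in> {1, -1}" "t \<in> {1, -1}"
    and D: "\<And>i j l. i < ?n \<Longrightarrow> j < ?n \<Longrightarrow> l < ?n \<Longrightarrow> i + j + l = ?n \<Longrightarrow>
      Dv (take i e @ take j (scale s v) @ take l (scale t ws)) > 0"
    using hyperconvex_signs[OF even pe(1) v(1) ws(1)] h pe ws by metis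
  have W: "Dv (xs @ take l ws) > 0 \<longleftrightarrow> Dv (xs @ drop (?n - l) e) > 0" if "length xs + l = ?n" "l < ?n" for xs l
    using same_orientation_Dv[OF ws(3)[OF that(2)], of xs "[]"] that len by simp
  have "Dv (take (?n - 1) e @ take 1 ws) > 0"
    using W[of "take (?n - 1) e" 1] len n pe by (simp add: pos_basis_def)
  moreover have "Dv (take (?n - 1) e @ scale t (take 1 ws)) > 0" using D[of "?n - 1" 0 1] n by simp
  moreover have "Dv (take (?n - 1) e @ scale t (take 1 ws)) = t * Dv (take (?n - 1) e @ take 1 ws)"
    using Dv_scale_middle[of "take (?n - 1) e" "take 1 ws" "[]" t] n len by simp
  ultimately have t: "t = 1" using st(2) by auto
  let ?Z = "\<lambda>i j. s * Z i j"
  have pv: "pos_basis (scale s v)" using pos_basis_scale[OF even st(1) v(1)] .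
  have sZ: "changes e (scale s v) ?Z" using v(2) by (simp add: changes_def scaleR_sum_right)
  have pos: "detf q (\<lambda>a. ?Z (i + a)) > 0" if "q \<le> ?n" "i + q \<le> ?n" for q i
  proof (cases "q = 0 \<or> q = ?n")
    case True
    then show ?thesis
      using Dv_between[OF len(1) sZ, of 0 ?n] pv pe(1) len that by (auto simp: pos_basis_def zero_less_mult_iff)
  next
    case False
    have "Dv (take i e @ take q (scale s v) @ take (?n - (i + q)) ws) > 0"
      using D[of i q "?n - (i + q)"] that False t by simp
    then have "Dv (take i e @ take q (scale s v) @ drop (i + q) e) > 0"
      using W[of "take i e @ take q (scale s v)" "?n - (i + q)"] that False len by simp
    then show ?thesis
      using Dv_between[OF len(1) sZ, of i q] that pe(1) by (simp add: pos_basis_def zero_less_mult_iff)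
  qed
  have "positive_flag ?n ?Z"
    unfolding positive_flag_def plucker_def
  proof (intro allI impI)
    fix p I assume "p \<le> ?n" "increasing p ?n I"
    then show "detf p (\<lambda>a. ?Z (I a)) > 0"
      unfolding increasing_def by (intro fekete[where p = ?n and n = ?n, OF pos]) auto
  qed
  then show ?thesis by (rule that[OF st(1)])
qed

text \<open>Intervals of flags between \<open>P t\<close> and \<open>S t\<close>, each nested in the previous one through a totally
  positive base change from a finite set.\<close>

locale nested_frames =
  fixes E :: "nat \<Rightarrow> 'n::{finite,linorder} vecs" and T :: "nat \<Rightarrow> nat \<Rightarrow> nat \<Rightarrow> real"
    and P S :: "nat \<Rightarrow> 'n flag"
  assumes even: "even CARD('n)"
    and adapted: "adapted (E t) (P t) (S t)"
    and step: "changes (E t) (E (Suc t)) (T t)"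
    and T: "uniformly_positive CARD('n) T"
begin

lemma E_pos: "pos_basis (E t)"
  using adapted by (rule adapted_pos_basis)

lemma E_len: "length (E t) = CARD('n)"
  using E_pos by (simp add: pos_basis_def)

lemma dual_step: "r < CARD('n) \<Longrightarrow> dual (E t) r \<bullet> x = (\<Sum>j<CARD('n). T t r j * (dual (E (Suc t)) j \<bullet> x))"
  by (rule dual_changes[OF E_pos E_pos step])

lemma changes_dual:
  assumes "length v = CARD('n)"
  shows "changes (E t) v (\<lambda>i j. dual (E t) i \<bullet> v ! j)"
  using assms dual_expand[OF E_pos[of t]] by (simp add: changes_def E_len)

text \<open>The coordinates of a flag in all intervals form a chain of positive flags, which exists and is
  unique; a vector in all cones is in the limit subspace by \<open>cone_limit\<close>, and conversely the span
  of \<open>k\<close> columns with positive minors contains only vectors with fewer than \<open>k\<close> sign changes.\<close>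

theorem limit_basis:
  obtains y where "pos_basis y"
    "\<And>f. (\<forall>t. hyperconvex (P t) f (S t)) \<longleftrightarrow> f = flag_of y"
    "\<And>k. k \<le> CARD('n) \<Longrightarrow> (\<Inter>t. few k (E t)) = span (set (take k y)) - {0}"
proof -
  let ?n = "CARD('n)"
  obtain Y where Y: "\<And>N. chain ?n ?n T N Y" "\<And>t. positive_flag ?n (Y t)"
    using limit_flag_exists[OF T] by blast
  have n0: "?n > 0" by simp
  define y where "y = map (\<lambda>j. \<Sum>r<?n. Y 0 r j *\<^sub>R E 0 ! r) [0..<?n]"
  have len: "length y = ?n" by (simp add: y_def)
  have Y_step: "Y t i j = (\<Sum>b<?n. T t i b * Y (Suc t) b j)" if "i < ?n" "j < ?n" for t i j
    using Y(1)[of t] that by (simp add: chain_def mmult_def)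
  have yY: "changes (E t) y (Y t)" for t
  proof (induction t)
    case 0
    then show ?case by (simp add: changes_def len E_len) (simp add: y_def)
  next
    case (Suc t)
    have "y ! j = (\<Sum>r<?n. Y (Suc t) r j *\<^sub>R E (Suc t) ! r)" if j: "j < ?n" for j
    proof -
      have "y ! j = (\<Sum>i<?n. Y t i j *\<^sub>R E t ! i)" using Suc j by (simp add: changes_def len E_len)
      also have "\<dots> = (\<Sum>i<?n. \<Sum>r<?n. (Y (Suc t) r j * T t i r) *\<^sub>R E t ! i)"
        using j by (intro sum.cong refl) (simp add: Y_step[of _ j t] scaleR_sum_left mult.commute)
      also have "\<dots> = (\<Sum>r<?n. Y (Suc t) r j *\<^sub>R (\<Sum>i<?n. T t i r *\<^sub>R E t ! i))"
        by (subst sum.swap) (simp add: scaleR_sum_right)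
      also have "\<dots> = (\<Sum>r<?n. Y (Suc t) r j *\<^sub>R E (Suc t) ! r)"
        using step[of t] by (intro sum.cong refl) (simp add: changes_def E_len)
      finally show ?thesis .
    qed
    then show ?case by (simp add: changes_def len E_len)
  qed
  have "increasing ?n ?n (\<lambda>a. a)" by (simp add: increasing_def)
  then have "detf ?n (Y 0) > 0" using Y(2)[of 0] by (simp add: positive_flag_def plucker_def)
  then have pos: "pos_basis y"
    using Dv_expand[of y "Y 0" "E 0"] yY[of 0] len E_len E_pos[of 0] by (simp add: pos_basis_def changes_def)
  show ?thesis
  proof (rule that[OF pos])
    fix f
    show "(\<forall>t. hyperconvex (P t) f (S t)) \<longleftrightarrow> f = flag_of y"
    proof
      assume "f = flag_of y"
      then show "\<forall>t. hyperconvex (P t) f (S t)"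
        using hyperconvex_if_positive_flag[OF adapted pos yY Y(2)] by simp
    next
      assume f: "\<forall>t. hyperconvex (P t) f (S t)"
      then have "f \<in> oriented_flags" using hyperconvex_flags by blast
      then obtain v where v: "pos_basis v" "f = flag_of v" by (rule flag_has_basis)
      have vlen: "length v = ?n" using v(1) by (simp add: pos_basis_def)
      define Z where "Z t i j = dual (E t) i \<bullet> v ! j" for t i j
      have vZ: "changes (E t) v (Z t)" for t unfolding Z_def by (rule changes_dual[OF vlen])
      have "\<exists>s. s \<in> {1, -1} \<and> positive_flag ?n (\<lambda>i j. s * Z t i j)" for t
      proof -
        have "hyperconvex (P t) (flag_of v) (S t)" using f v(2) by simp
        then show ?thesis by (rule positive_flag_if_hyperconvex[OF even adapted v(1) vZ]) blast
      qed
      then have "\<exists>s. \<forall>t. s t \<in> {1, -1} \<and> positive_flag ?n (\<lambda>i j. s t * Z t i j)" by (intro choice allI)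
      then obtain s where s: "\<And>t. s t \<in> {1, -1}" "\<And>t. positive_flag ?n (\<lambda>i j. s t * Z t i j)" by blast
      have Z_step: "Z t i j = (\<Sum>b<?n. T t i b * Z (Suc t) b j)" if "i < ?n" for t i j
        using dual_step[OF that] by (simp add: Z_def)
      \<comment> \<open>the sign is determined by the first vector, whose coordinates are propagated by positive matrices\<close>
      have first: "s t * Z t i 0 > 0" if i: "i < ?n" for t i
      proof -
        have "increasing 1 ?n (\<lambda>a. i)" using i by (simp add: increasing_def)
        moreover have "1 \<le> ?n" using n0 by simp
        ultimately have "plucker 1 (\<lambda>i j. s t * Z t i j) (\<lambda>a. i) > 0"
          using s(2)[of t] unfolding positive_flag_def by blast
        then show ?thesis by (simp add: plucker_def)
      qed
      have Tpos: "T t i j > 0" if "i < ?n" "j < ?n" for t i j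
      proof -
        have "increasing 1 ?n (\<lambda>a. i)" "increasing 1 ?n (\<lambda>a. j)" using that by (auto simp: increasing_def)
        moreover have "totally_positive ?n ?n (T t)" using T by (simp add: uniformly_positive_def)
        ultimately have "detf 1 (\<lambda>a b. T t i j) > 0"
          unfolding totally_positive_def by (elim allE[of _ "1::nat"] allE[of _ "\<lambda>a. i"] allE[of _ "\<lambda>a. j"]) simp
        then show ?thesis by simp
      qed
      have next_sign: "s (Suc t) * Z t 0 0 > 0" for t
      proof -
        have "s (Suc t) * Z t 0 0 = (\<Sum>b<?n. T t 0 b * (s (Suc t) * Z (Suc t) b 0))"
          using Z_step[OF n0, of t 0] by (simp add: sum_distrib_left mult_ac)
        also have "\<dots> > 0"
        proof (rule sum_pos)
          show "{..<?n} \<noteq> {}" using n0 by blast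
        qed (use Tpos n0 first in simp_all)
        finally show ?thesis .
      qed
      then have s_Suc: "s (Suc t) = s t" for t
      proof -
        have "s t * Z t 0 0 > 0" "s (Suc t) * Z t 0 0 > 0" using first[OF n0, of t] next_sign[of t] by simp_all
        moreover have "s t = 1 \<or> s t = -1" "s (Suc t) = 1 \<or> s (Suc t) = -1" using s(1) by auto
        ultimately show ?thesis by (elim disjE) simp_all
      qed
      have s0: "s t = s 0" for t by (induction t) (simp_all add: s_Suc)
      let ?Z = "\<lambda>t i j. s 0 * Z t i j"
      have Zp: "positive_flag ?n (?Z t)" for t using s(2)[of t] by (simp only: s0[of t])
      have Zc: "chain ?n ?n T N ?Z" for N
        unfolding chain_def mmult_def
      proof (intro allI impI)
        fix t i j assume i: "i < ?n"
        have "s 0 * Z t i j = s 0 * (\<Sum>b<?n. T t i b * Z (Suc t) b j)" by (simp only: Z_step[OF i])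
        also have "\<dots> = (\<Sum>b<?n. T t i b * (s 0 * Z (Suc t) b j))"
          by (simp add: sum_distrib_left mult.left_commute)
        finally show "s 0 * Z t i j = (\<Sum>b<?n. T t i b * (s 0 * Z (Suc t) b j))" .
      qed
      let ?v = "scale (s 0) v"
      have sv: "pos_basis ?v" using pos_basis_scale[OF even s(1) v(1)] .
      have svZ: "changes (E 0) ?v (?Z 0)"
        using vZ[of 0] by (simp add: changes_def scaleR_sum_right)
      have "same_orientation (take p y) (take p ?v)" if p: "p < ?n" for p
      proof -
        obtain l where l: "l > 0" "\<And>I. increasing p ?n I \<Longrightarrow> plucker p (?Z 0) I = l * plucker p (Y 0) I"
          using limit_flag_unique[OF T less_imp_le[OF p] Y Zc Zp] by blast
        have "increasing p ?n (\<lambda>a. a)" using p by (simp add: increasing_def)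
        then have "plucker p (Y 0) (\<lambda>a. a) > 0" using Y(2)[of 0] p by (simp add: positive_flag_def)
        then obtain M where M: "\<And>i j. i < ?n \<Longrightarrow> j < p \<Longrightarrow> ?Z 0 i j = (\<Sum>b<p. Y 0 i b * M b j)" "detf p M = l"
          using same_span_if_plucker_proportional[of p ?n "?Z 0" l "Y 0"] l p by auto
        have "take p ?v ! j = (\<Sum>b<p. M b j *\<^sub>R take p y ! b)" if j: "j < p" for j
        proof -
          have "take p ?v ! j = ?v ! j" using j by (rule nth_take)
          also have "\<dots> = (\<Sum>i<?n. ?Z 0 i j *\<^sub>R E 0 ! i)"
            using svZ j p vlen by (simp add: changes_def E_len)
          also have "\<dots> = (\<Sum>i<?n. \<Sum>b<p. (M b j * Y 0 i b) *\<^sub>R E 0 ! i)"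
            using M(1) j by (intro sum.cong refl) (simp add: scaleR_sum_left mult.commute)
          also have "\<dots> = (\<Sum>b<p. M b j *\<^sub>R (\<Sum>i<?n. Y 0 i b *\<^sub>R E 0 ! i))"
            by (subst sum.swap) (simp add: scaleR_sum_right)
          also have "\<dots> = (\<Sum>b<p. M b j *\<^sub>R take p y ! b)"
            using p by (intro sum.cong refl) (simp add: y_def)
          finally show ?thesis .
        qed
        then have "changes (take p y) (take p ?v) M" using p len vlen by (simp add: changes_def del: scale_simps(2))
        then show ?thesis
          unfolding same_orientation_iff using pos_basis_take[OF pos] pos_basis_take[OF sv] M(2) l(1) p len
          by (intro conjI exI[of _ M]) simp_all
      qed
      then have "flag_of y = flag_of v"
        unfolding flag_of_eq_iff[OF pos] using s(1) by blast
      then show "f = flag_of y" using v(2) by simp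
    qed
  next
    fix k assume k: "k \<le> ?n"
    show "(\<Inter>t. few k (E t)) = span (set (take k y)) - {0}"
    proof (intro equalityI subsetI)
      fix v assume v: "v \<in> (\<Inter>t. few k (E t))"
      then have v0: "v \<noteq> 0" by (auto simp: few_def)
      have "\<exists>c. \<forall>i<?n. dual (E 0) i \<bullet> v = (\<Sum>b<k. Y 0 i b * c b)"
      proof (rule cone_limit[OF T k Y, of "\<lambda>t i. dual (E t) i \<bullet> v"])
        show "\<exists>c. \<forall>i<?n. dual (E 0) i \<bullet> v = (\<Sum>b<k. Y 0 i b * c b)"
          if "\<And>i. i < ?n \<Longrightarrow> dual (E 0) i \<bullet> v = (\<Sum>b<k. Y 0 i b * c b)" for c using that by blast
        show "\<exists>i<?n. dual (E t) i \<bullet> v \<noteq> 0" for t by (rule coordinate_nonzero[OF E_pos v0])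
        show "\<exists>\<sigma>. signs_of ?n \<sigma> (coordinates (E t) v) \<and> sign_changes ?n \<sigma> < k" for t
          using v by (auto simp: few_def)
      qed (rule dual_step)
      then obtain c where c: "\<And>i. i < ?n \<Longrightarrow> dual (E 0) i \<bullet> v = (\<Sum>b<k. Y 0 i b * c b)" by blast
      have "v = (\<Sum>i<?n. (dual (E 0) i \<bullet> v) *\<^sub>R E 0 ! i)" by (rule dual_expand[OF E_pos])
      also have "\<dots> = (\<Sum>i<?n. \<Sum>b<k. (c b * Y 0 i b) *\<^sub>R E 0 ! i)"
        using c by (intro sum.cong refl) (simp add: scaleR_sum_left mult.commute)
      also have "\<dots> = (\<Sum>b<k. c b *\<^sub>R (\<Sum>i<?n. Y 0 i b *\<^sub>R E 0 ! i))"
        by (subst sum.swap) (simp add: scaleR_sum_right)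
      also have "\<dots> = (\<Sum>b<k. c b *\<^sub>R take k y ! b)"
        using k by (intro sum.cong refl) (simp add: y_def)
      also have "\<dots> \<in> span (set (take k y))"
        using k len by (intro span_sum span_scale span_base nth_mem) auto
      finally show "v \<in> span (set (take k y)) - {0}" using v0 by simp
    next
      fix v assume v: "v \<in> span (set (take k y)) - {0}"
      obtain c where c: "v = (\<Sum>b<k. c b *\<^sub>R y ! b)"
      proof -
        obtain u where u: "v = (\<Sum>x\<in>set (take k y). u x *\<^sub>R x)"
          using v span_finite[of "set (take k y)"] by auto
        have "distinct (take k y)" using pos_basis_take[OF pos] by (simp add: ordered_basis_def)
        then have "v = (\<Sum>b<k. u (y ! b) *\<^sub>R y ! b)"
          using u sum.reindex_bij_betw[OF bij_betw_nth[of "take k y" "{..<k}" "set (take k y)"], of "\<lambda>x. u x *\<^sub>R x"] k len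
          by simp
        then show ?thesis by (rule that)
      qed
      show "v \<in> (\<Inter>t. few k (E t))"
      proof
        fix t
        have coord: "dual (E t) i \<bullet> v = (\<Sum>b<k. Y t i b * c b)" if i: "i < ?n" for i
        proof -
          have "dual (E t) i \<bullet> y ! b = Y t i b" if b: "b < k" for b
            by (rule dual_unique[OF E_pos _ i]) (use yY[of t] b k len E_len in \<open>simp add: changes_def\<close>)
          then show ?thesis unfolding c by (simp add: inner_sum_right mult.commute)
        qed
        obtain \<sigma> where \<sigma>: "signs_of ?n \<sigma> (coordinates (E t) v)" using signs_exist by blast
        have "sign_changes ?n \<sigma> < k"
        proof (rule sign_changes_in_positive_span[where X = "Y t" and c = c])
          show "plucker k (Y t) I > 0" if "increasing k ?n I" for I
            using Y(2)[of t] that k by (simp add: positive_flag_def)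
          show "\<exists>b<k. c b \<noteq> 0"
          proof (rule ccontr)
            assume "\<not> (\<exists>b<k. c b \<noteq> 0)"
            then have "v = 0" unfolding c by (intro sum.neutral) auto
            then show False using v by simp
          qed
          show "signs_of ?n \<sigma> (\<lambda>i. \<Sum>b<k. Y t i b * c b)"
            using \<sigma> signs_of_cong[of ?n "coordinates (E t) v" "\<lambda>i. \<Sum>b<k. Y t i b * c b" \<sigma>] coord by blast
        qed (rule k)
        then show "v \<in> few k (E t)" using v \<sigma> by (auto simp: few_def)
      qed
    qed
  qed
qed

end


section \<open>Representatives of a homomorphism into the projective special linear group\<close>

lemma matrix_mult_minus_left: "(- A) ** B = - (A ** B :: 'n::finite sqmat)"
  and matrix_mult_minus_right: "A ** (- B) = - (A ** B :: 'n::finite sqmat)"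
  by (simp_all add: matrix_matrix_mult_def Finite_Cartesian_Product.vec_eq_iff sum_negf)

lemma matrix_vector_minus_left: "(- A :: 'n::finite sqmat) *v x = - (A *v x)"
  by (simp add: matrix_vector_mult_def Finite_Cartesian_Product.vec_eq_iff sum_negf)

lemma PSL_coset: "r_coset SL {Finite_Cartesian_Product.mat 1, - Finite_Cartesian_Product.mat 1} (M :: 'n::finite sqmat) = {M, - M}"
  by (auto simp: r_coset_def SL_def matrix_mult_minus_left)

lemma PSL_representative:
  assumes "p \<in> carrier (PSL :: 'n::finite psl monoid)"
  shows "\<exists>M. Determinants.det M = 1 \<and> p = {M, - M}"
proof -
  obtain M where "M \<in> carrier (SL :: 'n sqmat monoid)" "p = {M, - M}"
    using assms PSL_coset by (auto simp: PSL_def FactGroup_def RCOSETS_def)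
  then show ?thesis by (auto simp: SL_def)
qed

lemma PSL_mult:
  fixes M N :: "'n::finite sqmat"
  shows "{M, - M} \<otimes>\<^bsub>PSL\<^esub> {N, - N} = {M ** N, - (M ** N)}"
  by (auto simp: PSL_def FactGroup_def set_mult_def SL_def matrix_mult_minus_left matrix_mult_minus_right)

text \<open>The homomorphism lifts to matrices up to sign; \<open>R []\<close> is \<open>1\<close> or \<open>- 1\<close> because its class is
  idempotent.\<close>

lemma representatives_exist:
  fixes \<rho> :: "int list \<Rightarrow> 'n::finite psl"
  assumes \<rho>: "\<rho> \<in> hom (free_group g) PSL"
  obtains R where "\<And>w. w \<in> reduced_words g \<Longrightarrow> Determinants.det (R w) = 1"
    "\<And>w. w \<in> reduced_words g \<Longrightarrow> \<rho> w = {R w, - R w}"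
    "R [] \<in> {Finite_Cartesian_Product.mat 1, - Finite_Cartesian_Product.mat 1}"
    "\<And>u v. u \<in> reduced_words g \<Longrightarrow> v \<in> reduced_words g \<Longrightarrow> u \<otimes>\<^bsub>free_group g\<^esub> v \<in> reduced_words g \<Longrightarrow>
      R (u \<otimes>\<^bsub>free_group g\<^esub> v) \<in> {R u ** R v, - (R u ** R v)}"
proof -
  have "\<forall>w\<in>reduced_words g. \<exists>M. Determinants.det M = 1 \<and> \<rho> w = {M, - M}"
    using hom_in_carrier[OF \<rho>] by (simp add: PSL_representative)
  then obtain R where R: "\<And>w. w \<in> reduced_words g \<Longrightarrow> Determinants.det (R w) = 1"
    "\<And>w. w \<in> reduced_words g \<Longrightarrow> \<rho> w = {R w, - R w}" by metis
  have mult: "R (u \<otimes>\<^bsub>free_group g\<^esub> v) \<in> {R u ** R v, - (R u ** R v)}"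
    if uv: "u \<in> reduced_words g" "v \<in> reduced_words g" "u \<otimes>\<^bsub>free_group g\<^esub> v \<in> reduced_words g" for u v
  proof -
    have "\<rho> (u \<otimes>\<^bsub>free_group g\<^esub> v) = \<rho> u \<otimes>\<^bsub>PSL\<^esub> \<rho> v" using hom_mult[OF \<rho>] uv by simp
    then have "{R (u \<otimes>\<^bsub>free_group g\<^esub> v), - R (u \<otimes>\<^bsub>free_group g\<^esub> v)} = {R u ** R v, - (R u ** R v)}"
      using R(2) uv by (simp add: PSL_mult)
    then show ?thesis by blast
  qed
  have "R [] \<in> {R [] ** R [], - (R [] ** R [])}"
    using mult[of "[]" "[]"] by (simp add: mult_free_group)
  moreover obtain N where N: "R [] ** N = Finite_Cartesian_Product.mat 1"
    using R(1)[of "[]"] invertible_det_nz[of "R []"] by (auto simp: invertible_def)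
  have "R [] ** R [] ** N = R []" by (simp add: matrix_mul_assoc[symmetric] N)
  then have "(R [] ** R []) ** N = R []" "(- (R [] ** R [])) ** N = - R []"
    by (simp_all add: matrix_mult_minus_left)
  ultimately have "R [] ** N = R [] \<or> R [] ** N = - R []" by (metis insertE singletonD)
  then have "R [] \<in> {Finite_Cartesian_Product.mat 1, - Finite_Cartesian_Product.mat 1}"
    unfolding N by (metis insertCI minus_minus)
  then show ?thesis using that R mult by blast
qed


section \<open>The action on hyperconvex triples\<close>

lemma pos_basis_linear_image:
  fixes M :: "'n::{finite,linorder} sqmat"
  shows "Determinants.det M = 1 \<Longrightarrow> pos_basis vs \<Longrightarrow> pos_basis (map ((*v) M) vs)"
  by (simp add: pos_basis_def Dv_linear_image)

lemma hyperconvex_linear_image: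
  fixes M :: "'n::{finite,linorder} sqmat"
  assumes M: "Determinants.det M = 1" and even: "even CARD('n)" and h: "hyperconvex P Q S"
  shows "hyperconvex (act_flag {M, - M} P) (act_flag {M, - M} Q) (act_flag {M, - M} S)"
proof -
  obtain us vs ws where b: "pos_basis us" "pos_basis vs" "pos_basis ws"
    and F: "P = flag_of us" "Q = flag_of vs" "S = flag_of ws"
    using hyperconvex_flags[OF h] flag_has_basis by metis
  let ?M = "map ((*v) M)"
  have "Dv (take i (?M us) @ take j (?M vs) @ take l (?M ws)) = Dv (take i us @ take j vs @ take l ws)"
    if "i < CARD('n)" "j < CARD('n)" "l < CARD('n)" "i + j + l = CARD('n)" for i j l
  proof -
    have "length (take i us @ take j vs @ take l ws) = CARD('n)" using that b by (simp add: pos_basis_def)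
    from Dv_linear_image[OF this, of M] show ?thesis by (simp add: take_map M)
  qed
  then show ?thesis
    using h unfolding F act_flag_of[OF M even] hyperconvex_flag_of[OF b]
      hyperconvex_flag_of[OF b[THEN pos_basis_linear_image[OF M]]]
    by simp
qed

text \<open>Matrices that are inverse to each other up to sign act as inverses, since the sign exchanges the two
  lifts of a flag.\<close>

lemma act_flag_inverse:
  fixes M N :: "'n::{finite,linorder} sqmat"
  assumes MN: "N ** M \<in> {Finite_Cartesian_Product.mat 1, - Finite_Cartesian_Product.mat 1}"
    and det: "Determinants.det M = 1" "Determinants.det N = 1"
    and even: "even CARD('n)" and f: "f \<in> oriented_flags"
  shows "act_flag {N, - N} (act_flag {M, - M} f) = f"
proof -
  obtain v where v: "pos_basis v" "f = flag_of v" using f by (rule flag_has_basis)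
  obtain s :: real where s: "s \<in> {1, -1}" "\<And>x. N *v (M *v x) = s *\<^sub>R x"
  proof (cases "N ** M = Finite_Cartesian_Product.mat 1")
    case True
    show ?thesis by (rule that[of 1]) (simp_all add: matrix_vector_mul_assoc True)
  next
    case False
    then have "N ** M = - Finite_Cartesian_Product.mat 1" using MN by simp
    then show ?thesis by (intro that[of "-1"]) (simp_all add: matrix_vector_mul_assoc matrix_vector_minus_left)
  qed
  have "map ((*v) N) (map ((*v) M) v) = scale s v" using s(2) by (simp add: scale_def)
  then show ?thesis using v(2) act_flag_of[OF _ even] det flag_of_scale[OF s(1), of v] by simp
qed

lemma adapted_linear_image:
  fixes M :: "'n::{finite,linorder} sqmat"
  assumes M: "Determinants.det M = 1" and even: "even CARD('n)" and e: "adapted e P S"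
  shows "adapted (map ((*v) M) e) (act_flag {M, - M} P) (act_flag {M, - M} S)"
proof -
  obtain ws where ws: "pos_basis ws" "S = flag_of ws"
      "\<And>l. l < CARD('n) \<Longrightarrow> same_orientation (take l ws) (drop (CARD('n) - l) e)"
    and pe: "pos_basis e" "P = flag_of e" using e unfolding adapted_def by blast
  have "same_orientation (take l (map ((*v) M) ws)) (drop (CARD('n) - l) (map ((*v) M) e))" if "l < CARD('n)" for l
    using same_orientation_linear_image[OF _ ws(3)[OF that], of M] M by (simp add: take_map drop_map)
  then show ?thesis
    unfolding adapted_def using ws(1,2) pe pos_basis_linear_image[OF M] act_flag_of[OF M even] by blast
qed

lemma adapted_scale:
  fixes e :: "'n::{finite,linorder} vecs"
  assumes s: "s \<in> {1, -1}" and even: "even CARD('n)" and e: "adapted e P S"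
  shows "adapted (scale s e) P S"
proof -
  obtain ws where ws: "pos_basis ws" "S = flag_of ws"
      "\<And>l. l < CARD('n) \<Longrightarrow> same_orientation (take l ws) (drop (CARD('n) - l) e)"
    and pe: "pos_basis e" "P = flag_of e" using e unfolding adapted_def by blast
  have "s \<noteq> 0" using s by auto
  then have "same_orientation (take l (scale s ws)) (drop (CARD('n) - l) (scale s e))" if "l < CARD('n)" for l
    using same_orientation_scale[OF ws(3)[OF that]] by simp
  then show ?thesis
    unfolding adapted_def using ws(1,2) pe pos_basis_scale[OF even s]
    by (intro conjI exI[of _ "scale s ws"]) (simp_all add: flag_of_scale[OF s])
qed

text \<open>An element of the group that carries the pair \<open>(P, S)\<close> to the pair \<open>(S', P')\<close> carries a
  basis adapted to the first to the reverse of a basis adapted to \<open>(P', S')\<close>, up to factors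
  whose signs alternate. Reversal with alternating signs exchanges few and many sign changes.\<close>

theorem many_to_few:
  fixes M :: "'n::{finite,linorder} sqmat"
  assumes k: "CARD('n) = 2 * k" and M: "Determinants.det M = 1"
    and e: "adapted e P S" and e': "adapted e' P' S'"
    and act: "act_flag {M, - M} S = P'" "act_flag {M, - M} P = S'"
  shows "M *v x \<in> few k e' \<longleftrightarrow> x \<in> many k e"
proof -
  let ?n = "CARD('n)"
  have even: "even ?n" using k by simp
  obtain ws where ws: "pos_basis ws" "S = flag_of ws"
      "\<And>l. l < ?n \<Longrightarrow> same_orientation (take l ws) (drop (?n - l) e)"
    and pe: "pos_basis e" "P = flag_of e" using e unfolding adapted_def by blast
  obtain ws' where ws': "pos_basis ws'" "S' = flag_of ws'"
      "\<And>l. l < ?n \<Longrightarrow> same_orientation (take l ws') (drop (?n - l) e')"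
    and pe': "pos_basis e'" "P' = flag_of e'" using e' unfolding adapted_def by blast
  have "flag_of e' = flag_of (map ((*v) M) ws)" using act(1) ws(2) pe'(2) act_flag_of[OF M even] by simp
  then obtain s where s: "s \<in> {1, -1}"
    "\<And>i. i < ?n \<Longrightarrow> same_orientation (take i e') (take i (scale s (map ((*v) M) ws)))"
    unfolding flag_of_eq_iff[OF pe'(1)] by blast
  have s0: "s \<noteq> 0" using s(1) by auto
  have initial: "same_orientation (take i e') (scale s (map ((*v) M) (drop (?n - i) e)))" if i: "i < ?n" for i
  proof -
    have "same_orientation (map ((*v) M) (take i ws)) (map ((*v) M) (drop (?n - i) e))"
      using same_orientation_linear_image[OF _ ws(3)[OF i], of M] M by simp
    from same_orientation_scale[OF this s0] show ?thesis
      using same_orientation_trans[OF s(2)[OF i]] by (simp add: take_map)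
  qed
  have final: "span (set (drop (?n - l) e')) = span (set (map ((*v) M) (take l e)))" if l: "l < ?n" for l
  proof -
    have "flag_of ws' = flag_of (map ((*v) M) e)" using act(2) ws'(2) pe(2) act_flag_of[OF M even] by simp
    then have "span (set (take l ws')) = span (set (take l (map ((*v) M) e)))"
      using flag_subspace_flag_of[OF ws'(1) l] flag_subspace_flag_of[OF pos_basis_linear_image[OF M pe(1)] l] by simp
    then show ?thesis using same_orientation_span[OF ws'(3)[OF l]] by (simp add: take_map)
  qed
  obtain \<mu> where \<mu>: "\<And>p. p < ?n \<Longrightarrow> e' ! p = \<mu> p *\<^sub>R (M *v (e ! (?n - 1 - p)))"
    "\<And>p. p < ?n \<Longrightarrow> s * (-1) ^ p * \<mu> p > 0"
    using antidiagonal[OF even pe(1) pe'(1) M s(1) initial final] by blast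
  show ?thesis by (rule many_antidiagonal[OF k pe(1) pe'(1) M s(1) \<mu>])
qed


section \<open>Schottky groups acting on flags and on projective space\<close>

text \<open>What remains of the Schottky data on the projective line: \<open>\<alpha> j\<close> and \<open>\<beta> j\<close> are the flags at the
  endpoints of the interval of the letter \<open>j\<close>, and two disjoint intervals give the two hyperconvex
  triples that consist of both endpoints of one and one endpoint of the other, up to cyclic order.\<close>

locale flag_schottky =
  fixes g k :: nat and R :: "int list \<Rightarrow> 'n::{finite,linorder} sqmat" and \<alpha> \<beta> :: "int \<Rightarrow> 'n flag"
  assumes k: "k \<ge> 1" "CARD('n) = 2 * k"
    and det: "w \<in> reduced_words g \<Longrightarrow> Determinants.det (R w) = 1"
    and R_Nil: "R [] \<in> {Finite_Cartesian_Product.mat 1, - Finite_Cartesian_Product.mat 1}"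
    and R_mult: "u \<in> reduced_words g \<Longrightarrow> v \<in> reduced_words g \<Longrightarrow> u \<otimes>\<^bsub>free_group g\<^esub> v \<in> reduced_words g \<Longrightarrow>
      R (u \<otimes>\<^bsub>free_group g\<^esub> v) \<in> {R u ** R v, - (R u ** R v)}"
    and endpoints: "j \<in> letters g \<Longrightarrow> act_flag {R [j], - R [j]} (\<beta> (- j)) = \<alpha> j"
      "j \<in> letters g \<Longrightarrow> act_flag {R [j], - R [j]} (\<alpha> (- j)) = \<beta> j"
    and triples: "i \<in> letters g \<Longrightarrow> j \<in> letters g \<Longrightarrow> i \<noteq> j \<Longrightarrow> hyperconvex (\<beta> i) (\<alpha> j) (\<alpha> i)"
      "i \<in> letters g \<Longrightarrow> j \<in> letters g \<Longrightarrow> i \<noteq> j \<Longrightarrow> hyperconvex (\<alpha> j) (\<beta> j) (\<alpha> i)"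
begin

lemma even: "even CARD('n)"
  using k by simp

lemma det_letter: "j \<in> letters g \<Longrightarrow> Determinants.det (R [j]) = 1"
  by (rule det) (simp add: reduced_words_singleton)

definition act :: "int list \<Rightarrow> 'n flag \<Rightarrow> 'n flag" where
  "act w = act_flag {R w, - R w}"

text \<open>The interval of \<open>- i\<close> is disjoint from that of \<open>j\<close>, and \<open>i\<close> maps the endpoints of the former to
  those of the interval of \<open>i\<close>, in reverse order.\<close>

lemma images_of_triples:
  assumes "i \<in> letters g" "j \<in> letters g" "j \<noteq> - i"
  shows "hyperconvex (\<alpha> i) (act [i] (\<alpha> j)) (\<beta> i)" "hyperconvex (act [i] (\<alpha> j)) (act [i] (\<beta> j)) (\<beta> i)"
proof -
  have j: "- i \<in> letters g" "- i \<noteq> j" using assms by auto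
  note h = triples[OF j(1) assms(2) j(2), THEN hyperconvex_linear_image[OF det_letter[OF assms(1)] even]]
  show "hyperconvex (\<alpha> i) (act [i] (\<alpha> j)) (\<beta> i)" "hyperconvex (act [i] (\<alpha> j)) (act [i] (\<beta> j)) (\<beta> i)"
    using h unfolding act_def endpoints[OF assms(1)] by blast+
qed

definition B :: "int \<Rightarrow> 'n vecs" where
  "B j = (SOME e. adapted e (\<alpha> j) (\<beta> j))"

text \<open>Two flags have an adapted basis as soon as some flag lies between them; the image of \<open>\<alpha> j\<close> under the
  generator does.\<close>

lemma adapted_B: "j \<in> letters g \<Longrightarrow> adapted (B j) (\<alpha> j) (\<beta> j)"
proof -
  assume j: "j \<in> letters g"
  then have "hyperconvex (\<alpha> j) (act [j] (\<alpha> j)) (\<beta> j)" by (intro images_of_triples letters_nonzero)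
  then have "\<exists>e. adapted e (\<alpha> j) (\<beta> j)" by (rule adapted_exists[OF even]) blast
  then show ?thesis unfolding B_def by (rule someI_ex)
qed

lemma pos_basis_B: "j \<in> letters g \<Longrightarrow> pos_basis (B j)"
  by (rule adapted_pos_basis[OF adapted_B])

lemma transition_exists:
  assumes "i \<in> letters g" "j \<in> letters g" "j \<noteq> - i"
  shows "\<exists>T s. s \<in> {1, -1} \<and> changes (B i) (scale s (map ((*v) (R [i])) (B j))) T \<and>
    totally_positive CARD('n) CARD('n) T"
  using nested_adapted_totally_positive[OF even images_of_triples[OF assms] adapted_B[OF assms(1)]
      adapted_linear_image[OF det_letter[OF assms(1)] even adapted_B[OF assms(2)], folded act_def]]
  by metis

text \<open>Chosen as a function of the two letters, so that only finitely many arrays occur along a ray.\<close>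

definition transition :: "int \<Rightarrow> int \<Rightarrow> nat \<Rightarrow> nat \<Rightarrow> real" where
  "transition i j = (SOME T. \<exists>s. s \<in> {1, -1} \<and> changes (B i) (scale s (map ((*v) (R [i])) (B j))) T \<and>
    totally_positive CARD('n) CARD('n) T)"

lemma transition:
  assumes "i \<in> letters g" "j \<in> letters g" "j \<noteq> - i"
  shows "\<exists>s. s \<in> {1, -1} \<and> changes (B i) (scale s (map ((*v) (R [i])) (B j))) (transition i j) \<and>
    totally_positive CARD('n) CARD('n) (transition i j)"
  unfolding transition_def by (rule someI_ex[OF transition_exists[OF assms]])

definition act_proj :: "int list \<Rightarrow> 'n line \<Rightarrow> 'n line" where
  "act_proj w = act_line {R w, - R w}"

definition H :: "int \<Rightarrow> 'n line set" where
  "H j = proj_line ` few k (B j)"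

definition G :: "int \<Rightarrow> 'n line set" where
  "G j = proj_line ` strictly_few k (B j)"

lemma act_proj_line: "act_proj w (proj_line v) = proj_line (R w *v v)"
  by (simp add: act_proj_def act_line_proj)

lemma proj_line_minus: "proj_line (- v) = proj_line (v :: (real, 'n) Finite_Cartesian_Product.vec)"
  using span_image_scale[of "{v}" "\<lambda>_. -1"] by simp

lemma act_proj_Nil: "L \<in> topspace projective_space \<Longrightarrow> act_proj [] L = L"
proof -
  assume "L \<in> topspace projective_space"
  then obtain v where v: "L = proj_line v" by (auto simp: topspace_projective)
  have "R [] *v v = v \<or> R [] *v v = - v" using R_Nil by (auto simp: matrix_vector_minus_left)
  then show ?thesis using v act_proj_line proj_line_minus by auto
qed

lemma act_proj_mult:
  assumes "u \<in> reduced_words g" "v \<in> reduced_words g" "L \<in> topspace projective_space"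
  shows "act_proj (u \<otimes>\<^bsub>free_group g\<^esub> v) L = act_proj u (act_proj v L)"
proof -
  obtain x where x: "L = proj_line x" using assms(3) by (auto simp: topspace_projective)
  have "R (u \<otimes>\<^bsub>free_group g\<^esub> v) *v x = R u *v (R v *v x) \<or> R (u \<otimes>\<^bsub>free_group g\<^esub> v) *v x = - (R u *v (R v *v x))"
    using R_mult[OF assms(1,2) free_group_closed[OF assms(1,2)]]
    by (auto simp: matrix_vector_mul_assoc matrix_vector_minus_left)
  then show ?thesis unfolding x act_proj_line using proj_line_minus by auto
qed

lemma linear_surj:
  assumes "Determinants.det (M :: 'n sqmat) = 1"
  shows "(*v) M ` (- {0}) = - {0}"
proof (intro equalityI subsetI)
  fix y :: "(real, 'n) Finite_Cartesian_Product.vec" assume "y \<in> - {0}"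
  moreover obtain N where "M ** N = Finite_Cartesian_Product.mat 1"
    using invertible_det_nz[of M] assms by (auto simp: invertible_def)
  then have "y = M *v (N *v y)" by (simp add: matrix_vector_mul_assoc)
  ultimately show "y \<in> (*v) M ` (- {0})" by (intro image_eqI[of _ _ "N *v y"]) auto
next
  fix y assume "y \<in> (*v) M ` (- {0})"
  then show "y \<in> - {0}" using inj_matrix[of M] assms by auto
qed

sublocale ping_pong g "projective_space :: 'n line topology" act_proj H G
proof
  show "compact_space (projective_space :: 'n line topology)" by (rule compact_projective)
  show "act_proj [] L = L" if "L \<in> topspace projective_space" for L by (rule act_proj_Nil[OF that])
  show "act_proj (u \<otimes>\<^bsub>free_group g\<^esub> v) L = act_proj u (act_proj v L)"
    if "u \<in> reduced_words g" "v \<in> reduced_words g" "L \<in> topspace projective_space" for u v L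
    by (rule act_proj_mult[OF that])
  fix j assume j: "j \<in> letters g"
  show "continuous_map projective_space projective_space (act_proj [j])"
    unfolding act_proj_def using det_letter[OF j] by (intro continuous_act_line) simp
  show "closedin projective_space (H j)"
    unfolding H_def by (intro closedin_projective homogeneous_few closed_few k)
  show "openin projective_space (G j)"
    unfolding G_def using k by (intro openin_projective homogeneous_strictly_few open_strictly_few) simp
  show "G j \<subseteq> H j" unfolding G_def H_def by (intro image_mono strictly_few_subset)
  show "H j \<subseteq> projective_space closure_of G j"
    unfolding G_def H_def by (rule few_subset_closure[OF pos_basis_B[OF j]])
  show "act_proj [j] ` (topspace projective_space - G (- j)) = H j"
  proof -
    let ?M = "R [j]"
    have mf: "?M *v x \<in> few k (B j) \<longleftrightarrow> x \<in> many k (B (- j))" for x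
      using many_to_few[OF k(2) det_letter[OF j] adapted_B[of "- j"] adapted_B[OF j]] endpoints[OF j] j by simp
    have "- {0} - strictly_few k (B (- j)) = many k (B (- j))" by (auto simp: strictly_few_def many_def)
    then have "topspace projective_space - G (- j) = proj_line ` many k (B (- j))"
      unfolding G_def by (simp add: proj_compl[OF homogeneous_strictly_few])
    then have "act_proj [j] ` (topspace projective_space - G (- j)) = proj_line ` ((*v) ?M ` many k (B (- j)))"
      by (simp add: image_image act_proj_line)
    also have "(*v) ?M ` many k (B (- j)) = few k (B j)"
    proof (intro equalityI subsetI)
      fix y assume y: "y \<in> few k (B j)"
      then have "y \<in> (*v) ?M ` (- {0})" unfolding linear_surj[OF det_letter[OF j]] by (simp add: few_def)
      then show "y \<in> (*v) ?M ` many k (B (- j))" using mf y by blast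
    qed (use mf in blast)
    finally show ?thesis by (simp add: H_def)
  qed
next
  fix i j assume ij: "i \<in> letters g" "j \<in> letters g" "j \<noteq> - i"
  let ?M = "R [i]"
  obtain s where s: "s \<in> {1, -1}" "changes (B i) (scale s (map ((*v) ?M) (B j))) (transition i j)"
    "totally_positive CARD('n) CARD('n) (transition i j)" using transition[OF ij] by blast
  have p: "pos_basis (map ((*v) ?M) (B j))" using pos_basis_linear_image[OF det_letter[OF ij(1)] pos_basis_B[OF ij(2)]] .
  have ps: "pos_basis (scale s (map ((*v) ?M) (B j)))" by (rule pos_basis_scale[OF even s(1) p])
  have "?M *v x \<in> strictly_few k (B i)" if "x \<in> few k (B j)" for x
  proof -
    have "?M *v x \<in> few k (map ((*v) ?M) (B j))"
      using few_linear_image[OF pos_basis_B[OF ij(2)] p] det_letter[OF ij(1)] that by simp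
    then have "?M *v x \<in> few k (scale s (map ((*v) ?M) (B j)))" using few_scale[OF p ps s(1)] by simp
    then show ?thesis using few_totally_positive[OF pos_basis_B[OF ij(1)] ps s(2,3)] by blast
  qed
  then show "act_proj [i] ` H j \<subseteq> G i" unfolding H_def G_def by (auto simp: act_proj_line)
qed


section \<open>The limit curve\<close>

lemma R_append_letter:
  assumes "w @ [j] \<in> reduced_words g"
  shows "R (w @ [j]) \<in> {R w ** R [j], - (R w ** R [j])}"
  using R_mult[of w "[j]"] assms foldr_prepend_reduced[OF assms]
  by (simp add: mult_free_group reduced_words_append)

lemma map_R_append_letter:
  assumes "w @ [j] \<in> reduced_words g"
  obtains s :: real where "s \<in> {1, -1}" "\<And>vs. map ((*v) (R (w @ [j]))) vs = scale s (map ((*v) (R w)) (map ((*v) (R [j])) vs))"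
proof (cases "R (w @ [j]) = R w ** R [j]")
  case True
  show ?thesis by (rule that[of 1]) (simp_all add: True matrix_vector_mul_assoc)
next
  case False
  then have "R (w @ [j]) = - (R w ** R [j])" using R_append_letter[OF assms] by simp
  then show ?thesis by (intro that[of "-1"]) (simp_all add: matrix_vector_mul_assoc matrix_vector_minus_left scale_def)
qed

text \<open>The transitions hold up to signs, which are accumulated in \<open>\<sigma>\<close>.\<close>

theorem frames_along_ray:
  assumes x: "x \<in> free_group_boundary g"
  defines "w \<equiv> \<lambda>t. map x [0..<t]"
  obtains \<sigma> :: "nat \<Rightarrow> real" where "\<And>t. \<sigma> t \<in> {1, -1}"
    "nested_frames (\<lambda>t. scale (\<sigma> t) (map ((*v) (R (w t))) (B (x t)))) (\<lambda>t. transition (x t) (x (Suc t)))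
      (\<lambda>t. act (w t) (\<alpha> (x t))) (\<lambda>t. act (w t) (\<beta> (x t)))"
proof -
  have xl: "x t \<in> letters g" "x (Suc t) \<noteq> - x t" for t using x by (auto simp: free_group_boundary_def)
  have w: "w t \<in> reduced_words g" for t unfolding w_def by (rule boundary_prefix_reduced[OF x])
  have w_Suc: "w (Suc t) = w t @ [x t]" for t by (simp add: w_def)
  let ?E = "\<lambda>t. map ((*v) (R (w t))) (B (x t))"
  have "\<exists>s. s \<in> {1, -1} \<and> changes (?E t) (scale s (?E (Suc t))) (transition (x t) (x (Suc t)))" for t
  proof -
    obtain s where s: "s \<in> {1, -1}"
      "changes (B (x t)) (scale s (map ((*v) (R [x t])) (B (x (Suc t))))) (transition (x t) (x (Suc t)))"
      using transition[OF xl(1) xl(1) xl(2)] by blast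
    obtain r where r: "r \<in> {1, -1 :: real}"
      "\<And>vs. map ((*v) (R (w t @ [x t]))) vs = scale r (map ((*v) (R (w t))) (map ((*v) (R [x t])) vs))"
      using map_R_append_letter[of "w t" "x t"] w[of "Suc t"] unfolding w_Suc by blast
    have "changes (?E t) (scale s (map ((*v) (R (w t))) (map ((*v) (R [x t])) (B (x (Suc t))))))
        (transition (x t) (x (Suc t)))"
      using changes_linear_image[OF s(2), of "R (w t)"] by (simp only: scale_linear_image)
    moreover have "scale s (map ((*v) (R (w t))) (map ((*v) (R [x t])) (B (x (Suc t))))) = scale (s * r) (?E (Suc t))"
      unfolding w_Suc r(2) scale_simps(4) using sign_sq[OF r(1)] by (simp add: mult.assoc)
    moreover have "s * r \<in> {1, -1}" using s(1) r(1) by auto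
    ultimately show ?thesis by metis
  qed
  then have "\<exists>s. \<forall>t. s t \<in> {1, -1} \<and> changes (?E t) (scale (s t) (?E (Suc t))) (transition (x t) (x (Suc t)))"
    by (intro choice allI)
  then obtain s where s: "\<And>t. s t \<in> {1, -1}"
    "\<And>t. changes (?E t) (scale (s t) (?E (Suc t))) (transition (x t) (x (Suc t)))" by blast
  define \<sigma> where "\<sigma> t = (\<Prod>i<t. s i)" for t
  have \<sigma>: "\<sigma> t \<in> {1, -1}" for t
  proof (induction t)
    case (Suc t)
    then show ?case using s(1)[of t] by (auto simp: \<sigma>_def)
  qed (simp add: \<sigma>_def)
  have "nested_frames (\<lambda>t. scale (\<sigma> t) (?E t)) (\<lambda>t. transition (x t) (x (Suc t)))
      (\<lambda>t. act (w t) (\<alpha> (x t))) (\<lambda>t. act (w t) (\<beta> (x t)))"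
  proof
    show "even CARD('n)" by (rule even)
    show "adapted (scale (\<sigma> t) (?E t)) (act (w t) (\<alpha> (x t))) (act (w t) (\<beta> (x t)))" for t
      unfolding act_def by (intro adapted_scale \<sigma> even adapted_linear_image det w adapted_B xl)
    show "changes (scale (\<sigma> t) (?E t)) (scale (\<sigma> (Suc t)) (?E (Suc t))) (transition (x t) (x (Suc t)))" for t
      using changes_both_scale[OF s(2)[of t], of "\<sigma> t"] by (simp add: \<sigma>_def)
    have "range (\<lambda>t. transition (x t) (x (Suc t))) \<subseteq> (\<lambda>(i, j). transition i j) ` (letters g \<times> letters g)"
      using xl by auto
    then have "finite (range (\<lambda>t. transition (x t) (x (Suc t))))" by (rule finite_subset) simp
    moreover have "totally_positive CARD('n) CARD('n) (transition (x t) (x (Suc t)))" for t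
      using transition[OF xl(1) xl(1) xl(2)] by blast
    ultimately show "uniformly_positive CARD('n) (\<lambda>t. transition (x t) (x (Suc t)))"
      unfolding uniformly_positive_def by simp
  qed
  then show ?thesis by (rule that[OF \<sigma>])
qed

lemma act_flag_interval:
  assumes w: "w \<in> reduced_words g" and PQ: "P \<in> oriented_flags" "Q \<in> oriented_flags"
  shows "f \<in> act w ` flag_interval P Q \<longleftrightarrow> hyperconvex (act w P) f (act w Q)"
proof
  note M = det[OF w]
  assume "f \<in> act w ` flag_interval P Q"
  then show "hyperconvex (act w P) f (act w Q)"
    unfolding act_def flag_interval_def using hyperconvex_linear_image[OF M even] by blast
next
  note M = det[OF w]
  obtain N where N: "R w ** N = Finite_Cartesian_Product.mat 1" "N ** R w = Finite_Cartesian_Product.mat 1"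
    using invertible_det_nz[of "R w"] M by (auto simp: invertible_def)
  have dN: "Determinants.det N = 1" using det_mul[of "R w" N] N(1) M by simp
  assume h: "hyperconvex (act w P) f (act w Q)"
  then have f: "f \<in> oriented_flags" using hyperconvex_flags by blast
  let ?f = "act_flag {N, - N} f"
  have "hyperconvex (act_flag {N, - N} (act w P)) ?f (act_flag {N, - N} (act w Q))"
    by (rule hyperconvex_linear_image[OF dN even h])
  then have "hyperconvex P ?f Q"
    unfolding act_def using act_flag_inverse[OF _ M dN even] PQ N(2) by simp
  moreover have "f = act w ?f"
    unfolding act_def using act_flag_inverse[OF _ dN M even f] N(1) by simp
  ultimately show "f \<in> act w ` flag_interval P Q" unfolding flag_interval_def by blast
qed

theorem limit_flag:
  assumes x: "x \<in> free_group_boundary g"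
  defines "I \<equiv> \<lambda>m. act (butlast (map x [0..<m])) ` flag_interval (\<alpha> (last (map x [0..<m]))) (\<beta> (last (map x [0..<m])))"
  shows "projectivization (flag_subspace (THE f. f \<in> (\<Inter>m\<in>{1..}. I m)) k) = (\<Inter>m\<in>{1..}. Hw (map x [0..<m]))"
proof -
  let ?w = "\<lambda>t. map x [0..<t]"
  have xl: "x t \<in> letters g" for t using x by (simp add: free_group_boundary_def)
  have w: "?w t \<in> reduced_words g" for t by (rule boundary_prefix_reduced[OF x])
  obtain \<sigma> :: "nat \<Rightarrow> real" where \<sigma>: "\<And>t. \<sigma> t \<in> {1, -1}"
    and nf: "nested_frames (\<lambda>t. scale (\<sigma> t) (map ((*v) (R (?w t))) (B (x t)))) (\<lambda>t. transition (x t) (x (Suc t)))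
      (\<lambda>t. act (?w t) (\<alpha> (x t))) (\<lambda>t. act (?w t) (\<beta> (x t)))" using frames_along_ray[OF x] by blast
  let ?E = "\<lambda>t. map ((*v) (R (?w t))) (B (x t))"
  obtain y where y: "pos_basis y"
    "\<And>f. (\<forall>t. hyperconvex (act (?w t) (\<alpha> (x t))) f (act (?w t) (\<beta> (x t)))) \<longleftrightarrow> f = flag_of y"
    "\<And>k. k \<le> CARD('n) \<Longrightarrow> (\<Inter>t. few k (scale (\<sigma> t) (?E t))) = span (set (take k y)) - {0}"
    by (rule nested_frames.limit_basis[OF nf]) blast
  have flags: "\<alpha> j \<in> oriented_flags" "\<beta> j \<in> oriented_flags" if "j \<in> letters g" for j
    using hyperconvex_flags[OF images_of_triples(1)[OF that that letters_nonzero[OF that]]] by simp_all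
  have I: "f \<in> I (Suc t) \<longleftrightarrow> hyperconvex (act (?w t) (\<alpha> (x t))) f (act (?w t) (\<beta> (x t)))" for f t
    unfolding I_def using act_flag_interval[OF w flags[OF xl]] by simp
  have ge1: "(\<Inter>m\<in>{1..}. Z m) = (\<Inter>t. Z (Suc t))" for Z :: "nat \<Rightarrow> 'b set"
  proof -
    have "{1..} = range Suc" using Suc_le_D by (force simp: image_iff)
    then show ?thesis by (metis image_image)
  qed
  have "(THE f. f \<in> (\<Inter>m\<in>{1..}. I m)) = flag_of y"
    unfolding ge1 using y(2) by (intro the_equality) (simp_all add: I)
  then have "flag_subspace (THE f. f \<in> (\<Inter>m\<in>{1..}. I m)) k = span (set (take k y))"
    using flag_subspace_flag_of[OF y(1), of k] k by simp
  moreover have "(\<Inter>m\<in>{1..}. Hw (?w m)) = proj_line ` (\<Inter>t. few k (scale (\<sigma> t) (?E t)))"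
  proof -
    have pE: "pos_basis (?E t)" for t by (rule pos_basis_linear_image[OF det[OF w] pos_basis_B[OF xl]])
    have pos: "few k (scale (\<sigma> t) (?E t)) = few k (?E t)" for t
      by (rule few_scale[OF pE pos_basis_scale[OF even \<sigma> pE] \<sigma>])
    have "Hw (?w (Suc t)) = proj_line ` few k (?E t)" for t
    proof -
      have "Hw (?w (Suc t)) = proj_line ` ((*v) (R (?w t)) ` few k (B (x t)))"
        by (simp add: Hw_def H_def image_image act_proj_line)
      also have "(*v) (R (?w t)) ` few k (B (x t)) = few k (?E t)"
      proof (intro equalityI subsetI)
        fix v assume v: "v \<in> few k (?E t)"
        then have "v \<in> (*v) (R (?w t)) ` (- {0})" unfolding linear_surj[OF det[OF w]] by (simp add: few_def)
        then obtain u where "v = R (?w t) *v u" by blast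
        then show "v \<in> (*v) (R (?w t)) ` few k (B (x t))"
          using v few_linear_image[OF pos_basis_B[OF xl] pE] det[OF w] by auto
      qed (use few_linear_image[OF pos_basis_B[OF xl] pE] det[OF w] in auto)
      finally show ?thesis .
    qed
    then have *: "(\<Inter>m\<in>{1..}. Hw (?w m)) = (\<Inter>t. proj_line ` few k (?E t))" unfolding ge1 by simp
    have "(\<Inter>t. proj_line ` few k (?E t)) = proj_line ` (\<Inter>t. few k (?E t))"
    proof (intro equalityI subsetI)
      fix L assume L: "L \<in> (\<Inter>t. proj_line ` few k (?E t))"
      then obtain v where v: "L = proj_line v" "v \<in> few k (?E 0)" by blast
      then have v0: "v \<noteq> 0" by (simp add: few_def)
      have "v \<in> few k (?E t)" for t
        using L v(1) proj_line_in_iff[OF homogeneous_few v0] by blast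
      then show "L \<in> proj_line ` (\<Inter>t. few k (?E t))" using v(1) by blast
    qed blast
    then show ?thesis using * by (simp only: pos)
  qed
  ultimately show ?thesis
    using y(3)[of k] k by (auto simp: projectivization_def)
qed

theorem domain_of_discontinuity:
  "Omega = topspace projective_space - (\<Union>x\<in>free_group_boundary g. projectivization (flag_subspace
     (THE f. f \<in> (\<Inter>m\<in>{1..}. act (butlast (map x [0..<m])) `
        flag_interval (\<alpha> (last (map x [0..<m]))) (\<beta> (last (map x [0..<m]))))) k))"
proof -
  have "(\<Union>x\<in>free_group_boundary g. projectivization (flag_subspace
     (THE f. f \<in> (\<Inter>m\<in>{1..}. act (butlast (map x [0..<m])) `
        flag_interval (\<alpha> (last (map x [0..<m]))) (\<beta> (last (map x [0..<m]))))) k)) =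
      (\<Union>x\<in>free_group_boundary g. \<Inter>m\<in>{1..}. Hw (map x [0..<m]))"
    by (rule SUP_cong[OF refl limit_flag])
  then show ?thesis unfolding Omega_def limit_set_eq by (simp only:)
qed

text \<open>Each face is taken as a hypersurface with a single piece.\<close>

theorem polyhedral_frontier:
  "\<exists>\<H>. finite \<H> \<and> (\<forall>P\<in>\<H>. polyhedral_hypersurface P) \<and> X frontier_of D = \<Union>\<H>"
proof -
  let ?n = "CARD('n)"
  let ?C = "{(t, \<sigma>). t < ?n \<and> \<sigma> \<in> sign_patterns ?n \<and> crossing ?n k t \<sigma>}"
  let ?\<H> = "\<lambda>j. (\<lambda>(t, \<sigma>). projectivization (face (B j) t \<sigma>)) ` ?C"
  have "H j - G j = \<Union>(?\<H> j)" for j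
    unfolding H_def G_def few_many_faces by auto
  moreover have "(\<Union>j\<in>letters g. \<Union>(h j)) = \<Union>(\<Union>j\<in>letters g. h j)" for h :: "int \<Rightarrow> 'n line set set" by blast
  ultimately have "X frontier_of D = \<Union>(\<Union>j\<in>letters g. ?\<H> j)" unfolding frontier_D by (simp only:)
  moreover have "finite (\<Union>j\<in>letters g. ?\<H> j)" using finite_faces by simp
  moreover have "\<forall>P\<in>(\<Union>j\<in>letters g. ?\<H> j). polyhedral_hypersurface P"
    using polyhedral_face[OF pos_basis_B] by (auto intro!: polyhedral_hypersurface_piece)
  ultimately show ?thesis by (intro exI[of _ "\<Union>j\<in>letters g. ?\<H> j"] conjI)
qed

end


section \<open>The fundamental domain\<close>

text \<open>The conditions are given for positive letters; those for inverses follow by applying the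
  inverse matrix.\<close>

lemma flag_schottky_if_purely_hyperbolic:
  fixes \<xi>\<^sub>0 :: "2 line \<Rightarrow> 'n::{finite,linorder} flag"
  assumes k: "k \<ge> 1" "CARD('n) = 2 * k" and \<rho>: "purely_hyperbolic_schottky g A a b \<xi>\<^sub>0 h \<rho>"
  obtains R where "flag_schottky g k R (\<lambda>j. \<xi>\<^sub>0 (a j)) (\<lambda>j. \<xi>\<^sub>0 (b j))"
    "\<And>w. w \<in> reduced_words g \<Longrightarrow> \<rho> w = {R w, - R w}"
proof -
  have even: "even CARD('n)" using k by simp
  have gens: "schottky_generators g A a b" and hom: "\<rho> \<in> hom (free_group g) PSL"
    using \<rho> by (simp_all add: purely_hyperbolic_schottky_def)
  have flags: "\<xi>\<^sub>0 (a j) \<in> oriented_flags" "\<xi>\<^sub>0 (b j) \<in> oriented_flags" if "j \<in> letters g" for j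
    using \<rho> that by (simp_all add: purely_hyperbolic_schottky_def)
  have ends: "act_flag (\<rho> [j]) (\<xi>\<^sub>0 (b (- j))) = \<xi>\<^sub>0 (a j)" "act_flag (\<rho> [j]) (\<xi>\<^sub>0 (a (- j))) = \<xi>\<^sub>0 (b j)"
    if "j \<in> {1..int g}" for j using \<rho> that unfolding purely_hyperbolic_schottky_def by simp_all
  have conv: "hyperconvex (\<xi>\<^sub>0 p) (\<xi>\<^sub>0 q) (\<xi>\<^sub>0 r)"
    if "positively_ordered p q r" "{p, q, r} \<subseteq> a ` letters g \<union> b ` letters g" for p q r
    using \<rho> that unfolding purely_hyperbolic_schottky_def by simp
  obtain R where R: "\<And>w. w \<in> reduced_words g \<Longrightarrow> Determinants.det (R w) = 1"
    "\<And>w. w \<in> reduced_words g \<Longrightarrow> \<rho> w = {R w, - R w}"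
    "R [] \<in> {Finite_Cartesian_Product.mat 1, - Finite_Cartesian_Product.mat 1}"
    "\<And>u v. u \<in> reduced_words g \<Longrightarrow> v \<in> reduced_words g \<Longrightarrow> u \<otimes>\<^bsub>free_group g\<^esub> v \<in> reduced_words g \<Longrightarrow>
      R (u \<otimes>\<^bsub>free_group g\<^esub> v) \<in> {R u ** R v, - (R u ** R v)}"
    using representatives_exist[OF hom] by blast
  have single: "[j] \<in> reduced_words g" if "j \<in> letters g" for j using that by (simp add: reduced_words_singleton)
  have endpoints: "act_flag {R [j], - R [j]} (\<xi>\<^sub>0 (b (- j))) = \<xi>\<^sub>0 (a j)"
    "act_flag {R [j], - R [j]} (\<xi>\<^sub>0 (a (- j))) = \<xi>\<^sub>0 (b j)" if j: "j \<in> letters g" for j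
  proof -
    have j': "- j \<in> letters g" using j by simp
    have "act_flag {R [j], - R [j]} (\<xi>\<^sub>0 (b (- j))) = \<xi>\<^sub>0 (a j) \<and>
      act_flag {R [j], - R [j]} (\<xi>\<^sub>0 (a (- j))) = \<xi>\<^sub>0 (b j)"
    proof (cases "j > 0")
      case True
      then have "j \<in> {1..int g}" using j by (simp add: letters_def)
      then show ?thesis using ends[of j] R(2)[OF single[OF j]] by simp
    next
      case False
      then have i: "- j \<in> {1..int g}" using j by (simp add: letters_def)
      have "R [] \<in> {R [j] ** R [- j], - (R [j] ** R [- j])}"
        using R(4)[OF single[OF j] single[OF j']] by (simp add: mult_free_group)
      then have inv: "R [j] ** R [- j] \<in> {Finite_Cartesian_Product.mat 1, - Finite_Cartesian_Product.mat 1}"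
        using R(3) by auto
      have inverse: "act_flag {R [j], - R [j]} (act_flag (\<rho> [- j]) f) = f" if "f \<in> oriented_flags" for f
        unfolding R(2)[OF single[OF j']]
        by (rule act_flag_inverse[OF inv R(1)[OF single[OF j']] R(1)[OF single[OF j]] even that])
      show ?thesis
        using inverse[OF flags(1)[OF j]] inverse[OF flags(2)[OF j]] ends[OF i] by simp
    qed
    then show "act_flag {R [j], - R [j]} (\<xi>\<^sub>0 (b (- j))) = \<xi>\<^sub>0 (a j)"
      "act_flag {R [j], - R [j]} (\<xi>\<^sub>0 (a (- j))) = \<xi>\<^sub>0 (b j)" by simp_all
  qed
  have triples: "hyperconvex (\<xi>\<^sub>0 (b i)) (\<xi>\<^sub>0 (a j)) (\<xi>\<^sub>0 (a i))" "hyperconvex (\<xi>\<^sub>0 (a j)) (\<xi>\<^sub>0 (b j)) (\<xi>\<^sub>0 (a i))"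
    if ij: "i \<in> letters g" "j \<in> letters g" "i \<noteq> j" for i j
  proof -
    have top: "{a i, b i, a j, b j} \<subseteq> topspace projective_space" "a i \<noteq> b i" "a j \<noteq> b j"
      using gens ij unfolding schottky_generators_def by simp_all
    have disj: "(projective_space closure_of cyclic_interval (a i) (b i)) \<inter>
        (projective_space closure_of cyclic_interval (a j) (b j)) = {}"
      using gens ij unfolding schottky_generators_def by blast
    show "hyperconvex (\<xi>\<^sub>0 (b i)) (\<xi>\<^sub>0 (a j)) (\<xi>\<^sub>0 (a i))" "hyperconvex (\<xi>\<^sub>0 (a j)) (\<xi>\<^sub>0 (b j)) (\<xi>\<^sub>0 (a i))"
      using ij by (auto intro!: conv disjoint_intervals_ordered[OF top disj])
  qed
  have "flag_schottky g k R (\<lambda>j. \<xi>\<^sub>0 (a j)) (\<lambda>j. \<xi>\<^sub>0 (b j))"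
    by (rule flag_schottky.intro) (fact k R endpoints triples)+
  then show ?thesis by (rule that[OF _ R(2)])
qed

theorem theorem1p4:
  fixes k g :: nat
    and A :: "int \<Rightarrow> 2 psl"
    and a b :: "int \<Rightarrow> 2 line"
    and \<xi>\<^sub>0 :: "2 line \<Rightarrow> 'n::{finite,linorder} flag"
    and h :: "int \<Rightarrow> 'n::{finite,linorder} psl"
    and \<rho> :: "int list \<Rightarrow> 'n::{finite,linorder} psl"
    and \<xi> :: "(nat \<Rightarrow> int) \<Rightarrow> 'n::{finite,linorder} flag"
    and \<Omega> :: "'n::{finite,linorder} line set"
    and X :: "'n::{finite,linorder} line topology"
  assumes "k \<ge> 1" and "g \<ge> 1" and "CARD('n) = 2 * k"
    and "purely_hyperbolic_schottky g A a b \<xi>\<^sub>0 h \<rho>"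
  defines "\<xi> \<equiv> boundary_map a b \<xi>\<^sub>0 \<rho>"
    and "\<Omega> \<equiv> topspace projective_space -
               (\<Union>x\<in>free_group_boundary g. projectivization (flag_subspace (\<xi> x) k))"
    and "X \<equiv> subtopology projective_space \<Omega>"
  shows "(\<forall>\<gamma>\<in>carrier (free_group g). act_line (\<rho> \<gamma>) ` \<Omega> = \<Omega>) \<and>
    properly_discontinuous (carrier (free_group g)) (\<lambda>\<gamma>. act_line (\<rho> \<gamma>)) X \<and>
    cocompact (carrier (free_group g)) (\<lambda>\<gamma>. act_line (\<rho> \<gamma>)) X \<and>
    (\<exists>D. fundamental_domain (free_group g) (\<lambda>\<gamma>. act_line (\<rho> \<gamma>)) X D \<and>
         (\<exists>\<H>. finite \<H> \<and> (\<forall>H\<in>\<H>. polyhedral_hypersurface H) \<and> X frontier_of D = \<Union>\<H>))"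
proof -
  obtain R where R: "flag_schottky g k R (\<lambda>j. \<xi>\<^sub>0 (a j)) (\<lambda>j. \<xi>\<^sub>0 (b j))"
    and \<rho>: "\<And>w. w \<in> reduced_words g \<Longrightarrow> \<rho> w = {R w, - R w}"
    using flag_schottky_if_purely_hyperbolic[OF assms(1,3,4)] by blast
  interpret schottky: flag_schottky g k R "\<lambda>j. \<xi>\<^sub>0 (a j)" "\<lambda>j. \<xi>\<^sub>0 (b j)" by (rule R)
  have act_proj: "act_line (\<rho> w) = schottky.act_proj w" if "w \<in> reduced_words g" for w
    using \<rho>[OF that] by (simp add: schottky.act_proj_def)
  have "\<xi> x = (THE f. f \<in> (\<Inter>m\<in>{1..}. schottky.act (butlast (map x [0..<m])) `
      flag_interval (\<xi>\<^sub>0 (a (last (map x [0..<m])))) (\<xi>\<^sub>0 (b (last (map x [0..<m]))))))"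
    if x: "x \<in> free_group_boundary g" for x
  proof -
    have "act_flag (\<rho> (butlast (map x [0..<m]))) = schottky.act (butlast (map x [0..<m]))" for m
      using \<rho>[OF schottky.reduced_butlast[OF boundary_prefix_reduced[OF x, of m]]]
      by (simp add: schottky.act_def)
    then show ?thesis unfolding \<xi>_def boundary_map_def word_interval_def by (simp only:)
  qed
  then have \<Omega>: "\<Omega> = schottky.Omega"
    unfolding \<Omega>_def schottky.domain_of_discontinuity by (intro arg_cong2[where f = minus] SUP_cong refl) simp
  then have X: "X = schottky.X" by (simp add: X_def)
  have invariant: "\<forall>\<gamma>\<in>carrier (free_group g). act_line (\<rho> \<gamma>) ` \<Omega> = \<Omega>"
    using schottky.Omega_invariant by (simp add: \<Omega> act_proj)
  have "{\<gamma> \<in> reduced_words g. act_line (\<rho> \<gamma>) ` K \<inter> K \<noteq> {}} =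
      {\<gamma> \<in> reduced_words g. schottky.act_proj \<gamma> ` K \<inter> K \<noteq> {}}" for K
    using act_proj by auto
  then have discontinuous: "properly_discontinuous (carrier (free_group g)) (\<lambda>\<gamma>. act_line (\<rho> \<gamma>)) X"
    using schottky.properly_discontinuous_Omega unfolding X properly_discontinuous_def carrier_free_group by (simp only:)
  have "(\<lambda>\<gamma>. act_line (\<rho> \<gamma>) L) ` reduced_words g = (\<lambda>\<gamma>. schottky.act_proj \<gamma> L) ` reduced_words g" for L
    using act_proj by (intro image_cong) auto
  then have cocompact: "cocompact (carrier (free_group g)) (\<lambda>\<gamma>. act_line (\<rho> \<gamma>)) X"
    using schottky.cocompact_Omega unfolding X cocompact_def carrier_free_group by (simp only:)
  have "fundamental_domain (free_group g) (\<lambda>\<gamma>. act_line (\<rho> \<gamma>)) X schottky.D"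
    using schottky.fundamental_domain_D unfolding X fundamental_domain_def by (simp add: act_proj)
  moreover have "\<exists>\<H>. finite \<H> \<and> (\<forall>H\<in>\<H>. polyhedral_hypersurface H) \<and> X frontier_of schottky.D = \<Union>\<H>"
    unfolding X by (rule schottky.polyhedral_frontier)
  ultimately show ?thesis using invariant discontinuous cocompact by blast
qed

end
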